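(* Let $f_1,\dots,f_n$ be a square 2-bilinear system of type $(n_x,n_y,n_z;r,s)$ such that $V_{\mathcal P}(f_1,\dots,f_n)$ is finite. Choose $\theta\in\mathcal A(1,1,1)$ and let $M=\begin{bmatrix} M_{1,1} & M_{1,2} \\ M_{2,1} & M_{2,2} \end{bmatrix}$ be the matrix of $\delta_1(\boldsymbol{F^{(2)}},\boldsymbol m)$ for the universal overdetermined 2-bilinear system $\boldsymbol{F^{(2)}}$ and $\boldsymbol m=(n_y-1,-1,n_x+n_y-r+1)$, rearranged with respect to the monomial $\boldsymbol w^\theta$. Choose $f_0\in S(1,1,1)$. Then, after applying a generic linear change of coordinates $A$ preserving the multihomogeneous structure, the eigenvalues of the Schur complement of $M_{2,2}(f_0,f_1\circ A,\dots,f_n\circ A)$, i.e. of the matrix $$(M_{2,2}-M_{2,1}\cdot M_{1,1}^{-1}\cdot M_{1,2})(f_0,f_1\circ A,\dots,f_n\circ A),$$ are the evaluations of $\frac{f_0}{\boldsymbol w^\theta}$ over $V_{\mathcal P}(f_1\circ A,\dots,f_n\circ A)$.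
   Context: $\mathbb K$ is an algebraically closed field of characteristic $0$, $n_x,n_y,n_z\ge1$ are integers, $n=n_x+n_y+n_z$, $\mathcal P=\mathbb P^{n_x}\times\mathbb P^{n_y}\times\mathbb P^{n_z}$ over $\mathbb K$, with blocks of homogeneous coordinates $\boldsymbol x=(x_0,\dots,x_{n_x})$, $\boldsymbol y=(y_0,\dots,y_{n_y})$, $\boldsymbol z=(z_0,\dots,z_{n_z})$. For $t\in\{x,y,z\}$, $S_t(d)=\mathbb K[\boldsymbol t]_d$ (zero if $d<0$), $S(d_x,d_y,d_z)=S_x(d_x)\otimes S_y(d_y)\otimes S_z(d_z)$; $\mathcal A(\boldsymbol d)$ is the set of exponents $\sigma=(\sigma_x,\sigma_y,\sigma_z)$ of monomials of multidegree $\boldsymbol d$ and $\boldsymbol w^\sigma=\boldsymbol x^{\sigma_x}\boldsymbol y^{\sigma_y}\boldsymbol z^{\sigma_z}$. $V_{\mathcal P}(\cdot)$ is the set of common zeros in $\mathcal P$. A square 2-bilinear system of type $(n_x,n_y,n_z;r,s)$ is $(f_1,\dots,f_n)$ with $f_1,\dots,f_r\in S(1,1,0)$, $f_{r+1},\dots,f_n\in S(1,0,1)$, $n=r+s$, $n_y\le r$, $n_z\le s$. Adding $f_0\in S(1,1,1)$ gives an overdetermined 2-bilinear system $\boldsymbol{f_0}=(f_0,\dots,f_n)$. The universal such system $\boldsymbol{F^{(2)}}$ has as coefficients variables $\boldsymbol u=\{u_{i,\sigma}\}$, $u_{i,\sigma}$ being the coefficient of $\boldsymbol w^\sigma$ in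 the $i$-th polynomial; evaluating an object over $\mathbb K[\boldsymbol u]$ at $\boldsymbol{f_0}$ means replacing each $u_{i,\sigma}$ by the coefficient of $\boldsymbol w^\sigma$ in $f_i$. Change of coordinates: $A=(A_x,A_y,A_z)\in GL_{n_x+1}(\mathbb K)\times GL_{n_y+1}(\mathbb K)\times GL_{n_z+1}(\mathbb K)$ acting on each block of variables; "generic" means for all $A$ in some non-empty Zariski open subset. The map $\delta_1$. $E$ has basis $e_0,\dots,e_n$; $\boldsymbol e_I=e_{I_1}\wedge\dots\wedge e_{I_k}$ for $I=\{I_1<\dots<I_k\}$; $\bigwedge_{a,b,c}E$ is the span of the $\boldsymbol e_I$ with $\#(I\cap\{1,\dots,r\})=a$, $\#(I\cap\{r+1,\dots,n\})=b$, $\#(I\cap\{0\})=c$. Set $K_1=\big(S_x(1)^*\otimes S_y(r-n_y)^*\otimes S_z(0)\otimes\bigwedge_{r,s-n_z+1,0}E\big)\oplus\big(S_x(1)^*\otimes S_y(r-n_y+1)^*\otimes S_z(0)\otimes\bigwedge_{r,s-n_z,1}E\big)$ and $K_0=\big(S_x(0)^*\otimes S_y(r-n_y-1)^*\otimes S_z(0)\otimes\bigwedge_{r-1,s-n_z+1,0}E\big)\oplus\big(S_x(0)^*\otimes S_y(r-n_y)^*\otimes S_z(1)\otimes\bigwedge_{r,s-n_z,0}E\big)\oplus\big(S_x(0)^*\otimes S_y(r-n_y)^*\otimes S_z(0)\otimes\bigwedge_{r-1,s-n_z,1}E\big)\oplus\big(S_x(0)^*\otimes S_y(r-n_y+1)^*\otimes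 S_z(1)\otimes\bigwedge_{r,s-n_z-1,1}E\big)$. Let $\{\boldsymbol{\partial t}^{\sigma}\}$ be the basis of $S_t(d)^*$ dual to the monomials $\boldsymbol t^\sigma$; put $\boldsymbol t^\theta\star\boldsymbol{\partial t}^\sigma=\boldsymbol{\partial t}^{\sigma-\theta}$ if $\sigma\ge\theta$ componentwise and $0$ otherwise, extended bilinearly. Let $\psi$ be the bilinear map with $\psi(\boldsymbol{\partial x}^{\sigma_x}\otimes\boldsymbol{\partial y}^{\sigma_y}\otimes\boldsymbol z^{\sigma_z},\ \boldsymbol x^{\theta_x}\boldsymbol y^{\theta_y}\boldsymbol z^{\theta_z})=(\boldsymbol x^{\theta_x}\star\boldsymbol{\partial x}^{\sigma_x})\otimes(\boldsymbol y^{\theta_y}\star\boldsymbol{\partial y}^{\sigma_y})\otimes\boldsymbol z^{\theta_z+\sigma_z}$. Then $\delta_1(\boldsymbol{f_0},\boldsymbol m):K_1\to K_0$ is the linear map with $$\delta_1(\boldsymbol{f_0},\boldsymbol m)(\ell\otimes\boldsymbol e_I)=\sum_{i=1}^{n_x+n_y+1}(-1)^{i-1}\psi(\ell,f_{I_i})\otimes\boldsymbol e_{I\setminus\{I_i\}}.$$ For $\boldsymbol{F^{(2)}}$ the same formula is used over $\mathbb K[\boldsymbol u]$, and its matrix is taken with respect to the bases made of the $\boldsymbol{\partial x}^{\sigma_x}\otimes\boldsymbol{\partial y}^{\sigma_y}\otimes\boldsymbol z^{\sigma_z}\otimes\boldsymbol e_I$. "Rearranged with respect to $\boldsymbol w^\theta$"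 means: rows and columns are permuted and partitioned into blocks so that $M_{2,2}$ is square, all diagonal entries of $M_{2,2}$ equal $u_{0,\theta}$, and $u_{0,\theta}$ appears nowhere else in $M$ (this is possible for every $\theta\in\mathcal A(1,1,1)$). *)

theory Defs
  imports
    "HOL-Library.Poly_Mapping"
    "HOL-Library.Product_Plus"
    "Jordan_Normal_Form.Char_Poly"
    "Jordan_Normal_Form.Gauss_Jordan_Elimination"
begin

section \<open>Polynomials\<close>

text \<open>
  A polynomial ring over \<open>'a\<close> is the type \<open>m \<Rightarrow>\<^sub>0 'a\<close> of finitely supported coefficient functions
  on its exponents. Exponents of the three blocks of variables are triples, added componentwise.
\<close>

type_synonym expo = "(nat \<Rightarrow>\<^sub>0 nat) \<times> (nat \<Rightarrow>\<^sub>0 nat) \<times> (nat \<Rightarrow>\<^sub>0 nat)"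

type_synonym 'a tpoly = "expo \<Rightarrow>\<^sub>0 'a"

text \<open>The ring \<open>K[u]\<close>; the variable \<open>u\<close> with index \<open>(i, \<sigma>)\<close> is the coefficient of the monomial
  with exponent \<open>\<sigma>\<close> in the \<open>i\<close>-th polynomial.\<close>

type_synonym 'a upoly = "((nat \<times> expo) \<Rightarrow>\<^sub>0 nat) \<Rightarrow>\<^sub>0 'a"

text \<open>\<open>eval_with \<phi> \<mu> p\<close> replaces every coefficient \<open>c\<close> by \<open>\<phi> c\<close> and every monomial with exponent \<open>m\<close>
  by \<open>\<mu> m\<close>; it serves both for evaluation and for substitution.\<close>

definition eval_with ::
  "('a::zero \<Rightarrow> 'b::comm_semiring_1) \<Rightarrow> ('m \<Rightarrow> 'b) \<Rightarrow> ('m \<Rightarrow>\<^sub>0 'a) \<Rightarrow> 'b" where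
  "eval_with \<phi> \<mu> p = (\<Sum>m\<in>Poly_Mapping.keys p. \<phi> (Poly_Mapping.lookup p m) * \<mu> m)"

definition mon_val :: "('v \<Rightarrow> 'b::comm_semiring_1) \<Rightarrow> ('v \<Rightarrow>\<^sub>0 nat) \<Rightarrow> 'b" where
  "mon_val g m = (\<Prod>v\<in>Poly_Mapping.keys m. g v ^ Poly_Mapping.lookup m v)"

fun mon_val3 :: "(nat \<Rightarrow> 'b::comm_semiring_1) \<times> (nat \<Rightarrow> 'b) \<times> (nat \<Rightarrow> 'b) \<Rightarrow> expo \<Rightarrow> 'b" where
  "mon_val3 (x, y, z) (\<sigma>x, \<sigma>y, \<sigma>z) = mon_val x \<sigma>x * mon_val y \<sigma>y * mon_val z \<sigma>z"

definition teval :: "(nat \<Rightarrow> 'a::comm_semiring_1) \<times> (nat \<Rightarrow> 'a) \<times> (nat \<Rightarrow> 'a) \<Rightarrow> 'a tpoly \<Rightarrow> 'a" where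
  "teval w p = eval_with id (mon_val3 w) p"

definition poly_vars :: "(('v \<Rightarrow>\<^sub>0 nat) \<Rightarrow>\<^sub>0 'a::zero) \<Rightarrow> 'v set" where
  "poly_vars p = (\<Union>m\<in>Poly_Mapping.keys p. Poly_Mapping.keys m)"

definition tmonom :: "expo \<Rightarrow> 'a::zero_neq_one tpoly" where
  "tmonom \<theta> = Poly_Mapping.single \<theta> 1"

definition block_expos :: "nat \<Rightarrow> int \<Rightarrow> (nat \<Rightarrow>\<^sub>0 nat) set" where
  "block_expos m d =
     {\<sigma>. Poly_Mapping.keys \<sigma> \<subseteq> {..m} \<and> int (\<Sum>i\<le>m. Poly_Mapping.lookup \<sigma> i) = d}"

text \<open>The set \<open>\<A>(dx, dy, dz)\<close>; degrees are integers, so that it is empty as soon as one of them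
  is negative.\<close>

fun expos :: "nat \<Rightarrow> nat \<Rightarrow> nat \<Rightarrow> int \<times> int \<times> int \<Rightarrow> expo set" where
  "expos nx ny nz (dx, dy, dz) = block_expos nx dx \<times> block_expos ny dy \<times> block_expos nz dz"

definition forms :: "nat \<Rightarrow> nat \<Rightarrow> nat \<Rightarrow> int \<times> int \<times> int \<Rightarrow> 'a::zero tpoly set" where
  "forms nx ny nz d = {p. Poly_Mapping.keys p \<subseteq> expos nx ny nz d}"

section \<open>Multiprojective space\<close>

text \<open>Homogeneous coordinates \<open>v 0, \<dots>, v m\<close>; the values of \<open>v\<close> beyond \<open>m\<close> are normalised to \<open>0\<close>.\<close>

definition hom_coords :: "nat \<Rightarrow> (nat \<Rightarrow> 'a::field) set" where
  "hom_coords m = {v. (\<exists>i\<le>m. v i \<noteq> 0) \<and> (\<forall>i>m. v i = 0)}"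

definition proportional :: "nat \<Rightarrow> ((nat \<Rightarrow> 'a::field) \<times> (nat \<Rightarrow> 'a)) set" where
  "proportional m = {(v, w). v \<in> hom_coords m \<and> w \<in> hom_coords m \<and>
                             (\<exists>c. c \<noteq> 0 \<and> w = (\<lambda>i. c * v i))}"

definition projective_space :: "nat \<Rightarrow> (nat \<Rightarrow> 'a::field) set set" where
  "projective_space m = hom_coords m // proportional m"

definition VP :: "nat \<Rightarrow> nat \<Rightarrow> nat \<Rightarrow> 'a::field tpoly set \<Rightarrow>
    ((nat \<Rightarrow> 'a) set \<times> (nat \<Rightarrow> 'a) set \<times> (nat \<Rightarrow> 'a) set) set" where
  "VP nx ny nz F =
    {(a, b, c) \<in> projective_space nx \<times> projective_space ny \<times> projective_space nz.
       \<forall>p\<in>F. \<forall>x\<in>a. \<forall>y\<in>b. \<forall>z\<in>c. teval (x, y, z) p = 0}"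

text \<open>All triples of coordinate vectors representing a point of a set of points.\<close>

definition representatives :: "((nat \<Rightarrow> 'a) set \<times> (nat \<Rightarrow> 'a) set \<times> (nat \<Rightarrow> 'a) set) set \<Rightarrow>
    ((nat \<Rightarrow> 'a) \<times> (nat \<Rightarrow> 'a) \<times> (nat \<Rightarrow> 'a)) set" where
  "representatives V = (\<Union>(a, b, c)\<in>V. a \<times> b \<times> c)"

section \<open>2-bilinear systems\<close>

fun bilinear_degree :: "nat \<Rightarrow> nat \<Rightarrow> int \<times> int \<times> int" where
  "bilinear_degree r i = (if i = 0 then (1, 1, 1) else if i \<le> r then (1, 1, 0) else (1, 0, 1))"

definition square_two_bilinear ::
  "nat \<Rightarrow> nat \<Rightarrow> nat \<Rightarrow> nat \<Rightarrow> nat \<Rightarrow> (nat \<Rightarrow> 'a::zero tpoly) \<Rightarrow> bool" where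
  "square_two_bilinear nx ny nz r s f \<longleftrightarrow>
     nx \<ge> 1 \<and> ny \<ge> 1 \<and> nz \<ge> 1 \<and> nx + ny + nz = r + s \<and> ny \<le> r \<and> nz \<le> s \<and>
     (\<forall>i\<in>{1..r}. f i \<in> forms nx ny nz (1, 1, 0)) \<and>
     (\<forall>i\<in>{r+1..r+s}. f i \<in> forms nx ny nz (1, 0, 1))"

definition uvar :: "nat \<Rightarrow> expo \<Rightarrow> 'a::zero_neq_one upoly" where
  "uvar i \<sigma> = Poly_Mapping.single (Poly_Mapping.single (i, \<sigma>) 1) 1"

definition universal_system ::
  "nat \<Rightarrow> nat \<Rightarrow> nat \<Rightarrow> nat \<Rightarrow> nat \<Rightarrow> 'a::comm_ring_1 upoly tpoly" where
  "universal_system nx ny nz r i =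
     (\<Sum>\<sigma>\<in>expos nx ny nz (bilinear_degree r i). Poly_Mapping.single \<sigma> (uvar i \<sigma>))"

definition specialize :: "(nat \<Rightarrow> 'a::comm_ring_1 tpoly) \<Rightarrow> 'a upoly \<Rightarrow> 'a" where
  "specialize f p = eval_with id (mon_val (\<lambda>(i, \<sigma>). Poly_Mapping.lookup (f i) \<sigma>)) p"

section \<open>Changes of coordinates\<close>

type_synonym 'a coord_change = "'a mat \<times> 'a mat \<times> 'a mat"

definition GL :: "nat \<Rightarrow> 'a::field mat set" where
  "GL m = {A \<in> carrier_mat m m. invertible_mat A}"

definition GL3 :: "nat \<Rightarrow> nat \<Rightarrow> nat \<Rightarrow> 'a::field coord_change set" where
  "GL3 nx ny nz = GL (nx + 1) \<times> GL (ny + 1) \<times> GL (nz + 1)"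

text \<open>\<open>p \<circ> A\<close>, that is \<open>p(A\<^sub>x x, A\<^sub>y y, A\<^sub>z z)\<close>: the \<open>i\<close>-th variable of a block is replaced by the
  linear form given by the \<open>i\<close>-th row of the matrix for this block.\<close>

fun change_coords :: "'a::comm_ring_1 coord_change \<Rightarrow> 'a tpoly \<Rightarrow> 'a tpoly" where
  "change_coords (Ax, Ay, Az) p = eval_with (Poly_Mapping.single 0) (mon_val3
     (\<lambda>i. \<Sum>j<dim_col Ax. Poly_Mapping.single (Poly_Mapping.single j 1, 0, 0) (Ax $$ (i, j)),
      \<lambda>i. \<Sum>j<dim_col Ay. Poly_Mapping.single (0, Poly_Mapping.single j 1, 0) (Ay $$ (i, j)),
      \<lambda>i. \<Sum>j<dim_col Az. Poly_Mapping.single (0, 0, Poly_Mapping.single j 1) (Az $$ (i, j)))) p"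

datatype block = BlockX | BlockY | BlockZ

fun entry :: "'a coord_change \<Rightarrow> block \<times> nat \<times> nat \<Rightarrow> 'a" where
  "entry (Ax, Ay, Az) (b, i, j) =
     (case b of BlockX \<Rightarrow> Ax | BlockY \<Rightarrow> Ay | BlockZ \<Rightarrow> Az) $$ (i, j)"

definition entry_indices :: "nat \<Rightarrow> nat \<Rightarrow> nat \<Rightarrow> (block \<times> nat \<times> nat) set" where
  "entry_indices nx ny nz =
     {BlockX} \<times> {..nx} \<times> {..nx} \<union> {BlockY} \<times> {..ny} \<times> {..ny} \<union> {BlockZ} \<times> {..nz} \<times> {..nz}"

text \<open>Polynomials in the matrix entries suffice to describe the Zariski topology of the product of
  general linear groups, because the determinants are invertible on it.\<close>

definition zariski_open_GL3 ::
  "nat \<Rightarrow> nat \<Rightarrow> nat \<Rightarrow> 'a::field coord_change set \<Rightarrow> bool" where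
  "zariski_open_GL3 nx ny nz U \<longleftrightarrow>
     (\<exists>Q :: (((block \<times> nat \<times> nat) \<Rightarrow>\<^sub>0 nat) \<Rightarrow>\<^sub>0 'a) set.
        (\<forall>q\<in>Q. poly_vars q \<subseteq> entry_indices nx ny nz) \<and>
        U = {A \<in> GL3 nx ny nz. \<exists>q\<in>Q. eval_with id (mon_val (entry A)) q \<noteq> 0})"

section \<open>The Koszul-type map\<close>

text \<open>
  A pair \<open>(\<sigma>, I)\<close> stands for the basis element made of the dual monomials of \<open>\<sigma>\<^sub>x\<close> and \<open>\<sigma>\<^sub>y\<close>, the
  monomial of \<open>\<sigma>\<^sub>z\<close> and the exterior product of the \<open>e\<^sub>i\<close> for \<open>i \<in> I\<close> in increasing order.
  The modules \<open>K\<^sub>1\<close>, \<open>K\<^sub>0\<close> are spanned by such elements.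
\<close>

type_synonym kbasis = "expo \<times> nat set"

fun wedge_sets :: "nat \<Rightarrow> nat \<Rightarrow> int \<times> int \<times> int \<Rightarrow> nat set set" where
  "wedge_sets r s (a, b, c) = {I. I \<subseteq> {0..r+s} \<and> int (card (I \<inter> {1..r})) = a \<and>
     int (card (I \<inter> {r+1..r+s})) = b \<and> int (card (I \<inter> {0})) = c}"

definition K1_basis :: "nat \<Rightarrow> nat \<Rightarrow> nat \<Rightarrow> nat \<Rightarrow> nat \<Rightarrow> kbasis set" where
  "K1_basis nx ny nz r s =
     expos nx ny nz (1, int r - int ny, 0) \<times> wedge_sets r s (int r, int s - int nz + 1, 0) \<union>
     expos nx ny nz (1, int r - int ny + 1, 0) \<times> wedge_sets r s (int r, int s - int nz, 1)"

definition K0_basis :: "nat \<Rightarrow> nat \<Rightarrow> nat \<Rightarrow> nat \<Rightarrow> nat \<Rightarrow> kbasis set" where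
  "K0_basis nx ny nz r s =
     expos nx ny nz (0, int r - int ny - 1, 0) \<times> wedge_sets r s (int r - 1, int s - int nz + 1, 0) \<union>
     expos nx ny nz (0, int r - int ny, 1) \<times> wedge_sets r s (int r, int s - int nz, 0) \<union>
     expos nx ny nz (0, int r - int ny, 0) \<times> wedge_sets r s (int r - 1, int s - int nz, 1) \<union>
     expos nx ny nz (0, int r - int ny + 1, 1) \<times> wedge_sets r s (int r, int s - int nz - 1, 1)"

text \<open>Componentwise comparison; the library order on \<open>\<Rightarrow>\<^sub>0\<close> is lexicographic.\<close>

definition mon_dvd :: "(nat \<Rightarrow>\<^sub>0 nat) \<Rightarrow> (nat \<Rightarrow>\<^sub>0 nat) \<Rightarrow> bool" where
  "mon_dvd \<theta> \<sigma> \<longleftrightarrow> (\<forall>i. Poly_Mapping.lookup \<theta> i \<le> Poly_Mapping.lookup \<sigma> i)"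

text \<open>\<open>c\<close> times the value of \<open>\<psi>\<close> on a basis element and a monomial: the monomial acts by
  contraction on the first two blocks and by multiplication on the third one.\<close>

fun psi_mon :: "'r::comm_ring_1 \<Rightarrow> expo \<Rightarrow> expo \<Rightarrow> expo \<Rightarrow>\<^sub>0 'r" where
  "psi_mon c (\<sigma>x, \<sigma>y, \<sigma>z) (\<theta>x, \<theta>y, \<theta>z) =
     (if mon_dvd \<theta>x \<sigma>x \<and> mon_dvd \<theta>y \<sigma>y
      then Poly_Mapping.single (\<sigma>x - \<theta>x, \<sigma>y - \<theta>y, \<theta>z + \<sigma>z) c else 0)"

definition psi :: "(expo \<Rightarrow>\<^sub>0 'r::comm_ring_1) \<Rightarrow> 'r tpoly \<Rightarrow> expo \<Rightarrow>\<^sub>0 'r" where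
  "psi l p = (\<Sum>\<sigma>\<in>Poly_Mapping.keys l. \<Sum>\<theta>\<in>Poly_Mapping.keys p.
     psi_mon (Poly_Mapping.lookup l \<sigma> * Poly_Mapping.lookup p \<theta>) \<sigma> \<theta>)"

definition scaled_tensor :: "'r::comm_ring_1 \<Rightarrow> (expo \<Rightarrow>\<^sub>0 'r) \<Rightarrow> nat set \<Rightarrow> kbasis \<Rightarrow>\<^sub>0 'r" where
  "scaled_tensor c l I =
     (\<Sum>\<sigma>\<in>Poly_Mapping.keys l. Poly_Mapping.single (\<sigma>, I) (c * Poly_Mapping.lookup l \<sigma>))"

text \<open>\<open>\<delta>\<^sub>1(F, m)\<close> for \<open>m = (ny - 1, -1, nx + ny - r + 1)\<close>, whose source and target have the bases
  \<open>K1_basis\<close> and \<open>K0_basis\<close>; \<open>m\<close> enters only through these.\<close>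

definition delta1 ::
  "nat \<Rightarrow> nat \<Rightarrow> (nat \<Rightarrow> 'r::comm_ring_1 tpoly) \<Rightarrow> (kbasis \<Rightarrow>\<^sub>0 'r) \<Rightarrow> kbasis \<Rightarrow>\<^sub>0 'r" where
  "delta1 nx ny F v =
     (\<Sum>(\<sigma>, I)\<in>Poly_Mapping.keys v. \<Sum>i=1..nx+ny+1.
        (let k = sorted_list_of_set I ! (i - 1)
         in scaled_tensor ((-1) ^ (i - 1))
              (psi (Poly_Mapping.single \<sigma> (Poly_Mapping.lookup v (\<sigma>, I))) (F k)) (I - {k})))"

text \<open>The part of the matrix of \<open>\<delta>\<^sub>1\<close> with rows and columns indexed by the given lists of basis
  elements of the target and of the source.\<close>

definition delta1_mat ::
  "nat \<Rightarrow> nat \<Rightarrow> (nat \<Rightarrow> 'r::comm_ring_1 tpoly) \<Rightarrow> kbasis list \<Rightarrow> kbasis list \<Rightarrow> 'r mat" where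
  "delta1_mat nx ny F R C = mat (length R) (length C)
     (\<lambda>(i, j). Poly_Mapping.lookup (delta1 nx ny F (Poly_Mapping.single (C ! j) 1)) (R ! i))"

text \<open>\<open>R\<^sub>1\<close>, \<open>R\<^sub>2\<close> (\<open>C\<^sub>1\<close>, \<open>C\<^sub>2\<close>) list the rows (columns) of the upper and lower (left and right)
  blocks.\<close>

definition rearranged_delta1 ::
  "nat \<Rightarrow> nat \<Rightarrow> nat \<Rightarrow> nat \<Rightarrow> nat \<Rightarrow> expo \<Rightarrow>
   'a::comm_ring_1 upoly mat \<Rightarrow> 'a upoly mat \<Rightarrow> 'a upoly mat \<Rightarrow> 'a upoly mat \<Rightarrow> bool" where
  "rearranged_delta1 nx ny nz r s \<theta> M11 M12 M21 M22 \<longleftrightarrow>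
    (\<exists>R1 R2 C1 C2.
       distinct (R1 @ R2) \<and> set (R1 @ R2) = K0_basis nx ny nz r s \<and>
       distinct (C1 @ C2) \<and> set (C1 @ C2) = K1_basis nx ny nz r s \<and>
       (let F = universal_system nx ny nz r in
         M11 = delta1_mat nx ny F R1 C1 \<and> M12 = delta1_mat nx ny F R1 C2 \<and>
         M21 = delta1_mat nx ny F R2 C1 \<and> M22 = delta1_mat nx ny F R2 C2)) \<and>
    square_mat M22 \<and>
    (\<forall>i<dim_row M22. M22 $$ (i, i) = uvar 0 \<theta>) \<and>
    (\<forall>i<dim_row M22. \<forall>j<dim_col M22. i \<noteq> j \<longrightarrow> (0, \<theta>) \<notin> poly_vars (M22 $$ (i, j))) \<and>
    (\<forall>N\<in>{M11, M12, M21}. \<forall>i<dim_row N. \<forall>j<dim_col N. (0, \<theta>) \<notin> poly_vars (N $$ (i, j)))"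

text \<open>Meaningful only if \<open>M11\<close> is invertible.\<close>

definition schur_complement ::
  "'a::field mat \<Rightarrow> 'a mat \<Rightarrow> 'a mat \<Rightarrow> 'a mat \<Rightarrow> 'a mat" where
  "schur_complement M11 M12 M21 M22 = M22 - M21 * the (mat_inverse M11) * M12"

end

theory Submission
  imports Defs "HOL-Library.Function_Algebras"
begin

text \<open>
  Write the dual of \<open>x\<^sup>\<sigma>\<close> as the Laurent monomial \<open>x\<^bsup>-1-\<sigma>\<^esup>\<close>. Then \<open>\<delta>\<^sub>1\<close> is one
  multidegree of the Koszul complex of \<open>f\<^sub>0, \<dots>, f\<^sub>n\<close> with values in the Laurent functions that are
  supported on negative exponents of \<open>x\<close> and \<open>y\<close> and on nonnegative exponents of \<open>z\<close>. If the \<open>f\<^sub>i\<close> have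
  no common zero, they generate the unit ideal as soon as one variable of each block is inverted, so
  the Koszul complex with inverted variables is exact. Short exact sequences that change the sign
  condition on one variable at a time carry exactness over to the required support; therefore
  \<open>\<delta>\<^sub>1\<close> is bijective. At a common zero \<open>(x, y, z)\<close> the evaluation at \<open>(x, y)\<close> times an exterior form
  annihilated by the linear forms \<open>f\<^sub>l(x, y, \<cdot>)\<close> is a nonzero element of the kernel.

  Since \<open>u\<^sub>0\<^sub>,\<^sub>\<theta>\<close> occurs exactly on the diagonal of \<open>M\<^sub>2\<^sub>2\<close>, a number \<open>c\<close> is an eigenvalue of the
  Schur complement if and only if \<open>\<delta>\<^sub>1(f\<^sub>0 - c w\<^sup>\<theta>, f\<^sub>1, \<dots>, f\<^sub>n)\<close> is singular, that is, if and only if \<open>c\<close>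
  is a value of \<open>f\<^sub>0 / w\<^sup>\<theta>\<close> at a common zero of \<open>f\<^sub>1, \<dots>, f\<^sub>n\<close>. A vector in the kernel of \<open>M\<^sub>1\<^sub>1\<close> has no
  component along \<open>e\<^sub>0\<close> because \<open>\<delta>\<^sub>1(w\<^sup>\<theta>, f\<^sub>1, \<dots>, f\<^sub>n)\<close> is injective, and what remains is a cycle of
  the Koszul complex of \<open>f\<^sub>1, \<dots>, f\<^sub>n\<close> on \<open>z\<^sub>k = 0\<close>, where \<open>w\<^sup>\<theta> = x\<^sub>i y\<^sub>j z\<^sub>k\<close> and there are no
  common zeros. All of this only needs that \<open>w\<^sup>\<theta>\<close> vanishes at no common zero, which is a generic
  condition on the coordinates.
\<close>

hide_const (open) Module.smult

section \<open>Evaluation of polynomials\<close>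

text \<open>The degree vector \<open>m\<close> is chosen so that the complex has only two terms. On
  index sets with nx + ny + p elements, \<open>a\<close> of them in \<open>{1..r}\<close>, the
  z-degree of a chain is \<open>a - r + 1 - p\<close>, which is negative for p \<ge> 2. The x-degree
  is \<open>- 1 - nx - p\<close>, which for p < 0 is larger than nx + 1 negative exponents permit.
  So exactness alone yields injectivity on \<open>K_1\<close> and surjectivity onto
  \<open>K_0\<close>. In cohomological terms the support condition selects top cohomology in x and y
  and sections in z; each variable turned negative is a connecting homomorphism and costs one
  homological degree. Eigenvalues are compared as a set, so a criterion for singularity suffices and
  multiplicities are never tracked. That the matrix is square follows from bijectivity for one
  system without zeros, not from counting monomials. The field may be countable, so the
  Nullstellensatz is obtained by induction on the variables with pseudo-division, not by a
  cardinality argument.\<close>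

lemma poly_mapping_sum_singles:
  "p = (\<Sum>k\<in>Poly_Mapping.keys p. Poly_Mapping.single k (Poly_Mapping.lookup p k))"
  by (rule poly_mapping_eqI)
    (auto simp: lookup_sum lookup_single when_def in_keys_iff sum.delta)

lemma poly_mapping_induct [case_names zero single add]:
  assumes "P 0" "\<And>k c. P (Poly_Mapping.single k c)" "\<And>p q. P p \<Longrightarrow> P q \<Longrightarrow> P (p + q)"
  shows "P (p :: 'm \<Rightarrow>\<^sub>0 'a::comm_monoid_add)"
proof -
  have "P (\<Sum>k\<in>A. Poly_Mapping.single k (Poly_Mapping.lookup p k))" if "finite A" for A
    using that by (induction A rule: finite_induct) (auto intro: assms)
  then show ?thesis
    by (subst poly_mapping_sum_singles) simp
qed

text \<open>Cancellation makes the keys of a sum unpredictable, so additivity is checked over a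
  finite set containing all keys involved. The later lemmas with suffix \<open>_superset\<close>
  serve the same purpose.\<close>

lemma eval_with_superset:
  assumes "finite A" "Poly_Mapping.keys p \<subseteq> A" "\<phi> 0 = 0"
  shows "eval_with \<phi> \<mu> p = (\<Sum>m\<in>A. \<phi> (Poly_Mapping.lookup p m) * \<mu> m)"
  unfolding eval_with_def using assms
  by (intro sum.mono_neutral_left) (auto simp: in_keys_iff)

lemma eval_with_single:
  assumes "\<phi> 0 = 0"
  shows "eval_with \<phi> \<mu> (Poly_Mapping.single m c) = \<phi> c * \<mu> m"
  using assms by (subst eval_with_superset[where A = "{m}"]) auto

lemma eval_with_zero [simp]: "eval_with \<phi> \<mu> 0 = 0"
  by (simp add: eval_with_def)

lemma eval_with_add:
  fixes \<phi> :: "'a::comm_monoid_add \<Rightarrow> 'b::comm_semiring_1"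
  assumes "\<phi> 0 = 0" "\<And>a b. \<phi> (a + b) = \<phi> a + \<phi> b"
  shows "eval_with \<phi> \<mu> (p + q) = eval_with \<phi> \<mu> p + eval_with \<phi> \<mu> q"
proof -
  let ?A = "Poly_Mapping.keys p \<union> Poly_Mapping.keys q"
  have "Poly_Mapping.keys (p + q) \<subseteq> ?A"
    by (rule keys_add)
  then show ?thesis
    using assms by (simp add: eval_with_superset[where A = ?A] lookup_add distrib_right sum.distrib)
qed

lemma eval_with_sum:
  fixes \<phi> :: "'a::comm_monoid_add \<Rightarrow> 'b::comm_semiring_1"
  assumes "\<phi> 0 = 0" "\<And>a b. \<phi> (a + b) = \<phi> a + \<phi> b"
  shows "eval_with \<phi> \<mu> (\<Sum>i\<in>A. p i) = (\<Sum>i\<in>A. eval_with \<phi> \<mu> (p i))"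
  by (induction A rule: infinite_finite_induct) (auto simp: eval_with_add[OF assms])

lemma eval_with_mult:
  fixes \<phi> :: "'a::comm_semiring_1 \<Rightarrow> 'b::comm_semiring_1"
  assumes "\<phi> 0 = 0" "\<And>a b. \<phi> (a + b) = \<phi> a + \<phi> b" "\<And>a b. \<phi> (a * b) = \<phi> a * \<phi> b"
    and "\<And>m m'. \<mu> (m + m') = \<mu> m * \<mu> m'"
  shows "eval_with \<phi> \<mu> (p * q) = eval_with \<phi> \<mu> p * eval_with \<phi> \<mu> (q :: 'm::comm_monoid_add \<Rightarrow>\<^sub>0 'a)"
proof (induction p rule: poly_mapping_induct)
  case (single k c)
  show ?case
    by (induction q rule: poly_mapping_induct)
      (auto simp: mult_single eval_with_single eval_with_add[of \<phi>] assms algebra_simps)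
qed (auto simp: eval_with_add[of \<phi>] assms algebra_simps)

lemma mon_val_superset:
  assumes "finite A" "Poly_Mapping.keys m \<subseteq> A"
  shows "mon_val g m = (\<Prod>v\<in>A. g v ^ Poly_Mapping.lookup m v)"
  unfolding mon_val_def using assms
  by (intro prod.mono_neutral_left) (auto simp: in_keys_iff)

lemma mon_val_zero [simp]: "mon_val g 0 = 1"
  by (simp add: mon_val_def)

lemma mon_val_single [simp]: "mon_val g (Poly_Mapping.single v k) = g v ^ k"
  by (subst mon_val_superset[where A = "{v}"]) auto

lemma mon_val_add: "mon_val g (m + m') = mon_val g m * mon_val g m'"
proof -
  let ?A = "Poly_Mapping.keys m \<union> Poly_Mapping.keys m'"
  have "Poly_Mapping.keys (m + m') \<subseteq> ?A"
    by (rule keys_add)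
  then show ?thesis
    by (simp add: mon_val_superset[where A = ?A] lookup_add power_add prod.distrib)
qed

lemma mon_val_cong:
  assumes "\<And>v. v \<in> Poly_Mapping.keys m \<Longrightarrow> g v = h v"
  shows "mon_val g m = mon_val h m"
  unfolding mon_val_def using assms by (intro prod.cong) auto

lemma mon_val3_zero [simp]: "mon_val3 w 0 = 1"
  by (cases w) (simp add: zero_prod_def)

lemma mon_val3_add: "mon_val3 w (m + m') = mon_val3 w m * mon_val3 w m'"
  by (cases w; cases m; cases m') (simp add: mon_val_add algebra_simps)

lemma teval_zero [simp]: "teval w 0 = 0"
  by (simp add: teval_def)

lemma teval_single: "teval w (Poly_Mapping.single m c) = c * mon_val3 w m"
  by (simp add: teval_def eval_with_single)

lemma teval_add: "teval w (p + q) = teval w p + teval w q"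
  by (simp add: teval_def eval_with_add)

lemma teval_mult: "teval w (p * q) = teval w p * teval w q"
  by (simp add: teval_def eval_with_mult mon_val3_add)

lemma teval_one [simp]: "teval w 1 = 1"
  by (metis single_one teval_single mon_val3_zero mult_1)

lemma teval_sum: "teval w (\<Sum>i\<in>A. p i) = (\<Sum>i\<in>A. teval w (p i))"
  by (simp add: teval_def eval_with_sum)

lemma teval_diff: "teval w (p - q) = teval w p - teval w (q :: 'a::comm_ring_1 tpoly)"
  by (metis add_diff_cancel diff_add_cancel teval_add)

lemma teval_superset:
  assumes "finite A" "Poly_Mapping.keys p \<subseteq> A"
  shows "teval w p = (\<Sum>m\<in>A. Poly_Mapping.lookup p m * mon_val3 w m)"
  using assms by (simp add: teval_def eval_with_superset)

section \<open>A weak Nullstellensatz\<close>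

definition is_ideal :: "'r::comm_ring_1 set \<Rightarrow> bool" where
  "is_ideal J \<longleftrightarrow> 0 \<in> J \<and> (\<forall>a\<in>J. \<forall>b\<in>J. a + b \<in> J) \<and> (\<forall>a\<in>J. \<forall>c. c * a \<in> J)"

definition is_prime_ideal :: "'r::comm_ring_1 set \<Rightarrow> bool" where
  "is_prime_ideal J \<longleftrightarrow> is_ideal J \<and> 1 \<notin> J \<and> (\<forall>a b. a * b \<in> J \<longrightarrow> a \<in> J \<or> b \<in> J)"

lemma is_ideal_sum:
  assumes "is_ideal J" "\<And>i. i \<in> A \<Longrightarrow> g i \<in> J"
  shows "sum g A \<in> J"
  using assms(2)
  by (induction A rule: infinite_finite_induct) (use assms(1) in \<open>auto simp: is_ideal_def\<close>)

lemma is_ideal_uminus: "is_ideal J \<Longrightarrow> a \<in> J \<Longrightarrow> - a \<in> J"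
  unfolding is_ideal_def by (metis mult_minus1)

lemma is_ideal_diff: "is_ideal J \<Longrightarrow> a \<in> J \<Longrightarrow> b \<in> J \<Longrightarrow> a - b \<in> J"
  using is_ideal_uminus[of J b] unfolding is_ideal_def by (metis diff_conv_add_uminus)

lemma is_ideal_mult_left: "is_ideal J \<Longrightarrow> a \<in> J \<Longrightarrow> c * a \<in> J"
  by (simp add: is_ideal_def)

lemma is_ideal_mult_right: "is_ideal J \<Longrightarrow> a \<in> J \<Longrightarrow> a * c \<in> J"
  by (simp add: is_ideal_def mult.commute)

lemma is_ideal_add: "is_ideal J \<Longrightarrow> a \<in> J \<Longrightarrow> b \<in> J \<Longrightarrow> a + b \<in> J"
  by (simp add: is_ideal_def)

lemma is_ideal_zero: "is_ideal J \<Longrightarrow> 0 \<in> J"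
  by (simp add: is_ideal_def)

lemma is_ideal_add_principal:
  assumes "is_ideal J"
  shows "is_ideal {j + c * a | j c. j \<in> J}"
  unfolding is_ideal_def
proof (intro conjI ballI allI)
  show "0 \<in> {j + c * a | j c. j \<in> J}"
    using is_ideal_zero[OF assms] by (auto intro!: exI[of _ 0])
next
  fix x y assume "x \<in> {j + c * a | j c. j \<in> J}" "y \<in> {j + c * a | j c. j \<in> J}"
  then obtain j c j' c' where "x = j + c * a" "y = j' + c' * a" "j \<in> J" "j' \<in> J"
    by blast
  then have "x + y = (j + j') + (c + c') * a" "j + j' \<in> J"
    using assms by (auto simp: algebra_simps is_ideal_def)
  then show "x + y \<in> {j + c * a | j c. j \<in> J}"
    by blast
next
  fix x d assume "x \<in> {j + c * a | j c. j \<in> J}"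
  then obtain j c where "x = j + c * a" "j \<in> J"
    by blast
  then have "d * x = d * j + (d * c) * a" "d * j \<in> J"
    using assms by (auto simp: algebra_simps is_ideal_def)
  then show "d * x \<in> {j + c * a | j c. j \<in> J}"
    by blast
qed

text \<open>The maximal proper ideal supplied by Zorn's lemma is prime: if neither factor lies in
  it, then 1 lies in its extension by each factor, and the product of the two expressions puts 1
  into the ideal itself.\<close>

lemma prime_ideal_exists:
  assumes "is_ideal I" "1 \<notin> I"
  obtains J where "is_prime_ideal J" "I \<subseteq> J"
proof -
  let ?S = "{J. is_ideal J \<and> 1 \<notin> J \<and> I \<subseteq> J}"
  have "\<exists>M\<in>?S. \<forall>X\<in>?S. M \<subseteq> X \<longrightarrow> X = M"
  proof (rule subset_Zorn_nonempty)
    show "?S \<noteq> {}"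
      using assms by blast
  next
    fix C assume C: "C \<noteq> {}" "subset.chain ?S C"
    then have sub: "C \<subseteq> ?S" and ch: "\<And>X Y. X \<in> C \<Longrightarrow> Y \<in> C \<Longrightarrow> X \<subseteq> Y \<or> Y \<subseteq> X"
      by (auto simp: subset_chain_def)
    have "is_ideal (\<Union>C)"
      unfolding is_ideal_def
    proof (intro conjI ballI allI)
      show "0 \<in> \<Union>C"
        using C(1) sub by (auto simp: is_ideal_def)
    next
      fix a b assume "a \<in> \<Union>C" "b \<in> \<Union>C"
      then obtain X Y where "X \<in> C" "Y \<in> C" "a \<in> X" "b \<in> Y"
        by blast
      then obtain Z where "Z \<in> C" "a \<in> Z" "b \<in> Z"
        using ch[of X Y] by blast
      then have "a + b \<in> Z"
        using sub by (auto simp: is_ideal_def)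
      then show "a + b \<in> \<Union>C"
        using \<open>Z \<in> C\<close> by blast
    next
      fix a c assume "a \<in> \<Union>C"
      then obtain X where "X \<in> C" "a \<in> X"
        by blast
      moreover from this have "c * a \<in> X"
        using sub by (auto simp: is_ideal_def)
      ultimately show "c * a \<in> \<Union>C"
        by blast
    qed
    then show "\<Union>C \<in> ?S"
      using C(1) sub by auto
  qed
  then obtain M where MS: "M \<in> ?S" and maxS: "\<forall>X\<in>?S. M \<subseteq> X \<longrightarrow> X = M"
    by (rule bexE)
  have M: "is_ideal M" "1 \<notin> M" "I \<subseteq> M"
    using MS by simp_all
  have max: "X = M" if "is_ideal X" "1 \<notin> X" "I \<subseteq> X" "M \<subseteq> X" for X
    using maxS that by simp
  have *: "\<exists>j\<in>M. \<exists>c. 1 = j + c * a" if "a \<notin> M" for a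
  proof (rule ccontr)
    let ?X = "{j + c * a | j c. j \<in> M}"
    assume "\<not> ?thesis"
    then have "1 \<notin> ?X"
      by blast
    moreover have "M \<subseteq> ?X"
    proof
      fix x assume "x \<in> M"
      then have "x + 0 * a \<in> ?X"
        by blast
      then show "x \<in> ?X"
        by simp
    qed
    moreover have "is_ideal ?X"
      by (rule is_ideal_add_principal[OF M(1)])
    ultimately have "?X = M"
      using M(3) by (intro max) auto
    moreover have "0 + 1 * a \<in> ?X"
      using is_ideal_zero[OF M(1)] by blast
    then have "a \<in> ?X"
      by simp
    ultimately show False
      using that by blast
  qed
  have "a \<in> M \<or> b \<in> M" if "a * b \<in> M" for a b
  proof (rule ccontr)
    assume "\<not> ?thesis"
    then obtain j c j' c' where "j \<in> M" "j' \<in> M" and e: "1 = j + c * a" "1 = j' + c' * b"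
      using *[of a] *[of b] by blast
    have "1 = (j + c * a) * (j' + c' * b)"
      by (simp flip: e)
    then have "1 = j * (j' + c' * b) + c * a * j' + (c * c') * (a * b)"
      by (simp add: algebra_simps)
    moreover have "j * (j' + c' * b) \<in> M" "c * a * j' \<in> M" "(c * c') * (a * b) \<in> M"
      using \<open>j \<in> M\<close> \<open>j' \<in> M\<close> that M(1) by (simp_all add: is_ideal_mult_left is_ideal_mult_right)
    then have "j * (j' + c' * b) + c * a * j' + (c * c') * (a * b) \<in> M"
      by (intro is_ideal_add[OF M(1)])
    ultimately show False
      using M(2) by metis
  qed
  then show ?thesis
    using that[of M] M by (auto simp: is_prime_ideal_def)
qed

lemma exists_nonroot:
  fixes p :: "'a::{alg_closed_field, field_char_0} poly"
  assumes "p \<noteq> 0"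
  obtains c where "poly p c \<noteq> 0"
proof -
  have "finite {c. poly p c = 0}"
    using poly_roots_finite[OF assms] .
  then show ?thesis
    using that infinite_UNIV_char_0 by (metis (mono_tags, lifting) mem_Collect_eq ex_new_if_finite)
qed

text \<open>What the induction uses of a polynomial ring: constants, variables, and for every
  assignment of values a homomorphism realizing it. The ring stays fixed while the set of variables
  grows, which avoids a tower of polynomial types.\<close>

locale point_evaluations =
  fixes emb :: "'a::{alg_closed_field, field_char_0} \<Rightarrow> 'r::comm_ring_1"
    and var :: "'v \<Rightarrow> 'r"
    and ev :: "('v \<Rightarrow> 'a) \<Rightarrow> 'r \<Rightarrow> 'a"
  assumes emb_hom: "comm_ring_hom emb"
    and ev_hom: "comm_ring_hom (ev w)"
    and ev_emb: "ev w (emb a) = a"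
    and ev_var: "ev w (var v) = w v"
begin

interpretation emb: comm_ring_hom emb by (rule emb_hom)
interpretation ev: comm_ring_hom "ev w" for w by (rule ev_hom)

inductive_set subalg :: "'v set \<Rightarrow> 'r set" for V :: "'v set" where
  emb: "emb a \<in> subalg V"
| var: "v \<in> V \<Longrightarrow> var v \<in> subalg V"
| add: "p \<in> subalg V \<Longrightarrow> q \<in> subalg V \<Longrightarrow> p + q \<in> subalg V"
| mult: "p \<in> subalg V \<Longrightarrow> q \<in> subalg V \<Longrightarrow> p * q \<in> subalg V"

lemma subalg_zero: "0 \<in> subalg V"
  using subalg.emb[of 0] by simp

lemma subalg_uminus: "p \<in> subalg V \<Longrightarrow> - p \<in> subalg V"
  using subalg.mult[OF subalg.emb[of "-1"]] by (simp add: emb.hom_uminus)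

lemma subalg_diff: "p \<in> subalg V \<Longrightarrow> q \<in> subalg V \<Longrightarrow> p - q \<in> subalg V"
  using subalg.add[OF _ subalg_uminus, of p V q] by simp

lemma subalg_sum: "(\<And>i. i \<in> A \<Longrightarrow> g i \<in> subalg V) \<Longrightarrow> sum g A \<in> subalg V"
  by (induction A rule: infinite_finite_induct) (auto intro: subalg.intros subalg_zero)

lemma subalg_power: "p \<in> subalg V \<Longrightarrow> p ^ k \<in> subalg V"
  using subalg.emb[of 1 V] by (induction k) (auto intro: subalg.mult)

lemma subalg_mono: "p \<in> subalg V \<Longrightarrow> V \<subseteq> W \<Longrightarrow> p \<in> subalg W"
  by (induction rule: subalg.induct) (auto intro: subalg.intros)

lemma ev_cong: "p \<in> subalg V \<Longrightarrow> (\<And>v. v \<in> V \<Longrightarrow> w v = w' v) \<Longrightarrow> ev w p = ev w' p"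
  by (induction rule: subalg.induct) (auto simp: ev_emb ev_var ev.hom_add ev.hom_mult)

section \<open>One-variable polynomials over a subalgebra\<close>

definition subalg_polys :: "'v set \<Rightarrow> 'r poly set" where
  "subalg_polys V = {q. \<forall>i. coeff q i \<in> subalg V}"

lemma subalg_polys_add: "p \<in> subalg_polys V \<Longrightarrow> q \<in> subalg_polys V \<Longrightarrow> p + q \<in> subalg_polys V"
  by (auto simp: subalg_polys_def intro: subalg.add)

lemma subalg_polys_diff: "p \<in> subalg_polys V \<Longrightarrow> q \<in> subalg_polys V \<Longrightarrow> p - q \<in> subalg_polys V"
  by (auto simp: subalg_polys_def intro: subalg_diff)

lemma subalg_polys_mult: "p \<in> subalg_polys V \<Longrightarrow> q \<in> subalg_polys V \<Longrightarrow> p * q \<in> subalg_polys V"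
  by (auto simp: subalg_polys_def coeff_mult intro!: subalg_sum subalg.mult)

lemma subalg_polys_smult: "c \<in> subalg V \<Longrightarrow> q \<in> subalg_polys V \<Longrightarrow> smult c q \<in> subalg_polys V"
  by (auto simp: subalg_polys_def intro!: subalg.mult)

lemma subalg_polys_monom: "c \<in> subalg V \<Longrightarrow> monom c k \<in> subalg_polys V"
  by (auto simp: subalg_polys_def subalg_zero)

lemma subalg_polys_zero: "0 \<in> subalg_polys V"
  by (auto simp: subalg_polys_def subalg_zero)

text \<open>Adjoining a variable is expressed through evaluation at \<open>var v\<close>. The
  representing polynomial is not claimed to be unique; the later arguments work with any
  representative modulo the prime ideal.\<close>

lemma subalg_insert_poly:
  assumes "p \<in> subalg (insert v V)"
  shows "\<exists>q\<in>subalg_polys V. p = poly q (var v)"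
  using assms
proof (induction rule: subalg.induct)
  case (emb a)
  then show ?case
    by (intro bexI[of _ "[:emb a:]"])
      (auto simp: subalg_polys_def coeff_pCons subalg.emb subalg_zero split: nat.split)
next
  case (var u)
  show ?case
  proof (cases "u = v")
    case True
    have "1 \<in> subalg V"
      using subalg.emb[of 1] by simp
    then show ?thesis using True
      by (intro bexI[of _ "monom 1 1"] subalg_polys_monom) (auto simp: poly_monom)
  next
    case False
    then show ?thesis using var
      by (intro bexI[of _ "monom (var u) 0"] subalg_polys_monom) (auto simp: poly_monom intro: subalg.var)
  qed
next
  case (add p q)
  then show ?case
    by (metis poly_add subalg_polys_add)
next
  case (mult p q)
  then show ?case
    by (metis poly_mult subalg_polys_mult)
qed

lemma poly_in_subalg_insert:
  assumes "q \<in> subalg_polys V"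
  shows "poly q (var v) \<in> subalg (insert v V)"
  unfolding poly_altdef using assms
  by (auto simp: subalg_polys_def intro!: subalg_sum subalg.mult subalg_power subalg.var
      intro: subalg_mono)

text \<open>Leading coefficients are not invertible, so each division step first multiplies by
  \<open>lead_coeff d\<close>. The bound on the degree of the quotient is used to show that a
  quotient has smaller degree than a relation of minimal degree.\<close>

lemma subalg_pseudo_division:
  assumes "g \<in> subalg_polys V" "d \<in> subalg_polys V" "d \<noteq> 0"
  shows "\<exists>m. \<exists>q\<in>subalg_polys V. \<exists>r\<in>subalg_polys V. smult (lead_coeff d ^ m) g = d * q + r \<and>
     (r = 0 \<or> degree r < degree d) \<and> degree q \<le> degree g - degree d"
  using assms(1)
\<comment> \<open>The measure separates the zero polynomial from nonzero constants of the same
  degree, since a constant divisor reduces a constant to 0.\<close>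
proof (induction "if g = 0 then 0 else Suc (degree g)" arbitrary: g rule: less_induct)
  case less
  show ?case
  proof (cases "g = 0 \<or> degree g < degree d")
    case True
    then show ?thesis using less.prems
      by (intro exI[of _ 0] bexI[of _ 0] bexI[of _ g]) (auto simp: subalg_polys_zero)
  next
    case False
    define t where "t = monom (lead_coeff g) (degree g - degree d)"
    define g' where "g' = smult (lead_coeff d) g - t * d"
    have lc: "lead_coeff d \<in> subalg V" "lead_coeff g \<in> subalg V"
      using assms(2) less.prems by (auto simp: subalg_polys_def)
    then have t: "t \<in> subalg_polys V"
      unfolding t_def by (intro subalg_polys_monom)
    have g': "g' \<in> subalg_polys V"
      unfolding g'_def using less.prems assms(2) lc t
      by (intro subalg_polys_diff subalg_polys_smult subalg_polys_mult)
    have dt: "degree t \<le> degree g - degree d"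
      unfolding t_def by (rule degree_monom_le)
    have deg: "degree g' \<le> degree g"
      unfolding g'_def
    proof (rule degree_diff_le)
      show "degree (smult (lead_coeff d) g) \<le> degree g"
        by (rule degree_smult_le)
      show "degree (t * d) \<le> degree g"
        using degree_mult_le[of t d] dt False by linarith
    qed
    have "coeff (t * d) (degree g) = lead_coeff g * lead_coeff d"
      unfolding t_def coeff_monom_mult using False by simp
    then have c0: "coeff g' (degree g) = 0"
      unfolding g'_def by (simp add: mult.commute)
    have lt: "g' = 0 \<or> degree g' < degree g"
      using deg c0 by (metis le_neq_implies_less leading_coeff_0_iff)
    then have lt': "(if g' = 0 then 0 else Suc (degree g')) < (if g = 0 then 0 else Suc (degree g))"
      using False by auto
    obtain m q r where IH: "q \<in> subalg_polys V" "r \<in> subalg_polys V"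
      "smult (lead_coeff d ^ m) g' = d * q + r" "r = 0 \<or> degree r < degree d"
      "degree q \<le> degree g' - degree d"
      using less.hyps[OF lt' g'] by blast
    have "smult (lead_coeff d ^ Suc m) g = d * (q + smult (lead_coeff d ^ m) t) + r"
    proof -
      have "smult (lead_coeff d ^ Suc m) g = smult (lead_coeff d ^ m) (g' + t * d)"
        unfolding g'_def by (simp add: mult.commute)
      also have "\<dots> = d * q + r + smult (lead_coeff d ^ m) (t * d)"
        by (simp add: smult_add_right IH(3))
      finally show ?thesis
        by (simp add: algebra_simps)
    qed
    moreover have "degree (q + smult (lead_coeff d ^ m) t) \<le> degree g - degree d"
    proof (rule degree_add_le)
      show "degree q \<le> degree g - degree d"
        using IH(5) deg by simp
      show "degree (smult (lead_coeff d ^ m) t) \<le> degree g - degree d"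
        using degree_smult_le dt le_trans by blast
    qed
    moreover have "q + smult (lead_coeff d ^ m) t \<in> subalg_polys V"
      using IH(1) t lc by (intro subalg_polys_add subalg_polys_smult subalg_power)
    ultimately show ?thesis
      using IH(2,4) by blast
  qed
qed

lemma ev_poly: "ev w (poly q (var v)) = poly (map_poly (ev w) q) (w v)"
  using ev.poly_map_poly[of w q "var v"] by (simp add: ev_var)

text \<open>The coefficients do not involve \<open>v\<close>, so the value of \<open>v\<close> can
  be chosen after those of the other variables.\<close>

lemma ev_poly_update:
  assumes "q \<in> subalg_polys V" "v \<notin> V"
  shows "ev (w(v := c)) (poly q (var v)) = poly (map_poly (ev w) q) c"
proof -
  have "map_poly (ev (w(v := c))) q = map_poly (ev w) q"
    using assms by (intro poly_eqI) (auto simp: subalg_polys_def intro!: ev_cong)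
  then show ?thesis
    by (simp add: ev_poly)
qed

lemma poly_in_ideal:
  assumes "is_ideal J" "\<And>i. coeff q i \<in> J"
  shows "poly q x \<in> J"
  unfolding poly_altdef using assms by (intro is_ideal_sum is_ideal_mult_right) auto

lemma prime_power_notin:
  assumes "is_prime_ideal J" "a \<notin> J"
  shows "a ^ k \<notin> J"
  using assms by (induction k) (auto simp: is_prime_ideal_def)

text \<open>Dropping the coefficients that lie in a prime ideal does not change a polynomial modulo that
  ideal, and makes the leading coefficient invertible in the fraction field of the quotient.\<close>

lemma reduce_coeffs:
  assumes "is_ideal J" "q \<in> subalg_polys V"
  obtains q' where "q' \<in> subalg_polys V" "degree q' \<le> degree q" "\<And>i. coeff q i - coeff q' i \<in> J"
    "\<And>x. poly q x - poly q' x \<in> J" "q' = 0 \<or> lead_coeff q' \<notin> J"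
proof -
  define q' where "q' = map_poly (\<lambda>a. if a \<in> J then 0 else a) q"
  have c: "coeff q' i = (if coeff q i \<in> J then 0 else coeff q i)" for i
    unfolding q'_def using is_ideal_zero[OF assms(1)] by (simp add: coeff_map_poly)
  have d: "coeff q i - coeff q' i \<in> J" for i
    using is_ideal_zero[OF assms(1)] by (simp add: c)
  show ?thesis
  proof (rule that[of q'])
    show "q' \<in> subalg_polys V"
      using assms(2) by (auto simp: subalg_polys_def c subalg_zero)
    show "degree q' \<le> degree q"
      by (rule degree_le) (simp add: c coeff_eq_0)
    show "poly q x - poly q' x \<in> J" for x
      using poly_in_ideal[OF assms(1), of "q - q'" x] d by simp
    show "q' = 0 \<or> lead_coeff q' \<notin> J"
      using c[of "degree q'"] by (metis leading_coeff_0_iff)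
  qed (rule d)
qed

text \<open>The element \<open>h\<close> that must stay nonzero is what closes the induction: in the
  step, a leading coefficient and a multiple or a coefficient of \<open>h\<close> must not vanish at
  the point found for the remaining variables. The two cases are that \<open>var v\<close> is
  transcendental or algebraic over the fraction field of \<open>subalg V\<close> modulo
  \<open>J\<close>.\<close>

theorem prime_ideal_zero:
  assumes "finite V" "is_prime_ideal J" "h \<in> subalg V" "h \<notin> J"
  shows "\<exists>w. (\<forall>p\<in>subalg V \<inter> J. ev w p = 0) \<and> ev w h \<noteq> 0"
  using assms
proof (induction V arbitrary: h rule: finite_induct)
  case empty
  have emb: "\<exists>a. p = emb a" if "p \<in> subalg {}" for p
    using that by (induction rule: subalg.induct) (auto simp: emb.hom_add[symmetric] emb.hom_mult[symmetric])
  have J: "is_ideal J" "1 \<notin> J"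
    using empty by (auto simp: is_prime_ideal_def)
  have "ev w p = 0" if p: "p \<in> subalg {} \<inter> J" for p w
  proof (rule ccontr)
    assume *: "ev w p \<noteq> 0"
    obtain a where a: "p = emb a"
      using emb p by auto
    then have "a \<noteq> 0"
      using * by (simp add: ev_emb)
    then have "emb (inverse a) * p = 1"
      using emb.hom_mult[of "inverse a" a] by (simp add: a)
    then show False
      using is_ideal_mult_left[OF J(1), of p "emb (inverse a)"] p J(2) by auto
  qed
  moreover have "ev w h \<noteq> 0" for w
    using empty emb[of h] is_ideal_zero[OF J(1)] by (auto simp: ev_emb)
  ultimately show ?case
    by blast
next
  case (insert v V)
  have J: "is_ideal J" and prime: "\<And>a b. a * b \<in> J \<Longrightarrow> a \<in> J \<or> b \<in> J"
    using insert.prems by (auto simp: is_prime_ideal_def)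
  obtain qh where qh: "qh \<in> subalg_polys V" "h = poly qh (var v)"
    using subalg_insert_poly[OF insert.prems(2)] by blast
  \<comment> \<open>The relations satisfied by \<open>var v\<close> modulo \<open>J\<close> whose
    leading coefficient survives modulo \<open>J\<close>.\<close>
  define G where "G = {q \<in> subalg_polys V. poly q (var v) \<in> J \<and> lead_coeff q \<notin> J}"
  show ?case
  proof (cases "G = {}")
    \<comment> \<open>Transcendental case: a polynomial in \<open>var v\<close> lies in
      \<open>J\<close> only if all its coefficients do, so any \<open>c\<close> that is not a root
      of the specialized \<open>qh\<close> will do.\<close>
    case True
    have null: "coeff q i \<in> J" if q: "q \<in> subalg_polys V" "poly q (var v) \<in> J" for q i
    proof -
      obtain q' where q': "q' \<in> subalg_polys V" "\<And>i. coeff q i - coeff q' i \<in> J"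
        "\<And>x. poly q x - poly q' x \<in> J" "q' = 0 \<or> lead_coeff q' \<notin> J"
        using reduce_coeffs[OF J q(1)] by metis
      have "poly q' (var v) \<in> J"
        using is_ideal_diff[OF J q(2) q'(3)[of "var v"]] by simp
      then have "q' = 0"
        using q'(1,4) True by (auto simp: G_def)
      then show ?thesis
        using q'(2)[of i] by simp
    qed
    obtain i where i: "coeff qh i \<notin> J"
      using poly_in_ideal[OF J, of qh "var v"] insert.prems(3) qh(2) by blast
    obtain w where w: "\<And>p. p \<in> subalg V \<inter> J \<Longrightarrow> ev w p = 0" "ev w (coeff qh i) \<noteq> 0"
      using insert.IH[of "coeff qh i"] insert.prems(1) i qh(1) by (auto simp: subalg_polys_def)
    have "map_poly (ev w) qh \<noteq> 0"
      using w(2) by (metis coeff_0 ev.coeff_map_poly_hom)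
    then obtain c where c: "poly (map_poly (ev w) qh) c \<noteq> 0"
      by (rule exists_nonroot)
    have "ev (w(v := c)) p = 0" if p: "p \<in> subalg (insert v V) \<inter> J" for p
    proof -
      obtain q where q: "q \<in> subalg_polys V" "p = poly q (var v)"
        using subalg_insert_poly[of p v V] p by blast
      have "map_poly (ev w) q = 0"
        using null[OF q(1)] p q w(1) by (intro poly_eqI) (auto simp: subalg_polys_def)
      then show ?thesis
        using ev_poly_update[OF q(1) insert.hyps(2)] q(2) by simp
    qed
    moreover have "ev (w(v := c)) h \<noteq> 0"
      using c ev_poly_update[OF qh(1) insert.hyps(2)] qh(2) by simp
    ultimately show ?thesis
      by blast
  next
    case False
    \<comment> \<open>A relation of least degree plays the role of a minimal polynomial: anything in
      \<open>J\<close> of lower degree has all its coefficients in \<open>J\<close>.\<close>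
    define g where "g = arg_min degree (\<lambda>q. q \<in> G)"
    have g: "g \<in> G" and gmin: "\<And>q. q \<in> G \<Longrightarrow> degree g \<le> degree q"
      using False arg_min_nat_lemma[of "\<lambda>q. q \<in> G" _ degree] unfolding g_def by blast+
    have gP: "g \<in> subalg_polys V" and gJ: "poly g (var v) \<in> J" and gl: "lead_coeff g \<notin> J"
      using g by (auto simp: G_def)
    have g0: "g \<noteq> 0"
      using gl is_ideal_zero[OF J] by auto
    have lg: "lead_coeff g \<in> subalg V"
      using gP by (auto simp: subalg_polys_def)
    have gdeg: "degree g \<ge> 1"
    proof (rule ccontr)
      assume "\<not> ?thesis"
      then obtain a where "g = [:a:]"
        using degree_eq_zeroE[of g] by (metis One_nat_def Suc_leI not_gr_zero)
      then show False
        using gJ gl by simp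
    qed
    have null: "coeff q i \<in> J"
      if q: "q \<in> subalg_polys V" "poly q (var v) \<in> J" and deg: "degree q < degree g" for q i
    proof -
      obtain q' where q': "q' \<in> subalg_polys V" "degree q' \<le> degree q"
        "\<And>i. coeff q i - coeff q' i \<in> J"
        "\<And>x. poly q x - poly q' x \<in> J" "q' = 0 \<or> lead_coeff q' \<notin> J"
        using reduce_coeffs[OF J q(1)] by metis
      have "poly q' (var v) \<in> J"
        using is_ideal_diff[OF J q(2) q'(4)[of "var v"]] by simp
      then have "q' = 0"
        using q'(1,2,5) gmin[of q'] deg by (auto simp: G_def)
      then show ?thesis
        using q'(3)[of i] by simp
    qed
    \<comment> \<open>\<open>H\<close> consists of multiples of \<open>h\<close> that are nonzero
      modulo \<open>J\<close>. An element of least degree turns out to be a constant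
      \<open>b\<close>, hence lies in \<open>subalg V\<close>; keeping \<open>b\<close> nonzero by
      the induction hypothesis then keeps \<open>h\<close> nonzero.\<close>
    define H where "H = {q \<in> subalg_polys V. poly q (var v) \<notin> J \<and> lead_coeff q \<notin> J \<and>
      (\<exists>a\<in>subalg (insert v V). poly q (var v) - a * h \<in> J)}"
    have H_red: "\<exists>q'\<in>H. degree q' \<le> degree q"
      if hq: "q \<in> subalg_polys V" "poly q (var v) \<notin> J" "a \<in> subalg (insert v V)"
        "poly q (var v) - a * h \<in> J" for q a
    proof -
      obtain q' where q': "q' \<in> subalg_polys V" "degree q' \<le> degree q"
        "\<And>x. poly q x - poly q' x \<in> J" "q' = 0 \<or> lead_coeff q' \<notin> J"
        using reduce_coeffs[OF J hq(1)] by metis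
      have n: "poly q' (var v) \<notin> J"
        using is_ideal_add[OF J q'(3)[of "var v"], of "poly q' (var v)"] hq(2) by auto
      then have "q' \<noteq> 0"
        using is_ideal_zero[OF J] by auto
      moreover have "poly q' (var v) - a * h \<in> J"
        using is_ideal_diff[OF J hq(4) q'(3)[of "var v"]] by simp
      ultimately show ?thesis
        using q' n hq(3) by (auto simp: H_def)
    qed
    have "1 \<in> subalg (insert v V)"
      using subalg.emb[of 1] by simp
    then have "H \<noteq> {}"
      using H_red[of qh 1] qh insert.prems(3) is_ideal_zero[OF J] by auto
    define k where "k = arg_min degree (\<lambda>q. q \<in> H)"
    have k: "k \<in> H" and kmin: "\<And>q. q \<in> H \<Longrightarrow> degree k \<le> degree q"
      using \<open>H \<noteq> {}\<close> arg_min_nat_lemma[of "\<lambda>q. q \<in> H" _ degree] unfolding k_def by blast+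
    obtain a where a: "a \<in> subalg (insert v V)" "poly k (var v) - a * h \<in> J"
      and kP: "k \<in> subalg_polys V" and kJ: "poly k (var v) \<notin> J" and kl: "lead_coeff k \<notin> J"
      using k by (auto simp: H_def)
    have k0: "k \<noteq> 0"
      using kl is_ideal_zero[OF J] by auto
    have lk: "lead_coeff k \<in> subalg V"
      using kP by (auto simp: subalg_polys_def)
    \<comment> \<open>Up to an element of \<open>J\<close>, pseudo-division by \<open>g\<close> only
      multiplies \<open>k\<close> by a factor outside \<open>J\<close>, so the remainder is again a
      multiple of \<open>h\<close> that is nonzero modulo \<open>J\<close>.\<close>
    have klt: "degree k < degree g"
    proof (rule ccontr)
      assume ge: "\<not> ?thesis"
      obtain m q r where d: "q \<in> subalg_polys V" "r \<in> subalg_polys V"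
        "smult (lead_coeff g ^ m) k = g * q + r" "r = 0 \<or> degree r < degree g"
        using subalg_pseudo_division[OF kP gP g0] by blast
      have e: "lead_coeff g ^ m * poly k (var v) = poly g (var v) * poly q (var v) + poly r (var v)"
        using arg_cong[OF d(3), of "\<lambda>p. poly p (var v)"] by simp
      have gq: "poly g (var v) * poly q (var v) \<in> J"
        using is_ideal_mult_right[OF J gJ] .
      have n: "poly r (var v) \<notin> J"
        using is_ideal_add[OF J gq, of "poly r (var v)"] e prime[of "lead_coeff g ^ m" "poly k (var v)"] kJ
          prime_power_notin[OF insert.prems(1) gl] by metis
      have "poly r (var v) - (lead_coeff g ^ m * a) * h =
          lead_coeff g ^ m * (poly k (var v) - a * h) - poly g (var v) * poly q (var v)"
        using e by (simp add: algebra_simps)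
      also have "\<dots> \<in> J"
        by (intro is_ideal_diff[OF J] is_ideal_mult_left[OF J] a(2) gq)
      finally have "\<exists>q'\<in>H. degree q' \<le> degree r"
        using n d(2) a(1) lg by (intro H_red[of _ "lead_coeff g ^ m * a"])
          (auto intro!: subalg.mult subalg_power intro: subalg_mono)
      then obtain q' where "q' \<in> H" "degree q' \<le> degree r"
        by blast
      moreover have "r \<noteq> 0"
        using n is_ideal_zero[OF J] by auto
      ultimately show False
        using kmin[of q'] d(4) ge by auto
    qed
    \<comment> \<open>Otherwise divide \<open>g\<close> by \<open>k\<close>. A remainder outside
      \<open>J\<close> would give a smaller element of \<open>H\<close>. A remainder in
      \<open>J\<close> puts \<open>k * q\<close> into \<open>J\<close>; by primality and the degree
      bound all coefficients of \<open>q\<close> are in \<open>J\<close>, which contradicts the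
      leading coefficient of \<open>g\<close>.\<close>
    have kdeg: "degree k = 0"
    proof (rule ccontr)
      assume kd: "degree k \<noteq> 0"
      obtain m q r where d: "q \<in> subalg_polys V" "r \<in> subalg_polys V"
        "smult (lead_coeff k ^ m) g = k * q + r" "r = 0 \<or> degree r < degree k"
        "degree q \<le> degree g - degree k"
        using subalg_pseudo_division[OF gP kP k0] by blast
      have e: "lead_coeff k ^ m * poly g (var v) = poly k (var v) * poly q (var v) + poly r (var v)"
        using arg_cong[OF d(3), of "\<lambda>p. poly p (var v)"] by simp
      have lgJ: "lead_coeff k ^ m * poly g (var v) \<in> J"
        using is_ideal_mult_left[OF J gJ] .
      have rJ: "poly r (var v) \<in> J"
      proof (rule ccontr)
        assume n: "poly r (var v) \<notin> J"
        have "poly r (var v) - (- (a * poly q (var v))) * h =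
            lead_coeff k ^ m * poly g (var v) - poly q (var v) * (poly k (var v) - a * h)"
          using e by (simp add: algebra_simps)
        also have "\<dots> \<in> J"
          by (intro is_ideal_diff[OF J] is_ideal_mult_left[OF J] a(2) gJ)
        finally have "\<exists>q'\<in>H. degree q' \<le> degree r"
          using n d(2) by (intro H_red[of _ "- (a * poly q (var v))"])
            (auto intro!: subalg_uminus subalg.mult a(1) poly_in_subalg_insert d(1))
        then obtain q' where "q' \<in> H" "degree q' \<le> degree r"
          by blast
        moreover have "r \<noteq> 0"
          using n is_ideal_zero[OF J] by auto
        ultimately show False
          using kmin[of q'] d(4) by auto
      qed
      then have rnull: "coeff r i \<in> J" for i
        using null[OF d(2)] d(4) klt is_ideal_zero[OF J] by (cases "r = 0") auto
      have "poly k (var v) * poly q (var v) \<in> J"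
        using is_ideal_diff[OF J lgJ rJ] e by simp
      then have "poly q (var v) \<in> J"
        using prime kJ by blast
      then have qnull: "coeff q i \<in> J" for i
        using null[OF d(1)] d(5) kd gdeg by simp
      have "coeff (smult (lead_coeff k ^ m) g) (degree g) \<in> J"
        unfolding d(3) coeff_add coeff_mult
        by (intro is_ideal_add[OF J] is_ideal_sum[OF J] is_ideal_mult_left[OF J] qnull rnull)
      then show False
        using prime[of "lead_coeff k ^ m" "lead_coeff g"] gl prime_power_notin[OF insert.prems(1) kl]
        by auto
    qed
    then obtain b where b: "k = [:b:]"
      using degree_eq_zeroE by blast
    have bV: "b \<in> subalg V" and bJ: "b \<notin> J" and bh: "b - a * h \<in> J"
      using lk kJ a(2) by (auto simp: b)
    have "b * lead_coeff g \<notin> J"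
      using prime bJ gl by blast
    then obtain w where w: "\<And>p. p \<in> subalg V \<inter> J \<Longrightarrow> ev w p = 0" "ev w (b * lead_coeff g) \<noteq> 0"
      using insert.IH[OF insert.prems(1), of "b * lead_coeff g"] bV lg by (auto intro: subalg.mult)
    have wb: "ev w b \<noteq> 0" and wg: "ev w (lead_coeff g) \<noteq> 0"
      using w(2) by (auto simp: ev.hom_mult)
    have "degree (map_poly (ev w) g) \<ge> degree g"
      using wg by (intro le_degree) simp
    then have "degree (map_poly (ev w) g) > 0"
      using gdeg by linarith
    then obtain c where c: "poly (map_poly (ev w) g) c = 0"
      using alg_closed_imp_poly_has_root by blast
    \<comment> \<open>Modulo \<open>g\<close> an element of \<open>J\<close> leaves a remainder of
      lower degree than \<open>g\<close>, whose coefficients lie in \<open>J\<close> and therefore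
      vanish at \<open>w\<close>.\<close>
    have zero: "ev (w(v := c)) p = 0" if p: "p \<in> subalg (insert v V) \<inter> J" for p
    proof -
      obtain q where q: "q \<in> subalg_polys V" "p = poly q (var v)"
        using subalg_insert_poly[of p v V] p by blast
      obtain m q' r where d: "q' \<in> subalg_polys V" "r \<in> subalg_polys V"
        "smult (lead_coeff g ^ m) q = g * q' + r" "r = 0 \<or> degree r < degree g"
        using subalg_pseudo_division[OF q(1) gP g0] by blast
      have e: "lead_coeff g ^ m * p = poly g (var v) * poly q' (var v) + poly r (var v)"
        using arg_cong[OF d(3), of "\<lambda>p. poly p (var v)"] by (simp add: q(2))
      have "poly r (var v) \<in> J"
        using is_ideal_diff[OF J is_ideal_mult_left[OF J, of p "lead_coeff g ^ m"]
            is_ideal_mult_right[OF J gJ, of "poly q' (var v)"]] p e by simp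
      then have "coeff r i \<in> J" for i
        using null[OF d(2)] d(4) is_ideal_zero[OF J] by (cases "r = 0") auto
      then have "map_poly (ev w) r = 0"
        using w(1) d(2) by (intro poly_eqI) (auto simp: subalg_polys_def)
      then have "ev (w(v := c)) (poly r (var v)) = 0"
        using ev_poly_update[OF d(2) insert.hyps(2)] by simp
      moreover have "ev (w(v := c)) (poly g (var v)) = 0"
        using ev_poly_update[OF gP insert.hyps(2)] c by simp
      ultimately have "ev (w(v := c)) (lead_coeff g ^ m * p) = 0"
        unfolding e by (simp add: ev.hom_add ev.hom_mult)
      moreover have "ev (w(v := c)) (lead_coeff g) = ev w (lead_coeff g)"
        using insert.hyps(2) by (intro ev_cong[OF lg]) auto
      ultimately show ?thesis
        using wg by (simp add: ev.hom_mult ev.hom_power)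
    qed
    have "b - a * h \<in> subalg (insert v V)"
      using bV a(1) insert.prems(2) by (intro subalg_diff subalg.mult) (auto intro: subalg_mono)
    then have "ev (w(v := c)) (b - a * h) = 0"
      using zero bh by blast
    then have "ev (w(v := c)) b = ev (w(v := c)) a * ev (w(v := c)) h"
      by (simp add: ev.hom_minus ev.hom_mult)
    moreover have "ev (w(v := c)) b = ev w b"
      using insert.hyps(2) by (intro ev_cong[OF bV]) auto
    ultimately have "ev (w(v := c)) h \<noteq> 0"
      using wb by auto
    then show ?thesis
      using zero by blast
  qed
qed

theorem weak_nullstellensatz:
  assumes "finite V" "is_ideal I" "1 \<notin> I"
  shows "\<exists>w. \<forall>p\<in>subalg V \<inter> I. ev w p = 0"
proof -
  obtain J where J: "is_prime_ideal J" "I \<subseteq> J"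
    using prime_ideal_exists[OF assms(2,3)] .
  have "1 \<in> subalg V"
    using subalg.emb[of 1] by simp
  then show ?thesis
    using prime_ideal_zero[OF assms(1) J(1), of 1] J by (auto simp: is_prime_ideal_def)
qed

end

section \<open>Koszul complexes of Laurent functions\<close>

text \<open>The sign that sorts \<open>l\<close> into the increasing wedge product of
  \<open>J\<close>. It is defined on every additive group, so that it applies to scalars and to
  functions alike.\<close>

definition ksgn :: "nat \<Rightarrow> nat set \<Rightarrow> 'm::ab_group_add \<Rightarrow> 'm" where
  "ksgn l J m = (if even (card {j\<in>J. j < l}) then m else - m)"

lemma ksgn_add: "ksgn l J (a + b) = ksgn l J a + ksgn l J b"
  and ksgn_zero [simp]: "ksgn l J 0 = 0"
  and ksgn_uminus: "ksgn l J (- a) = - ksgn l J a"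
  and ksgn_ksgn [simp]: "ksgn l J (ksgn l J a) = a"
  by (auto simp: ksgn_def)

lemma ksgn_eq_0_iff [simp]: "ksgn l J a = 0 \<longleftrightarrow> a = 0"
  by (auto simp: ksgn_def)

lemma ksgn_sum: "ksgn l J (\<Sum>i\<in>A. f i) = (\<Sum>i\<in>A. ksgn l J (f i))"
  by (auto simp: ksgn_def sum_negf)

lemma additive_ksgn:
  assumes "\<And>a b. T (a + b) = T a + (T b :: 'm::ab_group_add)"
  shows "T (ksgn l J m) = ksgn l J (T m)"
proof -
  interpret T: additive T by standard (rule assms)
  show ?thesis
    by (auto simp: ksgn_def T.minus)
qed

lemma card_insert_below:
  assumes "finite J" "l \<notin> J"
  shows "card {j\<in>insert l J. j < k} = card {j\<in>J. j < k} + (if l < k then 1 else 0)"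
proof -
  have "{j\<in>insert l J. j < k} = (if l < k then insert l {j\<in>J. j < k} else {j\<in>J. j < k})"
    by auto
  then show ?thesis
    using assms by auto
qed

text \<open>Inserting the smaller index raises the count below the larger one, and not conversely;
  this is anticommutativity of the wedge product.\<close>

lemma ksgn_swap:
  assumes "finite J" "l \<notin> J" "k \<notin> J" "l \<noteq> k"
  shows "ksgn l J (ksgn k (insert l J) m) = - ksgn k J (ksgn l (insert k J) m)"
  using assms by (cases "l < k") (simp_all add: ksgn_def card_insert_below del: insert_iff)

lemma ksgn_swap':
  assumes "finite J" "l \<notin> J" "k \<notin> J" "l \<noteq> k"
  shows "ksgn l (insert k J) (ksgn k (insert l J) m) = - ksgn k J (ksgn l J m)"
  using assms by (cases "l < k") (simp_all add: ksgn_def card_insert_below del: insert_iff)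

text \<open>Chains are families of coefficients indexed by subsets, so the Koszul differential is
  written from the target: the coefficient at \<open>J\<close> collects the contributions of all
  \<open>insert l J\<close>. The companion \<open>wedge\<close> is exterior multiplication by the
  sum of the \<open>S l\<close> times \<open>e_l\<close>.\<close>

definition contract :: "nat set \<Rightarrow> (nat \<Rightarrow> 'm \<Rightarrow> 'm) \<Rightarrow> (nat set \<Rightarrow> 'm) \<Rightarrow> nat set \<Rightarrow> 'm::ab_group_add" where
  "contract N T \<omega> J = (\<Sum>l\<in>N - J. ksgn l J (T l (\<omega> (insert l J))))"

definition wedge :: "(nat \<Rightarrow> 'm \<Rightarrow> 'm) \<Rightarrow> (nat set \<Rightarrow> 'm) \<Rightarrow> nat set \<Rightarrow> 'm::ab_group_add" where
  "wedge T \<omega> J = (\<Sum>l\<in>J. ksgn l (J - {l}) (T l (\<omega> (J - {l}))))"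

text \<open>Having two families covers both the square of one differential and the interplay of
  different linear functionals.\<close>

lemma contract_anticommute:
  assumes "finite N" "finite J"
    and "\<And>l a b. T l (a + b) = T l a + T l b" "\<And>l a b. T' l (a + b) = T' l a + T' l b"
    and "\<And>l k m. T l (T' k m) = T' k (T l m)"
  shows "contract N T (contract N T' \<omega>) J + contract N T' (contract N T \<omega>) J = 0"
proof -
  have add: "T l (sum g A) = (\<Sum>i\<in>A. T l (g i))" "T' l (sum g A) = (\<Sum>i\<in>A. T' l (g i))" for l g and A :: "nat set"
  proof -
    interpret T: additive "T l" by standard (rule assms)
    interpret T': additive "T' l" by standard (rule assms)
    show "T l (sum g A) = (\<Sum>i\<in>A. T l (g i))" "T' l (sum g A) = (\<Sum>i\<in>A. T' l (g i))"
      by (rule T.sum T'.sum)+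
  qed
  have fin: "finite (N - J)"
    using assms by simp
  let ?P = "\<lambda>T T' l k. ksgn l J (ksgn k (insert l J) (T l (T' k (\<omega> (insert k (insert l J))))))"
  \<comment> \<open>Masking the diagonal gives both iterated sums the same rectangular index set, on
    which the order of summation can be exchanged.\<close>
  have e: "contract N S (contract N S' \<omega>) J = (\<Sum>l\<in>N - J. \<Sum>k\<in>N - J. if k \<noteq> l then ?P S S' l k else 0)"
    if "\<And>l g A. finite A \<Longrightarrow> S l (sum g (A :: nat set)) = (\<Sum>i\<in>A. S l (g i))"
      "\<And>l a b. S l (a + b) = S l a + S l b" for S S'
    unfolding contract_def
  proof (intro sum.cong refl)
    fix l assume "l \<in> N - J"
    have "(\<Sum>k\<in>N - J. if k \<noteq> l then ?P S S' l k else 0) = (\<Sum>k\<in>N - insert l J. ?P S S' l k)"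
      using fin by (intro sum.mono_neutral_cong_right) auto
    also have "\<dots> = ksgn l J (S l (\<Sum>k\<in>N - insert l J. ksgn k (insert l J) (S' k (\<omega> (insert k (insert l J))))))"
      using assms(1) by (subst that(1)) (simp_all add: ksgn_sum additive_ksgn[where T = "S l", OF that(2)])
    finally show "ksgn l J (S l (\<Sum>k\<in>N - insert l J. ksgn k (insert l J) (S' k (\<omega> (insert k (insert l J)))))) =
        (\<Sum>k\<in>N - J. if k \<noteq> l then ?P S S' l k else 0)"
      by simp
  qed
  have e1: "contract N T (contract N T' \<omega>) J = (\<Sum>l\<in>N - J. \<Sum>k\<in>N - J. if k \<noteq> l then ?P T T' l k else 0)"
    by (rule e) (simp_all add: add assms(3))
  have "contract N T' (contract N T \<omega>) J = (\<Sum>l\<in>N - J. \<Sum>k\<in>N - J. if k \<noteq> l then ?P T' T l k else 0)"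
    by (rule e) (simp_all add: add assms(4))
  also have "\<dots> = (\<Sum>k\<in>N - J. \<Sum>l\<in>N - J. if k \<noteq> l then ?P T' T l k else 0)"
    by (rule sum.swap)
  also have "\<dots> = (\<Sum>l\<in>N - J. \<Sum>k\<in>N - J. if k \<noteq> l then - ?P T T' l k else 0)"
  proof (intro sum.cong refl)
    fix k l assume "k \<in> N - J" "l \<in> N - J"
    then show "(if k \<noteq> l then ?P T' T l k else 0) = (if l \<noteq> k then - ?P T T' k l else 0)"
      using ksgn_swap[OF assms(2), of l k "T' l (T k (\<omega> (insert l (insert k J))))"]
      by (simp add: assms(5) insert_commute)
  qed
  finally have e2: "contract N T' (contract N T \<omega>) J =
    (\<Sum>l\<in>N - J. \<Sum>k\<in>N - J. if k \<noteq> l then - ?P T T' l k else 0)" .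
  show ?thesis
    unfolding e1 e2 sum.distrib[symmetric] by (intro sum.neutral ballI) simp
qed

text \<open>An analogue of Cartan's formula: terms with two distinct indices cancel by the sign
  rules, and only those that insert and remove the same index remain.\<close>

lemma contract_wedge:
  assumes "finite N" "J \<subseteq> N"
    and "\<And>l a b. T l (a + b) = T l a + T l b" "\<And>l a b. S l (a + b) = S l a + S l b"
    and "\<And>l k m. T l (S k m) = S k (T l m)"
  shows "contract N T (wedge S \<omega>) J + wedge S (contract N T \<omega>) J = (\<Sum>l\<in>N. T l (S l (\<omega> J)))"
proof -
  have fin: "finite J"
    using assms finite_subset by blast
  have add: "T l (sum g A) = (\<Sum>i\<in>A. T l (g i))" "S l (sum g A) = (\<Sum>i\<in>A. S l (g i))" for l g and A :: "nat set"
  proof -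
    interpret T: additive "T l" by standard (rule assms)
    interpret S: additive "S l" by standard (rule assms)
    show "T l (sum g A) = (\<Sum>i\<in>A. T l (g i))" "S l (sum g A) = (\<Sum>i\<in>A. S l (g i))"
      by (rule T.sum S.sum)+
  qed
  have kT: "T l (ksgn k I m) = ksgn k I (T l m)" and kS: "S l (ksgn k I m) = ksgn k I (S l m)" for l k I m
    using additive_ksgn[where T = "T l"] additive_ksgn[where T = "S l"] assms(3,4) by auto
  let ?Q = "\<lambda>l k. ksgn l J (ksgn k (insert l J - {k}) (T l (S k (\<omega> (insert l J - {k})))))"
  have "contract N T (wedge S \<omega>) J = (\<Sum>l\<in>N - J. T l (S l (\<omega> J)) + (\<Sum>k\<in>J. ?Q l k))"
    unfolding contract_def wedge_def
  proof (intro sum.cong refl)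
    fix l assume "l \<in> N - J"
    then have "insert l J - {l} = J" "l \<notin> J"
      by auto
    then show "ksgn l J (T l (\<Sum>k\<in>insert l J. ksgn k (insert l J - {k}) (S k (\<omega> (insert l J - {k}))))) =
        T l (S l (\<omega> J)) + (\<Sum>k\<in>J. ?Q l k)"
      using fin by (simp add: add kT ksgn_sum ksgn_add assms(3))
  qed
  also have "\<dots> = (\<Sum>l\<in>N - J. T l (S l (\<omega> J))) + (\<Sum>l\<in>N - J. \<Sum>k\<in>J. ?Q l k)"
    by (rule sum.distrib)
  finally have 1: "contract N T (wedge S \<omega>) J = (\<Sum>l\<in>N - J. T l (S l (\<omega> J))) + (\<Sum>l\<in>N - J. \<Sum>k\<in>J. ?Q l k)" .
  let ?R = "\<lambda>k l. ksgn k (J - {k}) (ksgn l (J - {k}) (S k (T l (\<omega> (insert l (J - {k}))))))"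
  have "wedge S (contract N T \<omega>) J = (\<Sum>k\<in>J. S k (T k (\<omega> J)) + (\<Sum>l\<in>N - J. ?R k l))"
    unfolding contract_def wedge_def
  proof (intro sum.cong refl)
    fix k assume k: "k \<in> J"
    then have "N - (J - {k}) = insert k (N - J)" "insert k (J - {k}) = J"
      using assms(2) by auto
    then show "ksgn k (J - {k}) (S k (\<Sum>l\<in>N - (J - {k}). ksgn l (J - {k}) (T l (\<omega> (insert l (J - {k})))))) =
        S k (T k (\<omega> J)) + (\<Sum>l\<in>N - J. ?R k l)"
      using k assms(1) by (simp add: add kS ksgn_sum ksgn_add assms(4))
  qed
  also have "\<dots> = (\<Sum>k\<in>J. T k (S k (\<omega> J))) + (\<Sum>k\<in>J. \<Sum>l\<in>N - J. ?R k l)"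
    by (simp add: sum.distrib assms(5))
  finally have 2: "wedge S (contract N T \<omega>) J = (\<Sum>k\<in>J. T k (S k (\<omega> J))) + (\<Sum>k\<in>J. \<Sum>l\<in>N - J. ?R k l)" .
  have "(\<Sum>k\<in>J. \<Sum>l\<in>N - J. ?R k l) = (\<Sum>l\<in>N - J. \<Sum>k\<in>J. - ?Q l k)"
  proof (subst sum.swap, intro sum.cong refl)
    fix k l assume kl: "l \<in> N - J" "k \<in> J"
    define I where "I = J - {k}"
    have I: "J = insert k I" "k \<notin> I" "l \<notin> I" "l \<noteq> k" "finite I" "insert l J - {k} = insert l I"
      using kl fin by (auto simp: I_def)
    show "?R k l = - ?Q l k"
      unfolding I(6) using ksgn_swap'[OF I(5,3,2,4), of "T l (S k (\<omega> (insert l I)))"] I(1,2,4)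
      by (simp add: assms(5))
  qed
  moreover have "(\<Sum>l\<in>N. T l (S l (\<omega> J))) = (\<Sum>l\<in>N - J. T l (S l (\<omega> J))) + (\<Sum>l\<in>J. T l (S l (\<omega> J)))"
    using assms(1,2) by (simp add: sum.subset_diff)
  ultimately show ?thesis
    unfolding 1 2 by (simp add: sum_negf)
qed

section \<open>Truncated action of polynomials on Laurent functions\<close>

type_synonym lexpo = "(block \<times> nat) \<Rightarrow>\<^sub>0 int"

text \<open>The functions on a convex set \<open>D\<close> of exponents form a subquotient of the Laurent functions;
  a polynomial acts by multiplication followed by truncation to \<open>D\<close>. This covers multiplication of
  polynomials as well as contraction of dual monomials.\<close>

definition act :: "'e::ab_group_add set \<Rightarrow> ('e \<Rightarrow>\<^sub>0 'a::comm_ring_1) \<Rightarrow> ('e \<Rightarrow> 'a) \<Rightarrow> 'e \<Rightarrow> 'a" where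
  "act D p a \<tau> = (if \<tau> \<in> D then \<Sum>\<theta>\<in>Poly_Mapping.keys p.
     Poly_Mapping.lookup p \<theta> * (if \<tau> - \<theta> \<in> D then a (\<tau> - \<theta>) else 0) else 0)"

lemma act_superset:
  assumes "finite A" "Poly_Mapping.keys p \<subseteq> A"
  shows "act D p a \<tau> = (if \<tau> \<in> D then \<Sum>\<theta>\<in>A.
     Poly_Mapping.lookup p \<theta> * (if \<tau> - \<theta> \<in> D then a (\<tau> - \<theta>) else 0) else 0)"
  unfolding act_def using assms
  by (intro if_cong refl sum.mono_neutral_left) (auto simp: in_keys_iff)

lemma act_nonzero:
  assumes "act D p a \<tau> \<noteq> 0"
  shows "\<exists>\<theta>\<in>Poly_Mapping.keys p. \<tau> \<in> D \<and> \<tau> - \<theta> \<in> D \<and> a (\<tau> - \<theta>) \<noteq> 0"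
proof (rule ccontr)
  assume not: "\<not> ?thesis"
  have "Poly_Mapping.lookup p \<theta> * (if \<tau> - \<theta> \<in> D then a (\<tau> - \<theta>) else 0) = 0"
    if h: "\<theta> \<in> Poly_Mapping.keys p" "\<tau> \<in> D" for \<theta>
    using not h by auto
  then have "act D p a \<tau> = 0"
    by (simp add: act_def)
  then show False
    using assms by simp
qed

lemma act_fun_add: "act D p (a + b) = act D p a + act D p b"
  by (rule ext) (auto simp: act_def sum.distrib[symmetric] algebra_simps intro!: sum.cong)

lemma act_add: "act D (p + q) a = act D p a + act D q a"
proof -
  let ?A = "Poly_Mapping.keys p \<union> Poly_Mapping.keys q"
  have "Poly_Mapping.keys (p + q) \<subseteq> ?A"
    by (rule keys_add)
  then show ?thesis
    by (intro ext) (simp add: act_superset[where A = ?A] lookup_add distrib_right sum.distrib)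
qed

lemma act_zero [simp]: "act D 0 a = 0"
  by (rule ext) (simp add: act_def)

lemma act_sum: "act D (\<Sum>i\<in>A. p i) a = (\<Sum>i\<in>A. act D (p i) a)"
  by (induction A rule: infinite_finite_induct) (auto simp: act_add)

lemma act_fun_sum: "act D p (\<Sum>i\<in>A. a i) = (\<Sum>i\<in>A. act D p (a i))"
proof -
  interpret additive "act D p" by standard (rule act_fun_add)
  show ?thesis by (rule sum)
qed

lemma act_fun_zero: "act D p 0 = 0"
  using act_fun_add[of D p 0 0] by simp

lemma act_single:
  "act D (Poly_Mapping.single g c) a \<tau> = (if \<tau> \<in> D \<and> \<tau> - g \<in> D then c * a (\<tau> - g) else 0)"
  by (subst act_superset[where A = "{g}"]) auto

lemma act_one: "act D 1 a \<tau> = (if \<tau> \<in> D then a \<tau> else 0)"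
  unfolding single_one[symmetric] act_single by simp

text \<open>Multiplying in two steps loses a term only if the intermediate exponent leaves
  \<open>D\<close>; convexity along \<open>G\<close> rules this out, so truncation is compatible
  with products.\<close>

definition convex_for :: "'e::ab_group_add set \<Rightarrow> 'e set \<Rightarrow> bool" where
  "convex_for G D \<longleftrightarrow> (\<forall>\<tau> g h. \<tau> \<in> D \<longrightarrow> g \<in> G \<longrightarrow> h \<in> G \<longrightarrow> \<tau> + g + h \<in> D \<longrightarrow> \<tau> + g \<in> D)"

lemma act_mult:
  assumes "convex_for G D" "Poly_Mapping.keys p \<subseteq> G" "Poly_Mapping.keys q \<subseteq> G"
  shows "act D (p * q) a = act D p (act D q a)"
proof -
  let ?s = "\<lambda>p k. Poly_Mapping.single k (Poly_Mapping.lookup p k)"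
  have s: "act D (?s p k * ?s q k') a = act D (?s p k) (act D (?s q k') a)"
    if "k \<in> Poly_Mapping.keys p" "k' \<in> Poly_Mapping.keys q" for k k'
  proof
    fix \<tau>
    have e: "\<tau> - (k + k') + k' = \<tau> - k" "\<tau> - (k + k') + k' + k = \<tau>"
      by simp_all
    have "\<tau> - k \<in> D" if "\<tau> - (k + k') \<in> D" "\<tau> \<in> D"
      using assms that \<open>k \<in> Poly_Mapping.keys p\<close> \<open>k' \<in> Poly_Mapping.keys q\<close>
      unfolding convex_for_def by (metis (no_types, lifting) e subsetD)
    then show "act D (?s p k * ?s q k') a \<tau> = act D (?s p k) (act D (?s q k') a) \<tau>"
      by (auto simp: mult_single act_single algebra_simps diff_diff_eq)
  qed
  have "act D (p * q) a = act D ((\<Sum>k\<in>Poly_Mapping.keys p. ?s p k) * (\<Sum>k'\<in>Poly_Mapping.keys q. ?s q k')) a"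
    by (simp flip: poly_mapping_sum_singles)
  also have "\<dots> = (\<Sum>k\<in>Poly_Mapping.keys p. \<Sum>k'\<in>Poly_Mapping.keys q. act D (?s p k) (act D (?s q k') a))"
    unfolding sum_product act_sum by (intro sum.cong refl s)
  also have "\<dots> = act D (\<Sum>k\<in>Poly_Mapping.keys p. ?s p k) (act D (\<Sum>k'\<in>Poly_Mapping.keys q. ?s q k') a)"
    unfolding act_sum act_fun_sum by (rule sum.swap)
  finally show ?thesis
    by (simp flip: poly_mapping_sum_singles)
qed

lemma sum_fun_apply: "(\<Sum>i\<in>A. f i) x = (\<Sum>i\<in>A. f i x)"
  by (induction A rule: infinite_finite_induct) auto

section \<open>Multidegrees and short exact sequences of supports\<close>

definition nonneg :: "('v \<Rightarrow>\<^sub>0 int) set" where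
  "nonneg = {e. \<forall>v. Poly_Mapping.lookup e v \<ge> 0}"

definition bdeg :: "block \<Rightarrow> lexpo \<Rightarrow> int" where
  "bdeg b e = (\<Sum>v\<in>Poly_Mapping.keys e. if fst v = b then Poly_Mapping.lookup e v else 0)"

lemma bdeg_superset:
  assumes "finite A" "Poly_Mapping.keys e \<subseteq> A"
  shows "bdeg b e = (\<Sum>v\<in>A. if fst v = b then Poly_Mapping.lookup e v else 0)"
  unfolding bdeg_def using assms
  by (intro sum.mono_neutral_left) (auto simp: in_keys_iff)

lemma bdeg_add: "bdeg b (e + e') = bdeg b e + bdeg b e'"
proof -
  let ?A = "Poly_Mapping.keys e \<union> Poly_Mapping.keys e'"
  have "Poly_Mapping.keys (e + e') \<subseteq> ?A"
    by (rule keys_add)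
  then show ?thesis
    by (simp add: bdeg_superset[where A = ?A] lookup_add sum.distrib[symmetric] if_distrib cong: if_cong)
qed

lemma bdeg_diff: "bdeg b (e - e') = bdeg b e - bdeg b e'"
  using bdeg_add[of b "e - e'" e'] by simp

lemma bdeg_single: "bdeg b (Poly_Mapping.single v k) = (if fst v = b then k else 0)"
  by (subst bdeg_superset[where A = "{v}"]) auto

text \<open>An up-closed part \<open>D'\<close> of \<open>D\<close> gives a short exact sequence
  \<open>0 \<rightarrow> M(D') \<rightarrow> M(D) \<rightarrow> M(D'') \<rightarrow> 0\<close> of the modules of functions supported in these sets.\<close>

definition short_exact :: "('v \<Rightarrow>\<^sub>0 int) set \<Rightarrow> ('v \<Rightarrow>\<^sub>0 int) set \<Rightarrow> ('v \<Rightarrow>\<^sub>0 int) set \<Rightarrow> bool" where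
  "short_exact D' D D'' \<longleftrightarrow> D = D' \<union> D'' \<and> D' \<inter> D'' = {} \<and>
     (\<forall>\<tau> g. \<tau> \<in> D' \<longrightarrow> g \<in> nonneg \<longrightarrow> \<tau> + g \<in> D \<longrightarrow> \<tau> + g \<in> D')"

definition restrict_to :: "'e set \<Rightarrow> ('i \<Rightarrow> 'e \<Rightarrow> 'a) \<Rightarrow> 'i \<Rightarrow> 'e \<Rightarrow> 'a::zero" where
  "restrict_to D \<omega> I \<tau> = (if \<tau> \<in> D then \<omega> I \<tau> else 0)"

text \<open>Exponents only grow under multiplication and \<open>D'\<close> is closed upwards, so
  nothing supported on \<open>D'\<close> contributes to values on \<open>D''\<close>: restriction to
  \<open>D''\<close> is the quotient map.\<close>

lemma act_restrict:
  assumes "short_exact D' D D''" "Poly_Mapping.keys p \<subseteq> nonneg"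
  shows "act D'' p (restrict_to D'' \<omega> I) \<tau> = (if \<tau> \<in> D'' then act D p (\<omega> I) \<tau> else 0)"
proof (cases "\<tau> \<in> D''")
  case True
  have "(if \<tau> - \<theta> \<in> D'' then restrict_to D'' \<omega> I (\<tau> - \<theta>) else 0) = (if \<tau> - \<theta> \<in> D then \<omega> I (\<tau> - \<theta>) else 0)"
    if "\<theta> \<in> Poly_Mapping.keys p" for \<theta>
  proof -
    have "\<tau> - \<theta> \<notin> D'"
    proof
      assume "\<tau> - \<theta> \<in> D'"
      moreover have "\<theta> \<in> nonneg" "\<tau> - \<theta> + \<theta> \<in> D"
        using that assms True by (auto simp: short_exact_def)
      ultimately have "\<tau> - \<theta> + \<theta> \<in> D'"
        using assms(1) unfolding short_exact_def by blast
      then show False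
        using True assms(1) by (auto simp: short_exact_def)
    qed
    then show ?thesis
      using assms(1) by (auto simp: short_exact_def restrict_to_def)
  qed
  then show ?thesis
    using True assms(1) by (auto simp: act_def short_exact_def)
qed (simp add: act_def)

text \<open>For the same reason functions supported on \<open>D'\<close> stay there, so that they
  form a submodule.\<close>

lemma act_sub:
  assumes "short_exact D' D D''" "Poly_Mapping.keys p \<subseteq> nonneg" "\<And>\<tau>. a \<tau> \<noteq> 0 \<Longrightarrow> \<tau> \<in> D'"
  shows "act D p a = act D' p a"
proof
  fix \<tau>
  have *: "\<tau> \<in> D'" if "\<tau> \<in> D" "\<tau> - \<theta> \<in> D'" "\<theta> \<in> Poly_Mapping.keys p" for \<theta>
  proof -
    have "\<theta> \<in> nonneg" "\<tau> - \<theta> + \<theta> \<in> D"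
      using that assms by auto
    then have "\<tau> - \<theta> + \<theta> \<in> D'"
      using assms(1) that unfolding short_exact_def by blast
    then show ?thesis by simp
  qed
  have e: "(if \<tau> - \<theta> \<in> D then a (\<tau> - \<theta>) else 0) = (if \<tau> - \<theta> \<in> D' then a (\<tau> - \<theta>) else 0)" for \<theta>
    using assms(1,3) by (auto simp: short_exact_def)
  show "act D p a \<tau> = act D' p a \<tau>"
  proof (cases "\<tau> \<in> D'")
    case True
    then have "\<tau> \<in> D"
      using assms(1) by (simp add: short_exact_def)
    then show ?thesis
      using True by (simp add: act_def e)
  next
    case False
    then have "(if \<tau> - \<theta> \<in> D' then a (\<tau> - \<theta>) else 0) = 0"
      if "\<tau> \<in> D" "\<theta> \<in> Poly_Mapping.keys p" for \<theta>
      using *[of \<theta>] that by auto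
    then show ?thesis
      using False by (simp add: act_def e)
  qed
qed

section \<open>The graded Koszul complex over a support set\<close>

locale koszul =
  fixes N :: "nat set" and F :: "nat \<Rightarrow> lexpo \<Rightarrow>\<^sub>0 'a::field_char_0"
    and dg :: "block \<Rightarrow> nat \<Rightarrow> int" and m :: "block \<Rightarrow> int"
  assumes finN: "finite N"
    and F_nonneg: "l \<in> N \<Longrightarrow> Poly_Mapping.keys (F l) \<subseteq> nonneg"
    and F_deg: "l \<in> N \<Longrightarrow> \<theta> \<in> Poly_Mapping.keys (F l) \<Longrightarrow> bdeg b \<theta> = dg b l"
begin

definition Fop :: "lexpo set \<Rightarrow> nat \<Rightarrow> (lexpo \<Rightarrow> 'a) \<Rightarrow> lexpo \<Rightarrow> 'a" where
  "Fop D l = act D (if l \<in> N then F l else 0)"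

lemma Fop_add: "Fop D l (a + b) = Fop D l a + Fop D l b"
  by (simp add: Fop_def act_fun_add)

text \<open>One multidegree strand of the complex; subtracting the degrees of the wedge factors
  makes the differential preserve \<open>m\<close>. Exterior degree, support and multidegree sit in
  one predicate, so that incompatible bounds make a chain group zero.\<close>

definition chain :: "int \<Rightarrow> lexpo set \<Rightarrow> (nat set \<Rightarrow> lexpo \<Rightarrow> 'a) \<Rightarrow> bool" where
  "chain p D \<omega> \<longleftrightarrow> (\<forall>I \<tau>. \<omega> I \<tau> \<noteq> 0 \<longrightarrow> I \<subseteq> N \<and> int (card I) = p \<and> \<tau> \<in> D \<and>
     (\<forall>b. bdeg b \<tau> = m b - (\<Sum>i\<in>I. dg b i)))"

lemma chain_outside: "chain p D \<omega> \<Longrightarrow> \<tau> \<notin> D \<Longrightarrow> \<omega> I \<tau> = 0"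
  by (auto simp: chain_def)

abbreviation bd :: "lexpo set \<Rightarrow> (nat set \<Rightarrow> lexpo \<Rightarrow> 'a) \<Rightarrow> nat set \<Rightarrow> lexpo \<Rightarrow> 'a" where
  "bd D \<equiv> contract N (Fop D)"

definition exact_at :: "lexpo set \<Rightarrow> int \<Rightarrow> bool" where
  "exact_at D p \<longleftrightarrow> (\<forall>\<omega>. chain p D \<omega> \<longrightarrow> bd D \<omega> = 0 \<longrightarrow> (\<exists>\<eta>. chain (p + 1) D \<eta> \<and> bd D \<eta> = \<omega>))"

lemma ksgn_fun: "ksgn l J (a :: lexpo \<Rightarrow> 'a) \<tau> = ksgn l J (a \<tau>)"
  by (auto simp: ksgn_def)

lemma bd_nonzero:
  assumes "bd D \<omega> J \<tau> \<noteq> 0"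
  obtains l \<theta> where "l \<in> N" "l \<notin> J" "\<theta> \<in> Poly_Mapping.keys (F l)" "\<tau> \<in> D" "\<tau> - \<theta> \<in> D"
    "\<omega> (insert l J) (\<tau> - \<theta>) \<noteq> 0"
proof -
  have "\<exists>l\<in>N - J. ksgn l J (Fop D l (\<omega> (insert l J)) \<tau>) \<noteq> 0"
  proof (rule ccontr)
    assume "\<not> ?thesis"
    then have "bd D \<omega> J \<tau> = 0"
      unfolding contract_def sum_fun_apply ksgn_fun by (intro sum.neutral) blast
    then show False
      using assms by simp
  qed
  then obtain l where lNJ: "l \<in> N - J" and nz: "ksgn l J (Fop D l (\<omega> (insert l J)) \<tau>) \<noteq> 0"
    by (rule bexE)
  have l: "l \<in> N" "l \<notin> J"
    using lNJ by blast+
  have l3: "act D (F l) (\<omega> (insert l J)) \<tau> \<noteq> 0"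
    using nz l(1) unfolding Fop_def ksgn_eq_0_iff by simp
  then show ?thesis
    using that[of l] act_nonzero[OF l3] l by blast
qed

lemma chain_bd:
  assumes "chain p D \<omega>"
  shows "chain (p - 1) D (bd D \<omega>)"
  unfolding chain_def
proof (intro allI impI)
  fix J \<tau> assume "bd D \<omega> J \<tau> \<noteq> 0"
  then obtain l \<theta> where l: "l \<in> N" "l \<notin> J" "\<theta> \<in> Poly_Mapping.keys (F l)" "\<tau> \<in> D"
    "\<omega> (insert l J) (\<tau> - \<theta>) \<noteq> 0"
    by (rule bd_nonzero)
  have c: "insert l J \<subseteq> N" "int (card (insert l J)) = p"
    "\<And>b. bdeg b (\<tau> - \<theta>) = m b - (\<Sum>i\<in>insert l J. dg b i)"
    using assms l(5) unfolding chain_def by blast+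
  have fin: "finite J"
    using finite_subset[OF c(1) finN] by simp
  have "bdeg b \<tau> = m b - (\<Sum>i\<in>J. dg b i)" for b
    using c(3)[of b] fin l(2) F_deg[OF l(1,3)] by (simp add: bdeg_diff)
  then show "J \<subseteq> N \<and> int (card J) = p - 1 \<and> \<tau> \<in> D \<and> (\<forall>b. bdeg b \<tau> = m b - (\<Sum>i\<in>J. dg b i))"
    using c(1,2) fin l(2,4) by simp
qed

lemma chain_diff: "chain p D \<omega> \<Longrightarrow> chain p D \<omega>' \<Longrightarrow> chain p D (\<omega> - \<omega>')"
  unfolding chain_def by (metis diff_0_right minus_apply diff_0 neg_equal_0_iff_equal)

lemma chain_mono: "chain p D \<omega> \<Longrightarrow> D \<subseteq> D' \<Longrightarrow> chain p D' \<omega>"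
  by (auto simp: chain_def)

lemma chain_restrict: "chain p D \<omega> \<Longrightarrow> chain p D' (restrict_to D' \<omega>)"
  by (auto simp: chain_def restrict_to_def)

lemma bd_add: "bd D (\<omega> + \<omega>') = bd D \<omega> + bd D \<omega>'"
  by (rule ext) (simp add: contract_def Fop_add ksgn_add sum.distrib)

lemma bd_diff: "bd D (\<omega> - \<omega>') = bd D \<omega> - bd D \<omega>'"
  using bd_add[of D "\<omega> - \<omega>'" \<omega>'] by (simp add: algebra_simps)

lemma bd_restrict:
  assumes "short_exact D' D D''"
  shows "bd D'' (restrict_to D'' \<omega>) = restrict_to D'' (bd D \<omega>)"
proof (intro ext)
  fix J \<tau>
  show "bd D'' (restrict_to D'' \<omega>) J \<tau> = restrict_to D'' (bd D \<omega>) J \<tau>"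
  proof (cases "\<tau> \<in> D''")
    case True
    then have "restrict_to D'' (bd D \<omega>) J \<tau> = bd D \<omega> J \<tau>"
      by (simp add: restrict_to_def)
    also have "\<dots> = bd D'' (restrict_to D'' \<omega>) J \<tau>"
      unfolding contract_def sum_fun_apply ksgn_fun Fop_def
      using F_nonneg True by (auto simp: act_restrict[OF assms] intro!: sum.cong)
    finally show ?thesis by simp
  next
    case False
    then show ?thesis
      unfolding restrict_to_def[of D'' "bd D \<omega>"] unfolding contract_def sum_fun_apply ksgn_fun Fop_def
      by (simp add: act_def)
  qed
qed

lemma bd_sub:
  assumes "short_exact D' D D''" "chain p D' \<omega>"
  shows "bd D \<omega> = bd D' \<omega>"
proof
  fix J
  show "bd D \<omega> J = bd D' \<omega> J"
    unfolding contract_def Fop_def using F_nonneg assms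
    by (intro sum.cong refl arg_cong[where f = "ksgn _ _"] act_sub) (auto simp: chain_def)
qed

lemma Fop_commute:
  assumes "convex_for nonneg D"
  shows "Fop D l (Fop D k a) = Fop D k (Fop D l a)"
  unfolding Fop_def using F_nonneg
  by (subst (1 2) act_mult[OF assms, symmetric]) (auto simp: mult.commute)

text \<open>Anticommutativity of the differential with itself says that twice its square is zero,
  and the characteristic is 0.\<close>

lemma bd_bd:
  assumes "convex_for nonneg D" "chain p D \<omega>"
  shows "bd D (bd D \<omega>) = 0"
proof (intro ext)
  fix J \<tau>
  show "bd D (bd D \<omega>) J \<tau> = 0 J \<tau>"
  proof (cases "finite J")
    case True
    have "bd D (bd D \<omega>) J + bd D (bd D \<omega>) J = 0"
      using contract_anticommute[where T = "Fop D" and T' = "Fop D", OF finN True]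
      by (simp add: Fop_add Fop_commute[OF assms(1)])
    then have "2 * bd D (bd D \<omega>) J \<tau> = 0"
      unfolding mult_2 by (rule fun_cong[of "_ + _" 0, simplified])
    then show ?thesis
      by simp
  next
    case False
    then have "\<not> J \<subseteq> N"
      using finN finite_subset by blast
    moreover have "chain (p - 1 - 1) D (bd D (bd D \<omega>))"
      by (intro chain_bd assms)
    ultimately show ?thesis
      by (auto simp: chain_def)
  qed
qed

text \<open>The piece H_{p+1}(D'') -> H_p(D') -> H_p(D) of the long exact sequence: a cycle on
  \<open>D'\<close> bounds on \<open>D\<close>, and the bounding chain is corrected by a boundary
  until it vanishes on \<open>D''\<close>.\<close>

lemma exact_sub:
  assumes ses: "short_exact D' D D''" and conv: "convex_for nonneg D"
    and ex: "exact_at D'' (p + 1)" "exact_at D p"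
  shows "exact_at D' p"
  unfolding exact_at_def
proof (intro allI impI)
  fix \<omega> assume \<omega>: "chain p D' \<omega>" "bd D' \<omega> = 0"
  have DD: "D' \<subseteq> D" "D'' \<subseteq> D"
    using ses by (auto simp: short_exact_def)
  have "bd D \<omega> = 0"
    using bd_sub[OF ses \<omega>(1)] \<omega>(2) by simp
  then obtain \<zeta> where \<zeta>: "chain (p + 1) D \<zeta>" "bd D \<zeta> = \<omega>"
    using ex(2) chain_mono[OF \<omega>(1) DD(1)] by (auto simp: exact_at_def)
  have "restrict_to D'' \<omega> = 0"
    using chain_outside[OF \<omega>(1)] ses by (intro ext) (auto simp: restrict_to_def short_exact_def)
  then have "bd D'' (restrict_to D'' \<zeta>) = 0"
    using bd_restrict[OF ses] \<zeta>(2) by simp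
  then obtain \<xi> where \<xi>: "chain (p + 1 + 1) D'' \<xi>" "bd D'' \<xi> = restrict_to D'' \<zeta>"
    using ex(1) chain_restrict[OF \<zeta>(1)] by (auto simp: exact_at_def)
  have \<xi>D: "chain (p + 1 + 1) D \<xi>"
    using chain_mono[OF \<xi>(1) DD(2)] .
  have "restrict_to D'' \<xi> = \<xi>"
    using chain_outside[OF \<xi>(1)] by (intro ext) (auto simp: restrict_to_def)
  then have r: "restrict_to D'' (bd D \<xi>) = restrict_to D'' \<zeta>"
    using bd_restrict[OF ses, of \<xi>] \<xi>(2) by simp
  define \<eta> where "\<eta> = \<zeta> - bd D \<xi>"
  have "chain (p + 1) D \<eta>"
    unfolding \<eta>_def using chain_bd[OF \<xi>D] by (intro chain_diff \<zeta>(1)) (simp add: add.commute)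
  moreover have "\<eta> I \<tau> = 0" if "\<tau> \<in> D''" for I \<tau>
    using fun_cong[OF fun_cong[OF r, of I], of \<tau>] that by (simp add: \<eta>_def restrict_to_def)
  ultimately have \<eta>: "chain (p + 1) D' \<eta>"
    using ses unfolding chain_def short_exact_def by blast
  have "bd D' \<eta> = \<omega>"
    using bd_sub[OF ses \<eta>] bd_bd[OF conv \<xi>D] \<zeta>(2) by (simp add: \<eta>_def bd_diff)
  then show "\<exists>\<eta>. chain (p + 1) D' \<eta> \<and> bd D' \<eta> = \<omega>"
    using \<eta> by blast
qed

text \<open>The piece H_p(D) -> H_p(D'') -> H_{p-1}(D'): extended by zero, a cycle on
  \<open>D''\<close> has its boundary in \<open>D'\<close>; subtracting a chain on \<open>D'\<close>
  with the same boundary makes it a cycle on \<open>D\<close>.\<close>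

lemma exact_quotient:
  assumes ses: "short_exact D' D D''" and conv: "convex_for nonneg D"
    and ex: "exact_at D p" "exact_at D' (p - 1)"
  shows "exact_at D'' p"
  unfolding exact_at_def
proof (intro allI impI)
  fix \<omega> assume \<omega>: "chain p D'' \<omega>" "bd D'' \<omega> = 0"
  have DD: "D' \<subseteq> D" "D'' \<subseteq> D"
    using ses by (auto simp: short_exact_def)
  have \<omega>D: "chain p D \<omega>"
    using chain_mono[OF \<omega>(1) DD(2)] .
  have r\<omega>: "restrict_to D'' \<omega> = \<omega>"
    using chain_outside[OF \<omega>(1)] by (intro ext) (auto simp: restrict_to_def)
  have "restrict_to D'' (bd D \<omega>) = 0"
    using bd_restrict[OF ses, of \<omega>] r\<omega> \<omega>(2) by simp
  then have "bd D \<omega> I \<tau> = 0" if "\<tau> \<in> D''" for I \<tau>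
    using that by (metis restrict_to_def zero_fun_apply)
  then have c: "chain (p - 1) D' (bd D \<omega>)"
    using chain_bd[OF \<omega>D] ses unfolding chain_def short_exact_def by blast
  have "bd D' (bd D \<omega>) = 0"
    using bd_sub[OF ses c] bd_bd[OF conv \<omega>D] by simp
  then obtain \<eta> where \<eta>: "chain p D' \<eta>" "bd D' \<eta> = bd D \<omega>"
    using ex(2) c by (auto simp: exact_at_def)
  have "bd D (\<omega> - \<eta>) = 0"
    using bd_sub[OF ses \<eta>(1)] \<eta>(2) by (simp add: bd_diff)
  moreover have "chain p D (\<omega> - \<eta>)"
    using chain_diff[OF \<omega>D chain_mono[OF \<eta>(1) DD(1)]] .
  ultimately obtain \<zeta> where \<zeta>: "chain (p + 1) D \<zeta>" "bd D \<zeta> = \<omega> - \<eta>"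
    using ex(1) by (auto simp: exact_at_def)
  have "restrict_to D'' (\<omega> - \<eta>) = \<omega>"
  proof (intro ext)
    fix I \<tau>
    have "\<eta> I \<tau> = 0" if "\<tau> \<in> D''"
      using \<eta>(1) ses that unfolding chain_def short_exact_def by blast
    then show "restrict_to D'' (\<omega> - \<eta>) I \<tau> = \<omega> I \<tau>"
      using fun_cong[OF fun_cong[OF r\<omega>, of I], of \<tau>] by (auto simp: restrict_to_def)
  qed
  then have "bd D'' (restrict_to D'' \<zeta>) = \<omega>"
    using bd_restrict[OF ses, of \<zeta>] \<zeta>(2) by simp
  then show "\<exists>\<eta>. chain (p + 1) D'' \<eta> \<and> bd D'' \<eta> = \<omega>"
    using chain_restrict[OF \<zeta>(1)] by blast
qed

lemma exact_trivial:
  assumes "\<And>\<omega>. chain p D \<omega> \<Longrightarrow> \<omega> = 0"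
  shows "exact_at D p"
  unfolding exact_at_def
proof (intro allI impI)
  fix \<omega> assume "chain p D \<omega>"
  then have "\<omega> = 0" by (rule assms)
  have "bd D 0 = 0"
    using bd_diff[of D 0 0] by simp
  then show "\<exists>\<eta>. chain (p + 1) D \<eta> \<and> bd D \<eta> = \<omega>"
    using \<open>\<omega> = 0\<close> by (intro exI[of _ 0]) (auto simp: chain_def)
qed

text \<open>Each variable made negative contributes one connecting homomorphism and raises the
  homological degree by one, whence the shift by \<open>n\<close>.\<close>

lemma exact_chain_up:
  assumes "\<And>k. k < n \<Longrightarrow> short_exact (Neg k) (Free k) (Neg (Suc k))"
    and "\<And>k. k < n \<Longrightarrow> convex_for nonneg (Free k)"
    and "\<And>k p. k < n \<Longrightarrow> exact_at (Free k) p"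
    and "exact_at (Neg 0) p"
  shows "exact_at (Neg n) (p + int n)"
proof -
  have "exact_at (Neg k) (p + int k)" if "k \<le> n" for k
    using that
  proof (induction k)
    case (Suc k)
    then show ?case
      using exact_quotient[OF assms(1,2,3), of k "p + int (Suc k)"] by simp
  qed (use assms(4) in simp)
  then show ?thesis by simp
qed

text \<open>Run backwards, each sequence uses the quotient one degree higher, so exactness at the
  end is assumed in every degree.\<close>

lemma exact_chain_down:
  assumes "\<And>k. k < n \<Longrightarrow> short_exact (Neg k) (Free k) (Neg (Suc k))"
    and "\<And>k. k < n \<Longrightarrow> convex_for nonneg (Free k)"
    and "\<And>k p. k < n \<Longrightarrow> exact_at (Free k) p"
    and "\<And>p. exact_at (Neg n) p"
  shows "exact_at (Neg 0) p"
proof -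
  have "\<forall>p. exact_at (Neg k) p" if "k \<le> n" for k
    using that
  proof (induction rule: inc_induct)
    case (step k)
    then show ?case
      using exact_sub[OF assms(1,2) _ assms(3), of k] by simp
  qed (use assms(4) in simp)
  then show ?thesis by simp
qed

text \<open>If the \<open>F l\<close> generate the unit ideal of a ring acting on the module, multiplication by the
  coefficients of a partition of unity is a contracting homotopy of the Koszul complex.\<close>

lemma exact_unit_ideal:
  assumes conv: "convex_for G D" and G: "nonneg \<subseteq> G"
    and unit: "(\<Sum>l\<in>N. F l * a l) = 1"
    and keys: "\<And>l. l \<in> N \<Longrightarrow> Poly_Mapping.keys (a l) \<subseteq> G"
    and deg: "\<And>l \<theta> b. l \<in> N \<Longrightarrow> \<theta> \<in> Poly_Mapping.keys (a l) \<Longrightarrow> bdeg b \<theta> = - dg b l"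
  shows "exact_at D p"
  unfolding exact_at_def
proof (intro allI impI)
  fix \<omega> assume \<omega>: "chain p D \<omega>" "bd D \<omega> = 0"
  define S where "S l = act D (if l \<in> N then a l else 0)" for l
  have FG: "Poly_Mapping.keys (if l \<in> N then F l else 0) \<subseteq> G" for l
    using F_nonneg[of l] G by auto
  have aG: "Poly_Mapping.keys (if l \<in> N then a l else 0) \<subseteq> G" for l
    using keys[of l] by auto
  have comm: "Fop D l (S k x) = S k (Fop D l x)" for l k x
    unfolding S_def Fop_def
    by (subst (1 2) act_mult[OF conv, symmetric]) (use FG aG in \<open>auto simp: mult.commute\<close>)
  define \<eta> where "\<eta> J = (if J \<subseteq> N then wedge S \<omega> J else 0)" for J
  have \<eta>: "chain (p + 1) D \<eta>"
    unfolding chain_def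
  proof (intro allI impI)
    fix I \<tau> assume nz: "\<eta> I \<tau> \<noteq> 0"
    then have I: "I \<subseteq> N" and "(\<Sum>l\<in>I. ksgn l (I - {l}) (S l (\<omega> (I - {l})) \<tau>)) \<noteq> 0"
      by (auto simp: \<eta>_def wedge_def sum_fun_apply ksgn_fun split: if_splits)
    then obtain l where l: "l \<in> I" "S l (\<omega> (I - {l})) \<tau> \<noteq> 0"
      by (metis (no_types, lifting) ksgn_zero sum.neutral)
    have lN: "l \<in> N"
      using l I by auto
    have nz2: "act D (a l) (\<omega> (I - {l})) \<tau> \<noteq> 0"
      using l(2) lN by (simp add: S_def)
    obtain \<theta> where \<theta>: "\<theta> \<in> Poly_Mapping.keys (a l)" and \<tau>: "\<tau> \<in> D"
      and "\<omega> (I - {l}) (\<tau> - \<theta>) \<noteq> 0"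
      using act_nonzero[OF nz2] by blast
    then have c: "int (card (I - {l})) = p" "\<And>b. bdeg b (\<tau> - \<theta>) = m b - (\<Sum>i\<in>I - {l}. dg b i)"
      using \<omega>(1) unfolding chain_def by blast+
    have fin: "finite I"
      using I finN finite_subset by blast
    have "bdeg b \<tau> = m b - (\<Sum>i\<in>I. dg b i)" for b
      using c(2)[of b] deg[OF lN \<theta>, of b] sum.remove[OF fin l(1), of "dg b"] by (simp add: bdeg_diff)
    moreover have "int (card I) = p + 1"
      using c(1) card.remove[OF fin l(1)] by simp
    ultimately show "I \<subseteq> N \<and> int (card I) = p + 1 \<and> \<tau> \<in> D \<and> (\<forall>b. bdeg b \<tau> = m b - (\<Sum>i\<in>I. dg b i))"
      using I \<tau> by simp
  qed
  have "bd D \<eta> J = \<omega> J" for J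
  proof (cases "J \<subseteq> N")
    case True
    have "bd D \<eta> J = bd D (wedge S \<omega>) J"
      unfolding contract_def \<eta>_def using True by (intro sum.cong refl) auto
    \<comment> \<open>The added term is zero because \<open>\<omega>\<close> is a cycle; it
      completes the left-hand side of \<open>contract_wedge\<close>.\<close>
    also have "\<dots> = bd D (wedge S \<omega>) J + wedge S (bd D \<omega>) J"
    proof -
      have "S l 0 = 0" for l
        unfolding S_def by (rule act_fun_zero)
      then show ?thesis
        by (simp add: wedge_def \<omega>(2))
    qed
    also have "\<dots> = (\<Sum>l\<in>N. Fop D l (S l (\<omega> J)))"
    proof (rule contract_wedge[where T = "Fop D" and S = S])
      show "S l (x + y) = S l x + S l y" for l x y
        by (simp add: S_def act_fun_add)
    qed (fact finN True Fop_add comm)+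
    also have "\<dots> = (\<Sum>l\<in>N. act D (F l * a l) (\<omega> J))"
    proof (intro sum.cong refl)
      fix l assume l: "l \<in> N"
      have "Poly_Mapping.keys (F l) \<subseteq> G"
        using F_nonneg[OF l] G by blast
      then show "Fop D l (S l (\<omega> J)) = act D (F l * a l) (\<omega> J)"
        using l by (simp add: act_mult[OF conv _ keys[OF l]] Fop_def S_def)
    qed
    also have "\<dots> = act D 1 (\<omega> J)"
      by (simp flip: unit act_sum)
    also have "\<dots> = \<omega> J"
      using chain_outside[OF \<omega>(1)] by (intro ext) (auto simp: act_one)
    finally show ?thesis .
  next
    case False
    have "bd D \<eta> J \<tau> = 0" for \<tau>
      using chain_bd[OF \<eta>] False unfolding chain_def by blast
    moreover have "\<omega> J \<tau> = 0" for \<tau>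
      using \<omega>(1) False unfolding chain_def by blast
    ultimately show ?thesis by (intro ext) simp
  qed
  then show "\<exists>\<eta>. chain (p + 1) D \<eta> \<and> bd D \<eta> = \<omega>"
    using \<eta> by blast
qed

end

section \<open>Changing the signs of the exponents\<close>

text \<open>The modules met while the variables \<open>vs\<close> are treated one by one: \<open>vs ! i\<close> has negative exponents
  for \<open>i < k\<close> and nonnegative ones otherwise, except that \<open>vs ! k\<close> is inverted if \<open>free\<close> holds.\<close>

definition blk :: "'v list \<Rightarrow> nat \<Rightarrow> bool \<Rightarrow> ('v \<Rightarrow>\<^sub>0 int) \<Rightarrow> bool" where
  "blk vs k free \<tau> \<longleftrightarrow> (\<forall>i<length vs.
     if i < k then Poly_Mapping.lookup \<tau> (vs ! i) < 0
     else free \<and> i = k \<or> Poly_Mapping.lookup \<tau> (vs ! i) \<ge> 0)"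

text \<open>The sign dichotomy for the one inverted variable is what splits the localized module
  into submodule and quotient.\<close>

lemma blk_free_iff:
  assumes "k < length vs"
  shows "blk vs k True \<tau> \<longleftrightarrow> blk vs k False \<tau> \<or> blk vs (Suc k) False \<tau>"
    and "\<not> (blk vs k False \<tau> \<and> blk vs (Suc k) False \<tau>)"
proof -
  show "\<not> (blk vs k False \<tau> \<and> blk vs (Suc k) False \<tau>)"
    using assms unfolding blk_def by (metis lessI less_irrefl not_less)
  show "blk vs k True \<tau> \<longleftrightarrow> blk vs k False \<tau> \<or> blk vs (Suc k) False \<tau>"
  proof
    assume *: "blk vs k True \<tau>"
    show "blk vs k False \<tau> \<or> blk vs (Suc k) False \<tau>"
    proof (cases "Poly_Mapping.lookup \<tau> (vs ! k) \<ge> 0")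
      case True
      then have "blk vs k False \<tau>"
        using * unfolding blk_def by auto
      then show ?thesis ..
    next
      case False
      have "blk vs (Suc k) False \<tau>"
        unfolding blk_def
      proof (intro allI impI)
        fix i assume "i < length vs"
        then show "if i < Suc k then Poly_Mapping.lookup \<tau> (vs ! i) < 0
          else False \<and> i = Suc k \<or> 0 \<le> Poly_Mapping.lookup \<tau> (vs ! i)"
          using * False unfolding blk_def by (cases "i = k") (auto split: if_splits)
      qed
      then show ?thesis ..
    qed
  next
    assume *: "blk vs k False \<tau> \<or> blk vs (Suc k) False \<tau>"
    show "blk vs k True \<tau>"
      unfolding blk_def
    proof (intro allI impI)
      fix i assume "i < length vs"
      then show "if i < k then Poly_Mapping.lookup \<tau> (vs ! i) < 0
          else True \<and> i = k \<or> 0 \<le> Poly_Mapping.lookup \<tau> (vs ! i)"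
        using * unfolding blk_def by (cases "i = k") (auto split: if_splits)
    qed
  qed
qed

text \<open>For each block, a pair tells how many variables are already negative and whether the
  next one is inverted. Variables outside the three lists get exponent 0, so that supports only see
  the variables in play.\<close>

definition region :: "'v list \<Rightarrow> 'v list \<Rightarrow> 'v list \<Rightarrow> nat \<times> bool \<Rightarrow> nat \<times> bool \<Rightarrow> nat \<times> bool
    \<Rightarrow> ('v \<Rightarrow>\<^sub>0 int) set" where
  "region xs ys zs P Q R = {\<tau>. blk xs (fst P) (snd P) \<tau> \<and> blk ys (fst Q) (snd Q) \<tau> \<and>
     blk zs (fst R) (snd R) \<tau> \<and>
     (\<forall>v. v \<notin> set xs \<union> set ys \<union> set zs \<longrightarrow> Poly_Mapping.lookup \<tau> v = 0)}"

definition free_var :: "'v list \<Rightarrow> nat \<times> bool \<Rightarrow> 'v set" where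
  "free_var vs P = (if snd P \<and> fst P < length vs then {vs ! fst P} else {})"

definition nonneg_except :: "'v set \<Rightarrow> ('v \<Rightarrow>\<^sub>0 int) set" where
  "nonneg_except V = {e. \<forall>v. v \<notin> V \<longrightarrow> Poly_Mapping.lookup e v \<ge> 0}"

lemma blk_convex:
  assumes "distinct vs" "free_var vs P \<inter> set vs = V \<inter> set vs" "g \<in> nonneg_except V" "h \<in> nonneg_except V"
    and "blk vs (fst P) (snd P) \<tau>" "blk vs (fst P) (snd P) (\<tau> + g + h)"
  shows "blk vs (fst P) (snd P) (\<tau> + g)"
  unfolding blk_def
proof (intro allI impI)
  fix i assume i: "i < length vs"
  let ?v = "vs ! i"
  have a: "if i < fst P then Poly_Mapping.lookup \<tau> ?v < 0
     else snd P \<and> i = fst P \<or> Poly_Mapping.lookup \<tau> ?v \<ge> 0"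
    "if i < fst P then Poly_Mapping.lookup (\<tau> + g + h) ?v < 0
     else snd P \<and> i = fst P \<or> Poly_Mapping.lookup (\<tau> + g + h) ?v \<ge> 0"
    using assms(5,6) i unfolding blk_def by blast+
  show "if i < fst P then Poly_Mapping.lookup (\<tau> + g) ?v < 0
     else snd P \<and> i = fst P \<or> Poly_Mapping.lookup (\<tau> + g) ?v \<ge> 0"
  proof (cases "snd P \<and> i = fst P")
    case False
    have "?v \<notin> free_var vs P"
      using False i assms(1) by (auto simp: free_var_def nth_eq_iff_index_eq)
    then have "?v \<notin> V"
      using assms(2) i nth_mem by blast
    then have "Poly_Mapping.lookup g ?v \<ge> 0" "Poly_Mapping.lookup h ?v \<ge> 0"
      using assms(3,4) by (auto simp: nonneg_except_def)
    then show ?thesis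
      using a False by (auto simp: lookup_add split: if_splits)
  qed auto
qed

text \<open>Inverted variables carry no sign condition, so multipliers may have any exponent there.
  At every other variable multipliers are nonnegative and the condition describes an
  interval.\<close>

lemma region_convex:
  assumes "distinct (xs @ ys @ zs)"
    and "V = free_var xs P \<union> free_var ys Q \<union> free_var zs R"
  shows "convex_for (nonneg_except V) (region xs ys zs P Q R)"
  unfolding convex_for_def
proof (intro allI impI)
  fix \<tau> g h
  assume \<tau>: "\<tau> \<in> region xs ys zs P Q R" and g: "g \<in> nonneg_except V" "h \<in> nonneg_except V"
    and h: "\<tau> + g + h \<in> region xs ys zs P Q R"
  have fv: "free_var vs P \<subseteq> set vs" for vs :: "'a list" and P
    by (auto simp: free_var_def)
  have d: "distinct xs" "distinct ys" "distinct zs" "set xs \<inter> set ys = {}" "set xs \<inter> set zs = {}" "set ys \<inter> set zs = {}"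
    using assms(1) by auto
  have V: "free_var xs P \<inter> set xs = V \<inter> set xs" "free_var ys Q \<inter> set ys = V \<inter> set ys"
    "free_var zs R \<inter> set zs = V \<inter> set zs" "V \<subseteq> set xs \<union> set ys \<union> set zs"
    using fv[of xs P] fv[of ys Q] fv[of zs R] d unfolding assms(2) by blast+
  have "Poly_Mapping.lookup (\<tau> + g) v = 0" if "v \<notin> set xs \<union> set ys \<union> set zs" for v
  proof -
    have "v \<notin> V"
      using V(4) that by blast
    then have "Poly_Mapping.lookup g v \<ge> 0" "Poly_Mapping.lookup h v \<ge> 0"
      using g by (auto simp: nonneg_except_def)
    moreover have "Poly_Mapping.lookup \<tau> v = 0" "Poly_Mapping.lookup (\<tau> + g + h) v = 0"
      using \<tau> h that by (auto simp: region_def)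
    ultimately show ?thesis
      by (simp add: lookup_add)
  qed
  moreover have "blk xs (fst P) (snd P) (\<tau> + g)"
    using \<tau> h by (intro blk_convex[OF d(1) V(1) g]) (auto simp: region_def)
  moreover have "blk ys (fst Q) (snd Q) (\<tau> + g)"
    using \<tau> h by (intro blk_convex[OF d(2) V(2) g]) (auto simp: region_def)
  moreover have "blk zs (fst R) (snd R) (\<tau> + g)"
    using \<tau> h by (intro blk_convex[OF d(3) V(3) g]) (auto simp: region_def)
  ultimately show "\<tau> + g \<in> region xs ys zs P Q R"
    by (simp add: region_def)
qed

lemma nonneg_subset_except: "nonneg \<subseteq> nonneg_except V"
  by (auto simp: nonneg_def nonneg_except_def)

lemma region_convex_nonneg:
  assumes "distinct (xs @ ys @ zs)"
  shows "convex_for nonneg (region xs ys zs P Q R)"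
  using region_convex[OF assms refl] nonneg_subset_except unfolding convex_for_def by blast

lemma blk_up:
  assumes "k < length vs" "blk vs k False \<tau>" "g \<in> nonneg" "blk vs k True (\<tau> + g)"
  shows "blk vs k False (\<tau> + g)"
proof -
  have "Poly_Mapping.lookup \<tau> (vs ! k) \<ge> 0"
    using assms(1,2) by (auto simp: blk_def)
  moreover have "Poly_Mapping.lookup g (vs ! k) \<ge> 0"
    using assms(3) by (simp add: nonneg_def)
  ultimately have "\<not> blk vs (Suc k) False (\<tau> + g)"
    using assms(1) by (auto simp: blk_def lookup_add not_less intro!: exI[of _ k])
  then show ?thesis
    using blk_free_iff(1)[OF assms(1)] assms(4) by blast
qed

text \<open>These are the sequences 0 -> M -> M_v -> M_v / M for localization at one variable
  v.\<close>

lemma short_exact_region: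
  "k < length xs \<Longrightarrow> short_exact (region xs ys zs (k, False) Q R) (region xs ys zs (k, True) Q R) (region xs ys zs (Suc k, False) Q R)"
  "k < length ys \<Longrightarrow> short_exact (region xs ys zs P (k, False) R) (region xs ys zs P (k, True) R) (region xs ys zs P (Suc k, False) R)"
  "k < length zs \<Longrightarrow> short_exact (region xs ys zs P Q (k, False)) (region xs ys zs P Q (k, True)) (region xs ys zs P Q (Suc k, False))"
proof -
  show "short_exact (region xs ys zs (k, False) Q R) (region xs ys zs (k, True) Q R) (region xs ys zs (Suc k, False) Q R)"
    if k: "k < length xs"
    using blk_free_iff[OF k] blk_up[OF k] unfolding short_exact_def region_def by auto
  show "short_exact (region xs ys zs P (k, False) R) (region xs ys zs P (k, True) R) (region xs ys zs P (Suc k, False) R)"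
    if k: "k < length ys"
    using blk_free_iff[OF k] blk_up[OF k] unfolding short_exact_def region_def by auto
  show "short_exact (region xs ys zs P Q (k, False)) (region xs ys zs P Q (k, True)) (region xs ys zs P Q (Suc k, False))"
    if k: "k < length zs"
    using blk_free_iff[OF k] blk_up[OF k] unfolding short_exact_def region_def by auto
qed

section \<open>Degree bounds forced by sign conditions\<close>

lemma bdeg_region:
  assumes "\<tau> \<in> region xs ys zs P Q R" "distinct (xs @ ys @ zs)"
    and "fst ` set xs \<subseteq> {BlockX}" "fst ` set ys \<subseteq> {BlockY}" "fst ` set zs \<subseteq> {BlockZ}"
  shows "bdeg BlockX \<tau> = (\<Sum>v\<in>set xs. Poly_Mapping.lookup \<tau> v)"
    and "bdeg BlockY \<tau> = (\<Sum>v\<in>set ys. Poly_Mapping.lookup \<tau> v)"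
    and "bdeg BlockZ \<tau> = (\<Sum>v\<in>set zs. Poly_Mapping.lookup \<tau> v)"
proof -
  let ?A = "set xs \<union> set ys \<union> set zs"
  have "Poly_Mapping.keys \<tau> \<subseteq> ?A"
    using assms(1) by (auto simp: region_def in_keys_iff)
  then have e: "bdeg b \<tau> = (\<Sum>v\<in>?A. if fst v = b then Poly_Mapping.lookup \<tau> v else 0)" for b
    by (intro bdeg_superset) auto
  have f: "fst v = BlockX" if "v \<in> set xs" for v
    using assms(3) that by auto
  have g: "fst v = BlockY" if "v \<in> set ys" for v
    using assms(4) that by auto
  have h: "fst v = BlockZ" if "v \<in> set zs" for v
    using assms(5) that by auto
  show "bdeg BlockX \<tau> = (\<Sum>v\<in>set xs. Poly_Mapping.lookup \<tau> v)"
    unfolding e by (intro sum.mono_neutral_cong_right) (auto dest: f g h)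
  show "bdeg BlockY \<tau> = (\<Sum>v\<in>set ys. Poly_Mapping.lookup \<tau> v)"
    unfolding e by (intro sum.mono_neutral_cong_right) (auto dest: f g h)
  show "bdeg BlockZ \<tau> = (\<Sum>v\<in>set zs. Poly_Mapping.lookup \<tau> v)"
    unfolding e by (intro sum.mono_neutral_cong_right) (auto dest: f g h)
qed

lemma blk_sum_neg:
  assumes "blk vs (length vs) False \<tau>" "distinct vs"
  shows "(\<Sum>v\<in>set vs. Poly_Mapping.lookup \<tau> v) \<le> - int (length vs)"
proof -
  have "(\<Sum>v\<in>set vs. Poly_Mapping.lookup \<tau> v) \<le> (\<Sum>v\<in>set vs. - 1)"
  proof (rule sum_mono)
    fix v assume "v \<in> set vs"
    then obtain i where "i < length vs" "v = vs ! i"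
      by (metis in_set_conv_nth)
    then show "Poly_Mapping.lookup \<tau> v \<le> - 1"
      using assms(1) by (auto simp: blk_def)
  qed
  then show ?thesis
    using assms(2) by (simp add: distinct_card)
qed

lemma blk_sum_nonneg:
  assumes "blk vs 0 False \<tau>"
  shows "(\<Sum>v\<in>set vs. Poly_Mapping.lookup \<tau> v) \<ge> 0"
proof (rule sum_nonneg)
  fix v assume "v \<in> set vs"
  then obtain i where "i < length vs" "v = vs ! i"
    by (metis in_set_conv_nth)
  then show "Poly_Mapping.lookup \<tau> v \<ge> 0"
    using assms by (auto simp: blk_def)
qed

text \<open>\<open>Z\<close> keeps the z-degrees above what \<open>length zs\<close> negative
  exponents permit, and \<open>Y\<close> keeps the y-degrees negative. In every exterior degree this
  empties one end of the z- and of the y-sequence: there is no top cohomology in z and there are no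
  sections in y.\<close>

locale koszul_blocks = koszul N F dg m
  for N :: "nat set" and F :: "nat \<Rightarrow> lexpo \<Rightarrow>\<^sub>0 'a::field_char_0"
    and dg :: "block \<Rightarrow> nat \<Rightarrow> int" and m :: "block \<Rightarrow> int" +
  fixes xs ys zs :: "(block \<times> nat) list"
  assumes dist: "distinct (xs @ ys @ zs)"
    and blocks: "fst ` set xs \<subseteq> {BlockX}" "fst ` set ys \<subseteq> {BlockY}" "fst ` set zs \<subseteq> {BlockZ}"
    and unit: "i < length xs \<Longrightarrow> j < length ys \<Longrightarrow> k < length zs \<Longrightarrow>
      \<exists>a. (\<Sum>l\<in>N. F l * a l) = 1 \<and> (\<forall>l\<in>N. Poly_Mapping.keys (a l) \<subseteq> nonneg_except {xs ! i, ys ! j, zs ! k} \<and>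
        (\<forall>\<theta>\<in>Poly_Mapping.keys (a l). \<forall>b. bdeg b \<theta> = - dg b l))"
    and Z: "I \<subseteq> N \<Longrightarrow> m BlockZ - (\<Sum>i\<in>I. dg BlockZ i) > - int (length zs)"
    and Y: "I \<subseteq> N \<Longrightarrow> m BlockY - (\<Sum>i\<in>I. dg BlockY i) < 0"
begin

abbreviation reg where "reg \<equiv> region xs ys zs"

lemma exact_free:
  assumes "i < length xs" "j < length ys" "k < length zs"
  shows "exact_at (reg (i, True) (j, True) (k, True)) p"
proof -
  obtain a where a: "(\<Sum>l\<in>N. F l * a l) = 1"
    "\<And>l. l \<in> N \<Longrightarrow> Poly_Mapping.keys (a l) \<subseteq> nonneg_except {xs ! i, ys ! j, zs ! k}"
    "\<And>l \<theta> b. l \<in> N \<Longrightarrow> \<theta> \<in> Poly_Mapping.keys (a l) \<Longrightarrow> bdeg b \<theta> = - dg b l"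
    using unit[OF assms] by blast
  have "{xs ! i, ys ! j, zs ! k} = free_var xs (i, True) \<union> free_var ys (j, True) \<union> free_var zs (k, True)"
    using assms by (auto simp: free_var_def)
  then show ?thesis
    using exact_unit_ideal[OF region_convex[OF dist] nonneg_subset_except a] by simp
qed

lemma chain_degree:
  assumes "chain p (reg P Q R) \<omega>" "\<omega> I \<tau> \<noteq> 0"
  shows "I \<subseteq> N" "int (card I) = p"
    "blk xs (fst P) (snd P) \<tau>" "blk ys (fst Q) (snd Q) \<tau>" "blk zs (fst R) (snd R) \<tau>"
    "(\<Sum>v\<in>set xs. Poly_Mapping.lookup \<tau> v) = m BlockX - (\<Sum>i\<in>I. dg BlockX i)"
    "(\<Sum>v\<in>set ys. Poly_Mapping.lookup \<tau> v) = m BlockY - (\<Sum>i\<in>I. dg BlockY i)"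
    "(\<Sum>v\<in>set zs. Poly_Mapping.lookup \<tau> v) = m BlockZ - (\<Sum>i\<in>I. dg BlockZ i)"
proof -
  have h: "I \<subseteq> N" "int (card I) = p" "\<tau> \<in> reg P Q R" "\<And>b. bdeg b \<tau> = m b - (\<Sum>i\<in>I. dg b i)"
    using assms unfolding chain_def by blast+
  then show "I \<subseteq> N" "int (card I) = p"
    "blk xs (fst P) (snd P) \<tau>" "blk ys (fst Q) (snd Q) \<tau>" "blk zs (fst R) (snd R) \<tau>"
    by (auto simp: region_def)
  show "(\<Sum>v\<in>set xs. Poly_Mapping.lookup \<tau> v) = m BlockX - (\<Sum>i\<in>I. dg BlockX i)"
    "(\<Sum>v\<in>set ys. Poly_Mapping.lookup \<tau> v) = m BlockY - (\<Sum>i\<in>I. dg BlockY i)"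
    "(\<Sum>v\<in>set zs. Poly_Mapping.lookup \<tau> v) = m BlockZ - (\<Sum>i\<in>I. dg BlockZ i)"
    using h(4) bdeg_region[OF h(3) dist blocks] by simp_all
qed

text \<open>Starting from the fully localized complexes, the z-variables are brought to nonnegative
  exponents downwards from the empty all-negative end; then the y- and the x-variables are made
  negative upwards. The x-step alone starts from a module known to be empty only in the single
  degree \<open>p\<close>, so it alone leaves a shift, by \<open>length xs\<close>.\<close>

theorem exact_inverse_system:
  assumes X: "\<And>I. I \<subseteq> N \<Longrightarrow> int (card I) = p \<Longrightarrow>
    m BlockX - (\<Sum>i\<in>I. dg BlockX i) < 0 \<or> m BlockY - (\<Sum>i\<in>I. dg BlockY i) > - int (length ys)"
  shows "exact_at (reg (length xs, False) (length ys, False) (0, False)) (p + int (length xs))"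
proof -
  have d: "distinct xs" "distinct ys" "distinct zs"
    using dist by auto
  note conv = region_convex_nonneg[OF dist]
  have z: "exact_at (reg (i, True) (j, True) (0, False)) p"
    if ij: "i < length xs" "j < length ys" for i j p
  proof (rule exact_chain_down[where n = "length zs" and Free = "\<lambda>k. reg (i, True) (j, True) (k, True)"
        and Neg = "\<lambda>k. reg (i, True) (j, True) (k, False)"])
    show "exact_at (reg (i, True) (j, True) (length zs, False)) p" for p
    proof (rule exact_trivial, intro ext, rule ccontr)
      fix \<omega> I \<tau> assume c: "chain p (reg (i, True) (j, True) (length zs, False)) \<omega>" and nz: "\<omega> I \<tau> \<noteq> 0 I \<tau>"
      then have nz: "\<omega> I \<tau> \<noteq> 0" by simp
      note h = chain_degree[OF c nz]
      show False
        using blk_sum_neg[of zs \<tau>] h(5,8) Z[OF h(1)] d by simp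
    qed
  qed (use ij in \<open>auto intro!: short_exact_region conv exact_free\<close>)
  have y: "exact_at (reg (i, True) (length ys, False) (0, False)) p"
    if i: "i < length xs" for i p
  proof -
    have "exact_at (reg (i, True) (length ys, False) (0, False)) (p - int (length ys) + int (length ys))"
    proof (rule exact_chain_up[where n = "length ys" and Free = "\<lambda>k. reg (i, True) (k, True) (0, False)"
          and Neg = "\<lambda>k. reg (i, True) (k, False) (0, False)"])
      show "exact_at (reg (i, True) (0, False) (0, False)) (p - int (length ys))"
      proof (rule exact_trivial, intro ext, rule ccontr)
        fix \<omega> I \<tau> assume c: "chain (p - int (length ys)) (reg (i, True) (0, False) (0, False)) \<omega>" and nz: "\<omega> I \<tau> \<noteq> 0 I \<tau>"
        then have nz: "\<omega> I \<tau> \<noteq> 0" by simp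
        note h = chain_degree[OF c nz]
        show False
          using blk_sum_nonneg[of ys \<tau>] h(4,7) Y[OF h(1)] by simp
      qed
    qed (use i in \<open>auto intro!: short_exact_region conv z\<close>)
    then show ?thesis by simp
  qed
  show ?thesis
  proof (rule exact_chain_up[where n = "length xs" and Free = "\<lambda>k. reg (k, True) (length ys, False) (0, False)"
        and Neg = "\<lambda>k. reg (k, False) (length ys, False) (0, False)"])
    show "exact_at (reg (0, False) (length ys, False) (0, False)) p"
    proof (rule exact_trivial, intro ext, rule ccontr)
      fix \<omega> I \<tau> assume c: "chain p (reg (0, False) (length ys, False) (0, False)) \<omega>" and nz: "\<omega> I \<tau> \<noteq> 0 I \<tau>"
      then have nz: "\<omega> I \<tau> \<noteq> 0" by simp
      note h = chain_degree[OF c nz]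
      show False
        using blk_sum_nonneg[of xs \<tau>] blk_sum_neg[of ys \<tau>] h X[OF h(1,2)] d by auto
    qed
  qed (auto intro!: short_exact_region conv y)
qed

end

section \<open>Forms without common zeros\<close>

fun expo_block :: "block \<Rightarrow> expo \<Rightarrow> nat \<Rightarrow>\<^sub>0 nat" where
  "expo_block BlockX (sx, sy, sz) = sx"
| "expo_block BlockY (sx, sy, sz) = sy"
| "expo_block BlockZ (sx, sy, sz) = sz"

definition lexp :: "expo \<Rightarrow> lexpo" where
  "lexp \<sigma> = (\<Sum>b\<in>{BlockX, BlockY, BlockZ}. \<Sum>i\<in>Poly_Mapping.keys (expo_block b \<sigma>).
     Poly_Mapping.single (b, i) (int (Poly_Mapping.lookup (expo_block b \<sigma>) i)))"

lemma expo_eqI: "(\<And>b. expo_block b \<sigma> = expo_block b \<tau>) \<Longrightarrow> \<sigma> = \<tau>"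
  by (cases \<sigma>; cases \<tau>) (metis expo_block.simps)

lemma lookup_lexp: "Poly_Mapping.lookup (lexp \<sigma>) (b, i) = int (Poly_Mapping.lookup (expo_block b \<sigma>) i)"
proof -
  have "Poly_Mapping.lookup (\<Sum>i\<in>Poly_Mapping.keys (expo_block c \<sigma>).
      Poly_Mapping.single (c, i) (int (Poly_Mapping.lookup (expo_block c \<sigma>) i))) (b, i) =
      (if c = b then int (Poly_Mapping.lookup (expo_block b \<sigma>) i) else 0)" for c
    by (auto simp: lookup_sum lookup_single when_def in_keys_iff sum.delta)
  then show ?thesis
    by (cases b) (simp_all add: lexp_def lookup_add)
qed

lemma expo_block_add: "expo_block b (\<sigma> + \<tau>) = expo_block b \<sigma> + expo_block b \<tau>"
  by (cases b; cases \<sigma>; cases \<tau>) auto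

lemma lexp_add: "lexp (\<sigma> + \<tau>) = lexp \<sigma> + lexp \<tau>"
  by (rule poly_mapping_eqI) (auto simp: lookup_lexp lookup_add expo_block_add split_paired_all)

lemma lexp_zero [simp]: "lexp 0 = 0"
  using lexp_add[of 0 0] by simp

lemma lexp_nonneg: "lexp \<sigma> \<in> nonneg"
  by (auto simp: nonneg_def lookup_lexp split_paired_all)

definition var_expo :: "block \<times> nat \<Rightarrow> expo" where
  "var_expo v = (case v of (b, i) \<Rightarrow> (if b = BlockX then Poly_Mapping.single i 1 else 0,
     if b = BlockY then Poly_Mapping.single i 1 else 0, if b = BlockZ then Poly_Mapping.single i 1 else 0))"

lemma lexp_var_expo: "lexp (var_expo v) = Poly_Mapping.single v 1"
proof (rule poly_mapping_eqI)
  fix u :: "block \<times> nat"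
  obtain b i c j where "u = (b, i)" "v = (c, j)"
    by (cases u; cases v) auto
  then show "Poly_Mapping.lookup (lexp (var_expo v)) u = Poly_Mapping.lookup (Poly_Mapping.single v 1) u"
    by (cases b; cases c) (auto simp: lookup_lexp var_expo_def lookup_single when_def)
qed

definition var_poly :: "block \<times> nat \<Rightarrow> 'a::comm_ring_1 tpoly" where
  "var_poly v = Poly_Mapping.single (var_expo v) 1"

definition point_of :: "(block \<times> nat \<Rightarrow> 'a) \<Rightarrow> (nat \<Rightarrow> 'a) \<times> (nat \<Rightarrow> 'a) \<times> (nat \<Rightarrow> 'a)" where
  "point_of w = (\<lambda>i. w (BlockX, i), \<lambda>i. w (BlockY, i), \<lambda>i. w (BlockZ, i))"

lemma teval_const: "teval w (Poly_Mapping.single 0 c) = c"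
  by (simp add: teval_single)

lemma teval_var_poly: "teval (point_of w) (var_poly v) = w v"
  by (cases v; cases "fst v") (auto simp: var_poly_def teval_single var_expo_def point_of_def)

interpretation tpoly: point_evaluations
  "Poly_Mapping.single 0 :: 'a::{alg_closed_field, field_char_0} \<Rightarrow> 'a tpoly" var_poly "\<lambda>w. teval (point_of w)"
proof (rule point_evaluations.intro)
  show "comm_ring_hom (Poly_Mapping.single 0 :: 'a \<Rightarrow> 'a tpoly)"
    by unfold_locales (auto simp: single_add mult_single)
  show "comm_ring_hom (teval (point_of w) :: 'a tpoly \<Rightarrow> 'a)" for w
    by unfold_locales (auto simp: teval_add teval_mult)
qed (auto simp: teval_const teval_var_poly)

lemma single_block_sum:
  fixes g :: "(nat \<Rightarrow>\<^sub>0 nat) \<Rightarrow> expo"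
  assumes g: "\<And>s t. g (s + t) = g s + g t" "g 0 = 0" and v: "\<And>i. g (Poly_Mapping.single i 1) = var_expo (b, i)"
    and "Pair b ` A \<subseteq> V" "finite A"
  shows "Poly_Mapping.single (g (\<Sum>i\<in>A. Poly_Mapping.single i (n i))) (1::'a::{alg_closed_field, field_char_0}) \<in> tpoly.subalg V"
  using assms(5,4)
proof (induction A rule: finite_induct)
  case empty
  then show ?case
    using tpoly.subalg.emb[of 1 V] by (simp add: g)
next
  case (insert i A)
  have "Poly_Mapping.single (g (Poly_Mapping.single i k)) (1::'a) \<in> tpoly.subalg V" for k
  proof (induction k)
    case 0
    then show ?case
      using tpoly.subalg.emb[of 1 V] by (simp add: g)
  next
    case (Suc k)
    have "Poly_Mapping.single i (Suc k) = Poly_Mapping.single i k + Poly_Mapping.single i 1"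
      by (simp flip: single_add)
    then have "Poly_Mapping.single (g (Poly_Mapping.single i (Suc k))) (1::'a) =
        Poly_Mapping.single (g (Poly_Mapping.single i k)) 1 * var_poly (b, i)"
      by (simp add: g v[unfolded One_nat_def] var_poly_def mult_single)
    then show ?case
      using Suc insert.prems by (auto intro!: tpoly.subalg.mult tpoly.subalg.var)
  qed
  moreover have "Poly_Mapping.single (g (\<Sum>i\<in>insert i A. Poly_Mapping.single i (n i))) (1::'a) =
      Poly_Mapping.single (g (Poly_Mapping.single i (n i))) 1 *
      Poly_Mapping.single (g (\<Sum>i\<in>A. Poly_Mapping.single i (n i))) 1"
    using insert.hyps by (simp add: g mult_single)
  ultimately show ?case
    using insert by (auto intro!: tpoly.subalg.mult)
qed

lemma tpoly_in_subalg:
  fixes p :: "'a::{alg_closed_field, field_char_0} tpoly"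
  assumes "\<And>\<theta> v. \<theta> \<in> Poly_Mapping.keys p \<Longrightarrow> v \<notin> V \<Longrightarrow> Poly_Mapping.lookup (lexp \<theta>) v = 0"
  shows "p \<in> tpoly.subalg V"
proof -
  have "Poly_Mapping.single \<theta> c \<in> tpoly.subalg V" if \<theta>: "\<theta> \<in> Poly_Mapping.keys p" for \<theta> and c :: 'a
  proof -
    have V: "Pair b ` Poly_Mapping.keys (expo_block b \<theta>) \<subseteq> V" for b
    proof (clarify, rule ccontr)
      fix i assume i: "i \<in> Poly_Mapping.keys (expo_block b \<theta>)" "(b, i) \<notin> V"
      then have "Poly_Mapping.lookup (lexp \<theta>) (b, i) \<noteq> 0"
        by (simp add: lookup_lexp in_keys_iff)
      then show False
        using assms[OF \<theta> i(2)] by simp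
    qed
    define g where "g b s = (if b = BlockX then (s, 0, 0) else if b = BlockY then (0, s, 0) else (0, 0, s) :: expo)"
      for b and s :: "nat \<Rightarrow>\<^sub>0 nat"
    have s: "Poly_Mapping.single (g b (expo_block b \<theta>)) (1::'a) \<in> tpoly.subalg V" for b
    proof (subst poly_mapping_sum_singles[of "expo_block b \<theta>"], rule single_block_sum[where b = b])
      show "g b (s + t) = g b s + g b t" for s t
        by (auto simp: g_def)
      show "g b 0 = 0"
        by (auto simp: g_def zero_prod_def)
      show "g b (Poly_Mapping.single i 1) = var_expo (b, i)" for i
        by (cases b) (auto simp: g_def var_expo_def)
    qed (use V in auto)
    have "\<theta> = 0 + g BlockX (expo_block BlockX \<theta>) + g BlockY (expo_block BlockY \<theta>) + g BlockZ (expo_block BlockZ \<theta>)"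
      by (cases \<theta>) (simp add: g_def)
    then have "Poly_Mapping.single \<theta> c = Poly_Mapping.single 0 c *
        Poly_Mapping.single (g BlockX (expo_block BlockX \<theta>)) 1 *
        Poly_Mapping.single (g BlockY (expo_block BlockY \<theta>)) 1 *
        Poly_Mapping.single (g BlockZ (expo_block BlockZ \<theta>)) 1"
      by (simp only: mult_single mult_1_right)
    then show ?thesis
      using s by (auto intro!: tpoly.subalg.mult tpoly.subalg.emb)
  qed
  then have "(\<Sum>\<theta>\<in>Poly_Mapping.keys p. Poly_Mapping.single \<theta> (Poly_Mapping.lookup p \<theta>)) \<in> tpoly.subalg V"
    by (intro tpoly.subalg_sum)
  then show ?thesis
    by (simp flip: poly_mapping_sum_singles)
qed

text \<open>The generators \<open>var_poly u - 1\<close> impose the value 1 on the variables in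
  \<open>U\<close>; if the resulting ideal were proper, the weak Nullstellensatz would give a zero
  on this chart.\<close>

lemma affine_unit_ideal:
  fixes f :: "nat \<Rightarrow> 'a::{alg_closed_field, field_char_0} tpoly"
  assumes "finite N" "finite V" "U \<subseteq> V" "finite U"
    and vars: "\<And>l \<theta> v. l \<in> N \<Longrightarrow> \<theta> \<in> Poly_Mapping.keys (f l) \<Longrightarrow> v \<notin> V \<Longrightarrow> Poly_Mapping.lookup (lexp \<theta>) v = 0"
    and empty: "\<And>w. (\<And>u. u \<in> U \<Longrightarrow> w u = 1) \<Longrightarrow> \<exists>l\<in>N. teval (point_of w) (f l) \<noteq> 0"
  shows "\<exists>a b. (\<Sum>l\<in>N. a l * f l) + (\<Sum>u\<in>U. b u * (var_poly u - 1)) = 1"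
proof (rule ccontr)
  let ?c = "\<lambda>a b. (\<Sum>l\<in>N. a l * f l) + (\<Sum>u\<in>U. b u * (var_poly u - 1))"
  define I where "I = {?c a b | a b. True}"
  assume "\<not> ?thesis"
  then have "1 \<notin> I"
    by (auto simp: I_def)
  have mem: "?c a b \<in> I" for a b
    unfolding I_def by (rule CollectI, rule exI[of _ a], rule exI[of _ b]) simp
  have "is_ideal I"
    unfolding is_ideal_def
  proof (intro conjI ballI allI)
    show "0 \<in> I"
      using mem[of "\<lambda>_. 0" "\<lambda>_. 0"] by simp
  next
    fix p q assume "p \<in> I" "q \<in> I"
    then obtain a b a' b' where "p = ?c a b" "q = ?c a' b'"
      unfolding I_def by blast
    then have "p + q = ?c (\<lambda>l. a l + a' l) (\<lambda>u. b u + b' u)"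
      by (simp only: distrib_right sum.distrib add_ac)
    then show "p + q \<in> I"
      using mem by simp
  next
    fix p c assume "p \<in> I"
    then obtain a b where "p = ?c a b"
      unfolding I_def by blast
    then have "c * p = ?c (\<lambda>l. c * a l) (\<lambda>u. c * b u)"
      by (simp add: distrib_left sum_distrib_left mult.assoc)
    then show "c * p \<in> I"
      using mem by simp
  qed
  then obtain w where w: "\<And>p. p \<in> tpoly.subalg V \<inter> I \<Longrightarrow> teval (point_of w) p = 0"
    using tpoly.weak_nullstellensatz[OF assms(2) _ \<open>1 \<notin> I\<close>] by blast
  have fI: "f l \<in> I" if "l \<in> N" for l
  proof -
    have "f l = ?c (\<lambda>k. if k = l then 1 else 0) (\<lambda>_. 0)"
      using that assms(1) by (simp add: if_distrib[of "\<lambda>x. x * _"] cong: if_cong)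
    then show ?thesis
      using mem[of "\<lambda>k. if k = l then 1 else 0" "\<lambda>_. 0"] by simp
  qed
  have uI: "var_poly u - 1 \<in> I" if "u \<in> U" for u
  proof -
    have "var_poly u - 1 = ?c (\<lambda>_. 0) (\<lambda>k. if k = u then 1 else 0)"
      using that assms(4) by (simp add: if_distrib[of "\<lambda>x. x * _"] cong: if_cong)
    then show ?thesis
      using mem[of "\<lambda>_. 0" "\<lambda>k. if k = u then 1 else 0"] by simp
  qed
  have "w u = 1" if "u \<in> U" for u
  proof -
    have "1 \<in> tpoly.subalg V"
      using tpoly.subalg.emb[of 1 V] by simp
    then have "teval (point_of w) (var_poly u - 1) = 0"
      using uI[OF that] that assms(3) by (intro w) (auto intro!: tpoly.subalg_diff tpoly.subalg.var)
    then show ?thesis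
      by (simp add: teval_diff teval_var_poly)
  qed
  then obtain l where "l \<in> N" "teval (point_of w) (f l) \<noteq> 0"
    using empty by blast
  moreover have "f l \<in> tpoly.subalg V" if "l \<in> N" for l
    using vars[OF that] by (intro tpoly_in_subalg)
  ultimately show False
    using w fI by blast
qed

section \<open>From an affine chart to a homogeneous partition of unity\<close>

definition map_expo :: "('m \<Rightarrow> 'n) \<Rightarrow> ('m \<Rightarrow>\<^sub>0 'a) \<Rightarrow> 'n::comm_monoid_add \<Rightarrow>\<^sub>0 'a::comm_ring_1" where
  "map_expo h = eval_with (Poly_Mapping.single 0) (\<lambda>\<theta>. Poly_Mapping.single (h \<theta>) 1)"

lemma map_expo_def': "map_expo h p = (\<Sum>\<theta>\<in>Poly_Mapping.keys p. Poly_Mapping.single (h \<theta>) (Poly_Mapping.lookup p \<theta>))"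
  by (simp add: map_expo_def eval_with_def mult_single)

lemma map_expo_single: "map_expo h (Poly_Mapping.single \<theta> c) = Poly_Mapping.single (h \<theta>) c"
  by (simp add: map_expo_def eval_with_single mult_single)

lemma map_expo_add: "map_expo h (p + q) = map_expo h p + map_expo h q"
  by (simp add: map_expo_def eval_with_add single_add)

lemma map_expo_diff: "map_expo h (p - q) = map_expo h p - map_expo h q"
  using map_expo_add[of h "p - q" q] by (simp add: algebra_simps)

lemma map_expo_sum: "map_expo h (\<Sum>i\<in>A. p i) = (\<Sum>i\<in>A. map_expo h (p i))"
  by (simp add: map_expo_def eval_with_sum single_add)

lemma map_expo_mult:
  fixes h :: "'m::comm_monoid_add \<Rightarrow> 'n::comm_monoid_add"
  assumes "\<And>s t. h (s + t) = h s + h t"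
  shows "map_expo h (p * q) = map_expo h p * map_expo h q"
  by (simp add: map_expo_def eval_with_mult single_add mult_single assms)

lemma keys_map_expo: "Poly_Mapping.keys (map_expo h p) \<subseteq> h ` Poly_Mapping.keys p"
  unfolding map_expo_def' using keys_sum by (fastforce split: if_splits)

lemma keys_mult_single:
  "Poly_Mapping.keys (Poly_Mapping.single c 1 * p) \<subseteq> (+) c ` Poly_Mapping.keys p"
  using keys_mult[of "Poly_Mapping.single c 1" p] by (auto split: if_splits)

definition block_var :: "block \<Rightarrow> (block \<times> nat) \<Rightarrow> (block \<times> nat) \<Rightarrow> (block \<times> nat) \<Rightarrow> block \<times> nat" where
  "block_var b u v w = (case b of BlockX \<Rightarrow> u | BlockY \<Rightarrow> v | BlockZ \<Rightarrow> w)"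

definition chart_expo :: "(block \<Rightarrow> block \<times> nat) \<Rightarrow> (block \<Rightarrow> int) \<Rightarrow> lexpo" where
  "chart_expo u c = (\<Sum>b\<in>{BlockX, BlockY, BlockZ}. Poly_Mapping.single (u b) (c b))"

lemma chart_expo_add: "chart_expo u (\<lambda>b. c b + d b) = chart_expo u c + chart_expo u d"
  by (simp add: chart_expo_def single_add algebra_simps)

lemma bdeg_chart_expo:
  assumes "\<And>b. fst (u b) = b"
  shows "bdeg b (chart_expo u c) = c b"
  by (cases b) (simp_all add: chart_expo_def bdeg_add bdeg_single assms)

lemma lookup_chart_expo:
  assumes "v \<notin> range u"
  shows "Poly_Mapping.lookup (chart_expo u c) v = 0"
  using assms by (auto simp: chart_expo_def lookup_add lookup_single when_def)

text \<open>Dividing each monomial by the powers of the chart variables \<open>u b\<close> that make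
  it of degree 0 in every block is multiplicative. It sends the chart variables to 1 and each
  \<open>f l\<close> to a monomial multiple of itself, and so turns the affine certificate into a
  homogeneous one.\<close>

lemma homogeneous_unit:
  fixes f :: "nat \<Rightarrow> 'a::{alg_closed_field, field_char_0} tpoly"
  assumes "finite N" "finite V" "range u \<subseteq> V" and u: "\<And>b. fst (u b) = b"
    and vars: "\<And>l \<theta> v. l \<in> N \<Longrightarrow> \<theta> \<in> Poly_Mapping.keys (f l) \<Longrightarrow> v \<notin> V \<Longrightarrow> Poly_Mapping.lookup (lexp \<theta>) v = 0"
    and deg: "\<And>l \<theta> b. l \<in> N \<Longrightarrow> \<theta> \<in> Poly_Mapping.keys (f l) \<Longrightarrow> bdeg b (lexp \<theta>) = dg b l"
    and empty: "\<And>w. (\<And>b. w (u b) = 1) \<Longrightarrow> \<exists>l\<in>N. teval (point_of w) (f l) \<noteq> 0"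
  shows "\<exists>a. (\<Sum>l\<in>N. map_expo lexp (f l) * a l) = 1 \<and>
    (\<forall>l\<in>N. Poly_Mapping.keys (a l) \<subseteq> nonneg_except (range u) \<and>
      (\<forall>\<theta>\<in>Poly_Mapping.keys (a l). \<forall>b. bdeg b \<theta> = - dg b l))"
proof -
  have UNIV_block: "(UNIV :: block set) = {BlockX, BlockY, BlockZ}"
    using block.exhaust by blast
  have fin: "finite (range u)"
    unfolding UNIV_block by simp
  have "\<exists>a b. (\<Sum>l\<in>N. a l * f l) + (\<Sum>v\<in>range u. b v * (var_poly v - 1)) = 1"
  proof (rule affine_unit_ideal[OF assms(1-3) fin])
    show "\<exists>l\<in>N. teval (point_of w) (f l) \<noteq> 0" if "\<And>v. v \<in> range u \<Longrightarrow> w v = 1" for w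
      using that by (intro empty) blast
  qed (rule vars)
  then obtain a b where ab: "(\<Sum>l\<in>N. a l * f l) + (\<Sum>v\<in>range u. b v * (var_poly v - 1)) = 1"
    by blast
  define h where "h \<sigma> = lexp \<sigma> - chart_expo u (\<lambda>b. bdeg b (lexp \<sigma>))" for \<sigma>
  have h_add: "h (\<sigma> + \<tau>) = h \<sigma> + h \<tau>" for \<sigma> \<tau>
    by (simp add: h_def lexp_add bdeg_add chart_expo_add algebra_simps)
  have h_deg: "bdeg b (h \<sigma>) = 0" for b \<sigma>
    by (simp add: h_def bdeg_diff bdeg_chart_expo[OF u])
  have h_nonneg: "Poly_Mapping.lookup (h \<sigma>) v \<ge> 0" if "v \<notin> range u" for \<sigma> v
  proof -
    have "Poly_Mapping.lookup (lexp \<sigma>) v \<ge> 0"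
      using lexp_nonneg[of \<sigma>] unfolding nonneg_def by blast
    then show ?thesis
      using that by (simp add: h_def lookup_minus lookup_chart_expo)
  qed
  have h_var: "h (var_expo (u b)) = 0" for b
    by (cases b) (simp_all add: h_def lexp_var_expo bdeg_single u chart_expo_def)
  have h_zero: "h 0 = 0"
    using h_add[of 0 0] by simp
  have one: "map_expo h 1 = (1 :: lexpo \<Rightarrow>\<^sub>0 'a)"
    by (simp add: map_expo_single h_zero flip: single_one)
  have var: "map_expo h (var_poly v - 1) = (0 :: lexpo \<Rightarrow>\<^sub>0 'a)" if "v \<in> range u" for v
    using that h_var by (auto simp: map_expo_diff one var_poly_def map_expo_single)
  define c where "c l = - chart_expo u (\<lambda>b. dg b l)" for l
  have f: "map_expo h (f l) = map_expo lexp (f l) * Poly_Mapping.single (c l) 1" if "l \<in> N" for l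
  proof -
    have "h \<theta> = lexp \<theta> + c l" if "\<theta> \<in> Poly_Mapping.keys (f l)" for \<theta>
      using deg[OF \<open>l \<in> N\<close> that] by (simp add: h_def c_def)
    then show ?thesis
      by (simp add: map_expo_def' sum_distrib_right mult_single)
  qed
  \<comment> \<open>The monomial of exponent \<open>c l\<close>, split off from the normalized
    \<open>f l\<close>, is moved into the coefficient and gives it degree
    \<open>- dg b l\<close>.\<close>
  define a' where "a' l = Poly_Mapping.single (c l) 1 * map_expo h (a l)" for l
  have "1 = map_expo h ((\<Sum>l\<in>N. a l * f l) + (\<Sum>v\<in>range u. b v * (var_poly v - 1)))"
    by (simp add: ab one)
  also have "\<dots> = (\<Sum>l\<in>N. map_expo h (a l) * map_expo h (f l)) +
      (\<Sum>v\<in>range u. map_expo h (b v) * map_expo h (var_poly v - 1))"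
    by (simp only: map_expo_add map_expo_sum map_expo_mult[OF h_add])
  also have "\<dots> = (\<Sum>l\<in>N. map_expo lexp (f l) * a' l)"
    by (simp add: var f a'_def mult_ac)
  finally have "(\<Sum>l\<in>N. map_expo lexp (f l) * a' l) = 1" by simp
  moreover have "bdeg b \<theta> = - dg b l" "\<theta> \<in> nonneg_except (range u)"
    if a': "\<theta> \<in> Poly_Mapping.keys (a' l)" for l \<theta> b
  proof -
    obtain \<sigma> where \<sigma>: "\<theta> = c l + h \<sigma>"
      using a' keys_mult_single[of "c l" "map_expo h (a l)"] keys_map_expo[of h "a l"]
      unfolding a'_def by blast
    show "bdeg b \<theta> = - dg b l"
      by (simp add: \<sigma> c_def bdeg_diff h_deg bdeg_chart_expo[OF u])
    show "\<theta> \<in> nonneg_except (range u)"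
      unfolding nonneg_except_def \<sigma> c_def
      by (simp add: lookup_minus lookup_chart_expo h_nonneg)
  qed
  ultimately show ?thesis
    by (intro exI[of _ a']) blast
qed

lemma koszul_blocks_of_system:
  fixes f :: "nat \<Rightarrow> 'a::{alg_closed_field, field_char_0} tpoly"
  assumes "finite N" and dist: "distinct (xs @ ys @ zs)"
    and blocks: "fst ` set xs \<subseteq> {BlockX}" "fst ` set ys \<subseteq> {BlockY}" "fst ` set zs \<subseteq> {BlockZ}"
    and vars: "\<And>l \<theta> v. l \<in> N \<Longrightarrow> \<theta> \<in> Poly_Mapping.keys (f l) \<Longrightarrow> v \<notin> set xs \<union> set ys \<union> set zs \<Longrightarrow>
      Poly_Mapping.lookup (lexp \<theta>) v = 0"
    and deg: "\<And>l \<theta> b. l \<in> N \<Longrightarrow> \<theta> \<in> Poly_Mapping.keys (f l) \<Longrightarrow> bdeg b (lexp \<theta>) = dg b l"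
    and empty: "\<And>w i j k. i < length xs \<Longrightarrow> j < length ys \<Longrightarrow> k < length zs \<Longrightarrow>
      w (xs ! i) = 1 \<Longrightarrow> w (ys ! j) = 1 \<Longrightarrow> w (zs ! k) = 1 \<Longrightarrow> \<exists>l\<in>N. teval (point_of w) (f l) \<noteq> 0"
    and Z: "\<And>I. I \<subseteq> N \<Longrightarrow> m BlockZ - (\<Sum>i\<in>I. dg BlockZ i) > - int (length zs)"
    and Y: "\<And>I. I \<subseteq> N \<Longrightarrow> m BlockY - (\<Sum>i\<in>I. dg BlockY i) < 0"
  shows "koszul_blocks N (\<lambda>l. map_expo lexp (f l)) dg m xs ys zs"
proof
  show "Poly_Mapping.keys (map_expo lexp (f l)) \<subseteq> nonneg" for l
    using keys_map_expo[of lexp "f l"] lexp_nonneg by auto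
  show "bdeg b \<theta> = dg b l" if "l \<in> N" "\<theta> \<in> Poly_Mapping.keys (map_expo lexp (f l))" for l \<theta> b
    using keys_map_expo[of lexp "f l"] that deg by auto
  fix i j k assume ijk: "i < length xs" "j < length ys" "k < length zs"
  define u where "u b = block_var b (xs ! i) (ys ! j) (zs ! k)" for b
  have range: "range u = {xs ! i, ys ! j, zs ! k}"
  proof -
    have U: "(UNIV :: block set) = {BlockX, BlockY, BlockZ}"
      using block.exhaust by blast
    show ?thesis
      unfolding U by (simp add: u_def block_var_def)
  qed
  have "xs ! i \<in> set xs" "ys ! j \<in> set ys" "zs ! k \<in> set zs"
    using ijk by auto
  then have f: "fst (xs ! i) = BlockX" "fst (ys ! j) = BlockY" "fst (zs ! k) = BlockZ"
    and sub: "range u \<subseteq> set xs \<union> set ys \<union> set zs"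
    using blocks unfolding range by auto
  have fu: "fst (u b) = b" for b
    using f by (cases b) (simp_all add: u_def block_var_def)
  have "\<exists>a. (\<Sum>l\<in>N. map_expo lexp (f l) * a l) = 1 \<and>
    (\<forall>l\<in>N. Poly_Mapping.keys (a l) \<subseteq> nonneg_except (range u) \<and>
      (\<forall>\<theta>\<in>Poly_Mapping.keys (a l). \<forall>b. bdeg b \<theta> = - dg b l))"
  proof (rule homogeneous_unit[OF \<open>finite N\<close> _ sub fu vars deg])
    show "\<exists>l\<in>N. teval (point_of w) (f l) \<noteq> 0" if w: "\<And>b. w (u b) = 1" for w
      using w[of BlockX] w[of BlockY] w[of BlockZ]
      by (intro empty[OF ijk]) (simp_all add: u_def block_var_def)
  qed auto
  then show "\<exists>a. (\<Sum>l\<in>N. map_expo lexp (f l) * a l) = 1 \<and>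
    (\<forall>l\<in>N. Poly_Mapping.keys (a l) \<subseteq> nonneg_except {xs ! i, ys ! j, zs ! k} \<and>
      (\<forall>\<theta>\<in>Poly_Mapping.keys (a l). \<forall>b. bdeg b \<theta> = - dg b l))"
    unfolding range .
qed (use assms in auto)

section \<open>The matrix entries of \<open>\<delta>\<^sub>1\<close>\<close>

definition contraction_coeff :: "'r::comm_ring_1 tpoly \<Rightarrow> expo \<Rightarrow> expo \<Rightarrow> 'r" where
  "contraction_coeff p \<tau> \<sigma> = (\<Sum>\<theta>\<in>Poly_Mapping.keys p.
     if expo_block BlockX \<sigma> = expo_block BlockX \<tau> + expo_block BlockX \<theta> \<and>
        expo_block BlockY \<sigma> = expo_block BlockY \<tau> + expo_block BlockY \<theta> \<and>
        expo_block BlockZ \<tau> = expo_block BlockZ \<sigma> + expo_block BlockZ \<theta>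
     then Poly_Mapping.lookup p \<theta> else 0)"

text \<open>At most one term of the sum is nonzero, since \<open>snd u\<close> determines the
  removed index. As a sum it can be specialized termwise and exchanged with other sums.\<close>

definition delta_entry :: "(nat \<Rightarrow> 'r::comm_ring_1 tpoly) \<Rightarrow> kbasis \<Rightarrow> kbasis \<Rightarrow> 'r" where
  "delta_entry F u v = (\<Sum>k\<in>snd v. if snd u = snd v - {k}
     then ksgn k (snd u) (contraction_coeff (F k) (fst u) (fst v)) else 0)"

lemma mon_dvd_add_iff: "mon_dvd \<theta> \<sigma> \<and> \<tau> = \<sigma> - \<theta> \<longleftrightarrow> \<sigma> = \<tau> + \<theta>"
proof
  assume *: "mon_dvd \<theta> \<sigma> \<and> \<tau> = \<sigma> - \<theta>"
  then have le: "Poly_Mapping.lookup \<theta> i \<le> Poly_Mapping.lookup \<sigma> i" for i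
    by (simp add: mon_dvd_def)
  show "\<sigma> = \<tau> + \<theta>"
    by (rule poly_mapping_eqI) (use * le in \<open>simp add: lookup_add lookup_minus\<close>)
qed (auto simp: mon_dvd_def lookup_add)

lemma lookup_psi_single:
  "Poly_Mapping.lookup (psi (Poly_Mapping.single \<sigma> 1) p) \<tau> = contraction_coeff p \<tau> \<sigma>"
proof -
  have "Poly_Mapping.lookup (psi_mon c \<sigma> \<theta>) \<tau> = (if expo_block BlockX \<sigma> = expo_block BlockX \<tau> + expo_block BlockX \<theta> \<and>
        expo_block BlockY \<sigma> = expo_block BlockY \<tau> + expo_block BlockY \<theta> \<and>
        expo_block BlockZ \<tau> = expo_block BlockZ \<sigma> + expo_block BlockZ \<theta> then c else 0)" for \<theta> and c :: 'a
  proof -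
    obtain a b e a' b' e' a'' b'' e'' where "\<sigma> = (a, b, e)" "\<theta> = (a', b', e')" "\<tau> = (a'', b'', e'')"
      by (metis prod_cases3)
    then show ?thesis
      using mon_dvd_add_iff[of a' a a''] mon_dvd_add_iff[of b' b b'']
      by (auto simp: lookup_single when_def add.commute)
  qed
  then show ?thesis
    by (simp add: psi_def contraction_coeff_def lookup_sum)
qed

lemma lookup_scaled_tensor:
  "Poly_Mapping.lookup (scaled_tensor c l I) (\<tau>, J) = (if J = I then c * Poly_Mapping.lookup l \<tau> else 0)"
  by (auto simp: scaled_tensor_def lookup_sum lookup_single when_def in_keys_iff sum.delta')

lemma card_below_nth_sorted:
  fixes xs :: "nat list"
  assumes "sorted xs" "distinct xs" "i < length xs"
  shows "card {j\<in>set xs. j < xs ! i} = i"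
proof -
  have s: "sorted_wrt (<) xs"
    using assms by (simp add: strict_sorted_iff)
  have "{j\<in>set xs. j < xs ! i} = (!) xs ` {..<i}"
  proof (intro equalityI subsetI)
    fix j assume "j \<in> {j\<in>set xs. j < xs ! i}"
    then obtain k where k: "k < length xs" "j = xs ! k" "xs ! k < xs ! i"
      by (auto simp: in_set_conv_nth)
    have "k < i"
    proof (rule ccontr)
      assume "\<not> k < i"
      then have "xs ! i \<le> xs ! k"
        using assms k by (simp add: sorted_nth_mono)
      then show False
        using k by simp
    qed
    then show "j \<in> (!) xs ` {..<i}"
      using k by auto
  next
    fix j assume "j \<in> (!) xs ` {..<i}"
    then show "j \<in> {j\<in>set xs. j < xs ! i}"
      using s assms(3) by (auto simp: sorted_wrt_nth_less)
  qed
  moreover have "inj_on ((!) xs) {..<i}"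
    using assms by (auto simp: inj_on_def nth_eq_iff_index_eq)
  ultimately show ?thesis
    by (simp add: card_image)
qed

lemma ksgn_eq_mult: "ksgn k J (c :: 'r::comm_ring_1) = (-1) ^ card {j\<in>J. j < k} * c"
  by (auto simp: ksgn_def)

text \<open>The i-th smallest element of \<open>I\<close> has i - 1 elements below it, so the sign
  by position is \<open>ksgn\<close>. The cardinality hypothesis makes the positions 1 to nx + ny +
  1 run over all of \<open>I\<close>.\<close>

lemma lookup_delta1:
  assumes "card I = nx + ny + 1"
  shows "Poly_Mapping.lookup (delta1 nx ny F (Poly_Mapping.single (\<sigma>, I) 1)) (\<tau>, J) = delta_entry F (\<tau>, J) (\<sigma>, I)"
proof -
  have fin: "finite I"
    using assms by (metis add_is_0 card.infinite one_neq_zero)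
  define xs where "xs = sorted_list_of_set I"
  have xs: "sorted xs" "distinct xs" "set xs = I" "length xs = nx + ny + 1"
    using fin assms by (auto simp: xs_def)
  let ?g = "\<lambda>k. if J = I - {k} then (-1) ^ card {j\<in>I. j < k} * contraction_coeff (F k) \<tau> \<sigma> else 0"
  have "Poly_Mapping.lookup (delta1 nx ny F (Poly_Mapping.single (\<sigma>, I) 1)) (\<tau>, J) =
      (\<Sum>i = 1..nx+ny+1. if J = I - {xs ! (i - 1)} then (-1) ^ (i - 1) * contraction_coeff (F (xs ! (i - 1))) \<tau> \<sigma> else 0)"
    by (simp add: delta1_def lookup_sum Let_def lookup_scaled_tensor lookup_psi_single xs_def del: sum.cl_ivl_Suc cong: if_cong)
  also have "\<dots> = (\<Sum>i = 1..nx+ny+1. ?g (xs ! (i - 1)))"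
    using card_below_nth_sorted[OF xs(1,2)] xs(3,4) by (intro sum.cong) auto
  also have "\<dots> = (\<Sum>i<nx+ny+1. ?g (xs ! i))"
    by (rule sum.reindex_bij_witness[of _ "\<lambda>i. i + 1" "\<lambda>i. i - 1"]) auto
  also have "\<dots> = (\<Sum>k\<in>I. ?g k)"
    using sum.reindex_bij_betw[OF bij_betw_nth[OF xs(2), of "{..<nx+ny+1}" I], of ?g] xs(3,4) by simp
  also have "\<dots> = delta_entry F (\<tau>, J) (\<sigma>, I)"
    unfolding delta_entry_def ksgn_eq_mult fst_conv snd_conv
  proof (intro sum.cong refl)
    fix k
    show "?g k = (if J = I - {k} then (- 1) ^ card {j\<in>J. j < k} * contraction_coeff (F k) \<tau> \<sigma> else 0)"
    proof (cases "J = I - {k}")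
      case True
      then have "{j\<in>I. j < k} = {j\<in>J. j < k}"
        by auto
      then show ?thesis
        by simp
    qed simp
  qed
  finally show ?thesis .
qed

section \<open>Laurent exponents of the basis elements\<close>

definition block_vars :: "block \<Rightarrow> nat \<Rightarrow> (block \<times> nat) list" where
  "block_vars b n = map (Pair b) [0..<n + 1]"

text \<open>The exponent of the Laurent monomial that represents a basis element; a dual monomial
  \<open>\<partial>x\<^sup>\<sigma>\<close> is represented by \<open>x\<^bsup>-1-\<sigma>\<^esup>\<close>.\<close>

definition kexp :: "nat \<Rightarrow> nat \<Rightarrow> expo \<Rightarrow> lexpo" where
  "kexp nx ny \<sigma> = (\<Sum>v\<in>set (block_vars BlockX nx @ block_vars BlockY ny). Poly_Mapping.single v (- 1)) +
     lexp (0, 0, expo_block BlockZ \<sigma>) - lexp (expo_block BlockX \<sigma>, expo_block BlockY \<sigma>, 0)"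

lemma lookup_kexp:
  "Poly_Mapping.lookup (kexp nx ny \<sigma>) (BlockX, i) = (if i \<le> nx then - 1 else 0) - int (Poly_Mapping.lookup (expo_block BlockX \<sigma>) i)"
  "Poly_Mapping.lookup (kexp nx ny \<sigma>) (BlockY, i) = (if i \<le> ny then - 1 else 0) - int (Poly_Mapping.lookup (expo_block BlockY \<sigma>) i)"
  "Poly_Mapping.lookup (kexp nx ny \<sigma>) (BlockZ, i) = int (Poly_Mapping.lookup (expo_block BlockZ \<sigma>) i)"
  by (auto simp: kexp_def lookup_add lookup_minus lookup_sum lookup_single when_def lookup_lexp
      block_vars_def sum.delta' image_iff)

text \<open>Contraction subtracts from a dual exponent, and negation turns this into addition; thus
  contraction in x and y and multiplication in z become one addition of
  \<open>lexp \<theta>\<close>.\<close>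

lemma kexp_eq_iff:
  "kexp nx ny \<tau> = kexp nx ny \<sigma> + lexp \<theta> \<longleftrightarrow>
    expo_block BlockX \<sigma> = expo_block BlockX \<tau> + expo_block BlockX \<theta> \<and>
    expo_block BlockY \<sigma> = expo_block BlockY \<tau> + expo_block BlockY \<theta> \<and>
    expo_block BlockZ \<tau> = expo_block BlockZ \<sigma> + expo_block BlockZ \<theta>"
proof
  assume *: "kexp nx ny \<tau> = kexp nx ny \<sigma> + lexp \<theta>"
  have e: "Poly_Mapping.lookup (kexp nx ny \<tau>) (b, i) = Poly_Mapping.lookup (kexp nx ny \<sigma>) (b, i) + int (Poly_Mapping.lookup (expo_block b \<theta>) i)" for b i
    by (simp add: * lookup_add lookup_lexp)
  show "expo_block BlockX \<sigma> = expo_block BlockX \<tau> + expo_block BlockX \<theta> \<and>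
    expo_block BlockY \<sigma> = expo_block BlockY \<tau> + expo_block BlockY \<theta> \<and>
    expo_block BlockZ \<tau> = expo_block BlockZ \<sigma> + expo_block BlockZ \<theta>"
  proof (intro conjI poly_mapping_eqI)
    fix i
    show "Poly_Mapping.lookup (expo_block BlockX \<sigma>) i = Poly_Mapping.lookup (expo_block BlockX \<tau> + expo_block BlockX \<theta>) i"
      using e[of BlockX i] by (simp add: lookup_kexp lookup_add)
    show "Poly_Mapping.lookup (expo_block BlockY \<sigma>) i = Poly_Mapping.lookup (expo_block BlockY \<tau> + expo_block BlockY \<theta>) i"
      using e[of BlockY i] by (simp add: lookup_kexp lookup_add)
    show "Poly_Mapping.lookup (expo_block BlockZ \<tau>) i = Poly_Mapping.lookup (expo_block BlockZ \<sigma> + expo_block BlockZ \<theta>) i"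
      using e[of BlockZ i] by (simp add: lookup_kexp lookup_add)
  qed
next
  assume *: "expo_block BlockX \<sigma> = expo_block BlockX \<tau> + expo_block BlockX \<theta> \<and>
    expo_block BlockY \<sigma> = expo_block BlockY \<tau> + expo_block BlockY \<theta> \<and>
    expo_block BlockZ \<tau> = expo_block BlockZ \<sigma> + expo_block BlockZ \<theta>"
  show "kexp nx ny \<tau> = kexp nx ny \<sigma> + lexp \<theta>"
  proof (rule poly_mapping_eqI)
    fix v :: "block \<times> nat"
    obtain b i where "v = (b, i)" by (cases v)
    then show "Poly_Mapping.lookup (kexp nx ny \<tau>) v = Poly_Mapping.lookup (kexp nx ny \<sigma> + lexp \<theta>) v"
      using * by (cases b) (simp_all add: lookup_kexp lookup_add lookup_lexp)
  qed
qed

lemma kexp_inj: "kexp nx ny \<sigma> = kexp nx ny \<tau> \<longleftrightarrow> \<sigma> = \<tau>"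
proof
  assume "kexp nx ny \<sigma> = kexp nx ny \<tau>"
  then have "kexp nx ny \<sigma> = kexp nx ny \<tau> + lexp 0"
    by simp
  then show "\<sigma> = \<tau>"
    unfolding kexp_eq_iff by (cases \<sigma>; cases \<tau>) (simp add: zero_prod_def)
qed simp

lemma contraction_coeff_kexp:
  "contraction_coeff p \<tau> \<sigma> = (\<Sum>\<theta>\<in>Poly_Mapping.keys p. if kexp nx ny \<tau> = kexp nx ny \<sigma> + lexp \<theta> then Poly_Mapping.lookup p \<theta> else 0)"
  unfolding contraction_coeff_def kexp_eq_iff ..

text \<open>All \<open>x\<close> and \<open>y\<close> have negative and all \<open>zs\<close> nonnegative exponents; \<open>zs\<close> lacks \<open>z\<^sub>k\<close> when the
  system is restricted to \<open>z\<^sub>k = 0\<close>.\<close>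

abbreviation kregion :: "nat \<Rightarrow> nat \<Rightarrow> (block \<times> nat) list \<Rightarrow> lexpo set" where
  "kregion nx ny zs \<equiv> region (block_vars BlockX nx) (block_vars BlockY ny) zs
     (length (block_vars BlockX nx), False) (length (block_vars BlockY ny), False) (0, False)"

lemma length_block_vars [simp]: "length (block_vars b n) = n + 1"
  and nth_block_vars: "i \<le> n \<Longrightarrow> block_vars b n ! i = (b, i)"
  and set_block_vars: "set (block_vars b n) = Pair b ` {..n}"
  and distinct_block_vars: "distinct (block_vars b n)"
  by (auto simp: block_vars_def distinct_map inj_on_def nth_append simp del: upt_Suc)

lemma kregion_iff:
  assumes "set zs \<subseteq> {BlockZ} \<times> UNIV"
  shows "\<tau> \<in> kregion nx ny zs \<longleftrightarrow> (\<forall>i\<le>nx. Poly_Mapping.lookup \<tau> (BlockX, i) < 0) \<and>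
    (\<forall>i\<le>ny. Poly_Mapping.lookup \<tau> (BlockY, i) < 0) \<and> (\<forall>i. Poly_Mapping.lookup \<tau> (BlockZ, i) \<ge> 0) \<and>
    (\<forall>i>nx. Poly_Mapping.lookup \<tau> (BlockX, i) = 0) \<and> (\<forall>i>ny. Poly_Mapping.lookup \<tau> (BlockY, i) = 0) \<and>
    (\<forall>i. (BlockZ, i) \<notin> set zs \<longrightarrow> Poly_Mapping.lookup \<tau> (BlockZ, i) = 0)" (is "_ \<longleftrightarrow> ?R")
proof -
  have x: "blk (block_vars b n) (length (block_vars b n)) False \<tau> \<longleftrightarrow> (\<forall>i\<le>n. Poly_Mapping.lookup \<tau> (b, i) < 0)" for b n
    by (auto simp: blk_def nth_block_vars less_Suc_eq_le)
  have z: "blk zs 0 False \<tau> \<longleftrightarrow> (\<forall>v\<in>set zs. Poly_Mapping.lookup \<tau> v \<ge> 0)"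
    by (simp add: blk_def all_set_conv_all_nth)
  have all: "(\<forall>v. P v) \<longleftrightarrow> (\<forall>i. P (BlockX, i)) \<and> (\<forall>i. P (BlockY, i)) \<and> (\<forall>i. P (BlockZ, i))" for P :: "block \<times> nat \<Rightarrow> bool"
  proof (intro iffI allI)
    fix v :: "block \<times> nat" assume h: "(\<forall>i. P (BlockX, i)) \<and> (\<forall>i. P (BlockY, i)) \<and> (\<forall>i. P (BlockZ, i))"
    obtain b i where "v = (b, i)" by (cases v)
    then show "P v"
      using h by (cases b) auto
  qed auto
  have n: "(BlockX, i) \<notin> set zs" "(BlockY, i) \<notin> set zs" for i
    using assms by auto
  have out: "(\<forall>v. v \<notin> set (block_vars BlockX nx) \<union> set (block_vars BlockY ny) \<union> set zs \<longrightarrow> Poly_Mapping.lookup \<tau> v = 0) \<longleftrightarrow>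
    (\<forall>i>nx. Poly_Mapping.lookup \<tau> (BlockX, i) = 0) \<and> (\<forall>i>ny. Poly_Mapping.lookup \<tau> (BlockY, i) = 0) \<and>
    (\<forall>i. (BlockZ, i) \<notin> set zs \<longrightarrow> Poly_Mapping.lookup \<tau> (BlockZ, i) = 0)"
    unfolding all set_block_vars using n by (simp add: image_iff not_le)
  have zz: "(\<forall>v\<in>set zs. Poly_Mapping.lookup \<tau> v \<ge> 0) \<and> (\<forall>i. (BlockZ, i) \<notin> set zs \<longrightarrow> Poly_Mapping.lookup \<tau> (BlockZ, i) = 0) \<longleftrightarrow>
    (\<forall>i. Poly_Mapping.lookup \<tau> (BlockZ, i) \<ge> 0) \<and> (\<forall>i. (BlockZ, i) \<notin> set zs \<longrightarrow> Poly_Mapping.lookup \<tau> (BlockZ, i) = 0)"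
    (is "?A \<longleftrightarrow> ?B")
  proof
    assume A: ?A
    have "Poly_Mapping.lookup \<tau> (BlockZ, i) \<ge> 0" for i
      using A by (cases "(BlockZ, i) \<in> set zs") auto
    then show ?B using A by blast
  next
    assume ?B
    then show ?A using assms by auto
  qed
  show ?thesis
    unfolding region_def mem_Collect_eq fst_conv snd_conv x z out using zz by blast
qed

lemma keys_subset_atMost_iff:
  fixes s :: "nat \<Rightarrow>\<^sub>0 nat"
  shows "Poly_Mapping.keys s \<subseteq> {..n} \<longleftrightarrow> (\<forall>i>n. Poly_Mapping.lookup s i = 0)"
proof -
  have "Poly_Mapping.keys s \<subseteq> {..n} \<longleftrightarrow> (\<forall>i. Poly_Mapping.lookup s i \<noteq> 0 \<longrightarrow> i \<le> n)"
    by (auto simp: subset_iff in_keys_iff)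
  then show ?thesis
    by (metis not_le)
qed

text \<open>The offsets nx + 1 and ny + 1 come from the -1 that each x- and y-variable contributes
  to \<open>kexp\<close>.\<close>

lemma expos_iff_kexp:
  "\<sigma> \<in> expos nx ny nz (dx, dy, dz) \<longleftrightarrow>
    kexp nx ny \<sigma> \<in> kregion nx ny (block_vars BlockZ nz) \<and>
    bdeg BlockX (kexp nx ny \<sigma>) = - dx - (int nx + 1) \<and> bdeg BlockY (kexp nx ny \<sigma>) = - dy - (int ny + 1) \<and>
    bdeg BlockZ (kexp nx ny \<sigma>) = dz"
proof -
  obtain a b c where \<sigma>: "\<sigma> = (a, b, c)" by (metis prod_cases3)
  have mem: "kexp nx ny \<sigma> \<in> kregion nx ny (block_vars BlockZ nz) \<longleftrightarrow>
      Poly_Mapping.keys a \<subseteq> {..nx} \<and> Poly_Mapping.keys b \<subseteq> {..ny} \<and> Poly_Mapping.keys c \<subseteq> {..nz}"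
    by (subst kregion_iff) (auto simp: keys_subset_atMost_iff lookup_kexp \<sigma> set_block_vars not_le image_iff)
  have bl: "fst ` set (block_vars b n) \<subseteq> {b}" for b n
    by (auto simp: set_block_vars)
  have di: "distinct (block_vars BlockX nx @ block_vars BlockY ny @ block_vars BlockZ nz)"
    by (auto simp: distinct_block_vars set_block_vars)
  have S: "(\<Sum>v\<in>set (block_vars b n). g v) = (\<Sum>i\<le>n. g (b, i))" for g :: "block \<times> nat \<Rightarrow> int" and b n
    unfolding set_block_vars by (subst sum.reindex) (auto simp: inj_on_def)
  show ?thesis
  proof (cases "kexp nx ny \<sigma> \<in> kregion nx ny (block_vars BlockZ nz)")
    case True
    show ?thesis
      unfolding bdeg_region[OF True di bl bl bl] S
      using True mem by (auto simp: lookup_kexp \<sigma> block_expos_def sum_subtractf)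
  next
    case False
    then show ?thesis
      using mem by (auto simp: \<sigma> block_expos_def)
  qed
qed

text \<open>Together with injectivity of \<open>kexp\<close>, this makes chains on the region the
  same as coordinate vectors, so that no exponent is missed in passing between them.\<close>

lemma kregion_imp_kexp:
  assumes "set zs \<subseteq> {BlockZ} \<times> UNIV" "\<rho> \<in> kregion nx ny zs"
  shows "\<exists>\<sigma>. \<rho> = kexp nx ny \<sigma>"
proof -
  note r = assms(2)[unfolded kregion_iff[OF assms(1)]]
  define A where "A = snd ` set zs"
  have A: "finite A" "\<And>i. i \<notin> A \<Longrightarrow> (BlockZ, i) \<notin> set zs"
    by (force simp: A_def)+
  define a where "a = (\<Sum>i\<le>nx. Poly_Mapping.single i (nat (- 1 - Poly_Mapping.lookup \<rho> (BlockX, i))))"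
  define b where "b = (\<Sum>i\<le>ny. Poly_Mapping.single i (nat (- 1 - Poly_Mapping.lookup \<rho> (BlockY, i))))"
  define c where "c = (\<Sum>i\<in>A. Poly_Mapping.single i (nat (Poly_Mapping.lookup \<rho> (BlockZ, i))))"
  have l: "Poly_Mapping.lookup a i = (if i \<le> nx then nat (- 1 - Poly_Mapping.lookup \<rho> (BlockX, i)) else 0)"
    "Poly_Mapping.lookup b i = (if i \<le> ny then nat (- 1 - Poly_Mapping.lookup \<rho> (BlockY, i)) else 0)"
    "Poly_Mapping.lookup c i = (if i \<in> A then nat (Poly_Mapping.lookup \<rho> (BlockZ, i)) else 0)" for i
    using A(1) by (auto simp: a_def b_def c_def lookup_sum lookup_single when_def)
  have "\<rho> = kexp nx ny (a, b, c)"
  proof (rule poly_mapping_eqI)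
    fix v :: "block \<times> nat"
    obtain t i where v: "v = (t, i)" by (cases v)
    have x: "i \<le> nx \<longrightarrow> Poly_Mapping.lookup \<rho> (BlockX, i) < 0" "i > nx \<longrightarrow> Poly_Mapping.lookup \<rho> (BlockX, i) = 0"
      and y: "i \<le> ny \<longrightarrow> Poly_Mapping.lookup \<rho> (BlockY, i) < 0" "i > ny \<longrightarrow> Poly_Mapping.lookup \<rho> (BlockY, i) = 0"
      and z: "Poly_Mapping.lookup \<rho> (BlockZ, i) \<ge> 0" "i \<notin> A \<longrightarrow> Poly_Mapping.lookup \<rho> (BlockZ, i) = 0"
      using r A(2) by blast+
    show "Poly_Mapping.lookup \<rho> v = Poly_Mapping.lookup (kexp nx ny (a, b, c)) v"
      using x y z by (cases t) (auto simp: v lookup_kexp l)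
  qed
  then show ?thesis by blast
qed

section \<open>Coordinate vectors as Koszul chains\<close>

definition chain_of :: "nat \<Rightarrow> nat \<Rightarrow> kbasis set \<Rightarrow> (kbasis \<Rightarrow> 'a) \<Rightarrow> nat set \<Rightarrow> lexpo \<Rightarrow> 'a::comm_monoid_add" where
  "chain_of nx ny S v I \<rho> = (\<Sum>u\<in>S. if snd u = I \<and> kexp nx ny (fst u) = \<rho> then v u else 0)"

lemma chain_of_kexp:
  assumes "finite S"
  shows "chain_of nx ny S v I (kexp nx ny \<sigma>) = (if (\<sigma>, I) \<in> S then v (\<sigma>, I) else 0)"
proof -
  have "chain_of nx ny S v I (kexp nx ny \<sigma>) = (\<Sum>u\<in>S. if u = (\<sigma>, I) then v u else 0)"
    unfolding chain_of_def kexp_inj by (intro sum.cong if_cong) auto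
  then show ?thesis
    using assms by simp
qed

lemma chain_of_nonzero:
  assumes "chain_of nx ny S v I \<rho> \<noteq> 0"
  obtains \<sigma> where "(\<sigma>, I) \<in> S" "\<rho> = kexp nx ny \<sigma>"
proof -
  have "\<exists>u\<in>S. (if snd u = I \<and> kexp nx ny (fst u) = \<rho> then v u else 0) \<noteq> 0"
  proof (rule ccontr)
    assume "\<not> ?thesis"
    then have "chain_of nx ny S v I \<rho> = 0"
      unfolding chain_of_def by (intro sum.neutral) blast
    then show False
      using assms by simp
  qed
  then obtain u where "u \<in> S" "snd u = I" "kexp nx ny (fst u) = \<rho>"
    by (auto split: if_splits)
  then show ?thesis
    using that[of "fst u"] by auto
qed

lemma act_map_expo:
  "act D (map_expo h p) a \<tau> = (\<Sum>\<theta>\<in>Poly_Mapping.keys p.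
     if \<tau> \<in> D \<and> \<tau> - h \<theta> \<in> D then Poly_Mapping.lookup p \<theta> * a (\<tau> - h \<theta>) else 0)"
  unfolding map_expo_def' act_sum sum_fun_apply act_single ..

text \<open>Identifies the matrix of \<open>delta_entry\<close> with the Koszul differential.
  Truncation to \<open>D\<close> loses nothing, because the exponents of all elements of
  \<open>S\<close> lie in \<open>D\<close>.\<close>

lemma (in koszul) bd_chain_of:
  assumes F: "\<And>l. l \<in> N \<Longrightarrow> F l = map_expo lexp (g l)"
    and S: "finite S" "\<And>u. u \<in> S \<Longrightarrow> kexp nx ny (fst u) \<in> D \<and> snd u \<subseteq> N" and \<tau>: "kexp nx ny \<tau> \<in> D"
  shows "bd D (chain_of nx ny S v) J (kexp nx ny \<tau>) = (\<Sum>u\<in>S. delta_entry g (\<tau>, J) u * v u)"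
proof -
  let ?\<omega> = "chain_of nx ny S v" and ?e = "kexp nx ny"
  have T: "Fop D l (?\<omega> (insert l J)) (?e \<tau>) =
      (\<Sum>u\<in>S. if snd u = insert l J then contraction_coeff (g l) \<tau> (fst u) * v u else 0)"
    if l: "l \<in> N" for l
  proof -
    have "Fop D l (?\<omega> (insert l J)) (?e \<tau>) = (\<Sum>\<theta>\<in>Poly_Mapping.keys (g l).
        if ?e \<tau> - lexp \<theta> \<in> D then Poly_Mapping.lookup (g l) \<theta> * ?\<omega> (insert l J) (?e \<tau> - lexp \<theta>) else 0)"
      using \<tau> l by (simp add: Fop_def F act_map_expo)
    also have "\<dots> = (\<Sum>\<theta>\<in>Poly_Mapping.keys (g l). Poly_Mapping.lookup (g l) \<theta> * ?\<omega> (insert l J) (?e \<tau> - lexp \<theta>))"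
    proof (intro sum.cong refl)
      fix \<theta>
      have "?\<omega> (insert l J) (?e \<tau> - lexp \<theta>) = 0" if "?e \<tau> - lexp \<theta> \<notin> D"
      proof (rule ccontr)
        assume "?\<omega> (insert l J) (?e \<tau> - lexp \<theta>) \<noteq> 0"
        then obtain \<sigma> where "(\<sigma>, insert l J) \<in> S" "?e \<tau> - lexp \<theta> = ?e \<sigma>"
          by (rule chain_of_nonzero)
        then show False
          using S(2)[of "(\<sigma>, insert l J)"] that by simp
      qed
      then show "(if ?e \<tau> - lexp \<theta> \<in> D then Poly_Mapping.lookup (g l) \<theta> * ?\<omega> (insert l J) (?e \<tau> - lexp \<theta>) else 0) =
          Poly_Mapping.lookup (g l) \<theta> * ?\<omega> (insert l J) (?e \<tau> - lexp \<theta>)"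
        by simp
    qed
    also have "\<dots> = (\<Sum>\<theta>\<in>Poly_Mapping.keys (g l). \<Sum>u\<in>S. if snd u = insert l J then
        (if ?e \<tau> = ?e (fst u) + lexp \<theta> then Poly_Mapping.lookup (g l) \<theta> else 0) * v u else 0)"
      unfolding chain_of_def sum_distrib_left
      by (intro sum.cong refl) (auto simp: algebra_simps)
    also have "\<dots> = (\<Sum>u\<in>S. if snd u = insert l J then contraction_coeff (g l) \<tau> (fst u) * v u else 0)"
      by (subst sum.swap, intro sum.cong refl)
        (simp add: contraction_coeff_kexp[of _ _ _ nx ny] sum_distrib_right)
    finally show ?thesis .
  qed
  have E: "delta_entry g (\<tau>, J) u = (\<Sum>l\<in>N - J. if snd u = insert l J then ksgn l J (contraction_coeff (g l) \<tau> (fst u)) else 0)"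
    if u: "u \<in> S" for u
  proof -
    have sub: "snd u \<subseteq> N" "finite (snd u)"
      using S(2)[OF u] finN finite_subset by auto
    have "{k \<in> snd u. J = snd u - {k}} = {l \<in> N - J. snd u = insert l J}"
      using sub(1) by auto
    then have "(\<Sum>k | k \<in> snd u \<and> J = snd u - {k}. ksgn k J (contraction_coeff (g k) \<tau> (fst u))) =
        (\<Sum>l | l \<in> N - J \<and> snd u = insert l J. ksgn l J (contraction_coeff (g l) \<tau> (fst u)))"
      by simp
    then show ?thesis
      using sub(2) finN by (simp add: delta_entry_def sum.If_cases Int_def)
  qed
  have "bd D ?\<omega> J (?e \<tau>) = (\<Sum>l\<in>N - J. \<Sum>u\<in>S.
      (if snd u = insert l J then ksgn l J (contraction_coeff (g l) \<tau> (fst u)) else 0) * v u)"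
    unfolding contract_def sum_fun_apply ksgn_fun
  proof (intro sum.cong refl)
    fix l assume "l \<in> N - J"
    then have l: "l \<in> N" by simp
    show "ksgn l J (Fop D l (?\<omega> (insert l J)) (?e \<tau>)) =
        (\<Sum>u\<in>S. (if snd u = insert l J then ksgn l J (contraction_coeff (g l) \<tau> (fst u)) else 0) * v u)"
      unfolding T[OF l] ksgn_sum by (intro sum.cong refl) (simp add: ksgn_def)
  qed
  also have "\<dots> = (\<Sum>u\<in>S. delta_entry g (\<tau>, J) u * v u)"
    by (subst sum.swap) (simp add: E sum_distrib_right)
  finally show ?thesis .
qed

section \<open>The modules \<open>K\<^sub>1\<close> and \<open>K\<^sub>0\<close>\<close>

lemma finite_block_expos: "finite (block_expos m d)"
proof (rule finite_imageD)
  let ?h = "\<lambda>\<sigma> :: nat \<Rightarrow>\<^sub>0 nat. \<lambda>i\<in>{..m}. Poly_Mapping.lookup \<sigma> i"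
  have "?h ` block_expos m d \<subseteq> PiE {..m} (\<lambda>_. {..nat d})"
  proof (intro image_subsetI PiE_I)
    fix \<sigma> i assume \<sigma>: "\<sigma> \<in> block_expos m d" and i: "i \<in> {..m}"
    have "Poly_Mapping.lookup \<sigma> i \<le> (\<Sum>i\<le>m. Poly_Mapping.lookup \<sigma> i)"
      using i by (intro member_le_sum) auto
    moreover have "d = int (\<Sum>i\<le>m. Poly_Mapping.lookup \<sigma> i)"
      using \<sigma> by (simp add: block_expos_def)
    ultimately show "(\<lambda>i\<in>{..m}. Poly_Mapping.lookup \<sigma> i) i \<in> {..nat d}"
      using i by (simp del: of_nat_sum)
  qed auto
  then show "finite (?h ` block_expos m d)"
    by (rule finite_subset) (intro finite_PiE, auto)
  show "inj_on ?h (block_expos m d)"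
  proof (rule inj_onI)
    fix \<sigma> \<tau> assume *: "\<sigma> \<in> block_expos m d" "\<tau> \<in> block_expos m d" "?h \<sigma> = ?h \<tau>"
    show "\<sigma> = \<tau>"
    proof (rule poly_mapping_eqI)
      fix i
      show "Poly_Mapping.lookup \<sigma> i = Poly_Mapping.lookup \<tau> i"
      proof (cases "i \<le> m")
        case True
        then show ?thesis
          using fun_cong[OF *(3), of i] by simp
      next
        case False
        then have "i \<notin> Poly_Mapping.keys \<sigma>" "i \<notin> Poly_Mapping.keys \<tau>"
          using * by (auto simp: block_expos_def)
        then show ?thesis
          by (simp add: in_keys_iff)
      qed
    qed
  qed
qed

lemma finite_expos: "finite (expos nx ny nz d)"
  by (cases d) (simp add: finite_block_expos)

lemma finite_K1_basis: "finite (K1_basis nx ny nz r s)"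
  and finite_K0_basis: "finite (K0_basis nx ny nz r s)"
  by (auto simp: K1_basis_def K0_basis_def finite_block_expos)

lemma bdeg_lexp_expos:
  assumes "\<theta> \<in> expos nx ny nz (dx, dy, dz)"
  shows "bdeg BlockX (lexp \<theta>) = dx" "bdeg BlockY (lexp \<theta>) = dy" "bdeg BlockZ (lexp \<theta>) = dz"
    and "v \<notin> set (block_vars BlockX nx) \<union> set (block_vars BlockY ny) \<union> set (block_vars BlockZ nz) \<Longrightarrow>
      Poly_Mapping.lookup (lexp \<theta>) v = 0"
proof -
  obtain a b c where \<theta>: "\<theta> = (a, b, c)" by (metis prod_cases3)
  let ?A = "set (block_vars BlockX nx) \<union> set (block_vars BlockY ny) \<union> set (block_vars BlockZ nz)"
  have h: "Poly_Mapping.keys a \<subseteq> {..nx}" "int (\<Sum>i\<le>nx. Poly_Mapping.lookup a i) = dx"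
    "Poly_Mapping.keys b \<subseteq> {..ny}" "int (\<Sum>i\<le>ny. Poly_Mapping.lookup b i) = dy"
    "Poly_Mapping.keys c \<subseteq> {..nz}" "int (\<Sum>i\<le>nz. Poly_Mapping.lookup c i) = dz"
    using assms by (auto simp: \<theta> block_expos_def)
  have out: "Poly_Mapping.lookup (lexp \<theta>) v = 0" if "v \<notin> ?A" for v
  proof -
    obtain t i where v: "v = (t, i)" by (cases v)
    show ?thesis
      using that h(1,3,5) unfolding keys_subset_atMost_iff v
      by (cases t) (auto simp: lookup_lexp \<theta> set_block_vars image_iff not_le)
  qed
  then show "v \<notin> ?A \<Longrightarrow> Poly_Mapping.lookup (lexp \<theta>) v = 0" .
  have "Poly_Mapping.keys (lexp \<theta>) \<subseteq> ?A"
    using out by (auto simp: in_keys_iff)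
  then have e: "bdeg t (lexp \<theta>) = (\<Sum>v\<in>?A. if fst v = t then Poly_Mapping.lookup (lexp \<theta>) v else 0)" for t
    by (intro bdeg_superset) auto
  have S: "(\<Sum>v\<in>Pair t ` {..n}. g v) = (\<Sum>i\<le>n. g (t, i))" for g :: "block \<times> nat \<Rightarrow> int" and t n
    by (subst sum.reindex) (auto simp: inj_on_def)
  have "(\<Sum>v\<in>?A. if fst v = BlockX then Poly_Mapping.lookup (lexp \<theta>) v else 0) = (\<Sum>v\<in>Pair BlockX ` {..nx}. Poly_Mapping.lookup (lexp \<theta>) v)"
    by (intro sum.mono_neutral_cong_right) (auto simp: set_block_vars)
  then show "bdeg BlockX (lexp \<theta>) = dx"
    unfolding e using h by (simp add: S lookup_lexp \<theta>)
  have "(\<Sum>v\<in>?A. if fst v = BlockY then Poly_Mapping.lookup (lexp \<theta>) v else 0) = (\<Sum>v\<in>Pair BlockY ` {..ny}. Poly_Mapping.lookup (lexp \<theta>) v)"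
    by (intro sum.mono_neutral_cong_right) (auto simp: set_block_vars)
  then show "bdeg BlockY (lexp \<theta>) = dy"
    unfolding e using h by (simp add: S lookup_lexp \<theta>)
  have "(\<Sum>v\<in>?A. if fst v = BlockZ then Poly_Mapping.lookup (lexp \<theta>) v else 0) = (\<Sum>v\<in>Pair BlockZ ` {..nz}. Poly_Mapping.lookup (lexp \<theta>) v)"
    by (intro sum.mono_neutral_cong_right) (auto simp: set_block_vars)
  then show "bdeg BlockZ (lexp \<theta>) = dz"
    unfolding e using h by (simp add: S lookup_lexp \<theta>)
qed

section \<open>The multidegrees of \<open>K_1\<close> and \<open>K_0\<close>\<close>

definition sys_deg :: "nat \<Rightarrow> block \<Rightarrow> nat \<Rightarrow> int" where
  "sys_deg r b l = (case b of BlockX \<Rightarrow> 1 | BlockY \<Rightarrow> if l \<le> r then 1 else 0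
     | BlockZ \<Rightarrow> if l = 0 \<or> l > r then 1 else 0)"

text \<open>The degree vector \<open>m\<close> of \<open>\<delta>\<^sub>1\<close>.\<close>

definition sys_shift :: "nat \<Rightarrow> nat \<Rightarrow> nat \<Rightarrow> block \<Rightarrow> int" where
  "sys_shift nx ny r b = (case b of BlockX \<Rightarrow> int ny - 1 | BlockY \<Rightarrow> - 1 | BlockZ \<Rightarrow> int nx + int ny - int r + 1)"

lemma sys_deg_sum:
  assumes "I \<subseteq> {0..r+s}"
  defines "a \<equiv> int (card (I \<inter> {1..r}))" and "b \<equiv> int (card (I \<inter> {r+1..r+s}))" and "c \<equiv> int (card (I \<inter> {0}))"
  shows "(\<Sum>i\<in>I. sys_deg r BlockX i) = a + b + c" "(\<Sum>i\<in>I. sys_deg r BlockY i) = a + c"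
    "(\<Sum>i\<in>I. sys_deg r BlockZ i) = b + c" "int (card I) = a + b + c"
    "0 \<le> a" "a \<le> int r" "0 \<le> b" "b \<le> int s" "0 \<le> c" "c \<le> 1"
proof -
  have fin: "finite I"
    using assms(1) finite_subset by blast
  have I: "I = (I \<inter> {1..r}) \<union> (I \<inter> {r+1..r+s}) \<union> (I \<inter> {0})"
    using assms(1) by (auto simp: Suc_le_eq)
  have S: "(\<Sum>i\<in>I. g i) = (\<Sum>i\<in>I \<inter> {1..r}. g i) + (\<Sum>i\<in>I \<inter> {r+1..r+s}. g i) + (\<Sum>i\<in>I \<inter> {0}. g i)" for g :: "nat \<Rightarrow> int"
  proof -
    have "(\<Sum>i\<in>I. g i) = (\<Sum>i\<in>(I \<inter> {1..r}) \<union> (I \<inter> {r+1..r+s}). g i) + (\<Sum>i\<in>I \<inter> {0}. g i)"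
      using fin by (subst I, subst sum.union_disjoint) auto
    also have "(\<Sum>i\<in>(I \<inter> {1..r}) \<union> (I \<inter> {r+1..r+s}). g i) = (\<Sum>i\<in>I \<inter> {1..r}. g i) + (\<Sum>i\<in>I \<inter> {r+1..r+s}. g i)"
      using fin by (intro sum.union_disjoint) auto
    finally show ?thesis .
  qed
  show "(\<Sum>i\<in>I. sys_deg r BlockX i) = a + b + c"
    unfolding S by (simp add: sys_deg_def a_def b_def c_def)
  then show "int (card I) = a + b + c"
    by (simp add: sys_deg_def)
  show "(\<Sum>i\<in>I. sys_deg r BlockY i) = a + c"
    unfolding S by (simp add: sys_deg_def a_def b_def c_def)
  show "(\<Sum>i\<in>I. sys_deg r BlockZ i) = b + c"
    unfolding S by (simp add: sys_deg_def a_def b_def c_def)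
  show "0 \<le> a" "0 \<le> b" "0 \<le> c"
    by (auto simp: a_def b_def c_def)
  show "a \<le> int r"
    using card_mono[of "{1..r}" "I \<inter> {1..r}"] by (simp add: a_def)
  show "b \<le> int s"
    using card_mono[of "{r+1..r+s}" "I \<inter> {r+1..r+s}"] by (simp add: b_def)
  show "c \<le> 1"
    using card_mono[of "{0::nat}" "I \<inter> {0}"] by (simp add: c_def)
qed

lemma all_blocks: "(\<forall>b. P b) \<longleftrightarrow> P BlockX \<and> P BlockY \<and> P BlockZ"
  by (metis block.exhaust)

text \<open>Elimination gives \<open>C = a - r\<close>; with \<open>a \<le> r\<close> and
  \<open>0 \<le> C\<close> this forces \<open>a = r\<close> and \<open>C = 0\<close>, leaving one
  summand for each value of \<open>c\<close>.\<close>

lemma K1_arith: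
  fixes a b c A B C nx ny nz r s :: int
  assumes "nx + ny + nz = r + s" "a \<le> r" "0 \<le> c" "c \<le> 1" "0 \<le> C"
  shows "((A = - 1 - (nx + 1) \<and> B = - (r - ny) - (ny + 1) \<and> C = 0) \<and> a = r \<and> b = s - nz + 1 \<and> c = 0 \<or>
    (A = - 1 - (nx + 1) \<and> B = - (r - ny + 1) - (ny + 1) \<and> C = 0) \<and> a = r \<and> b = s - nz \<and> c = 1) \<longleftrightarrow>
    a + b + c = nx + ny + 1 \<and> A = ny - 1 - (a + b + c) \<and> B = - 1 - (a + c) \<and> C = nx + ny - r + 1 - (b + c)" (is "?L \<longleftrightarrow> ?R")
proof
  assume "?L"
  then show "?R"
    using assms(1) by (elim disjE conjE; intro conjI; linarith)
next
  assume R: "?R"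
  then have e: "a + b + c = nx + ny + 1" "A = ny - 1 - (a + b + c)" "B = - 1 - (a + c)" "C = nx + ny - r + 1 - (b + c)"
    by auto
  have "a = r" using e assms by linarith
  moreover have "c = 0 \<or> c = 1" using assms by linarith
  ultimately show "?L"
    using e assms by (elim disjE; simp)
qed

text \<open>Here \<open>C = a - r + 1\<close>, so \<open>a\<close> is \<open>r\<close> or
  \<open>r - 1\<close>; combined with the two values of \<open>c\<close> these are the four
  summands.\<close>

lemma K0_arith:
  fixes a b c A B C nx ny nz r s :: int
  assumes "nx + ny + nz = r + s" "a \<le> r" "0 \<le> c" "c \<le> 1" "0 \<le> C"
  shows "((A = - 0 - (nx + 1) \<and> B = - (r - ny - 1) - (ny + 1) \<and> C = 0) \<and> a = r - 1 \<and> b = s - nz + 1 \<and> c = 0 \<or>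
    (A = - 0 - (nx + 1) \<and> B = - (r - ny) - (ny + 1) \<and> C = 1) \<and> a = r \<and> b = s - nz \<and> c = 0 \<or>
    (A = - 0 - (nx + 1) \<and> B = - (r - ny) - (ny + 1) \<and> C = 0) \<and> a = r - 1 \<and> b = s - nz \<and> c = 1 \<or>
    (A = - 0 - (nx + 1) \<and> B = - (r - ny + 1) - (ny + 1) \<and> C = 1) \<and> a = r \<and> b = s - nz - 1 \<and> c = 1) \<longleftrightarrow>
    a + b + c = nx + ny \<and> A = ny - 1 - (a + b + c) \<and> B = - 1 - (a + c) \<and> C = nx + ny - r + 1 - (b + c)" (is "?L \<longleftrightarrow> ?R")
proof
  assume "?L"
  then show "?R"
    using assms(1) by (elim disjE conjE; intro conjI; linarith)
next
  assume R: "?R"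
  then have e: "a + b + c = nx + ny" "A = ny - 1 - (a + b + c)" "B = - 1 - (a + c)" "C = nx + ny - r + 1 - (b + c)"
    by auto
  have "a = r \<or> a = r - 1" using e assms by linarith
  moreover have "c = 0 \<or> c = 1" using assms by linarith
  ultimately show "?L"
    using e assms by (elim disjE; simp)
qed
text \<open>The two and the four summands collapse to one uniform condition on exterior degree,
  support and multidegree, which is the shape required by the general exactness theorem.\<close>

lemma mem_K_iff:
  assumes "nx + ny + nz = r + s"
  shows "(\<sigma>, I) \<in> K1_basis nx ny nz r s \<longleftrightarrow> I \<subseteq> {0..r+s} \<and> int (card I) = int (nx + ny + 1) \<and>
      kexp nx ny \<sigma> \<in> kregion nx ny (block_vars BlockZ nz) \<and>
      (\<forall>b. bdeg b (kexp nx ny \<sigma>) = sys_shift nx ny r b - (\<Sum>i\<in>I. sys_deg r b i))" (is ?K1)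
    and "(\<sigma>, I) \<in> K0_basis nx ny nz r s \<longleftrightarrow> I \<subseteq> {0..r+s} \<and> int (card I) = int (nx + ny) \<and>
      kexp nx ny \<sigma> \<in> kregion nx ny (block_vars BlockZ nz) \<and>
      (\<forall>b. bdeg b (kexp nx ny \<sigma>) = sys_shift nx ny r b - (\<Sum>i\<in>I. sys_deg r b i))" (is ?K0)
proof -
  let ?R = "kexp nx ny \<sigma> \<in> kregion nx ny (block_vars BlockZ nz)"
  have Z: "bdeg BlockZ (kexp nx ny \<sigma>) \<ge> 0" if ?R
  proof -
    have bl: "fst ` set (block_vars b n) \<subseteq> {b}" for b n
      by (auto simp: set_block_vars)
    have di: "distinct (block_vars BlockX nx @ block_vars BlockY ny @ block_vars BlockZ nz)"
      by (auto simp: distinct_block_vars set_block_vars)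
    show ?thesis
      unfolding bdeg_region(3)[OF that di bl bl bl]
      using that by (intro blk_sum_nonneg) (simp add: region_def)
  qed
  define A B C where "A = bdeg BlockX (kexp nx ny \<sigma>)" and "B = bdeg BlockY (kexp nx ny \<sigma>)" and "C = bdeg BlockZ (kexp nx ny \<sigma>)"
  note ABC = A_def[symmetric] B_def[symmetric] C_def[symmetric]
  have n: "int nx + int ny + int nz = int r + int s"
    using assms by linarith
  show ?K1
  proof (cases "I \<subseteq> {0..r+s} \<and> ?R")
    case True
    note s = sys_deg_sum[OF conjunct1[OF True]]
    have C: "0 \<le> C"
      using Z True by (simp add: C_def)
    show ?thesis
      unfolding K1_basis_def all_blocks Un_iff mem_Times_iff fst_conv snd_conv expos_iff_kexp wedge_sets.simps
        mem_Collect_eq s(1-4) ABC sys_shift_def block.case of_nat_add of_nat_1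
      using True K1_arith[OF n s(6,9,10) C, of A B "int (card (I \<inter> {r + 1..r + s}))"] by blast
  next
    case False
    then show ?thesis
      unfolding K1_basis_def Un_iff mem_Times_iff fst_conv snd_conv expos_iff_kexp wedge_sets.simps by blast
  qed
  show ?K0
  proof (cases "I \<subseteq> {0..r+s} \<and> ?R")
    case True
    note s = sys_deg_sum[OF conjunct1[OF True]]
    have C: "0 \<le> C"
      using Z True by (simp add: C_def)
    have RT: "?R = True" and IT: "(I \<subseteq> {0..r+s}) = True"
      using True by blast+
    show ?thesis
      unfolding K0_basis_def all_blocks Un_iff mem_Times_iff fst_conv snd_conv expos_iff_kexp wedge_sets.simps
        mem_Collect_eq s(1-4) ABC sys_shift_def block.case of_nat_add of_nat_1 RT IT simp_thms disj_assoc
      by (rule K0_arith[OF n s(6,9,10) C])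
  next
    case False
    show ?thesis
    proof (cases "I \<subseteq> {0..r+s}")
      case True
      then have RF: "?R = False"
        using False by blast
      show ?thesis
        unfolding K0_basis_def Un_iff mem_Times_iff fst_conv snd_conv expos_iff_kexp RF simp_thms ..
    next
      case False
      then have IF: "(I \<subseteq> {0..r+s}) = False"
        by blast
      show ?thesis
        unfolding K0_basis_def Un_iff mem_Times_iff fst_conv snd_conv wedge_sets.simps mem_Collect_eq IF simp_thms ..
    qed
  qed
qed

section \<open>Systems without common zeros\<close>

definition no_common_zero ::
  "nat \<Rightarrow> nat \<Rightarrow> nat \<Rightarrow> nat set \<Rightarrow> (nat \<Rightarrow> 'a::field tpoly) \<Rightarrow> bool" where
  "no_common_zero nx ny nz N f \<longleftrightarrow> (\<forall>x\<in>hom_coords nx. \<forall>y\<in>hom_coords ny. \<forall>z\<in>hom_coords nz.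
     \<exists>l\<in>N. teval (x, y, z) (f l) \<noteq> 0)"

lemma teval_cong_forms:
  assumes "p \<in> forms nx ny nz d"
    and "\<And>i. i \<le> nx \<Longrightarrow> x i = x' i" "\<And>i. i \<le> ny \<Longrightarrow> y i = y' i" "\<And>i. i \<le> nz \<Longrightarrow> z i = z' i"
  shows "teval (x, y, z) p = teval (x', y', z') p"
  unfolding teval_def eval_with_def
proof (intro sum.cong refl)
  fix \<theta> assume "\<theta> \<in> Poly_Mapping.keys p"
  then have "\<theta> \<in> expos nx ny nz d"
    using assms(1) by (auto simp: forms_def)
  then have "mon_val3 (x, y, z) \<theta> = mon_val3 (x', y', z') \<theta>"
    using assms(2-4) by (cases \<theta>; cases d) (auto simp: block_expos_def intro!: arg_cong2[where f = "(*)"] mon_val_cong)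
  then show "id (Poly_Mapping.lookup p \<theta>) * mon_val3 (x, y, z) \<theta> = id (Poly_Mapping.lookup p \<theta>) * mon_val3 (x', y', z') \<theta>"
    by simp
qed

section \<open>Restriction to the hyperplane z_k = 0\<close>

definition cut_var :: "nat \<Rightarrow> 'a::comm_ring_1 tpoly \<Rightarrow> 'a tpoly" where
  "cut_var k p = (\<Sum>\<theta>\<in>Poly_Mapping.keys p. if Poly_Mapping.lookup (expo_block BlockZ \<theta>) k = 0
     then Poly_Mapping.single \<theta> (Poly_Mapping.lookup p \<theta>) else 0)"

lemma lookup_cut_var:
  "Poly_Mapping.lookup (cut_var k p) \<theta> = (if Poly_Mapping.lookup (expo_block BlockZ \<theta>) k = 0 then Poly_Mapping.lookup p \<theta> else 0)"
proof -
  have "Poly_Mapping.lookup (cut_var k p) \<theta> = (\<Sum>\<theta>'\<in>Poly_Mapping.keys p. if \<theta>' = \<theta> then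
      (if Poly_Mapping.lookup (expo_block BlockZ \<theta>) k = 0 then Poly_Mapping.lookup p \<theta> else 0) else 0)"
    unfolding cut_var_def lookup_sum by (intro sum.cong refl) (auto simp: lookup_single when_def)
  then show ?thesis
    by (simp add: in_keys_iff)
qed

lemma keys_cut_var: "\<theta> \<in> Poly_Mapping.keys (cut_var k p) \<longleftrightarrow>
    \<theta> \<in> Poly_Mapping.keys p \<and> Poly_Mapping.lookup (expo_block BlockZ \<theta>) k = 0"
  by (auto simp: in_keys_iff lookup_cut_var)

lemma teval_cut_var:
  "teval (x, y, z) (cut_var k p) = teval (x, y, z(k := 0)) p"
proof -
  have "teval (x, y, z) (cut_var k p) = (\<Sum>\<theta>\<in>Poly_Mapping.keys p. Poly_Mapping.lookup (cut_var k p) \<theta> * mon_val3 (x, y, z) \<theta>)"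
    by (rule teval_superset) (auto simp: keys_cut_var)
  also have "\<dots> = (\<Sum>\<theta>\<in>Poly_Mapping.keys p. Poly_Mapping.lookup p \<theta> * mon_val3 (x, y, z(k := 0)) \<theta>)"
  proof (intro sum.cong refl)
    fix \<theta> :: expo
    obtain a b c where \<theta>: "\<theta> = (a, b, c)" by (metis prod_cases3)
    have "mon_val (z(k := 0)) c = (if Poly_Mapping.lookup c k = 0 then mon_val z c else 0)"
    proof (cases "Poly_Mapping.lookup c k = 0")
      case True
      then show ?thesis
        by (auto intro!: mon_val_cong simp: in_keys_iff)
    next
      case False
      then have "k \<in> Poly_Mapping.keys c"
        by (simp add: in_keys_iff)
      then have "mon_val (z(k := 0)) c = 0"
        unfolding mon_val_def using False by (intro prod_zero) (auto intro!: bexI[of _ k] simp: power_0_left)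
      then show ?thesis
        using False by simp
    qed
    then show "Poly_Mapping.lookup (cut_var k p) \<theta> * mon_val3 (x, y, z) \<theta> =
        Poly_Mapping.lookup p \<theta> * mon_val3 (x, y, z(k := 0)) \<theta>"
      by (simp add: \<theta> lookup_cut_var)
  qed
  also have "\<dots> = teval (x, y, z(k := 0)) p"
    by (rule teval_superset[symmetric]) auto
  finally show ?thesis .
qed

section \<open>Bijectivity of \<open>delta1\<close> for systems without common zeros\<close>

locale two_bilinear_system =
  fixes nx ny nz r s :: nat and f :: "nat \<Rightarrow> 'a::{alg_closed_field, field_char_0} tpoly"
  assumes dims: "nx + ny + nz = r + s" "ny \<le> r" "nz \<le> s" "ny \<ge> 1" "nz \<ge> 1"
    and f_forms: "l \<le> r + s \<Longrightarrow> f l \<in> forms nx ny nz (sys_deg r BlockX l, sys_deg r BlockY l, sys_deg r BlockZ l)"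
begin

abbreviation "bX \<equiv> block_vars BlockX nx"
abbreviation "bY \<equiv> block_vars BlockY ny"
abbreviation "bZ \<equiv> block_vars BlockZ nz"
abbreviation "K1 \<equiv> K1_basis nx ny nz r s"
abbreviation "K0 \<equiv> K0_basis nx ny nz r s"

lemma f_keys:
  assumes "l \<le> r + s" "\<theta> \<in> Poly_Mapping.keys (f l)"
  shows "v \<notin> set bX \<union> set bY \<union> set bZ \<Longrightarrow> Poly_Mapping.lookup (lexp \<theta>) v = 0"
    and "bdeg b (lexp \<theta>) = sys_deg r b l"
proof -
  have \<theta>: "\<theta> \<in> expos nx ny nz (sys_deg r BlockX l, sys_deg r BlockY l, sys_deg r BlockZ l)"
    using f_forms[OF assms(1)] assms(2) by (auto simp: forms_def)
  show "v \<notin> set bX \<union> set bY \<union> set bZ \<Longrightarrow> Poly_Mapping.lookup (lexp \<theta>) v = 0"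
    by (rule bdeg_lexp_expos(4)[OF \<theta>])
  show "bdeg b (lexp \<theta>) = sys_deg r b l"
    using bdeg_lexp_expos(1-3)[OF \<theta>] by (cases b) simp_all
qed

lemma blocks_distinct: "distinct (bX @ bY @ bZ)"
  by (auto simp: distinct_block_vars set_block_vars)

lemma fst_block_vars: "fst ` set (block_vars b n) \<subseteq> {b}"
  by (auto simp: set_block_vars)

text \<open>The arithmetic behind \<open>m\<close>. The first three bounds serve as \<open>Z\<close>
  and \<open>Y\<close>, the second one for the system without index 0 and with one z-variable less.
  The next two give exactness in exterior degrees nx + ny + 1 and nx + ny. The last two exclude
  chains of degree nx + ny + 2 and nx + ny - 1.\<close>

lemma shift_bounds:
  assumes "I \<subseteq> {0..r+s}"
  shows "sys_shift nx ny r BlockZ - (\<Sum>i\<in>I. sys_deg r BlockZ i) > - int (nz + 1)"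
    and "0 \<notin> I \<Longrightarrow> sys_shift nx ny r BlockZ - (\<Sum>i\<in>I. sys_deg r BlockZ i) > - int nz"
    and "sys_shift nx ny r BlockY - (\<Sum>i\<in>I. sys_deg r BlockY i) < 0"
    and "int (card I) = int ny \<Longrightarrow> sys_shift nx ny r BlockX - (\<Sum>i\<in>I. sys_deg r BlockX i) < 0"
    and "int (card I) = int ny - 1 \<Longrightarrow> sys_shift nx ny r BlockY - (\<Sum>i\<in>I. sys_deg r BlockY i) > - int (ny + 1)"
    and "int (card I) = int (nx + ny + 2) \<Longrightarrow> sys_shift nx ny r BlockZ - (\<Sum>i\<in>I. sys_deg r BlockZ i) < 0"
    and "int (card I) = int (nx + ny) - 1 \<Longrightarrow> sys_shift nx ny r BlockX - (\<Sum>i\<in>I. sys_deg r BlockX i) > - int (nx + 1)"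
  using sys_deg_sum[OF assms] dims(1) by (auto simp: sys_shift_def)

lemma koszul_full:
  assumes "no_common_zero nx ny nz {0..r+s} f"
  shows "koszul_blocks {0..r+s} (\<lambda>l. map_expo lexp (f l)) (sys_deg r) (sys_shift nx ny r) bX bY bZ"
proof (rule koszul_blocks_of_system[OF _ blocks_distinct fst_block_vars fst_block_vars fst_block_vars])
  fix w :: "block \<times> nat \<Rightarrow> 'a" and i j k
  assume "i < length bX" "j < length bY" "k < length bZ" "w (bX ! i) = 1" "w (bY ! j) = 1" "w (bZ ! k) = 1"
  then have w: "i \<le> nx" "j \<le> ny" "k \<le> nz" "w (BlockX, i) = 1" "w (BlockY, j) = 1" "w (BlockZ, k) = 1"
    by (auto simp: less_Suc_eq_le nth_block_vars)
  \<comment> \<open>Homogeneous coordinates are normalized to 0 beyond the last variable, whereas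
    \<open>w\<close> is arbitrary there; forms do not see the difference.\<close>
  define t where "t n b = (\<lambda>i. if i \<le> n then w (b, i) else 0)" for n :: nat and b
  have "t nx BlockX \<in> hom_coords nx"
    using w by (auto simp: t_def hom_coords_def intro!: exI[of _ i])
  moreover have "t ny BlockY \<in> hom_coords ny"
    using w by (auto simp: t_def hom_coords_def intro!: exI[of _ j])
  moreover have "t nz BlockZ \<in> hom_coords nz"
    using w by (auto simp: t_def hom_coords_def intro!: exI[of _ k])
  ultimately obtain l where l: "l \<in> {0..r+s}" "teval (t nx BlockX, t ny BlockY, t nz BlockZ) (f l) \<noteq> 0"
    using assms unfolding no_common_zero_def by blast
  have "teval (t nx BlockX, t ny BlockY, t nz BlockZ) (f l) = teval (point_of w) (f l)"
    unfolding point_of_def using l(1) by (intro teval_cong_forms[OF f_forms]) (auto simp: t_def)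
  then show "\<exists>l\<in>{0..r+s}. teval (point_of w) (f l) \<noteq> 0"
    using l by auto
qed (use f_keys shift_bounds in auto)

text \<open>Setting z_k to 0 leaves \<open>nz\<close> z-variables and tightens the bound
  \<open>Z\<close> by one; dropping \<open>f 0\<close> gains this one back.\<close>

lemma koszul_cut:
  assumes "k \<le> nz" and "\<And>x y z. x \<in> hom_coords nx \<Longrightarrow> y \<in> hom_coords ny \<Longrightarrow> z \<in> hom_coords nz \<Longrightarrow> z k = 0 \<Longrightarrow>
    \<exists>l\<in>{1..r+s}. teval (x, y, z) (f l) \<noteq> 0"
  shows "koszul_blocks {1..r+s} (\<lambda>l. map_expo lexp (cut_var k (f l))) (sys_deg r) (sys_shift nx ny r) bX bY
    (filter (\<lambda>v. v \<noteq> (BlockZ, k)) bZ)"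
proof (rule koszul_blocks_of_system)
  let ?zs = "filter (\<lambda>v. v \<noteq> (BlockZ, k)) bZ"
  show "distinct (bX @ bY @ ?zs)" "fst ` set ?zs \<subseteq> {BlockZ}" "fst ` set bX \<subseteq> {BlockX}" "fst ` set bY \<subseteq> {BlockY}"
    using blocks_distinct fst_block_vars[of BlockZ nz] fst_block_vars by auto
  show "Poly_Mapping.lookup (lexp \<theta>) v = 0"
    if "l \<in> {1..r+s}" "\<theta> \<in> Poly_Mapping.keys (cut_var k (f l))" "v \<notin> set bX \<union> set bY \<union> set ?zs" for l \<theta> v
    using that f_keys(1)[of l \<theta> v] by (cases "v = (BlockZ, k)") (auto simp: keys_cut_var lookup_lexp)
  show "bdeg b (lexp \<theta>) = sys_deg r b l" if "l \<in> {1..r+s}" "\<theta> \<in> Poly_Mapping.keys (cut_var k (f l))" for l \<theta> b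
    using that f_keys(2)[of l \<theta> b] by (auto simp: keys_cut_var)
  have len: "length ?zs = nz"
  proof -
    have "set ?zs = Pair BlockZ ` ({..nz} - {k})"
      by (auto simp: set_block_vars)
    then have "card (set ?zs) = nz"
      using assms(1) by (simp add: card_image inj_on_def)
    then show ?thesis
      using distinct_card[of ?zs] by (simp add: distinct_block_vars)
  qed
  show "- int (length ?zs) < sys_shift nx ny r BlockZ - (\<Sum>i\<in>I. sys_deg r BlockZ i)"
    if "I \<subseteq> {1..r+s}" for I
    unfolding len using that by (intro shift_bounds(2)) auto
  show "sys_shift nx ny r BlockY - (\<Sum>i\<in>I. sys_deg r BlockY i) < 0" if "I \<subseteq> {1..r+s}" for I
    using that by (intro shift_bounds(3)) auto
  fix w :: "block \<times> nat \<Rightarrow> 'a" and i j k'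
  assume h: "i < length bX" "j < length bY" "k' < length ?zs" "w (bX ! i) = 1" "w (bY ! j) = 1" "w (?zs ! k') = 1"
  have "?zs ! k' \<in> set ?zs"
    using h(3) nth_mem by blast
  then obtain k'' where k'': "?zs ! k' = (BlockZ, k'')" "k'' \<le> nz" "k'' \<noteq> k"
    by (auto simp: set_block_vars)
  have w: "i \<le> nx" "j \<le> ny" "w (BlockX, i) = 1" "w (BlockY, j) = 1" "w (BlockZ, k'') = 1"
    using h k'' by (auto simp: less_Suc_eq_le nth_block_vars)
  define t where "t n b = (\<lambda>i. if i \<le> n \<and> (b, i) \<noteq> (BlockZ, k) then w (b, i) else 0)" for n :: nat and b
  have "t nx BlockX \<in> hom_coords nx"
    using w by (auto simp: t_def hom_coords_def intro!: exI[of _ i])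
  moreover have "t ny BlockY \<in> hom_coords ny"
    using w by (auto simp: t_def hom_coords_def intro!: exI[of _ j])
  moreover have "t nz BlockZ \<in> hom_coords nz" "t nz BlockZ k = 0"
    using w k'' by (auto simp: t_def hom_coords_def intro!: exI[of _ k''])
  ultimately obtain l where l: "l \<in> {1..r+s}" "teval (t nx BlockX, t ny BlockY, t nz BlockZ) (f l) \<noteq> 0"
    using assms(2) by blast
  have "teval (t nx BlockX, t ny BlockY, t nz BlockZ) (f l) = teval (point_of w) (cut_var k (f l))"
    unfolding point_of_def teval_cut_var using l(1) by (intro teval_cong_forms[OF f_forms]) (auto simp: t_def)
  then show "\<exists>l\<in>{1..r+s}. teval (point_of w) (cut_var k (f l)) \<noteq> 0"
    using l by auto
qed auto

lemma bZ_sub: "set bZ \<subseteq> {BlockZ} \<times> UNIV" "set (filter P bZ) \<subseteq> {BlockZ} \<times> UNIV"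
  by (auto simp: set_block_vars)

text \<open>Exactness in exterior degree nx + ny + 1 makes a kernel vector a boundary, and there are
  no chains one degree higher.\<close>

theorem delta_injective:
  assumes nz: "no_common_zero nx ny nz {0..r+s} f"
    and v: "\<And>u. u \<in> K0 \<Longrightarrow> (\<Sum>w\<in>K1. delta_entry f u w * v w) = 0" and w: "w \<in> K1"
  shows "v w = 0"
proof -
  interpret koszul_blocks "{0..r+s}" "\<lambda>l. map_expo lexp (f l)" "sys_deg r" "sys_shift nx ny r" bX bY bZ
    by (rule koszul_full[OF nz])
  let ?D = "kregion nx ny bZ"
  define \<omega> where "\<omega> = chain_of nx ny K1 v"
  have ch: "chain (int (nx + ny + 1)) ?D \<omega>"
    unfolding chain_def
  proof (intro allI impI)
    fix I \<tau> assume "\<omega> I \<tau> \<noteq> 0"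
    then obtain \<sigma> where "(\<sigma>, I) \<in> K1" "\<tau> = kexp nx ny \<sigma>"
      unfolding \<omega>_def by (rule chain_of_nonzero)
    then show "I \<subseteq> {0..r+s} \<and> int (card I) = int (nx + ny + 1) \<and> \<tau> \<in> ?D \<and>
        (\<forall>b. bdeg b \<tau> = sys_shift nx ny r b - (\<Sum>i\<in>I. sys_deg r b i))"
      unfolding mem_K_iff(1)[OF dims(1)] by blast
  qed
  have "bd ?D \<omega> J \<rho> = 0" for J \<rho>
  proof (rule ccontr)
    assume nz: "bd ?D \<omega> J \<rho> \<noteq> 0"
    have "chain (int (nx + ny)) ?D (bd ?D \<omega>)"
      using chain_bd[OF ch] by simp
    then have J: "J \<subseteq> {0..r+s}" "int (card J) = int (nx + ny)" "\<rho> \<in> ?D"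
      "\<forall>b. bdeg b \<rho> = sys_shift nx ny r b - (\<Sum>i\<in>J. sys_deg r b i)"
      using nz unfolding chain_def by blast+
    obtain \<tau> where \<tau>: "\<rho> = kexp nx ny \<tau>"
      using kregion_imp_kexp[OF bZ_sub(1) J(3)] by blast
    have K0: "(\<tau>, J) \<in> K0"
      unfolding mem_K_iff(2)[OF dims(1)] using J \<tau> by blast
    have "bd ?D \<omega> J \<rho> = (\<Sum>u\<in>K1. delta_entry f (\<tau>, J) u * v u)"
      unfolding \<tau> \<omega>_def
    proof (rule bd_chain_of[OF refl finite_K1_basis])
      show "kexp nx ny (fst u) \<in> ?D \<and> snd u \<subseteq> {0..r+s}" if "u \<in> K1" for u
        using that mem_K_iff(1)[OF dims(1), of "fst u" "snd u"] by simp
    qed (use J \<tau> in simp)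
    then show False
      using v[OF K0] nz by simp
  qed
  then have "bd ?D \<omega> = 0"
    by (intro ext) simp
  \<comment> \<open>The level \<open>ny\<close> shifted by the nx + 1 variables of \<open>bX\<close>
    is the exterior degree of \<open>K_1\<close>.\<close>
  moreover have "exact_at ?D (int ny + int (length bX))"
    by (rule exact_inverse_system) (use shift_bounds(4) in blast)
  ultimately obtain \<eta> where \<eta>: "chain (int (nx + ny + 2)) ?D \<eta>" "bd ?D \<eta> = \<omega>"
    using ch unfolding exact_at_def by (auto simp: algebra_simps)
  have "\<eta> = 0"
  proof (intro ext, rule ccontr)
    fix I \<tau> assume "\<eta> I \<tau> \<noteq> 0 I \<tau>"
    then have "\<eta> I \<tau> \<noteq> 0" by simp
    note h = chain_degree[OF \<eta>(1) this]
    show False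
      using shift_bounds(6)[OF h(1,2)] h(8) blk_sum_nonneg[of bZ \<tau>] h(5) by simp
  qed
  then have "\<omega> = 0"
    using bd_diff[of ?D 0 0] \<eta>(2) by simp
  then show ?thesis
    using chain_of_kexp[OF finite_K1_basis, of nx ny nx ny nz r s v "snd w" "fst w"] w by (simp add: \<omega>_def)
qed

text \<open>Elements of \<open>K_1\<close> have z-degree 0 and so live on the hyperplane z_k = 0.
  Only rows without z_k are tested, because the other rows vanish after restriction.\<close>

theorem delta_injective_cut:
  assumes k: "k \<le> nz" and zero: "\<And>x y z. x \<in> hom_coords nx \<Longrightarrow> y \<in> hom_coords ny \<Longrightarrow> z \<in> hom_coords nz \<Longrightarrow> z k = 0 \<Longrightarrow>
      \<exists>l\<in>{1..r+s}. teval (x, y, z) (f l) \<noteq> 0"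
    and v: "\<And>u. u \<in> K0 \<Longrightarrow> 0 \<notin> snd u \<Longrightarrow> Poly_Mapping.lookup (expo_block BlockZ (fst u)) k = 0 \<Longrightarrow>
      (\<Sum>w\<in>{w\<in>K1. 0 \<notin> snd w}. delta_entry f u w * v w) = 0"
    and w: "w \<in> K1" "0 \<notin> snd w"
  shows "v w = 0"
proof -
  define zs where "zs = filter (\<lambda>v. v \<noteq> (BlockZ, k)) bZ"
  interpret koszul_blocks "{1..r+s}" "\<lambda>l. map_expo lexp (cut_var k (f l))" "sys_deg r" "sys_shift nx ny r" bX bY zs
    unfolding zs_def by (rule koszul_cut[OF k zero])
  let ?D = "kregion nx ny zs" and ?S = "{w\<in>K1. 0 \<notin> snd w}"
  have zs: "set zs \<subseteq> {BlockZ} \<times> UNIV"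
    unfolding zs_def by (rule bZ_sub)
  have D: "\<rho> \<in> ?D \<longleftrightarrow> \<rho> \<in> kregion nx ny bZ \<and> Poly_Mapping.lookup \<rho> (BlockZ, k) = 0" for \<rho>
    unfolding kregion_iff[OF zs] kregion_iff[OF bZ_sub(1)] by (auto simp: zs_def)
  have N: "I \<subseteq> {1..r+s} \<longleftrightarrow> I \<subseteq> {0..r+s} \<and> 0 \<notin> I" for I :: "nat set"
    by (auto simp: Suc_le_eq intro!: Nat.gr0I)
  have S: "kexp nx ny (fst u) \<in> ?D \<and> snd u \<subseteq> {1..r+s}" if "u \<in> ?S" for u
  proof -
    have u: "u \<in> K1" "0 \<notin> snd u"
      using that by auto
    then have K: "snd u \<subseteq> {0..r+s}" "kexp nx ny (fst u) \<in> kregion nx ny bZ"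
      using mem_K_iff(1)[OF dims(1), of "fst u" "snd u"] by simp_all
    obtain a b c where e: "fst u = (a, b, c)" by (metis prod_cases3)
    have "c \<in> block_expos nz 0"
      using u(1) e by (auto simp: K1_basis_def)
    then have "(\<Sum>i\<le>nz. Poly_Mapping.lookup c i) = 0"
      by (simp add: block_expos_def del: of_nat_sum)
    then have "Poly_Mapping.lookup c k = 0"
      using k by simp
    then show ?thesis
      unfolding D N lookup_kexp using K u(2) by (simp add: e)
  qed
  define \<omega> where "\<omega> = chain_of nx ny ?S v"
  have fin: "finite ?S"
    using finite_K1_basis by simp
  have ch: "chain (int (nx + ny + 1)) ?D \<omega>"
    unfolding chain_def
  proof (intro allI impI)
    fix I \<tau> assume "\<omega> I \<tau> \<noteq> 0"
    then obtain \<sigma> where \<sigma>: "(\<sigma>, I) \<in> ?S" "\<tau> = kexp nx ny \<sigma>"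
      unfolding \<omega>_def by (rule chain_of_nonzero)
    then have K: "(\<sigma>, I) \<in> K1" by simp
    show "I \<subseteq> {1..r+s} \<and> int (card I) = int (nx + ny + 1) \<and> \<tau> \<in> ?D \<and>
        (\<forall>b. bdeg b \<tau> = sys_shift nx ny r b - (\<Sum>i\<in>I. sys_deg r b i))"
      using S[OF \<sigma>(1)] K unfolding fst_conv snd_conv \<sigma>(2) mem_K_iff(1)[OF dims(1)] by blast
  qed
  have "bd ?D \<omega> J \<rho> = 0" for J \<rho>
  proof (rule ccontr)
    assume nz: "bd ?D \<omega> J \<rho> \<noteq> 0"
    have "chain (int (nx + ny)) ?D (bd ?D \<omega>)"
      using chain_bd[OF ch] by simp
    then have J: "J \<subseteq> {1..r+s}" "int (card J) = int (nx + ny)" "\<rho> \<in> ?D"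
      "\<forall>b. bdeg b \<rho> = sys_shift nx ny r b - (\<Sum>i\<in>J. sys_deg r b i)"
      using nz unfolding chain_def by blast+
    obtain \<tau> where \<tau>: "\<rho> = kexp nx ny \<tau>"
      using kregion_imp_kexp[OF zs J(3)] by blast
    have K0: "(\<tau>, J) \<in> K0" "0 \<notin> J"
      unfolding mem_K_iff(2)[OF dims(1)] using J \<tau> D N by blast+
    have \<tau>k: "Poly_Mapping.lookup (expo_block BlockZ \<tau>) k = 0"
    proof -
      have "Poly_Mapping.lookup \<rho> (BlockZ, k) = 0"
        using J(3) unfolding D by blast
      then show ?thesis
        by (simp add: \<tau> lookup_kexp)
    qed
    have "bd ?D \<omega> J \<rho> = (\<Sum>u\<in>?S. delta_entry (\<lambda>l. cut_var k (f l)) (\<tau>, J) u * v u)"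
      unfolding \<tau> \<omega>_def by (rule bd_chain_of[OF refl fin S]) (use J \<tau> in simp_all)
    also have "\<dots> = (\<Sum>u\<in>?S. delta_entry f (\<tau>, J) u * v u)"
    proof -
      \<comment> \<open>In a row without z_k, monomials divisible by z_k cannot contribute, so the
        system and its restriction have the same entries.\<close>
      have "contraction_coeff (cut_var k p) \<tau> \<sigma> = contraction_coeff p \<tau> \<sigma>" for p :: "'a tpoly" and \<sigma>
      proof -
        have "Poly_Mapping.lookup (expo_block BlockZ \<theta>) k = 0" if "expo_block BlockZ \<tau> = expo_block BlockZ \<sigma> + expo_block BlockZ \<theta>" for \<theta>
          using \<tau>k that by (simp add: lookup_add)
        then show ?thesis
          unfolding contraction_coeff_def
          by (intro sum.mono_neutral_cong_left) (auto simp: keys_cut_var lookup_cut_var)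
      qed
      then show ?thesis
        unfolding delta_entry_def fst_conv snd_conv by (simp cong: if_cong)
    qed
    finally show False
      using v[of "(\<tau>, J)"] K0 \<tau>k nz by simp
  qed
  then have "bd ?D \<omega> = 0"
    by (intro ext) simp
  moreover have "exact_at ?D (int ny + int (length bX))"
    by (rule exact_inverse_system) (use shift_bounds(4) N in blast)
  ultimately obtain \<eta> where \<eta>: "chain (int (nx + ny + 2)) ?D \<eta>" "bd ?D \<eta> = \<omega>"
    using ch unfolding exact_at_def by (auto simp: algebra_simps)
  have "\<eta> = 0"
  proof (intro ext, rule ccontr)
    fix I \<tau> assume "\<eta> I \<tau> \<noteq> 0 I \<tau>"
    then have "\<eta> I \<tau> \<noteq> 0" by simp
    note h = chain_degree[OF \<eta>(1) this]
    show False
      using shift_bounds(6)[OF conjunct1[OF N[THEN iffD1, OF h(1)]] h(2)] h(8) blk_sum_nonneg[of zs \<tau>] h(5) by simp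
  qed
  then have "\<omega> = 0"
    using bd_diff[of ?D 0 0] \<eta>(2) by simp
  then show ?thesis
    using chain_of_kexp[OF fin, of nx ny v "snd w" "fst w"] w by (simp add: \<omega>_def)
qed

text \<open>Every element of \<open>K_0\<close> is a cycle because no chains exist one degree lower;
  exactness in degree nx + ny then makes it a boundary.\<close>

theorem delta_surjective:
  assumes nz: "no_common_zero nx ny nz {0..r+s} f"
  shows "\<exists>v. \<forall>u\<in>K0. (\<Sum>w\<in>K1. delta_entry f u w * v w) = g u"
proof -
  interpret koszul_blocks "{0..r+s}" "\<lambda>l. map_expo lexp (f l)" "sys_deg r" "sys_shift nx ny r" bX bY bZ
    by (rule koszul_full[OF nz])
  let ?D = "kregion nx ny bZ"
  define \<omega> where "\<omega> = chain_of nx ny K0 g"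
  have ch: "chain (int (nx + ny)) ?D \<omega>"
    unfolding chain_def
  proof (intro allI impI)
    fix I \<tau> assume "\<omega> I \<tau> \<noteq> 0"
    then obtain \<sigma> where "(\<sigma>, I) \<in> K0" "\<tau> = kexp nx ny \<sigma>"
      unfolding \<omega>_def by (rule chain_of_nonzero)
    then show "I \<subseteq> {0..r+s} \<and> int (card I) = int (nx + ny) \<and> \<tau> \<in> ?D \<and>
        (\<forall>b. bdeg b \<tau> = sys_shift nx ny r b - (\<Sum>i\<in>I. sys_deg r b i))"
      unfolding mem_K_iff(2)[OF dims(1)] by blast
  qed
  have "bd ?D \<omega> J \<rho> = 0" for J \<rho>
  proof (rule ccontr)
    assume nz: "bd ?D \<omega> J \<rho> \<noteq> 0"
    note h = chain_degree[OF chain_bd[OF ch] nz]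
    show False
      using shift_bounds(7)[OF h(1,2)] h(6) blk_sum_neg[of bX \<rho>] h(3) by (simp add: distinct_block_vars)
  qed
  then have "bd ?D \<omega> = 0"
    by (intro ext) simp
  moreover have "exact_at ?D (int ny - 1 + int (length bX))"
    by (rule exact_inverse_system) (use shift_bounds(5) in simp)
  ultimately obtain \<eta> where \<eta>: "chain (int (nx + ny + 1)) ?D \<eta>" "bd ?D \<eta> = \<omega>"
    using ch unfolding exact_at_def by (auto simp: algebra_simps)
  define v where "v w = \<eta> (snd w) (kexp nx ny (fst w))" for w
  have \<eta>v: "\<eta> = chain_of nx ny K1 v"
  proof (intro ext)
    fix I \<tau>
    show "\<eta> I \<tau> = chain_of nx ny K1 v I \<tau>"
    proof (cases "\<tau> \<in> ?D")
      case True
      then obtain \<sigma> where \<sigma>: "\<tau> = kexp nx ny \<sigma>"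
        using kregion_imp_kexp[OF bZ_sub(1)] by blast
      have "\<eta> I \<tau> = 0" if "(\<sigma>, I) \<notin> K1"
        using \<eta>(1) that True unfolding chain_def mem_K_iff(1)[OF dims(1)] \<sigma> by blast
      then show ?thesis
        unfolding \<sigma> chain_of_kexp[OF finite_K1_basis] by (simp add: v_def)
    next
      case False
      have "chain_of nx ny K1 v I \<tau> = 0"
      proof (rule ccontr)
        assume "chain_of nx ny K1 v I \<tau> \<noteq> 0"
        then obtain \<sigma> where "(\<sigma>, I) \<in> K1" "\<tau> = kexp nx ny \<sigma>"
          by (rule chain_of_nonzero)
        then show False
          using False unfolding mem_K_iff(1)[OF dims(1)] by blast
      qed
      then show ?thesis
        using chain_outside[OF \<eta>(1) False] by simp
    qed
  qed
  have "(\<Sum>w\<in>K1. delta_entry f u w * v w) = g u" if u: "u \<in> K0" for u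
  proof -
    obtain \<tau> J where uJ: "u = (\<tau>, J)" by (cases u)
    have \<tau>: "kexp nx ny \<tau> \<in> ?D"
      using u mem_K_iff(2)[OF dims(1), of \<tau> J] by (simp add: uJ)
    have "(\<Sum>w\<in>K1. delta_entry f u w * v w) = bd ?D \<eta> J (kexp nx ny \<tau>)"
      unfolding \<eta>v uJ
    proof (rule bd_chain_of[OF refl finite_K1_basis _ \<tau>, symmetric])
      show "kexp nx ny (fst u) \<in> ?D \<and> snd u \<subseteq> {0..r+s}" if "u \<in> K1" for u
        using that mem_K_iff(1)[OF dims(1), of "fst u" "snd u"] by simp
    qed
    also have "\<dots> = g u"
      unfolding \<eta>(2) \<omega>_def chain_of_kexp[OF finite_K0_basis] using u by (simp add: uJ)
    finally show ?thesis .
  qed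
  then show ?thesis by blast
qed

end

section \<open>The kernel of \<open>\<delta>\<^sub>1\<close> at a common zero\<close>

definition functional :: "(nat \<Rightarrow> 'a::field) \<Rightarrow> nat \<Rightarrow> 'a \<Rightarrow> 'a" where
  "functional \<phi> l c = \<phi> l * c"

lemma functional_anticommute:
  assumes "finite N" "finite J"
  shows "contract N (functional \<phi>) (contract N (functional \<psi>) c) J = - contract N (functional \<psi>) (contract N (functional \<phi>) c) J"
  using contract_anticommute[OF assms, of "functional \<phi>" "functional \<psi>" c]
  by (simp add: functional_def algebra_simps eq_neg_iff_add_eq_0)

lemma contract_functional_square:
  fixes c :: "nat set \<Rightarrow> 'a::field_char_0"
  assumes "finite N" "finite J"
  shows "contract N (functional \<phi>) (contract N (functional \<phi>) c) J = 0"
  using functional_anticommute[OF assms, of \<phi> \<phi> c] by (simp add: eq_neg_iff_add_eq_0 mult_2[symmetric])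

text \<open>\<open>t\<close> is the codegree relative to the top form, and only indices in
  \<open>W\<close> may be missing. In the application this puts \<open>{1..r}\<close> into every
  index set, as the summands of \<open>K_1\<close> demand.\<close>

definition wedge_support :: "nat set \<Rightarrow> nat set \<Rightarrow> nat \<Rightarrow> (nat set \<Rightarrow> 'a::zero) \<Rightarrow> bool" where
  "wedge_support N W t c \<longleftrightarrow> (\<forall>I. c I \<noteq> 0 \<longrightarrow> I \<subseteq> N \<and> N - W \<subseteq> I \<and> card I + t = card N)"

lemma wedge_support_contract:
  fixes c :: "nat set \<Rightarrow> 'a::field_char_0"
  assumes "finite N" "wedge_support N W t c" "\<And>l. l \<notin> W \<Longrightarrow> \<phi> l = 0"
  shows "wedge_support N W (Suc t) (contract N (functional \<phi>) c)"
  unfolding wedge_support_def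
proof (intro allI impI)
  fix J assume nz: "contract N (functional \<phi>) c J \<noteq> 0"
  have "\<exists>l\<in>N - J. \<phi> l * c (insert l J) \<noteq> 0"
  proof (rule ccontr)
    assume "\<not> ?thesis"
    then have "contract N (functional \<phi>) c J = 0"
      unfolding contract_def functional_def by (intro sum.neutral) simp
    then show False using nz by simp
  qed
  then obtain l where l: "l \<in> N" "l \<notin> J" "\<phi> l \<noteq> 0" "c (insert l J) \<noteq> 0"
    by auto
  have h: "insert l J \<subseteq> N" "N - W \<subseteq> insert l J" "card (insert l J) + t = card N"
    using assms(2) l(4) unfolding wedge_support_def by blast+
  have "finite J"
    using finite_subset[OF h(1) assms(1)] by simp
  moreover have "l \<in> W"
    using assms(3) l(3) by blast
  ultimately show "J \<subseteq> N \<and> N - W \<subseteq> J \<and> card J + Suc t = card N"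
    using h l(2) by auto
qed

lemma wedge_support_finite:
  assumes "finite N" "wedge_support N W t c" "\<not> J \<subseteq> N"
  shows "contract N (functional \<phi>) c J = 0"
  unfolding contract_def functional_def
  using assms by (intro sum.neutral) (auto simp: wedge_support_def)

text \<open>Contract the top form with the functionals one after another, omitting each that gives zero.\<close>

lemma common_kernel_exists:
  fixes \<phi> :: "nat \<Rightarrow> nat \<Rightarrow> 'a::field_char_0"
  assumes "finite N" "\<And>i l. l \<notin> W \<Longrightarrow> \<phi> i l = 0"
  shows "\<exists>t\<le>q. \<exists>c. c \<noteq> 0 \<and> wedge_support N W t c \<and> (\<forall>i<q. contract N (functional (\<phi> i)) c = 0)"
proof (induction q)
  case 0
  show ?case
    by (intro exI[of _ 0] conjI exI[of _ "\<lambda>I. if I = N then 1 else 0"])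
      (auto simp: wedge_support_def fun_eq_iff)
next
  case (Suc q)
  then obtain t c where c: "t \<le> q" "c \<noteq> 0" "wedge_support N W t c" "\<And>i. i < q \<Longrightarrow> contract N (functional (\<phi> i)) c = 0"
    by blast
  show ?case
  proof (cases "contract N (functional (\<phi> q)) c = 0")
    case True
    then have "\<forall>i<Suc q. contract N (functional (\<phi> i)) c = 0"
      using c(4) by (metis less_SucE)
    then show ?thesis
      using c(1-3) le_SucI by blast
  next
    case False
    let ?c = "contract N (functional (\<phi> q)) c"
    have ws: "wedge_support N W (Suc t) ?c"
      by (rule wedge_support_contract[OF assms(1) c(3) assms(2)])
    have "contract N (functional (\<phi> i)) ?c J = 0" if "i < Suc q" for i J
    proof (cases "J \<subseteq> N")
      case True
      then have fin: "finite J"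
        using assms(1) finite_subset by blast
      show ?thesis
      proof (cases "i = q")
        case True
        then show ?thesis
          using contract_functional_square[OF assms(1) fin] by simp
      next
        case False
        then have "contract N (functional (\<phi> i)) c = 0"
          using c(4) that by simp
        then show ?thesis
          using functional_anticommute[OF assms(1) fin, of "\<phi> i" "\<phi> q" c]
          by (simp add: contract_def functional_def)
      qed
    next
      case False
      then show ?thesis
        by (rule wedge_support_finite[OF assms(1) ws])
    qed
    then have "\<forall>i<Suc q. contract N (functional (\<phi> i)) ?c = 0"
      by (auto simp: fun_eq_iff)
    then show ?thesis
      using False ws c(1) by (intro exI[of _ "Suc t"] conjI exI[of _ ?c]) auto
  qed
qed

text \<open>Fewer than \<open>T\<close> effective contractions leave a form of too high degree.
  Contracting further with coordinate functionals lowers it; anticommutativity keeps the form in the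
  common kernel, and choosing an index of \<open>W\<close> that occurs in its support keeps it
  nonzero.\<close>

lemma common_kernel_degree:
  fixes \<phi> :: "nat \<Rightarrow> nat \<Rightarrow> 'a::field_char_0"
  assumes "finite N" "W \<subseteq> N" "T \<le> card W" "c \<noteq> 0" "wedge_support N W t c" "t \<le> T"
    and "\<And>i. i < q \<Longrightarrow> contract N (functional (\<phi> i)) c = 0"
  shows "\<exists>c. c \<noteq> 0 \<and> wedge_support N W T c \<and> (\<forall>i<q. contract N (functional (\<phi> i)) c = 0)"
  using assms(4-7)
proof (induction "T - t" arbitrary: t c)
  case 0
  then show ?case
    by (intro exI[of _ c]) auto
next
  case (Suc n)
  obtain I where I: "c I \<noteq> 0"
    using Suc.prems(1) by (auto simp: fun_eq_iff)
  then have h: "I \<subseteq> N" "N - W \<subseteq> I" "card I + t = card N"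
    using Suc.prems(2) unfolding wedge_support_def by blast+
  \<comment> \<open>As \<open>t < T\<close> and \<open>T \<le> card W\<close>, an index set in the
    support is larger than \<open>N - W\<close>, so it contains an index of
    \<open>W\<close>.\<close>
  have "card (N - W) + card W = card N"
    using assms(1,2) card_Diff_subset[of W N] card_mono[of N W] finite_subset[of W N] by simp
  then have "card (N - W) < card I"
    using h(3) Suc.hyps(2) assms(3) by linarith
  then have "\<not> I \<subseteq> N - W"
    using card_mono[of "N - W" I] assms(1) by fastforce
  then obtain l where l: "l \<in> I" "l \<in> W"
    using h(1) by blast
  define \<epsilon> where "\<epsilon> j = (if j = l then 1 else 0 :: 'a)" for j
  let ?c = "contract N (functional \<epsilon>) c"
  have fin: "finite I"
    using h(1) assms(1) finite_subset by blast
  have "?c (I - {l}) = ksgn l (I - {l}) (c I)"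
  proof -
    have "?c (I - {l}) = (\<Sum>j\<in>N - (I - {l}). if j = l then ksgn l (I - {l}) (c I) else 0)"
      unfolding contract_def functional_def
    proof (intro sum.cong refl)
      fix j
      show "ksgn j (I - {l}) (\<epsilon> j * c (insert j (I - {l}))) = (if j = l then ksgn l (I - {l}) (c I) else 0)"
        using l(1) by (cases "j = l") (simp_all add: \<epsilon>_def insert_absorb)
    qed
    also have "\<dots> = ksgn l (I - {l}) (c I)"
    proof -
      have "l \<in> N - (I - {l})" "finite (N - (I - {l}))"
        using assms(1,2) l(2) by blast+
      then show ?thesis
        by (simp only: sum.delta if_True)
    qed
    finally show ?thesis .
  qed
  then have "?c \<noteq> 0"
    using I by (metis ksgn_eq_0_iff zero_fun_apply)
  moreover have ws: "wedge_support N W (Suc t) ?c"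
    using l(2) by (intro wedge_support_contract[OF assms(1) Suc.prems(2)]) (auto simp: \<epsilon>_def)
  moreover have "contract N (functional (\<phi> i)) ?c = 0" if "i < q" for i
  proof
    fix J
    show "contract N (functional (\<phi> i)) ?c J = 0 J"
    proof (cases "J \<subseteq> N")
      case True
      then have "finite J"
        using assms(1) finite_subset by blast
      then show ?thesis
        using functional_anticommute[OF assms(1), of J "\<phi> i" \<epsilon> c] Suc.prems(4)[OF that]
        by (simp add: contract_def functional_def)
    next
      case False
      then show ?thesis
        using wedge_support_finite[OF assms(1) ws] by simp
    qed
  qed
  ultimately show ?case
    using Suc.hyps(1)[of "Suc t" ?c] Suc.hyps(2) by auto
qed

lemma block_expos_0: "s \<in> block_expos n 0 \<Longrightarrow> s = 0"
proof (rule poly_mapping_eqI)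
  fix i assume s: "s \<in> block_expos n 0"
  then have "(\<Sum>i\<le>n. Poly_Mapping.lookup s i) = 0"
    by (simp add: block_expos_def del: of_nat_sum)
  then show "Poly_Mapping.lookup s i = Poly_Mapping.lookup 0 i"
    using s by (cases "i \<le> n") (auto simp: block_expos_def keys_subset_atMost_iff)
qed

lemma block_expos_1:
  assumes "s \<in> block_expos n 1"
  obtains k where "k \<le> n" "s = Poly_Mapping.single k 1"
proof -
  have s: "(\<Sum>i\<le>n. Poly_Mapping.lookup s i) = 1" "Poly_Mapping.keys s \<subseteq> {..n}"
    using assms by (simp_all add: block_expos_def del: of_nat_sum)
  then obtain k where k: "k \<le> n" "Poly_Mapping.lookup s k \<noteq> 0"
    by (metis atMost_iff sum.neutral zero_neq_one)
  have "(\<Sum>i\<le>n. Poly_Mapping.lookup s i) = Poly_Mapping.lookup s k + (\<Sum>i\<in>{..n} - {k}. Poly_Mapping.lookup s i)"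
    using k(1) by (intro sum.remove) auto
  then have "Poly_Mapping.lookup s k = 1 \<and> (\<Sum>i\<in>{..n} - {k}. Poly_Mapping.lookup s i) = 0"
    using s(1) k(2) by linarith
  then have sk: "Poly_Mapping.lookup s k = 1" "\<And>i. i \<in> {..n} - {k} \<Longrightarrow> Poly_Mapping.lookup s i = 0"
    by (simp_all add: sum_eq_0_iff)
  have "s = Poly_Mapping.single k 1"
  proof (rule poly_mapping_eqI)
    fix i
    show "Poly_Mapping.lookup s i = Poly_Mapping.lookup (Poly_Mapping.single k 1) i"
      using sk s(2) k(1) by (cases "i = k"; cases "i \<le> n") (auto simp: keys_subset_atMost_iff lookup_single)
  qed
  then show ?thesis
    using that k(1) by blast
qed

lemma single_in_block_expos: "k \<le> n \<Longrightarrow> Poly_Mapping.single k d \<in> block_expos n (int d)"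
  by (auto simp: block_expos_def lookup_single when_def simp flip: of_nat_sum)

lemma delta_entry_alt:
  assumes "finite N" "snd u \<subseteq> N"
  shows "delta_entry g (\<tau>, J) u = (\<Sum>l\<in>N - J. if snd u = insert l J then ksgn l J (contraction_coeff (g l) \<tau> (fst u)) else 0)"
proof -
  have fin: "finite (snd u)"
    using assms finite_subset by blast
  have "{k \<in> snd u. J = snd u - {k}} = {l \<in> N - J. snd u = insert l J}"
    using assms(2) by auto
  then have "(\<Sum>k | k \<in> snd u \<and> J = snd u - {k}. ksgn k J (contraction_coeff (g k) \<tau> (fst u))) =
      (\<Sum>l | l \<in> N - J \<and> snd u = insert l J. ksgn l J (contraction_coeff (g l) \<tau> (fst u)))"
    by simp
  then show ?thesis
    using fin assms(1) by (simp add: delta_entry_def sum.If_cases Int_def)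
qed

section \<open>The kernel vector of a common zero\<close>

context two_bilinear_system
begin

text \<open>The coefficient of \<open>z\<^sup>\<zeta>\<close> in \<open>f\<^sub>l(x, y, z)\<close> for fixed \<open>x\<close> and \<open>y\<close>.\<close>

definition partial_value :: "(nat \<Rightarrow> 'a) \<Rightarrow> (nat \<Rightarrow> 'a) \<Rightarrow> (nat \<Rightarrow>\<^sub>0 nat) \<Rightarrow> nat \<Rightarrow> 'a" where
  "partial_value x y \<zeta> l = (\<Sum>\<theta>\<in>Poly_Mapping.keys (f l). if expo_block BlockZ \<theta> = \<zeta>
     then Poly_Mapping.lookup (f l) \<theta> * mon_val x (expo_block BlockX \<theta>) * mon_val y (expo_block BlockY \<theta>) else 0)"

text \<open>In the dual basis, evaluation at a point has the monomial values as its coordinates; the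
  vector is the tensor product of the evaluations at \<open>x\<close> and \<open>y\<close> with the
  form \<open>c\<close>. One formula serves both summands of \<open>K_1\<close>.\<close>

definition point_vector :: "(nat \<Rightarrow> 'a) \<Rightarrow> (nat \<Rightarrow> 'a) \<Rightarrow> (nat set \<Rightarrow> 'a) \<Rightarrow> kbasis \<Rightarrow> 'a" where
  "point_vector x y c w = mon_val x (expo_block BlockX (fst w)) * mon_val y (expo_block BlockY (fst w)) * c (snd w)"

lemma K1_expo_Z: "w \<in> K1 \<Longrightarrow> expo_block BlockZ (fst w) = 0"
  using block_expos_0 by (cases "fst w") (auto simp: K1_basis_def)

text \<open>Contracting an evaluation functional with a form multiplies it by the value of the form.
  The image is therefore the same evaluations times, for each z-monomial of the row, a contraction
  of \<open>c\<close> with the corresponding coefficients of the system.\<close>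

lemma delta_point_vector:
  assumes u: "(\<tau>, J) \<in> K0"
  shows "(\<Sum>w\<in>K1. delta_entry f (\<tau>, J) w * point_vector x y c w) =
    mon_val x (expo_block BlockX \<tau>) * mon_val y (expo_block BlockY \<tau>) *
    contract {0..r+s} (functional (partial_value x y (expo_block BlockZ \<tau>))) c J"
proof -
  let ?N = "{0..r+s}"
  let ?X = "\<lambda>\<sigma>. mon_val x (expo_block BlockX \<sigma>) * mon_val y (expo_block BlockY \<sigma>)"
  have J: "J \<subseteq> ?N" "int (card J) = int (nx + ny)" "kexp nx ny \<tau> \<in> kregion nx ny bZ"
    "\<And>b. bdeg b (kexp nx ny \<tau>) = sys_shift nx ny r b - (\<Sum>i\<in>J. sys_deg r b i)"
    using u unfolding mem_K_iff(2)[OF dims(1)] by blast+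
  have finJ: "finite J"
    using J(1) finite_subset by blast
  have K1N: "snd w \<subseteq> ?N" if "w \<in> K1" for w
    using that mem_K_iff(1)[OF dims(1), of "fst w" "snd w"] by simp
  have inner: "(\<Sum>w\<in>K1. if snd w = insert l J then contraction_coeff (f l) \<tau> (fst w) * ?X (fst w) else 0) =
      ?X \<tau> * partial_value x y (expo_block BlockZ \<tau>) l" if l: "l \<in> ?N - J" for l
  proof -
    let ?rel = "\<lambda>\<theta> \<sigma>. expo_block BlockX \<sigma> = expo_block BlockX \<tau> + expo_block BlockX \<theta> \<and>
        expo_block BlockY \<sigma> = expo_block BlockY \<tau> + expo_block BlockY \<theta> \<and>
        expo_block BlockZ \<tau> = expo_block BlockZ \<sigma> + expo_block BlockZ \<theta>"
    have "(\<Sum>w\<in>K1. if snd w = insert l J then contraction_coeff (f l) \<tau> (fst w) * ?X (fst w) else 0) =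
      (\<Sum>w\<in>K1. \<Sum>\<theta>\<in>Poly_Mapping.keys (f l). if snd w = insert l J \<and> ?rel \<theta> (fst w)
        then Poly_Mapping.lookup (f l) \<theta> * ?X (fst w) else 0)"
      unfolding contraction_coeff_def sum_distrib_right by (intro sum.cong refl) (auto intro!: sum.cong)
    also have "\<dots> = (\<Sum>\<theta>\<in>Poly_Mapping.keys (f l). \<Sum>w\<in>K1. if snd w = insert l J \<and> ?rel \<theta> (fst w)
        then Poly_Mapping.lookup (f l) \<theta> * ?X (fst w) else 0)"
      by (rule sum.swap)
    also have "\<dots> = (\<Sum>\<theta>\<in>Poly_Mapping.keys (f l). ?X \<tau> * (if expo_block BlockZ \<theta> = expo_block BlockZ \<tau>
        then Poly_Mapping.lookup (f l) \<theta> * mon_val x (expo_block BlockX \<theta>) * mon_val y (expo_block BlockY \<theta>) else 0))"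
    proof (intro sum.cong refl)
      fix \<theta> assume \<theta>: "\<theta> \<in> Poly_Mapping.keys (f l)"
      show "(\<Sum>w\<in>K1. if snd w = insert l J \<and> ?rel \<theta> (fst w) then Poly_Mapping.lookup (f l) \<theta> * ?X (fst w) else 0) =
        ?X \<tau> * (if expo_block BlockZ \<theta> = expo_block BlockZ \<tau>
          then Poly_Mapping.lookup (f l) \<theta> * mon_val x (expo_block BlockX \<theta>) * mon_val y (expo_block BlockY \<theta>) else 0)"
      proof (cases "expo_block BlockZ \<theta> = expo_block BlockZ \<tau>")
        case True
        \<comment> \<open>The only exponent of a column that can meet this row through
          \<open>\<theta>\<close>; its z-part is 0 because \<open>K_1\<close> has z-degree
          0.\<close>
        define \<sigma> :: expo where "\<sigma> = (expo_block BlockX \<tau> + expo_block BlockX \<theta>, expo_block BlockY \<tau> + expo_block BlockY \<theta>, 0)"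
        have rel: "?rel \<theta> \<sigma>"
          using True by (simp add: \<sigma>_def)
        then have k: "kexp nx ny \<tau> = kexp nx ny \<sigma> + lexp \<theta>"
          by (simp add: kexp_eq_iff)
        have "kexp nx ny \<sigma> \<in> kregion nx ny bZ"
        proof -
          have out: "Poly_Mapping.lookup (expo_block b \<theta>) i = 0" if "(b, i) \<notin> set bX \<union> set bY \<union> set bZ" for b i
            using f_keys(1)[OF _ \<theta> that] l by (simp add: lookup_lexp)
          have "Poly_Mapping.lookup (expo_block BlockX \<theta>) i = 0" if "i > nx" for i
            by (rule out) (use that in \<open>auto simp: set_block_vars\<close>)
          moreover have "Poly_Mapping.lookup (expo_block BlockY \<theta>) i = 0" if "i > ny" for i
            by (rule out) (use that in \<open>auto simp: set_block_vars\<close>)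
          ultimately show ?thesis
            using J(3) unfolding kregion_iff[OF bZ_sub(1)] lookup_kexp \<sigma>_def
            by (auto simp: lookup_add)
        qed
        moreover have "bdeg b (kexp nx ny \<sigma>) = sys_shift nx ny r b - (\<Sum>i\<in>insert l J. sys_deg r b i)" for b
          using J(4)[of b] f_keys(2)[OF _ \<theta>, of b] l finJ unfolding k by (simp add: bdeg_add)
        ultimately have mem: "(\<sigma>, insert l J) \<in> K1"
          unfolding mem_K_iff(1)[OF dims(1)] using J(1,2) l finJ by auto
        have "(\<Sum>w\<in>K1. if snd w = insert l J \<and> ?rel \<theta> (fst w) then Poly_Mapping.lookup (f l) \<theta> * ?X (fst w) else 0) =
          (\<Sum>w\<in>K1. if w = (\<sigma>, insert l J) then Poly_Mapping.lookup (f l) \<theta> * ?X \<sigma> else 0)"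
        proof (intro sum.cong refl)
          fix w assume w: "w \<in> K1"
          have "snd w = insert l J \<and> ?rel \<theta> (fst w) \<longleftrightarrow> w = (\<sigma>, insert l J)"
          proof
            assume h: "snd w = insert l J \<and> ?rel \<theta> (fst w)"
            have "fst w = \<sigma>"
              by (cases "fst w") (use h K1_expo_Z[OF w] in \<open>auto simp: \<sigma>_def\<close>)
            then show "w = (\<sigma>, insert l J)"
              using h by (cases w) auto
          qed (use rel in auto)
          then show "(if snd w = insert l J \<and> ?rel \<theta> (fst w) then Poly_Mapping.lookup (f l) \<theta> * ?X (fst w) else 0) =
            (if w = (\<sigma>, insert l J) then Poly_Mapping.lookup (f l) \<theta> * ?X \<sigma> else 0)"
            by auto
        qed
        also have "\<dots> = Poly_Mapping.lookup (f l) \<theta> * ?X \<sigma>"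
          using mem finite_K1_basis by simp
        finally show ?thesis
          using True by (simp add: \<sigma>_def mon_val_add)
      next
        case False
        then show ?thesis
          using K1_expo_Z by (auto intro!: sum.neutral)
      qed
    qed
    finally show ?thesis
      by (simp add: partial_value_def sum_distrib_left)
  qed
  have "(\<Sum>w\<in>K1. delta_entry f (\<tau>, J) w * point_vector x y c w) =
      (\<Sum>w\<in>K1. \<Sum>l\<in>?N - J. ksgn l J ((if snd w = insert l J then contraction_coeff (f l) \<tau> (fst w) * ?X (fst w) else 0) * c (insert l J)))"
    by (intro sum.cong refl)
      (auto simp: delta_entry_alt[OF _ K1N] sum_distrib_right point_vector_def ksgn_def intro!: sum.cong)
  also have "\<dots> = (\<Sum>l\<in>?N - J. ksgn l J ((\<Sum>w\<in>K1. if snd w = insert l J then contraction_coeff (f l) \<tau> (fst w) * ?X (fst w) else 0) * c (insert l J)))"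
    by (subst sum.swap) (simp add: ksgn_sum sum_distrib_right)
  also have "\<dots> = (\<Sum>l\<in>?N - J. ksgn l J (?X \<tau> * partial_value x y (expo_block BlockZ \<tau>) l * c (insert l J)))"
    by (intro sum.cong refl) (simp add: inner)
  also have "\<dots> = ?X \<tau> * contract ?N (functional (partial_value x y (expo_block BlockZ \<tau>))) c J"
    unfolding contract_def functional_def sum_distrib_left
    by (intro sum.cong refl) (auto simp: ksgn_def)
  finally show ?thesis .
qed

lemma f_expos:
  assumes "l \<le> r + s" "\<theta> \<in> Poly_Mapping.keys (f l)"
  shows "expo_block BlockZ \<theta> \<in> block_expos nz (sys_deg r BlockZ l)"
proof -
  have "\<theta> \<in> expos nx ny nz (sys_deg r BlockX l, sys_deg r BlockY l, sys_deg r BlockZ l)"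
    using f_forms[OF assms(1)] assms(2) by (auto simp: forms_def)
  then show ?thesis
    by (cases \<theta>) simp
qed

text \<open>The nz + 1 coefficient functionals of the z-variables satisfy a linear relation with
  coefficients \<open>z\<close>, because the point is a zero. So nz contractions of the top form on
  r + s + 1 indices suffice, which leaves the exterior degree nx + ny + 1 of
  \<open>K_1\<close>.\<close>

theorem delta_kernel_at_zero:
  assumes x: "x \<in> hom_coords nx" and y: "y \<in> hom_coords ny" and z: "z \<in> hom_coords nz"
    and zero: "\<And>l. l \<le> r + s \<Longrightarrow> teval (x, y, z) (f l) = 0"
  shows "\<exists>v. (\<exists>w\<in>K1. v w \<noteq> 0) \<and> (\<forall>u\<in>K0. (\<Sum>w\<in>K1. delta_entry f u w * v w) = 0)"
proof -
  let ?N = "{0..r+s}" and ?W = "insert 0 {r+1..r+s}"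
  define \<phi> where "\<phi> k = (\<lambda>l. if l \<le> r + s then partial_value x y (Poly_Mapping.single k 1) l else 0)" for k
  obtain k0 where k0: "k0 \<le> nz" "z k0 \<noteq> 0"
    using z by (auto simp: hom_coords_def)
  have \<phi>W: "\<phi> k l = 0" if "l \<notin> ?W" for k l
  proof (cases "l \<le> r + s")
    case True
    then have "sys_deg r BlockZ l = 0"
      using that by (auto simp: sys_deg_def)
    then have "expo_block BlockZ \<theta> = 0" if "\<theta> \<in> Poly_Mapping.keys (f l)" for \<theta>
      using f_expos[OF True that] block_expos_0 by simp
    moreover have "Poly_Mapping.single k (1::nat) \<noteq> 0"
      by (metis lookup_single_eq lookup_zero zero_neq_one)
    ultimately have "partial_value x y (Poly_Mapping.single k 1) l = 0"
      unfolding partial_value_def by (intro sum.neutral) auto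
    then show ?thesis
      by (simp add: \<phi>_def)
  qed (simp add: \<phi>_def)
  have rel: "(\<Sum>k\<le>nz. z k * \<phi> k l) = 0" if l: "l \<le> r + s" for l
  proof (cases "l \<in> ?W")
    case True
    then have deg: "sys_deg r BlockZ l = 1"
      by (auto simp: sys_deg_def)
    have "(\<Sum>k\<le>nz. z k * \<phi> k l) = (\<Sum>k\<le>nz. \<Sum>\<theta>\<in>Poly_Mapping.keys (f l). if expo_block BlockZ \<theta> = Poly_Mapping.single k 1
        then Poly_Mapping.lookup (f l) \<theta> * mon_val x (expo_block BlockX \<theta>) * mon_val y (expo_block BlockY \<theta>) * z k else 0)"
      using l unfolding \<phi>_def partial_value_def
      by (simp add: sum_distrib_left if_distrib[of "\<lambda>t. _ * t"] mult_ac cong: if_cong)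
    also have "\<dots> = (\<Sum>\<theta>\<in>Poly_Mapping.keys (f l). \<Sum>k\<le>nz. if expo_block BlockZ \<theta> = Poly_Mapping.single k 1
        then Poly_Mapping.lookup (f l) \<theta> * mon_val x (expo_block BlockX \<theta>) * mon_val y (expo_block BlockY \<theta>) * z k else 0)"
      by (rule sum.swap)
    also have "\<dots> = (\<Sum>\<theta>\<in>Poly_Mapping.keys (f l). Poly_Mapping.lookup (f l) \<theta> * mon_val3 (x, y, z) \<theta>)"
    proof (intro sum.cong refl)
      fix \<theta> assume "\<theta> \<in> Poly_Mapping.keys (f l)"
      then obtain k' where k': "k' \<le> nz" "expo_block BlockZ \<theta> = Poly_Mapping.single k' 1"
        using f_expos[OF l] unfolding deg by (metis block_expos_1)
      have inj: "Poly_Mapping.single k' (1::nat) = Poly_Mapping.single k 1 \<longleftrightarrow> k = k'" for k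
        by (metis lookup_single_eq lookup_single_not_eq zero_neq_one)
      show "(\<Sum>k\<le>nz. if expo_block BlockZ \<theta> = Poly_Mapping.single k 1
        then Poly_Mapping.lookup (f l) \<theta> * mon_val x (expo_block BlockX \<theta>) * mon_val y (expo_block BlockY \<theta>) * z k else 0) =
        Poly_Mapping.lookup (f l) \<theta> * mon_val3 (x, y, z) \<theta>"
        unfolding k'(2) inj using k' by (cases \<theta>) (simp add: mult_ac)
    qed
    also have "\<dots> = teval (x, y, z) (f l)"
      by (rule teval_superset[symmetric]) auto
    finally show ?thesis
      using zero[OF l] by simp
  next
    case False
    then show ?thesis
      using \<phi>W by simp
  qed
  \<comment> \<open>Enumerates the indices up to nz other than \<open>k0\<close>; the functional at
    \<open>k0\<close> depends on the others since \<open>z k0\<close> is nonzero.\<close>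
  define g where "g i = (if i < k0 then i else Suc i)" for i
  obtain t c0 where c0: "t \<le> nz" "c0 \<noteq> 0" "wedge_support ?N ?W t c0"
    "\<And>i. i < nz \<Longrightarrow> contract ?N (functional (\<phi> (g i))) c0 = 0"
    using common_kernel_exists[of ?N ?W "\<lambda>i. \<phi> (g i)" nz] \<phi>W by auto
  have W: "?W \<subseteq> ?N" "nz \<le> card ?W" "finite ?N"
    using dims(3) by auto
  obtain c where c: "c \<noteq> 0" "wedge_support ?N ?W nz c"
    "\<And>i. i < nz \<Longrightarrow> contract ?N (functional (\<phi> (g i))) c = 0"
    using common_kernel_degree[OF W(3,1,2) c0(2,3,1), of nz "\<lambda>i. \<phi> (g i)"] c0(4) by blast
  have ck: "contract ?N (functional (\<phi> k)) c J = 0" if "k \<le> nz" "k \<noteq> k0" for k J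
  proof -
    have "k = g (if k < k0 then k else k - 1)" "(if k < k0 then k else k - 1) < nz"
      using that k0 by (auto simp: g_def)
    then show ?thesis
      using c(3) by (metis zero_fun_apply)
  qed
  have lin: "(\<Sum>k\<le>nz. z k * contract ?N (functional (\<phi> k)) c J) = 0" for J
  proof -
    have "(\<Sum>k\<le>nz. z k * contract ?N (functional (\<phi> k)) c J) =
        (\<Sum>l\<in>?N - J. ksgn l J ((\<Sum>k\<le>nz. z k * \<phi> k l) * c (insert l J)))"
      unfolding contract_def sum_distrib_left sum_distrib_right ksgn_sum
      by (subst sum.swap) (auto intro!: sum.cong simp: ksgn_def functional_def)
    then show ?thesis
      by (simp add: rel)
  qed
  have "z k0 * contract ?N (functional (\<phi> k0)) c J = 0" for J
  proof -
    have "(\<Sum>k\<le>nz. z k * contract ?N (functional (\<phi> k)) c J) = z k0 * contract ?N (functional (\<phi> k0)) c J +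
        (\<Sum>k\<in>{..nz} - {k0}. z k * contract ?N (functional (\<phi> k)) c J)"
      using k0 by (intro sum.remove) auto
    also have "(\<Sum>k\<in>{..nz} - {k0}. z k * contract ?N (functional (\<phi> k)) c J) = 0"
      using ck by (intro sum.neutral) auto
    finally show ?thesis
      using lin[of J] by simp
  qed
  then have ck: "contract ?N (functional (\<phi> k)) c J = 0" if "k \<le> nz" for k J
    using ck that k0 by (cases "k = k0") auto
  have cW: "contract ?N (functional (partial_value x y \<zeta>)) c J = 0" if "\<zeta> = 0 \<or> (\<exists>k\<le>nz. \<zeta> = Poly_Mapping.single k 1)" for \<zeta> J
    using that
  proof
    assume "\<exists>k\<le>nz. \<zeta> = Poly_Mapping.single k 1"
    then obtain k where k: "k \<le> nz" "\<zeta> = Poly_Mapping.single k 1" by blast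
    have "contract ?N (functional (partial_value x y \<zeta>)) c J = contract ?N (functional (\<phi> k)) c J"
      unfolding contract_def functional_def \<phi>_def k(2) by (intro sum.cong refl) auto
    then show ?thesis
      using ck[OF k(1)] by simp
  next
    assume \<zeta>: "\<zeta> = 0"
    \<comment> \<open>In z-degree 0 this coefficient is the full value of \<open>f l\<close> at the
      point; in z-degree 1 there is no monomial free of z.\<close>
    have "partial_value x y 0 l = 0" if l: "l \<le> r + s" for l
    proof (cases "sys_deg r BlockZ l = 0")
      case True
      then have \<theta>0: "expo_block BlockZ \<theta> = 0" if "\<theta> \<in> Poly_Mapping.keys (f l)" for \<theta>
        using f_expos[OF l that] block_expos_0 by simp
      have "partial_value x y 0 l = (\<Sum>\<theta>\<in>Poly_Mapping.keys (f l). Poly_Mapping.lookup (f l) \<theta> * mon_val3 (x, y, z) \<theta>)"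
        unfolding partial_value_def
      proof (intro sum.cong refl)
        fix \<theta> assume "\<theta> \<in> Poly_Mapping.keys (f l)"
        then have "expo_block BlockZ \<theta> = 0" by (rule \<theta>0)
        then show "(if expo_block BlockZ \<theta> = 0 then Poly_Mapping.lookup (f l) \<theta> * mon_val x (expo_block BlockX \<theta>) * mon_val y (expo_block BlockY \<theta>) else 0) =
            Poly_Mapping.lookup (f l) \<theta> * mon_val3 (x, y, z) \<theta>"
          by (cases \<theta>) simp
      qed
      also have "\<dots> = teval (x, y, z) (f l)"
        by (rule teval_superset[symmetric]) auto
      finally show ?thesis
        using zero[OF l] by simp
    next
      case False
      then have "sys_deg r BlockZ l = 1"
        by (auto simp: sys_deg_def split: if_splits)
      then have "expo_block BlockZ \<theta> \<noteq> 0" if "\<theta> \<in> Poly_Mapping.keys (f l)" for \<theta>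
        using f_expos[OF l that] by (auto simp: block_expos_def)
      then show ?thesis
        unfolding partial_value_def by (intro sum.neutral) auto
    qed
    then show ?thesis
      unfolding contract_def functional_def \<zeta> by (intro sum.neutral) auto
  qed
  define v where "v = point_vector x y c"
  have "(\<Sum>w\<in>K1. delta_entry f u w * v w) = 0" if u: "u \<in> K0" for u
  proof -
    obtain \<tau> J where uJ: "u = (\<tau>, J)" by (cases u)
    have "expo_block BlockZ \<tau> \<in> block_expos nz 0 \<union> block_expos nz 1"
      using u by (cases \<tau>) (auto simp: uJ K0_basis_def)
    then have "expo_block BlockZ \<tau> = 0 \<or> (\<exists>k\<le>nz. expo_block BlockZ \<tau> = Poly_Mapping.single k 1)"
      using block_expos_0 block_expos_1 by (metis UnE)
    then show ?thesis
      using delta_point_vector[of \<tau> J x y c] u cW by (simp add: uJ v_def)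
  qed
  moreover have "\<exists>w\<in>K1. v w \<noteq> 0"
  proof -
    obtain I where I: "c I \<noteq> 0"
      using c(1) by (auto simp: fun_eq_iff)
    then have h: "I \<subseteq> ?N" "?N - ?W \<subseteq> I" "card I + nz = card ?N"
      using c(2) unfolding wedge_support_def by blast+
    obtain i where i: "i \<le> nx" "x i \<noteq> 0"
      using x by (auto simp: hom_coords_def)
    obtain j where j: "j \<le> ny" "y j \<noteq> 0"
      using y by (auto simp: hom_coords_def)
    have "?N - ?W = {1..r}"
      by auto
    then have a: "I \<inter> {1..r} = {1..r}"
      using h(2) by auto
    note ss = sys_deg_sum[OF h(1)]
    have cardI: "card I = nx + ny + 1"
      using h(3) dims(1) by simp
    have bc: "int (card (I \<inter> {r+1..r+s})) + int (card (I \<inter> {0})) = int s - int nz + 1"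
    proof -
      have "int (card (I \<inter> {1..r})) = int r"
        unfolding a by simp
      then show ?thesis
        using ss(4) cardI dims(1) by linarith
    qed
    have c01: "card (I \<inter> {0}) = 0 \<or> card (I \<inter> {0}) = 1"
      using ss(10) by linarith
    \<comment> \<open>The y-degrees of the two summands of \<open>K_1\<close> differ by one,
      according to whether 0 is in \<open>I\<close>. The monomial is built from coordinates that are
      nonzero at the point.\<close>
    define e where "e = r - ny + card (I \<inter> {0})"
    define \<sigma> :: expo where "\<sigma> = (Poly_Mapping.single i 1, Poly_Mapping.single j e, 0)"
    have "0 \<in> block_expos nz 0"
      by (simp add: block_expos_def)
    moreover have "int e = int r - int ny + int (card (I \<inter> {0}))"
      using dims(2) by (simp add: e_def)
    ultimately have \<sigma>: "\<sigma> \<in> expos nx ny nz (1, int r - int ny + int (card (I \<inter> {0})), 0)"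
      using single_in_block_expos[OF i(1), of 1] single_in_block_expos[OF j(1), of e] by (simp add: \<sigma>_def)
    have "(\<sigma>, I) \<in> K1"
      using c01
    proof
      assume c: "card (I \<inter> {0}) = 0"
      have "\<sigma> \<in> expos nx ny nz (1, int r - int ny, 0)"
        using \<sigma> unfolding c of_nat_0 add_0_right .
      moreover have "I \<in> wedge_sets r s (int r, int s - int nz + 1, 0)"
        unfolding wedge_sets.simps mem_Collect_eq a c
        using h(1) bc[unfolded c of_nat_0 add_0_right] by simp
      ultimately show ?thesis
        unfolding K1_basis_def by blast
    next
      assume c: "card (I \<inter> {0}) = 1"
      have "\<sigma> \<in> expos nx ny nz (1, int r - int ny + 1, 0)"
        using \<sigma> unfolding c of_nat_1 .
      moreover have "I \<in> wedge_sets r s (int r, int s - int nz, 1)"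
        unfolding wedge_sets.simps mem_Collect_eq a c
        using h(1) bc[unfolded c of_nat_1] by simp
      ultimately show ?thesis
        unfolding K1_basis_def by blast
    qed
    moreover have "v (\<sigma>, I) \<noteq> 0"
      using i j I by (simp add: v_def point_vector_def \<sigma>_def)
    ultimately show ?thesis by blast
  qed
  ultimately show ?thesis by blast
qed

end

section \<open>Schur complements\<close>

text \<open>With more columns than rows, the matrix padded by zero rows to a square has determinant
  0, since its transpose kills a unit vector. A kernel vector of the padded matrix is one of the
  original.\<close>

lemma injective_mat_le:
  fixes A :: "'a::field mat"
  assumes A: "A \<in> carrier_mat nr nc" and inj: "\<And>v. v \<in> carrier_vec nc \<Longrightarrow> A *\<^sub>v v = 0\<^sub>v nr \<Longrightarrow> v = 0\<^sub>v nc"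
  shows "nc \<le> nr"
proof (rule ccontr)
  assume "\<not> nc \<le> nr"
  then have lt: "nr < nc" by simp
  define B where "B = mat nc nc (\<lambda>(i, j). if i < nr then A $$ (i, j) else 0)"
  have B: "B \<in> carrier_mat nc nc"
    by (simp add: B_def)
  have "transpose_mat B *\<^sub>v unit_vec nc nr = 0\<^sub>v nc"
    using lt by (intro eq_vecI) (auto simp: B_def)
  moreover have "unit_vec nc nr \<noteq> (0\<^sub>v nc :: 'a vec)"
    using lt by (metis index_unit_vec(1) index_zero_vec(1) zero_neq_one)
  ultimately have "det (transpose_mat B) = 0"
    using B by (subst det_0_iff_vec_prod_zero_field[of _ nc]) (auto intro!: exI[of _ "unit_vec nc nr"])
  then have "det B = 0"
    using det_transpose[OF B] by simp
  then obtain v where v: "v \<in> carrier_vec nc" "v \<noteq> 0\<^sub>v nc" "B *\<^sub>v v = 0\<^sub>v nc"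
    using det_0_iff_vec_prod_zero_field[OF B] by blast
  have "A *\<^sub>v v = 0\<^sub>v nr"
  proof (rule eq_vecI)
    fix i assume "i < dim_vec (0\<^sub>v nr)"
    then have i: "i < nr" by simp
    have "row A i = row B i"
      using A i lt by (intro eq_vecI) (auto simp: B_def)
    then have "(A *\<^sub>v v) $ i = (B *\<^sub>v v) $ i"
      using A B i lt by simp
    then show "(A *\<^sub>v v) $ i = 0\<^sub>v nr $ i"
      using v(3) i lt by simp
  qed (use A in auto)
  then show False
    using inj v by blast
qed

text \<open>A vector killed by the transpose is orthogonal to the image, which contains all unit
  vectors.\<close>

lemma surjective_mat_le:
  fixes A :: "'a::field mat"
  assumes A: "A \<in> carrier_mat nr nc" and surj: "\<And>b. b \<in> carrier_vec nr \<Longrightarrow> \<exists>v\<in>carrier_vec nc. A *\<^sub>v v = b"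
  shows "nr \<le> nc"
proof (rule injective_mat_le)
  show "transpose_mat A \<in> carrier_mat nc nr"
    using A by simp
  fix w assume w: "w \<in> carrier_vec nr" "transpose_mat A *\<^sub>v w = 0\<^sub>v nc"
  show "w = 0\<^sub>v nr"
  proof (rule eq_vecI)
    fix i assume "i < dim_vec (0\<^sub>v nr)"
    then have i: "i < nr" by simp
    obtain v where v: "v \<in> carrier_vec nc" "A *\<^sub>v v = unit_vec nr i"
      using surj[of "unit_vec nr i"] by auto
    have "w $ i = unit_vec nr i \<bullet> w"
      using w(1) i by simp
    also have "\<dots> = (A *\<^sub>v v) \<bullet> w"
      by (simp add: v(2))
    also have "\<dots> = (transpose_mat A *\<^sub>v w) \<bullet> v"
      using transpose_vec_mult_scalar[OF A v(1) w(1)] A v(1) w(1) comm_scalar_prod[of w nr "A *\<^sub>v v"]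
      by (metis mult_mat_vec_carrier)
    also have "\<dots> = 0"
      using v(1) by (simp add: w(2))
    finally show "w $ i = 0\<^sub>v nr $ i"
      using i by simp
  qed (use w in auto)
qed

lemma injective_mat_inverse:
  fixes A :: "'a::field mat"
  assumes A: "A \<in> carrier_mat n n" and inj: "\<And>v. v \<in> carrier_vec n \<Longrightarrow> A *\<^sub>v v = 0\<^sub>v n \<Longrightarrow> v = 0\<^sub>v n"
  obtains B where "mat_inverse A = Some B" "B \<in> carrier_mat n n" "A * B = 1\<^sub>m n" "B * A = 1\<^sub>m n" "invertible_mat A"
proof -
  have "det A \<noteq> 0"
    using det_0_iff_vec_prod_zero_field[OF A] inj by blast
  then have "A \<in> Units (ring_mat TYPE('a) n ())"
    by (rule det_non_zero_imp_unit[OF A])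
  then obtain B where B: "mat_inverse A = Some B"
    using mat_inverse(1)[OF A, of "()"] by (metis option.exhaust)
  have h: "A * B = 1\<^sub>m n" "B * A = 1\<^sub>m n" "B \<in> carrier_mat n n"
    using mat_inverse(2)[OF A B] by auto
  have "invertible_mat A"
    using A h unfolding invertible_mat_def inverts_mat_def by (auto intro!: exI[of _ B])
  then show ?thesis
    using that B h by blast
qed

text \<open>The upper block equation determines \<open>p\<close> from \<open>q\<close>. The
  right-hand side is a kernel condition on the whole matrix with \<open>c\<close> subtracted on the
  diagonal of \<open>M22\<close>, which is what replacing \<open>f_0\<close> by
  \<open>f_0 - c w^\<theta>\<close> will do.\<close>

lemma schur_complement_eigenvalue_iff:
  fixes M11 :: "'a::field mat"
  assumes M: "M11 \<in> carrier_mat n1 n1" "M12 \<in> carrier_mat n1 n2" "M21 \<in> carrier_mat n2 n1" "M22 \<in> carrier_mat n2 n2"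
    and inj: "\<And>v. v \<in> carrier_vec n1 \<Longrightarrow> M11 *\<^sub>v v = 0\<^sub>v n1 \<Longrightarrow> v = 0\<^sub>v n1"
  shows "eigenvalue (schur_complement M11 M12 M21 M22) c \<longleftrightarrow>
    (\<exists>p\<in>carrier_vec n1. \<exists>q\<in>carrier_vec n2. (p \<noteq> 0\<^sub>v n1 \<or> q \<noteq> 0\<^sub>v n2) \<and>
      M11 *\<^sub>v p + M12 *\<^sub>v q = 0\<^sub>v n1 \<and> M21 *\<^sub>v p + M22 *\<^sub>v q = c \<cdot>\<^sub>v q)" (is "?L \<longleftrightarrow> ?R")
proof -
  obtain B where B: "mat_inverse M11 = Some B" "B \<in> carrier_mat n1 n1" "M11 * B = 1\<^sub>m n1" "B * M11 = 1\<^sub>m n1"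
    using injective_mat_inverse[OF M(1) inj] by blast
  define S where "S = schur_complement M11 M12 M21 M22"
  have S: "S = M22 - M21 * B * M12" "S \<in> carrier_mat n2 n2"
    using M B(2) by (auto simp: S_def schur_complement_def B(1))
  have Sq: "S *\<^sub>v q = M22 *\<^sub>v q - M21 *\<^sub>v (B *\<^sub>v (M12 *\<^sub>v q))" if q: "q \<in> carrier_vec n2" for q
  proof -
    have "S *\<^sub>v q = M22 *\<^sub>v q - (M21 * B * M12) *\<^sub>v q"
      unfolding S(1) using M B(2) q by (intro minus_mult_distrib_mat_vec[of _ n2 n2]) auto
    also have "(M21 * B * M12) *\<^sub>v q = (M21 * B) *\<^sub>v (M12 *\<^sub>v q)"
      using M B(2) q by (intro assoc_mult_mat_vec[of _ n2 n1 _ n2]) auto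
    also have "\<dots> = M21 *\<^sub>v (B *\<^sub>v (M12 *\<^sub>v q))"
      using M B(2) q by (intro assoc_mult_mat_vec[of _ n2 n1 _ n1]) auto
    finally show ?thesis .
  qed
  show ?thesis
    unfolding S_def[symmetric]
  proof
    assume "eigenvalue S c"
    then obtain q where q: "q \<in> carrier_vec n2" "q \<noteq> 0\<^sub>v n2" "S *\<^sub>v q = c \<cdot>\<^sub>v q"
      using S(2) by (auto simp: eigenvalue_def eigenvector_def)
    define t where "t = B *\<^sub>v (M12 *\<^sub>v q)"
    have t: "t \<in> carrier_vec n1"
      using M B(2) q by (auto simp: t_def)
    have M11t: "M11 *\<^sub>v t = M12 *\<^sub>v q"
    proof -
      have "M11 *\<^sub>v t = (M11 * B) *\<^sub>v (M12 *\<^sub>v q)"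
        unfolding t_def using M B(2) q by (intro assoc_mult_mat_vec[symmetric, of _ n1 n1 _ n1]) auto
      then show ?thesis
        using M q by (simp add: B(3))
    qed
    have neg: "M *\<^sub>v (- t) = - (M *\<^sub>v t)" if "M \<in> carrier_mat n n1" for M n
      using t that by (intro eq_vecI) auto
    show ?R
    proof (intro bexI conjI)
      show "- t \<in> carrier_vec n1" "q \<in> carrier_vec n2" "- t \<noteq> 0\<^sub>v n1 \<or> q \<noteq> 0\<^sub>v n2"
        using t q by auto
      show "M11 *\<^sub>v - t + M12 *\<^sub>v q = 0\<^sub>v n1"
        unfolding neg[OF M(1)] M11t using M q by (intro eq_vecI) auto
      show "M21 *\<^sub>v - t + M22 *\<^sub>v q = c \<cdot>\<^sub>v q"
        unfolding neg[OF M(3)] q(3)[symmetric] Sq[OF q(1)] t_def[symmetric]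
        using M t q(1) by (intro eq_vecI) auto
    qed
  next
    assume ?R
    then obtain p q where p: "p \<in> carrier_vec n1" and q: "q \<in> carrier_vec n2" and nz: "p \<noteq> 0\<^sub>v n1 \<or> q \<noteq> 0\<^sub>v n2"
      and e: "M11 *\<^sub>v p + M12 *\<^sub>v q = 0\<^sub>v n1" "M21 *\<^sub>v p + M22 *\<^sub>v q = c \<cdot>\<^sub>v q"
      by blast
    have M12q: "M12 *\<^sub>v q = M11 *\<^sub>v (- p)"
    proof (rule eq_vecI)
      fix i assume "i < dim_vec (M11 *\<^sub>v (- p))"
      then have i: "i < n1"
        using M by simp
      have "(M11 *\<^sub>v p + M12 *\<^sub>v q) $ i = 0"
        using e(1) i by simp
      then show "(M12 *\<^sub>v q) $ i = (M11 *\<^sub>v (- p)) $ i"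
        using M i p q by (simp add: add_eq_0_iff)
    qed (use M in auto)
    have Bp: "B *\<^sub>v (M12 *\<^sub>v q) = - p"
    proof -
      have "B *\<^sub>v (M12 *\<^sub>v q) = (B * M11) *\<^sub>v (- p)"
        unfolding M12q using M B(2) p by (intro assoc_mult_mat_vec[symmetric, of _ n1 n1 _ n1]) auto
      then show ?thesis
        using p by (simp add: B(4))
    qed
    have "q \<noteq> 0\<^sub>v n2"
    proof
      assume q0: "q = 0\<^sub>v n2"
      have "M11 *\<^sub>v p = 0\<^sub>v n1"
      proof -
        have "M12 *\<^sub>v q = 0\<^sub>v n1"
          unfolding q0 using M by (intro eq_vecI) auto
        then show ?thesis
          using e(1) right_zero_vec[OF mult_mat_vec_carrier[OF M(1) p]] by simp
      qed
      then show False
        using inj[OF p] nz q0 by simp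
    qed
    moreover have "S *\<^sub>v q = c \<cdot>\<^sub>v q"
    proof -
      have "M21 *\<^sub>v (- p) = - (M21 *\<^sub>v p)"
        using p M by (intro eq_vecI) auto
      then show ?thesis
        unfolding Sq[OF q] Bp e(2)[symmetric] using M p q by (intro eq_vecI) auto
    qed
    ultimately show "eigenvalue S c"
      using q S(2) by (auto simp: eigenvalue_def eigenvector_def)
  qed
qed

section \<open>Matrices of \<open>delta1\<close> in ordered bases\<close>

definition delta_mat :: "(nat \<Rightarrow> 'r::comm_ring_1 tpoly) \<Rightarrow> kbasis list \<Rightarrow> kbasis list \<Rightarrow> 'r mat" where
  "delta_mat F R C = mat (length R) (length C) (\<lambda>(i, j). delta_entry F (R ! i) (C ! j))"

lemma delta_mat_carrier [simp]: "delta_mat F R C \<in> carrier_mat (length R) (length C)"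
  by (simp add: delta_mat_def)

definition vec_on :: "kbasis list \<Rightarrow> (kbasis \<Rightarrow> 'a) \<Rightarrow> 'a vec" where
  "vec_on C v = vec (length C) (\<lambda>j. v (C ! j))"

lemma vec_on_carrier [simp]: "vec_on C v \<in> carrier_vec (length C)"
  by (simp add: vec_on_def)

lemma delta_mat_mult_vec_on:
  assumes "distinct C" "i < length R"
  shows "(delta_mat F R C *\<^sub>v vec_on C v) $ i = (\<Sum>w\<in>set C. delta_entry F (R ! i) w * v w)"
proof -
  have "(delta_mat F R C *\<^sub>v vec_on C v) $ i = (\<Sum>j<length C. delta_entry F (R ! i) (C ! j) * v (C ! j))"
    using assms(2) by (simp add: delta_mat_def vec_on_def scalar_prod_def atLeast0LessThan)
  also have "\<dots> = (\<Sum>w\<in>set C. delta_entry F (R ! i) w * v w)"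
    using sum.reindex_bij_betw[OF bij_betw_nth[OF assms(1) refl refl], of "\<lambda>w. delta_entry F (R ! i) w * v w"]
    by simp
  finally show ?thesis .
qed

lemma vec_on_ex:
  assumes "distinct C" "p \<in> carrier_vec (length C)"
  shows "\<exists>v. p = vec_on C v \<and> (\<forall>w. w \<notin> set C \<longrightarrow> v w = (0 :: 'a::zero))"
proof -
  define v where "v w = (if w \<in> set C then p $ (THE j. j < length C \<and> C ! j = w) else 0)" for w
  have "v (C ! j) = p $ j" if "j < length C" for j
  proof -
    have "(THE j'. j' < length C \<and> C ! j' = C ! j) = j"
      using assms(1) that by (intro the_equality) (auto simp: nth_eq_iff_index_eq)
    then show ?thesis
      using that by (simp add: v_def)
  qed
  then have "p = vec_on C v"
    using assms(2) by (intro eq_vecI) (auto simp: vec_on_def)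
  then show ?thesis
    by (auto simp: v_def)
qed

lemma vec_on_eq_0_iff: "vec_on C v = 0\<^sub>v (length C) \<longleftrightarrow> (\<forall>w\<in>set C. v w = (0 :: 'a::zero))"
  unfolding vec_on_def by (simp add: vec_eq_iff all_set_conv_all_nth)

text \<open>A single system without zeros gives a linear bijection between the two spaces; this
  replaces a count by binomial coefficients.\<close>

lemma (in two_bilinear_system) card_K_eq:
  assumes "no_common_zero nx ny nz {0..r+s} f"
  shows "card K0 = card K1"
proof -
  obtain R where R: "set R = K0" "distinct R"
    using finite_distinct_list[OF finite_K0_basis] by blast
  obtain C where C: "set C = K1" "distinct C"
    using finite_distinct_list[OF finite_K1_basis] by blast
  let ?A = "delta_mat f R C"
  have Av: "(?A *\<^sub>v vec_on C v) $ i = (\<Sum>w\<in>K1. delta_entry f (R ! i) w * v w)" if "i < length R" for v i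
    using delta_mat_mult_vec_on[OF C(2) that] by (simp add: C(1))
  have "length C \<le> length R"
  proof (rule injective_mat_le[of ?A])
    fix p assume p: "p \<in> carrier_vec (length C)" "?A *\<^sub>v p = 0\<^sub>v (length R)"
    obtain v where v: "p = vec_on C v"
      using vec_on_ex[OF C(2) p(1)] by blast
    have "(\<Sum>w\<in>K1. delta_entry f u w * v w) = 0" if u: "u \<in> K0" for u
    proof -
      obtain i where i: "i < length R" "R ! i = u"
        using u R(1) by (metis in_set_conv_nth)
      then show ?thesis
        using Av[OF i(1), of v] p(2) v by simp
    qed
    then have "v w = 0" if "w \<in> K1" for w
      using delta_injective[OF assms _ that] by blast
    then show "p = 0\<^sub>v (length C)"
      unfolding v vec_on_eq_0_iff by (simp add: C(1))
  qed simp
  moreover have "length R \<le> length C"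
  proof (rule surjective_mat_le[of ?A])
    fix b :: "'a vec" assume b: "b \<in> carrier_vec (length R)"
    obtain g where g: "b = vec_on R g"
      using vec_on_ex[OF R(2) b] by blast
    obtain v where v: "\<forall>u\<in>K0. (\<Sum>w\<in>K1. delta_entry f u w * v w) = g u"
      using delta_surjective[OF assms] by blast
    have "?A *\<^sub>v vec_on C v = b"
    proof (rule eq_vecI)
      fix i assume "i < dim_vec b"
      then have i: "i < length R"
        using b by simp
      then have "R ! i \<in> K0"
        using R(1) nth_mem by blast
      then show "(?A *\<^sub>v vec_on C v) $ i = b $ i"
        using Av[OF i, of v] v i by (simp add: g vec_on_def)
    qed (use b in \<open>simp add: delta_mat_def\<close>)
    then show "\<exists>v\<in>carrier_vec (length C). ?A *\<^sub>v v = b"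
      using vec_on_carrier by blast
  qed simp
  ultimately show ?thesis
    using R C distinct_card[of R] distinct_card[of C] by simp
qed

section \<open>Specialization of the universal system\<close>

lemma specialize_add: "specialize F (p + q) = specialize F p + specialize F q"
  by (simp add: specialize_def eval_with_add)

lemma specialize_zero [simp]: "specialize F 0 = 0"
  by (simp add: specialize_def)

lemma specialize_uminus: "specialize F (- p) = - specialize F p"
  using specialize_add[of F p "- p"] by (simp add: add_eq_0_iff2)

lemma specialize_sum: "specialize F (\<Sum>i\<in>A. p i) = (\<Sum>i\<in>A. specialize F (p i))"
  by (simp add: specialize_def eval_with_sum)

lemma specialize_ksgn: "specialize F (ksgn l J p) = ksgn l J (specialize F p)"
  by (simp add: ksgn_def specialize_uminus)

lemma specialize_uvar: "specialize F (uvar i \<sigma>) = Poly_Mapping.lookup (F i) \<sigma>"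
  by (simp add: specialize_def uvar_def eval_with_single)

lemma specialize_cong:
  assumes "\<And>i \<sigma>. (i, \<sigma>) \<in> poly_vars p \<Longrightarrow> Poly_Mapping.lookup (F i) \<sigma> = Poly_Mapping.lookup (G i) \<sigma>"
  shows "specialize F p = specialize G p"
  unfolding specialize_def eval_with_def
proof (intro sum.cong refl arg_cong2[where f = "(*)"] mon_val_cong)
  fix m v assume mv: "m \<in> Poly_Mapping.keys p" "v \<in> Poly_Mapping.keys m"
  obtain i \<sigma> where v: "v = (i, \<sigma>)" by (cases v)
  have "(i, \<sigma>) \<in> poly_vars p"
    unfolding poly_vars_def using mv v by blast
  then show "(case v of (i, \<sigma>) \<Rightarrow> Poly_Mapping.lookup (F i) \<sigma>) = (case v of (i, \<sigma>) \<Rightarrow> Poly_Mapping.lookup (G i) \<sigma>)"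
    using assms v by simp
qed

lemma lookup_universal_system:
  "Poly_Mapping.lookup (universal_system nx ny nz r i) \<sigma> =
    (if \<sigma> \<in> expos nx ny nz (bilinear_degree r i) then uvar i \<sigma> else 0)"
  by (auto simp: universal_system_def lookup_sum lookup_single when_def finite_expos
      simp del: bilinear_degree.simps)

lemma bilinear_degree_sys_deg: "bilinear_degree r l = (sys_deg r BlockX l, sys_deg r BlockY l, sys_deg r BlockZ l)"
  by (auto simp: sys_deg_def)

declare bilinear_degree.simps [simp del]

lemma contraction_coeff_superset:
  assumes "finite A" "Poly_Mapping.keys p \<subseteq> A"
  shows "contraction_coeff p \<tau> \<sigma> = (\<Sum>\<theta>\<in>A.
     if expo_block BlockX \<sigma> = expo_block BlockX \<tau> + expo_block BlockX \<theta> \<and>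
        expo_block BlockY \<sigma> = expo_block BlockY \<tau> + expo_block BlockY \<theta> \<and>
        expo_block BlockZ \<tau> = expo_block BlockZ \<sigma> + expo_block BlockZ \<theta>
     then Poly_Mapping.lookup p \<theta> else 0)"
  unfolding contraction_coeff_def using assms
  by (intro sum.mono_neutral_left) (auto simp: in_keys_iff)

text \<open>A coefficient that vanishes in \<open>F\<close> is still a variable in the universal
  system, so the supports differ; both sums are therefore taken over all exponents of the given
  degree.\<close>

lemma specialize_delta_entry:
  assumes F: "\<And>l. l \<in> snd w \<Longrightarrow> F l \<in> forms nx ny nz (bilinear_degree r l)"
  shows "specialize F (delta_entry (universal_system nx ny nz r) u w) = delta_entry F u w"
proof -
  have "specialize F (contraction_coeff (universal_system nx ny nz r l) \<tau> \<sigma>) = contraction_coeff (F l) \<tau> \<sigma>"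
    if l: "l \<in> snd w" for l \<tau> \<sigma>
  proof -
    let ?A = "expos nx ny nz (bilinear_degree r l)"
    have "Poly_Mapping.keys (universal_system nx ny nz r l :: 'a upoly tpoly) \<subseteq> ?A" "Poly_Mapping.keys (F l) \<subseteq> ?A"
      using F[OF l] by (auto simp: in_keys_iff lookup_universal_system forms_def split: if_splits)
    then show ?thesis
      by (simp add: contraction_coeff_superset[OF finite_expos] specialize_sum lookup_universal_system
          specialize_uvar if_distrib[of "specialize F"] cong: if_cong)
  qed
  then show ?thesis
    unfolding delta_entry_def specialize_sum
    by (intro sum.cong refl) (simp add: specialize_ksgn)
qed

lemma K1_card: "nx + ny + nz = r + s \<Longrightarrow> w \<in> K1_basis nx ny nz r s \<Longrightarrow> card (snd w) = nx + ny + 1"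
  using mem_K_iff(1)[of nx ny nz r s "fst w" "snd w"] by (simp add: of_nat_eq_iff[symmetric] del: of_nat_eq_iff)

lemma delta1_mat_eq:
  assumes "nx + ny + nz = r + s" "set C \<subseteq> K1_basis nx ny nz r s"
  shows "delta1_mat nx ny F R C = delta_mat F R C"
proof (rule eq_matI)
  fix i j assume "i < dim_row (delta_mat F R C)" "j < dim_col (delta_mat F R C)"
  then have ij: "i < length R" "j < length C"
    by (simp_all add: delta_mat_def)
  then have "C ! j \<in> K1_basis nx ny nz r s"
    using assms(2) nth_mem by blast
  then have "card (snd (C ! j)) = nx + ny + 1"
    using K1_card[OF assms(1)] by blast
  then show "delta1_mat nx ny F R C $$ (i, j) = delta_mat F R C $$ (i, j)"
    using ij lookup_delta1[of "snd (C ! j)" nx ny F "fst (C ! j)" "fst (R ! i)" "snd (R ! i)"]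
    by (simp add: delta1_mat_def delta_mat_def)
qed (simp_all add: delta1_mat_def delta_mat_def)

lemma specialize_delta1_mat:
  assumes "nx + ny + nz = r + s" "set C \<subseteq> K1_basis nx ny nz r s"
    and F: "\<And>l. l \<le> r + s \<Longrightarrow> F l \<in> forms nx ny nz (bilinear_degree r l)"
  shows "map_mat (specialize F) (delta1_mat nx ny (universal_system nx ny nz r) R C) = delta_mat F R C"
proof (rule eq_matI)
  fix i j assume "i < dim_row (delta_mat F R C)" "j < dim_col (delta_mat F R C)"
  then have ij: "i < length R" "j < length C"
    by (simp_all add: delta_mat_def)
  then have "C ! j \<in> K1_basis nx ny nz r s"
    using assms(2) nth_mem by blast
  then have "snd (C ! j) \<subseteq> {0..r+s}"
    using mem_K_iff(1)[OF assms(1), of "fst (C ! j)" "snd (C ! j)"] by simp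
  then have "specialize F (delta_entry (universal_system nx ny nz r) (R ! i) (C ! j)) = delta_entry F (R ! i) (C ! j)"
    using F by (intro specialize_delta_entry) auto
  then show "map_mat (specialize F) (delta1_mat nx ny (universal_system nx ny nz r) R C) $$ (i, j) = delta_mat F R C $$ (i, j)"
    using ij by (simp add: delta1_mat_eq[OF assms(1,2)] delta_mat_def)
qed (simp_all add: delta1_mat_def delta_mat_def)

lemma mat_entry_notin:
  assumes "M = delta1_mat nx ny U R C" "\<forall>i<dim_row M. \<forall>j<dim_col M. v \<notin> poly_vars (M $$ (i, j))"
    and "nx + ny + nz = r + s" "set C \<subseteq> K1_basis nx ny nz r s" "u \<in> set R" "w \<in> set C"
  shows "v \<notin> poly_vars (delta_entry U u w)"
proof -
  obtain i j where ij: "i < length R" "R ! i = u" "j < length C" "C ! j = w"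
    using assms(5,6) by (metis in_set_conv_nth)
  have "M = delta_mat U R C"
    using assms(1) delta1_mat_eq[OF assms(3,4)] by simp
  then show ?thesis
    using assms(2) ij by (auto simp: delta_mat_def)
qed

lemma single_in_forms:
  "\<theta> \<in> expos nx ny nz d \<Longrightarrow> Poly_Mapping.single \<theta> c \<in> forms nx ny nz d"
  by (simp add: forms_def)

lemma forms_diff: "p \<in> forms nx ny nz d \<Longrightarrow> q \<in> forms nx ny nz d \<Longrightarrow> p - q \<in> forms nx ny nz d"
  for p :: "'a::comm_ring_1 tpoly"
  using keys_diff[of p q] unfolding forms_def by blast

lemma keys_single_subset: "Poly_Mapping.keys (Poly_Mapping.single v c) \<subseteq> {v}"
  by simp

lemma contraction_coeff_single:
  "contraction_coeff (Poly_Mapping.single \<theta> c) \<tau> \<sigma> =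
     (if expo_block BlockX \<sigma> = expo_block BlockX \<tau> + expo_block BlockX \<theta> \<and>
        expo_block BlockY \<sigma> = expo_block BlockY \<tau> + expo_block BlockY \<theta> \<and>
        expo_block BlockZ \<tau> = expo_block BlockZ \<sigma> + expo_block BlockZ \<theta> then c else 0)"
  unfolding contraction_coeff_superset[OF finite.insertI[OF finite.emptyI] keys_single_subset] by simp

lemma delta_entry_nonzero:
  assumes "delta_entry F u w \<noteq> 0"
  obtains k where "k \<in> snd w" "snd u = snd w - {k}" "contraction_coeff (F k) (fst u) (fst w) \<noteq> 0"
proof -
  have "\<exists>k\<in>snd w. (if snd u = snd w - {k} then ksgn k (snd u) (contraction_coeff (F k) (fst u) (fst w)) else 0) \<noteq> 0"
  proof (rule ccontr)
    assume "\<not> ?thesis"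
    then have "delta_entry F u w = 0"
      unfolding delta_entry_def by (intro sum.neutral) blast
    then show False using assms by simp
  qed
  then obtain k where k: "k \<in> snd w" "(if snd u = snd w - {k} then ksgn k (snd u) (contraction_coeff (F k) (fst u) (fst w)) else 0) \<noteq> 0"
    by blast
  then show ?thesis
    using that[of k] by (simp split: if_splits)
qed

lemma delta_entry_remove:
  assumes "finite I" "k \<in> I"
  shows "delta_entry F (\<tau>, I - {k}) (\<sigma>, I) = ksgn k (I - {k}) (contraction_coeff (F k) \<tau> \<sigma>)"
proof -
  have "I - {k} = I - {l} \<longleftrightarrow> l = k" if "l \<in> I" for l
    using that assms(2) by auto
  then have "delta_entry F (\<tau>, I - {k}) (\<sigma>, I) =
      (\<Sum>l\<in>I. if l = k then ksgn k (I - {k}) (contraction_coeff (F k) \<tau> \<sigma>) else 0)"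
    unfolding delta_entry_def fst_conv snd_conv by (intro sum.cong refl) auto
  then show ?thesis
    using assms by simp
qed

text \<open>Guarantees that wherever \<open>w^\<theta>\<close> acts on a column containing
  \<open>e_0\<close>, the target is one of the rows of the matrix.\<close>

lemma K1_contract_mem_K0:
  assumes dims: "nx + ny + nz = r + s" and w: "(\<sigma>, I) \<in> K1_basis nx ny nz r s" "0 \<in> I"
    and \<theta>: "\<theta> \<in> expos nx ny nz (1, 1, 1)"
    and rel: "expo_block BlockX \<sigma> = expo_block BlockX \<tau> + expo_block BlockX \<theta>"
        "expo_block BlockY \<sigma> = expo_block BlockY \<tau> + expo_block BlockY \<theta>"
        "expo_block BlockZ \<tau> = expo_block BlockZ \<sigma> + expo_block BlockZ \<theta>"
  shows "(\<tau>, I - {0}) \<in> K0_basis nx ny nz r s"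
proof -
  have h: "I \<subseteq> {0..r+s}" "int (card I) = int (nx + ny + 1)" "kexp nx ny \<sigma> \<in> kregion nx ny (block_vars BlockZ nz)"
    "\<And>b. bdeg b (kexp nx ny \<sigma>) = sys_shift nx ny r b - (\<Sum>i\<in>I. sys_deg r b i)"
    using w(1) unfolding mem_K_iff(1)[OF dims] by blast+
  have fin: "finite I"
    using h(1) finite_subset by blast
  have bZ: "set (block_vars BlockZ nz) \<subseteq> {BlockZ} \<times> UNIV"
    by (auto simp: set_block_vars)
  have k: "kexp nx ny \<tau> = kexp nx ny \<sigma> + lexp \<theta>"
    using rel by (simp add: kexp_eq_iff)
  have out: "Poly_Mapping.lookup (expo_block BlockZ \<theta>) i = 0" if "(BlockZ, i) \<notin> set (block_vars BlockZ nz)" for i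
    using bdeg_lexp_expos(4)[OF \<theta>, of "(BlockZ, i)"] that by (auto simp: lookup_lexp set_block_vars)
  have "kexp nx ny \<tau> \<in> kregion nx ny (block_vars BlockZ nz)"
    using h(3) unfolding kregion_iff[OF bZ] lookup_kexp rel by (auto simp: lookup_add out)
  moreover have "bdeg b (kexp nx ny \<tau>) = sys_shift nx ny r b - (\<Sum>i\<in>I - {0}. sys_deg r b i)" for b
    using h(4)[of b] bdeg_lexp_expos(1-3)[OF \<theta>] sum.remove[OF fin w(2), of "sys_deg r b"]
    unfolding k by (cases b) (simp_all add: bdeg_add sys_deg_def)
  moreover have "int (card (I - {0})) = int (nx + ny)"
    using h(2) w(2) fin by simp
  ultimately show ?thesis
    unfolding mem_K_iff(2)[OF dims] using h(1) by blast
qed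

text \<open>Only the diagonal of \<open>M22\<close> depends on the coefficient of
  \<open>w^\<theta>\<close> in \<open>f_0\<close>. Subtracting \<open>c w^\<theta>\<close> from
  \<open>f_0\<close> therefore subtracts \<open>c\<close> there and nowhere else, and the eigenvalue
  condition becomes singularity of \<open>delta1\<close> for the modified system.\<close>

theorem schur_complement_eigenvalues:
  fixes nx ny nz r s :: nat and g :: "nat \<Rightarrow> 'a::{alg_closed_field, field_char_0} tpoly"
  assumes sys: "square_two_bilinear nx ny nz r s g"
    and \<theta>: "\<theta> \<in> expos nx ny nz (1, 1, 1)"
    and re: "rearranged_delta1 nx ny nz r s \<theta> M11 M12 M21 M22"
    and f0: "f0 \<in> forms nx ny nz (1, 1, 1)"
    and generic: "\<And>x y z. x \<in> hom_coords nx \<Longrightarrow> y \<in> hom_coords ny \<Longrightarrow> z \<in> hom_coords nz \<Longrightarrow>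
      (\<And>l. l \<in> {1..r+s} \<Longrightarrow> teval (x, y, z) (g l) = 0) \<Longrightarrow> mon_val3 (x, y, z) \<theta> \<noteq> 0"
  defines "ev \<equiv> map_mat (specialize (g(0 := f0)))"
  shows "invertible_mat (ev M11)"
    and "eigenvalue (schur_complement (ev M11) (ev M12) (ev M21) (ev M22)) c \<longleftrightarrow>
      \<not> no_common_zero nx ny nz {0..r+s} (g(0 := f0 - Poly_Mapping.single \<theta> c))"
proof -
  have dims: "nx + ny + nz = r + s" "ny \<le> r" "nz \<le> s" "ny \<ge> 1" "nz \<ge> 1"
    and g1: "\<And>i. i \<in> {1..r} \<Longrightarrow> g i \<in> forms nx ny nz (1, 1, 0)"
    and g2: "\<And>i. i \<in> {r+1..r+s} \<Longrightarrow> g i \<in> forms nx ny nz (1, 0, 1)"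
    using sys by (auto simp: square_two_bilinear_def)
  have forms: "(g(0 := h)) l \<in> forms nx ny nz (bilinear_degree r l)"
    if "h \<in> forms nx ny nz (1, 1, 1)" "l \<le> r + s" for h l
    using that g1[of l] g2[of l] by (auto simp: bilinear_degree.simps)
  have system: "two_bilinear_system nx ny nz r s (g(0 := h))" if "h \<in> forms nx ny nz (1, 1, 1)" for h
    using dims forms[OF that] by unfold_locales (auto simp: bilinear_degree_sys_deg)
  let ?K1 = "K1_basis nx ny nz r s" and ?K0 = "K0_basis nx ny nz r s"
  let ?U = "universal_system nx ny nz r :: nat \<Rightarrow> 'a upoly tpoly"
  obtain R1 R2 C1 C2 where RC: "distinct (R1 @ R2)" "set (R1 @ R2) = ?K0" "distinct (C1 @ C2)" "set (C1 @ C2) = ?K1"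
    and M: "M11 = delta1_mat nx ny ?U R1 C1" "M12 = delta1_mat nx ny ?U R1 C2"
      "M21 = delta1_mat nx ny ?U R2 C1" "M22 = delta1_mat nx ny ?U R2 C2"
    and sq: "square_mat M22"
    and diag: "\<And>i. i < dim_row M22 \<Longrightarrow> M22 $$ (i, i) = uvar 0 \<theta>"
    and offdiag: "\<And>i j. i < dim_row M22 \<Longrightarrow> j < dim_col M22 \<Longrightarrow> i \<noteq> j \<Longrightarrow> (0, \<theta>) \<notin> poly_vars (M22 $$ (i, j))"
    and rest: "\<forall>N\<in>{M11, M12, M21}. \<forall>i<dim_row N. \<forall>j<dim_col N. (0, \<theta>) \<notin> poly_vars (N $$ (i, j))"
    using re unfolding rearranged_delta1_def Let_def by blast
  have C12: "set C1 \<subseteq> ?K1" "set C2 \<subseteq> ?K1" and R12: "set R1 \<subseteq> ?K0" "set R2 \<subseteq> ?K0"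
    using RC by auto
  have C1C2: "set C1 \<union> set C2 = ?K1" "set C1 \<inter> set C2 = {}" "distinct C1" "distinct C2"
    and R1R2: "set R1 \<union> set R2 = ?K0" "distinct R1" "distinct R2"
    using RC by auto
  have len2: "length R2 = length C2"
    using sq by (simp add: M(4) delta1_mat_def)
  have M22: "M22 = delta_mat ?U R2 C2"
    unfolding M(4) by (rule delta1_mat_eq[OF dims(1) C12(2)])
  have K1N: "snd w \<subseteq> {0..r+s}" "finite (snd w)" if "w \<in> ?K1" for w
  proof -
    show "snd w \<subseteq> {0..r+s}"
      using that mem_K_iff(1)[OF dims(1), of "fst w" "snd w"] by simp
    then show "finite (snd w)"
      using finite_subset by blast
  qed
  have spec: "specialize (g(0 := h)) (delta_entry ?U u w) = delta_entry (g(0 := h)) u w"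
    if h: "h \<in> forms nx ny nz (1, 1, 1)" and w: "w \<in> ?K1" for h u w
  proof (rule specialize_delta_entry)
    fix l assume "l \<in> snd w"
    then have "l \<le> r + s"
      using K1N(1)[OF w] by auto
    then show "(g(0 := h)) l \<in> forms nx ny nz (bilinear_degree r l)"
      by (rule forms[OF h])
  qed
  have indep: "delta_entry (g(0 := h)) u w = delta_entry (g(0 := h')) u w"
    if h: "h \<in> forms nx ny nz (1, 1, 1)" "h' \<in> forms nx ny nz (1, 1, 1)"
      "\<And>\<sigma>. \<sigma> \<noteq> \<theta> \<Longrightarrow> Poly_Mapping.lookup h \<sigma> = Poly_Mapping.lookup h' \<sigma>"
      and w: "w \<in> ?K1" and nv: "(0, \<theta>) \<notin> poly_vars (delta_entry ?U u w)" for h h' u w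
  proof -
    have "specialize (g(0 := h)) (delta_entry ?U u w) = specialize (g(0 := h')) (delta_entry ?U u w)"
    proof (rule specialize_cong)
      fix i \<sigma> assume "(i, \<sigma>) \<in> poly_vars (delta_entry ?U u w)"
      then have "i \<noteq> 0 \<or> \<sigma> \<noteq> \<theta>"
        using nv by auto
      then show "Poly_Mapping.lookup ((g(0 := h)) i) \<sigma> = Poly_Mapping.lookup ((g(0 := h')) i) \<sigma>"
        using h(3)[of \<sigma>] by auto
    qed
    then show ?thesis
      using spec[OF h(1) w] spec[OF h(2) w] by simp
  qed
  have nv11: "(0, \<theta>) \<notin> poly_vars (delta_entry ?U u w)" if "u \<in> set R1" "w \<in> set C1" for u w
    using rest by (intro mat_entry_notin[OF M(1) _ dims(1) C12(1) that]) blast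
  have nv12: "(0, \<theta>) \<notin> poly_vars (delta_entry ?U u w)" if "u \<in> set R1" "w \<in> set C2" for u w
    using rest by (intro mat_entry_notin[OF M(2) _ dims(1) C12(2) that]) blast
  have nv21: "(0, \<theta>) \<notin> poly_vars (delta_entry ?U u w)" if "u \<in> set R2" "w \<in> set C1" for u w
    using rest by (intro mat_entry_notin[OF M(3) _ dims(1) C12(1) that]) blast
  let ?t = "Poly_Mapping.single \<theta> (1::'a)"
  have t: "?t \<in> forms nx ny nz (1, 1, 1)"
    by (rule single_in_forms[OF \<theta>])
  have zero_form: "0 \<in> forms nx ny nz (1, 1, 1)"
    by (simp add: forms_def)
  obtain a b e where abe: "\<theta> = (a, b, e)" by (metis prod_cases3)
  obtain i0 where i0: "i0 \<le> nx" "a = Poly_Mapping.single i0 1"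
    using \<theta> by (auto simp: abe elim: block_expos_1)
  obtain j0 where j0: "j0 \<le> ny" "b = Poly_Mapping.single j0 1"
    using \<theta> by (auto simp: abe elim: block_expos_1)
  obtain k0 where k0: "k0 \<le> nz" "e = Poly_Mapping.single k0 1"
    using \<theta> by (auto simp: abe elim: block_expos_1)
  have mon\<theta>: "mon_val3 (x, y, z) \<theta> = x i0 * y j0 * z k0" for x y z :: "nat \<Rightarrow> 'a"
    by (simp add: abe i0 j0 k0)
  have teval\<theta>: "teval w (Poly_Mapping.single \<theta> d) = d * mon_val3 w \<theta>" for w and d :: 'a
    by (rule teval_single)
  \<comment> \<open>By \<open>generic\<close>, putting \<open>w^\<theta>\<close> at index 0 removes
    all common zeros; this system serves both for injectivity and for comparing the sizes of the
    bases.\<close>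
  have ncz: "no_common_zero nx ny nz {0..r+s} (g(0 := ?t))"
    unfolding no_common_zero_def
  proof (intro ballI, rule ccontr)
    fix x y z :: "nat \<Rightarrow> 'a"
    assume xyz: "x \<in> hom_coords nx" "y \<in> hom_coords ny" "z \<in> hom_coords nz"
    assume "\<not> (\<exists>l\<in>{0..r+s}. teval (x, y, z) ((g(0 := ?t)) l) \<noteq> 0)"
    then have z: "\<And>l. l \<le> r + s \<Longrightarrow> teval (x, y, z) ((g(0 := ?t)) l) = 0"
      by auto
    have "teval (x, y, z) (g l) = 0" if "l \<in> {1..r+s}" for l
      using z[of l] that by auto
    then have "mon_val3 (x, y, z) \<theta> \<noteq> 0"
      using generic[OF xyz] by blast
    then show False
      using z[of 0] by (simp add: teval\<theta>)
  qed
  \<comment> \<open>If \<open>w^\<theta>\<close> acted nontrivially on a column of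
    \<open>C1\<close>, the variable \<open>u_{0,\<theta>}\<close> would occur outside
    \<open>M22\<close>. This is detected by comparing the entries for \<open>w^\<theta>\<close> and
    for 0 at index 0.\<close>
  have col: "\<not> (0 \<in> snd w \<and> expo_block BlockX (fst w) = expo_block BlockX (fst u) + expo_block BlockX \<theta> \<and>
      expo_block BlockY (fst w) = expo_block BlockY (fst u) + expo_block BlockY \<theta> \<and>
      expo_block BlockZ (fst u) = expo_block BlockZ (fst w) + expo_block BlockZ \<theta>)"
    if w: "w \<in> set C1" for u w
  proof
    assume h: "0 \<in> snd w \<and> expo_block BlockX (fst w) = expo_block BlockX (fst u) + expo_block BlockX \<theta> \<and>
      expo_block BlockY (fst w) = expo_block BlockY (fst u) + expo_block BlockY \<theta> \<and>
      expo_block BlockZ (fst u) = expo_block BlockZ (fst w) + expo_block BlockZ \<theta>"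
    have wK: "w \<in> ?K1"
      using w C12 by blast
    define u' where "u' = (fst u, snd w - {0})"
    have "u' \<in> ?K0"
      unfolding u'_def using h wK by (intro K1_contract_mem_K0[OF dims(1) _ _ \<theta>, of "fst w"]) auto
    then have nv: "(0, \<theta>) \<notin> poly_vars (delta_entry ?U u' w)"
      using R1R2(1) nv11 nv21 w by blast
    have "delta_entry (g(0 := ?t)) u' w = delta_entry (g(0 := 0)) u' w"
      by (rule indep[OF t zero_form _ wK nv]) (auto simp: lookup_single)
    moreover have "delta_entry F u' w = ksgn 0 (snd w - {0}) (contraction_coeff (F 0) (fst u) (fst w))" for F :: "nat \<Rightarrow> 'a tpoly"
      using delta_entry_remove[OF K1N(2)[OF wK], of 0 F "fst u" "fst w"] h by (simp add: u'_def)
    ultimately have "contraction_coeff ?t (fst u) (fst w) = contraction_coeff 0 (fst u) (fst w)"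
      by (simp add: ksgn_def)
    then show False
      using h by (simp add: contraction_coeff_single) (simp add: contraction_coeff_def)
  qed
  \<comment> \<open>A row of \<open>R2\<close> contains a diagonal entry
    \<open>u_{0,\<theta>}\<close>, so it arises by removing \<open>e_0\<close> and multiplying by
    z_k0. The system with \<open>w^\<theta>\<close> at index 0 and zero elsewhere detects
    this.\<close>
  have row: "0 \<notin> snd u \<and> Poly_Mapping.lookup (expo_block BlockZ (fst u)) k0 \<noteq> 0" if u: "u \<in> set R2" for u
  proof -
    obtain i where i: "i < length R2" "R2 ! i = u"
      using u by (metis in_set_conv_nth)
    let ?w = "C2 ! i"
    have iC: "i < length C2"
      using i len2 by simp
    then have wK: "?w \<in> ?K1"
      using C12(2) nth_mem by blast
    have U: "delta_entry ?U u ?w = uvar 0 \<theta>"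
      using diag[of i] i iC by (simp add: M22 delta_mat_def)
    define F where "F l = (if l = 0 then ?t else 0 :: 'a tpoly)" for l :: nat
    have "specialize F (delta_entry ?U u ?w) = delta_entry F u ?w"
      using t by (intro specialize_delta_entry) (auto simp: F_def forms_def bilinear_degree.simps)
    then have "delta_entry F u ?w \<noteq> 0"
      using U by (simp add: specialize_uvar F_def)
    then obtain k where k: "k \<in> snd ?w" "snd u = snd ?w - {k}" "contraction_coeff (F k) (fst u) (fst ?w) \<noteq> 0"
      by (rule delta_entry_nonzero)
    have k0': "k = 0"
      using k(3) by (auto simp: F_def contraction_coeff_def split: if_splits)
    then have "contraction_coeff ?t (fst u) (fst ?w) \<noteq> 0"
      using k(3) by (simp add: F_def)
    then have "expo_block BlockZ (fst u) = expo_block BlockZ (fst ?w) + expo_block BlockZ \<theta>"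
      unfolding contraction_coeff_single by (auto split: if_splits)
    then show ?thesis
      using k(2) k0' by (simp add: abe k0 lookup_add)
  qed
  have sum_C1: "(\<Sum>w\<in>?K1. q w * v w) = (\<Sum>w\<in>set C1. q w * v w)" if "\<And>w. w \<notin> set C1 \<Longrightarrow> v w = 0" for q v :: "kbasis \<Rightarrow> 'a"
    using that C12(1) finite_K1_basis by (intro sum.mono_neutral_right) auto
  let ?F = "g(0 := f0)"
  interpret F: two_bilinear_system nx ny nz r s ?F
    by (rule system[OF f0])
  interpret T: two_bilinear_system nx ny nz r s "g(0 := ?t)"
    by (rule system[OF t])
  \<comment> \<open>The vector is extended by zero to \<open>C2\<close>. Its \<open>e_0\<close> part
    \<open>v1\<close> is killed by \<open>delta1\<close> for
    \<open>w^\<theta>, f_1, ..., f_n\<close>: rows containing 0 do not see the form at index 0, and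
    in rows without 0 only \<open>w^\<theta>\<close> could act, which \<open>col\<close>
    excludes.\<close>
  have inj: "v w = 0"
    if v0: "\<And>w. w \<notin> set C1 \<Longrightarrow> v w = 0" and v: "\<And>u. u \<in> set R1 \<Longrightarrow> (\<Sum>w\<in>set C1. delta_entry ?F u w * v w) = 0"
    for v and w
  proof -
    have vR1: "(\<Sum>w\<in>?K1. delta_entry ?F u w * v w) = 0" if "u \<in> set R1" for u
      using v[OF that] sum_C1[OF v0] by simp
    define v1 where "v1 w = (if 0 \<in> snd w then v w else 0)" for w
    have "(\<Sum>w\<in>?K1. delta_entry (g(0 := ?t)) u w * v1 w) = 0" if u: "u \<in> ?K0" for u
    proof (cases "0 \<in> snd u")
      case True
      then have "u \<in> set R1"
        using row R1R2(1) u by blast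
      have "delta_entry (g(0 := ?t)) u w * v1 w = delta_entry ?F u w * v w" for w
      proof (cases "0 \<in> snd w")
        case w: True
        have "delta_entry (g(0 := ?t)) u w = delta_entry ?F u w"
          unfolding delta_entry_def using True by (intro sum.cong refl) auto
        then show ?thesis
          using w by (simp add: v1_def)
      next
        case False
        have "delta_entry ?F u w = 0"
        proof (rule ccontr)
          assume "delta_entry ?F u w \<noteq> 0"
          then obtain k where "snd u = snd w - {k}"
            by (rule delta_entry_nonzero)
          then show False
            using True False by auto
        qed
        then show ?thesis
          using False by (simp add: v1_def)
      qed
      then show ?thesis
        using vR1[OF \<open>u \<in> set R1\<close>] by simp
    next
      case False
      have "delta_entry (g(0 := ?t)) u w * v1 w = 0" for w
      proof (rule ccontr)
        assume nz: "delta_entry (g(0 := ?t)) u w * v1 w \<noteq> 0"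
        then have w: "0 \<in> snd w" "w \<in> set C1"
          using v0[of w] by (auto simp: v1_def split: if_splits)
        obtain k where k: "k \<in> snd w" "snd u = snd w - {k}" "contraction_coeff ((g(0 := ?t)) k) (fst u) (fst w) \<noteq> 0"
          using nz delta_entry_nonzero by (metis mult_zero_left)
        have "k = 0"
          using False k(2) w(1) by auto
        then have "contraction_coeff ?t (fst u) (fst w) \<noteq> 0"
          using k(3) by simp
        then show False
          using col[OF w(2), of u] w(1) unfolding contraction_coeff_single by (auto split: if_splits)
      qed
      then show ?thesis
        by (intro sum.neutral) blast
    qed
    then have v1: "v1 w = 0" if "w \<in> ?K1" for w
      using T.delta_injective[OF ncz _ that] by blast
    have v10: "v w = 0" if "w \<in> ?K1" "0 \<in> snd w" for w
      using v1[OF that(1)] that(2) by (simp add: v1_def)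
    \<comment> \<open>What remains has no \<open>e_0\<close>. By \<open>row\<close>, every row
      without z_k0 is in \<open>R1\<close>, so all equations required on the hyperplane z_k0 = 0 are
      available.\<close>
    have "v w = 0" if w: "w \<in> ?K1" "0 \<notin> snd w" for w
    proof (rule F.delta_injective_cut[OF k0(1) _ _ w])
      show "\<exists>l\<in>{1..r+s}. teval (x, y, z) (?F l) \<noteq> 0"
        if "x \<in> hom_coords nx" "y \<in> hom_coords ny" "z \<in> hom_coords nz" "z k0 = 0" for x y z
      proof (rule ccontr)
        assume not: "\<not> ?thesis"
        have "teval (x, y, z) (g l) = 0" if "l \<in> {1..r+s}" for l
        proof -
          have "?F l = g l" using that by auto
          then show ?thesis using not that by metis
        qed
        then have "mon_val3 (x, y, z) \<theta> \<noteq> 0"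
          using generic[OF that(1-3)] by blast
        then show False
          using that(4) by (simp add: mon\<theta>)
      qed
      fix u assume u: "u \<in> ?K0" "0 \<notin> snd u" "Poly_Mapping.lookup (expo_block BlockZ (fst u)) k0 = 0"
      then have "u \<in> set R1"
        using row R1R2(1) by blast
      have "(\<Sum>w\<in>{w\<in>?K1. 0 \<notin> snd w}. delta_entry ?F u w * v w) = (\<Sum>w\<in>?K1. delta_entry ?F u w * v w)"
        using v10 finite_K1_basis by (intro sum.mono_neutral_left) auto
      then show "(\<Sum>w\<in>{w\<in>?K1. 0 \<notin> snd w}. delta_entry ?F u w * v w) = 0"
        using vR1[OF \<open>u \<in> set R1\<close>] by simp
    qed
    then show ?thesis
      using v10 v0 C12(1) by blast
  qed
  \<comment> \<open>\<open>M22\<close> is square by assumption and the whole matrix by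
    \<open>card_K_eq\<close>, hence so is \<open>M11\<close>.\<close>
  have len1: "length R1 = length C1"
  proof -
    have "card ?K0 = length R1 + length R2" "card ?K1 = length C1 + length C2"
      using distinct_card[OF RC(1)] distinct_card[OF RC(3)] RC(2,4) by simp_all
    then show ?thesis
      using T.card_K_eq[OF ncz] len2 by simp
  qed
  let ?n1 = "length C1" and ?n2 = "length C2"
  have ev: "ev M11 = delta_mat ?F R1 C1" "ev M12 = delta_mat ?F R1 C2" "ev M21 = delta_mat ?F R2 C1" "ev M22 = delta_mat ?F R2 C2"
    unfolding ev_def M using specialize_delta1_mat[OF dims(1)] C12 forms[OF f0] by blast+
  have car: "ev M11 \<in> carrier_mat ?n1 ?n1" "ev M12 \<in> carrier_mat ?n1 ?n2" "ev M21 \<in> carrier_mat ?n2 ?n1" "ev M22 \<in> carrier_mat ?n2 ?n2"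
    using delta_mat_carrier[of ?F R1 C1] delta_mat_carrier[of ?F R1 C2] delta_mat_carrier[of ?F R2 C1]
      delta_mat_carrier[of ?F R2 C2] unfolding ev len1 len2 .
  have inj_mat: "p = 0\<^sub>v ?n1" if p: "p \<in> carrier_vec ?n1" "ev M11 *\<^sub>v p = 0\<^sub>v ?n1" for p
  proof -
    obtain v where v: "p = vec_on C1 v" "\<forall>w. w \<notin> set C1 \<longrightarrow> v w = 0"
      using vec_on_ex[OF C1C2(3) p(1)] by blast
    have "(\<Sum>w\<in>set C1. delta_entry ?F u w * v w) = 0" if u: "u \<in> set R1" for u
    proof -
      obtain i where i: "i < length R1" "R1 ! i = u"
        using u by (metis in_set_conv_nth)
      have "(delta_mat ?F R1 C1 *\<^sub>v vec_on C1 v) $ i = 0"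
        using p(2) i len1 unfolding ev v(1) by simp
      then show ?thesis
        using delta_mat_mult_vec_on[OF C1C2(3) i(1), of ?F v] i(2) by simp
    qed
    then have "v w = 0" for w
      using inj v(2) by blast
    then show ?thesis
      unfolding v(1) vec_on_eq_0_iff by blast
  qed
  show "invertible_mat (ev M11)"
    using injective_mat_inverse[OF car(1) inj_mat] by blast
  let ?h = "f0 - Poly_Mapping.single \<theta> c"
  let ?Fc = "g(0 := ?h)"
  have h: "?h \<in> forms nx ny nz (1, 1, 1)"
    by (rule forms_diff[OF f0 single_in_forms[OF \<theta>]])
  interpret Fc: two_bilinear_system nx ny nz r s ?Fc
    by (rule system[OF h])
  have agree: "Poly_Mapping.lookup f0 \<sigma> = Poly_Mapping.lookup ?h \<sigma>" if "\<sigma> \<noteq> \<theta>" for \<sigma>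
    using that by (simp add: lookup_minus lookup_single)
  have e11: "delta_entry ?F u w = delta_entry ?Fc u w" if "u \<in> set R1" "w \<in> set C1" for u w
    using indep[OF f0 h agree _ nv11[OF that]] that C12 by blast
  have e12: "delta_entry ?F u w = delta_entry ?Fc u w" if "u \<in> set R1" "w \<in> set C2" for u w
    using indep[OF f0 h agree _ nv12[OF that]] that C12 by blast
  have e21: "delta_entry ?F u w = delta_entry ?Fc u w" if "u \<in> set R2" "w \<in> set C1" for u w
    using indep[OF f0 h agree _ nv21[OF that]] that C12 by blast
  have e22: "delta_entry ?F (R2 ! i) (C2 ! j) = delta_entry ?Fc (R2 ! i) (C2 ! j) + (if i = j then c else 0)"
    if ij: "i < ?n2" "j < ?n2" for i j
  proof -
    have w: "C2 ! j \<in> ?K1"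
      using C12(2) ij nth_mem by blast
    have U: "delta_entry ?U (R2 ! i) (C2 ! j) = M22 $$ (i, j)" and dim: "dim_row M22 = ?n2" "dim_col M22 = ?n2"
      using ij len2 by (simp_all add: M22 delta_mat_def)
    show ?thesis
    proof (cases "i = j")
      case True
      have "M22 $$ (i, j) = uvar 0 \<theta>"
        using diag[of i] ij True dim by simp
      then have "delta_entry ?F (R2 ! i) (C2 ! j) = Poly_Mapping.lookup f0 \<theta>"
        "delta_entry ?Fc (R2 ! i) (C2 ! j) = Poly_Mapping.lookup f0 \<theta> - c"
        using spec[OF f0 w, of "R2 ! i"] spec[OF h w, of "R2 ! i"] unfolding U
        by (simp_all add: specialize_uvar lookup_minus)
      then show ?thesis
        using True by simp
    next
      case False
      then show ?thesis
        using indep[OF f0 h agree w] offdiag[of i j] ij dim U by simp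
    qed
  qed
  \<comment> \<open>A pair of block vectors is a coordinate function on \<open>K_1\<close> split
    along \<open>C1\<close> and \<open>C2\<close>; the term with \<open>c\<close> is absorbed into
    \<open>?Fc\<close>.\<close>
  have "(\<exists>p\<in>carrier_vec ?n1. \<exists>q\<in>carrier_vec ?n2. (p \<noteq> 0\<^sub>v ?n1 \<or> q \<noteq> 0\<^sub>v ?n2) \<and>
      ev M11 *\<^sub>v p + ev M12 *\<^sub>v q = 0\<^sub>v ?n1 \<and> ev M21 *\<^sub>v p + ev M22 *\<^sub>v q = c \<cdot>\<^sub>v q) \<longleftrightarrow>
    (\<exists>v. (\<exists>w\<in>?K1. v w \<noteq> 0) \<and> (\<forall>u\<in>?K0. (\<Sum>w\<in>?K1. delta_entry ?Fc u w * v w) = 0))" (is "?A \<longleftrightarrow> ?B")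
  proof -
    have key: "ev M11 *\<^sub>v vec_on C1 v + ev M12 *\<^sub>v vec_on C2 v = 0\<^sub>v ?n1 \<and>
        ev M21 *\<^sub>v vec_on C1 v + ev M22 *\<^sub>v vec_on C2 v = c \<cdot>\<^sub>v vec_on C2 v \<longleftrightarrow>
      (\<forall>u\<in>?K0. (\<Sum>w\<in>?K1. delta_entry ?Fc u w * v w) = 0)" for v :: "kbasis \<Rightarrow> 'a"
    proof -
      have split: "(\<Sum>w\<in>?K1. q w) = (\<Sum>w\<in>set C1. q w) + (\<Sum>w\<in>set C2. q w)" for q :: "kbasis \<Rightarrow> 'a"
        using C1C2(1,2) by (metis List.finite_set sum.union_disjoint)
      have r1: "(ev M11 *\<^sub>v vec_on C1 v + ev M12 *\<^sub>v vec_on C2 v) $ i = (\<Sum>w\<in>?K1. delta_entry ?Fc (R1 ! i) w * v w)"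
        if i: "i < ?n1" for i
      proof -
        have R: "R1 ! i \<in> set R1" "i < length R1"
          using i len1 by simp_all
        have "(ev M11 *\<^sub>v vec_on C1 v + ev M12 *\<^sub>v vec_on C2 v) $ i =
            (delta_mat ?F R1 C1 *\<^sub>v vec_on C1 v) $ i + (delta_mat ?F R1 C2 *\<^sub>v vec_on C2 v) $ i"
          unfolding ev using R(2) by (intro index_add_vec(1)) (simp add: delta_mat_def)
        also have "\<dots> = (\<Sum>w\<in>?K1. delta_entry ?Fc (R1 ! i) w * v w)"
          unfolding delta_mat_mult_vec_on[OF C1C2(3) R(2)] delta_mat_mult_vec_on[OF C1C2(4) R(2)] split
          using e11[OF R(1)] e12[OF R(1)] by simp
        finally show ?thesis .
      qed
      have r2: "(ev M21 *\<^sub>v vec_on C1 v + ev M22 *\<^sub>v vec_on C2 v) $ i =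
          (\<Sum>w\<in>?K1. delta_entry ?Fc (R2 ! i) w * v w) + (c \<cdot>\<^sub>v vec_on C2 v) $ i"
        if i: "i < ?n2" for i
      proof -
        have R: "R2 ! i \<in> set R2" "i < length R2"
          using i len2 by simp_all
        have s2: "(\<Sum>w\<in>set C2. q w) = (\<Sum>j<?n2. q (C2 ! j))" for q :: "kbasis \<Rightarrow> 'a"
          using sum.reindex_bij_betw[OF bij_betw_nth[OF C1C2(4) refl refl], of q] by simp
        have "(ev M21 *\<^sub>v vec_on C1 v + ev M22 *\<^sub>v vec_on C2 v) $ i =
            (delta_mat ?F R2 C1 *\<^sub>v vec_on C1 v) $ i + (delta_mat ?F R2 C2 *\<^sub>v vec_on C2 v) $ i"
          unfolding ev using R(2) by (intro index_add_vec(1)) (simp add: delta_mat_def)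
        also have "\<dots> = (\<Sum>w\<in>set C1. delta_entry ?Fc (R2 ! i) w * v w) +
            (\<Sum>j<?n2. delta_entry ?F (R2 ! i) (C2 ! j) * v (C2 ! j))"
          unfolding delta_mat_mult_vec_on[OF C1C2(3) R(2)] delta_mat_mult_vec_on[OF C1C2(4) R(2)]
          using e21[OF R(1)] by (simp add: s2)
        also have "(\<Sum>j<?n2. delta_entry ?F (R2 ! i) (C2 ! j) * v (C2 ! j)) =
            (\<Sum>j<?n2. delta_entry ?Fc (R2 ! i) (C2 ! j) * v (C2 ! j) + (if i = j then c * v (C2 ! i) else 0))"
          using e22[OF i] by (intro sum.cong refl) (auto simp: algebra_simps)
        also have "\<dots> = (\<Sum>w\<in>set C2. delta_entry ?Fc (R2 ! i) w * v w) + c * v (C2 ! i)"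
          using i by (simp add: sum.distrib s2)
        finally have "(ev M21 *\<^sub>v vec_on C1 v + ev M22 *\<^sub>v vec_on C2 v) $ i =
            ((\<Sum>w\<in>set C1. delta_entry ?Fc (R2 ! i) w * v w) + (\<Sum>w\<in>set C2. delta_entry ?Fc (R2 ! i) w * v w)) +
              c * v (C2 ! i)"
          by (simp only: add.assoc)
        moreover have "(c \<cdot>\<^sub>v vec_on C2 v) $ i = c * v (C2 ! i)"
          using i by (simp add: vec_on_def)
        ultimately show ?thesis
          by (simp only: split)
      qed
      have "ev M11 *\<^sub>v vec_on C1 v + ev M12 *\<^sub>v vec_on C2 v = 0\<^sub>v ?n1 \<longleftrightarrow>
          (\<forall>u\<in>set R1. (\<Sum>w\<in>?K1. delta_entry ?Fc u w * v w) = 0)"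
      proof -
        have d: "dim_vec (ev M11 *\<^sub>v vec_on C1 v + ev M12 *\<^sub>v vec_on C2 v) = ?n1"
          using car by simp
        show ?thesis
          unfolding vec_eq_iff d using r1 len1 by (simp add: all_set_conv_all_nth)
      qed
      moreover have "ev M21 *\<^sub>v vec_on C1 v + ev M22 *\<^sub>v vec_on C2 v = c \<cdot>\<^sub>v vec_on C2 v \<longleftrightarrow>
          (\<forall>u\<in>set R2. (\<Sum>w\<in>?K1. delta_entry ?Fc u w * v w) = 0)"
      proof -
        have d: "dim_vec (ev M21 *\<^sub>v vec_on C1 v + ev M22 *\<^sub>v vec_on C2 v) = ?n2" "dim_vec (c \<cdot>\<^sub>v vec_on C2 v) = ?n2"
          using car by (simp_all add: vec_on_def)
        show ?thesis
          unfolding vec_eq_iff d using r2 len2 by (simp add: all_set_conv_all_nth)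
      qed
      ultimately show ?thesis
        using R1R2(1) by blast
    qed
    show ?thesis
    proof
      assume ?A
      then obtain p q where pq: "p \<in> carrier_vec ?n1" "q \<in> carrier_vec ?n2" "p \<noteq> 0\<^sub>v ?n1 \<or> q \<noteq> 0\<^sub>v ?n2"
        "ev M11 *\<^sub>v p + ev M12 *\<^sub>v q = 0\<^sub>v ?n1" "ev M21 *\<^sub>v p + ev M22 *\<^sub>v q = c \<cdot>\<^sub>v q"
        by blast
      obtain vp where vp: "p = vec_on C1 vp"
        using vec_on_ex[OF C1C2(3) pq(1)] by blast
      obtain vq where vq: "q = vec_on C2 vq"
        using vec_on_ex[OF C1C2(4) pq(2)] by blast
      define v where "v w = (if w \<in> set C1 then vp w else vq w)" for w
      have p: "p = vec_on C1 v"
        unfolding vp by (auto simp: vec_on_def v_def)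
      have q: "q = vec_on C2 v"
      proof -
        have "C2 ! j \<notin> set C1" if "j < ?n2" for j
          using C1C2(2) that nth_mem by blast
        then show ?thesis
          unfolding vq by (auto simp: vec_on_def v_def)
      qed
      have "\<exists>w\<in>?K1. v w \<noteq> 0"
        using pq(3) C12 unfolding p q vec_on_eq_0_iff by blast
      then show ?B
        using key[of v] pq(4,5) unfolding p q by blast
    next
      assume ?B
      then obtain v where v: "\<exists>w\<in>?K1. v w \<noteq> 0" "\<forall>u\<in>?K0. (\<Sum>w\<in>?K1. delta_entry ?Fc u w * v w) = 0"
        by blast
      have "vec_on C1 v \<noteq> 0\<^sub>v ?n1 \<or> vec_on C2 v \<noteq> 0\<^sub>v ?n2"
        using v(1) C1C2(1) unfolding vec_on_eq_0_iff by blast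
      then show ?A
        using key[of v] v(2) vec_on_carrier by blast
    qed
  qed
  moreover have "?B \<longleftrightarrow> \<not> no_common_zero nx ny nz {0..r+s} ?Fc"
  proof
    assume ?B
    then show "\<not> no_common_zero nx ny nz {0..r+s} ?Fc"
      using Fc.delta_injective by blast
  next
    assume "\<not> no_common_zero nx ny nz {0..r+s} ?Fc"
    then obtain x y z where xyz: "x \<in> hom_coords nx" "y \<in> hom_coords ny" "z \<in> hom_coords nz"
      "\<And>l. l \<le> r + s \<Longrightarrow> teval (x, y, z) (?Fc l) = 0"
      unfolding no_common_zero_def by auto
    then show ?B
      by (rule Fc.delta_kernel_at_zero)
  qed
  ultimately show "eigenvalue (schur_complement (ev M11) (ev M12) (ev M21) (ev M22)) c \<longleftrightarrow>
      \<not> no_common_zero nx ny nz {0..r+s} ?Fc"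
    using schur_complement_eigenvalue_iff[OF car inj_mat] by simp
qed

section \<open>Changes of coordinates\<close>

lemma teval_power: "teval w (p ^ k) = teval w p ^ k"
  by (induction k) (auto simp: teval_mult)

lemma teval_prod: "teval w (\<Prod>i\<in>A. p i) = (\<Prod>i\<in>A. teval w (p i))"
  by (induction A rule: infinite_finite_induct) (auto simp: teval_mult)

lemma teval_mon_val: "teval w (mon_val X \<sigma>) = mon_val (\<lambda>i. teval w (X i)) \<sigma>"
  by (simp add: mon_val_def teval_prod teval_power)

lemma teval_mon_val3: "teval w (mon_val3 (X, Y, Z) \<theta>) =
    mon_val3 (\<lambda>i. teval w (X i), \<lambda>i. teval w (Y i), \<lambda>i. teval w (Z i)) \<theta>"
  by (cases \<theta>) (simp add: teval_mult teval_mon_val)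

lemma teval_substitute:
  "teval w (eval_with (Poly_Mapping.single 0) (mon_val3 (X, Y, Z)) p) =
    teval (\<lambda>i. teval w (X i), \<lambda>i. teval w (Y i), \<lambda>i. teval w (Z i)) p"
  by (simp add: eval_with_def[of "Poly_Mapping.single 0"] teval_sum teval_mult teval_const teval_mon_val3)
    (simp add: teval_def eval_with_def)

definition mat_apply :: "'a::comm_ring_1 mat \<Rightarrow> (nat \<Rightarrow> 'a) \<Rightarrow> nat \<Rightarrow> 'a" where
  "mat_apply A x i = (if i < dim_row A then \<Sum>j<dim_col A. A $$ (i, j) * x j else 0)"

text \<open>Beyond the last row the entries read by \<open>change_coords\<close> are unspecified,
  while \<open>mat_apply\<close> is 0; forms of the given multidegree ignore these
  coordinates.\<close>

lemma teval_change_coords: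
  assumes "p \<in> forms nx ny nz d" "dim_row Ax = nx + 1" "dim_row Ay = ny + 1" "dim_row Az = nz + 1"
  shows "teval (x, y, z) (change_coords (Ax, Ay, Az) p) = teval (mat_apply Ax x, mat_apply Ay y, mat_apply Az z) p"
  unfolding change_coords.simps teval_substitute
  using assms by (intro teval_cong_forms[OF assms(1)]) (auto simp: mat_apply_def teval_sum teval_single)

section \<open>Multidegrees under products and substitutions\<close>

lemma block_expos_add: "s \<in> block_expos n d \<Longrightarrow> t \<in> block_expos n e \<Longrightarrow> s + t \<in> block_expos n (d + e)"
  using keys_add[of s t] by (auto simp: block_expos_def lookup_add sum.distrib)

lemma forms_mult:
  fixes p q :: "'a::comm_ring_1 tpoly"
  assumes "p \<in> forms nx ny nz (a, b, c)" "q \<in> forms nx ny nz (a', b', c')"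
  shows "p * q \<in> forms nx ny nz (a + a', b + b', c + c')"
proof -
  have "Poly_Mapping.keys (p * q) \<subseteq> {s + t | s t. s \<in> Poly_Mapping.keys p \<and> t \<in> Poly_Mapping.keys q}"
    by (rule keys_mult)
  also have "\<dots> \<subseteq> expos nx ny nz (a + a', b + b', c + c')"
  proof
    fix x assume "x \<in> {s + t | s t. s \<in> Poly_Mapping.keys p \<and> t \<in> Poly_Mapping.keys q}"
    then obtain s t where x: "x = s + t" "s \<in> Poly_Mapping.keys p" "t \<in> Poly_Mapping.keys q"
      by blast
    then have "s \<in> expos nx ny nz (a, b, c)" "t \<in> expos nx ny nz (a', b', c')"
      using assms by (auto simp: forms_def)
    then show "x \<in> expos nx ny nz (a + a', b + b', c + c')"
      unfolding x(1) by (cases s; cases t) (auto intro: block_expos_add)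
  qed
  finally show ?thesis
    by (simp add: forms_def)
qed

lemma block_expos_zero: "0 \<in> block_expos n 0"
  by (simp add: block_expos_def)

lemma forms_const: "Poly_Mapping.single 0 c \<in> forms nx ny nz (0, 0, 0)"
  by (auto simp: forms_def zero_prod_def block_expos_zero)

lemma forms_one: "1 \<in> forms nx ny nz (0, 0, 0)"
  by (auto simp: forms_def zero_prod_def block_expos_zero)

lemma forms_sum:
  fixes p :: "'i \<Rightarrow> 'a::comm_ring_1 tpoly"
  assumes "\<And>i. i \<in> A \<Longrightarrow> p i \<in> forms nx ny nz d"
  shows "(\<Sum>i\<in>A. p i) \<in> forms nx ny nz d"
proof -
  have "Poly_Mapping.keys (\<Sum>i\<in>A. p i) \<subseteq> (\<Union>i\<in>A. Poly_Mapping.keys (p i))"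
    by (rule keys_sum)
  then show ?thesis
    using assms by (fastforce simp: forms_def)
qed

lemma forms_power:
  fixes p :: "'a::comm_ring_1 tpoly"
  assumes "p \<in> forms nx ny nz (a, b, c)"
  shows "p ^ k \<in> forms nx ny nz (int k * a, int k * b, int k * c)"
proof (induction k)
  case 0
  show ?case
    using forms_one by simp
next
  case (Suc k)
  show ?case
    using forms_mult[OF assms Suc.IH] by (simp add: algebra_simps)
qed

lemma forms_mon_val:
  fixes X :: "nat \<Rightarrow> 'a::comm_ring_1 tpoly"
  assumes "\<And>i. i \<in> Poly_Mapping.keys \<sigma> \<Longrightarrow> X i \<in> forms nx ny nz (a, b, c)"
  shows "mon_val X \<sigma> \<in> forms nx ny nz ((\<Sum>i\<in>Poly_Mapping.keys \<sigma>. int (Poly_Mapping.lookup \<sigma> i)) * a,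
    (\<Sum>i\<in>Poly_Mapping.keys \<sigma>. int (Poly_Mapping.lookup \<sigma> i)) * b, (\<Sum>i\<in>Poly_Mapping.keys \<sigma>. int (Poly_Mapping.lookup \<sigma> i)) * c)"
proof -
  have "(\<Prod>i\<in>A. X i ^ Poly_Mapping.lookup \<sigma> i) \<in> forms nx ny nz ((\<Sum>i\<in>A. int (Poly_Mapping.lookup \<sigma> i)) * a,
      (\<Sum>i\<in>A. int (Poly_Mapping.lookup \<sigma> i)) * b, (\<Sum>i\<in>A. int (Poly_Mapping.lookup \<sigma> i)) * c)"
    if "finite A" "A \<subseteq> Poly_Mapping.keys \<sigma>" for A
    using that
  proof (induction A rule: finite_induct)
    case empty
    show ?case
      using forms_one by simp
  next
    case (insert i A)
    show ?case
      using forms_mult[OF forms_power[OF assms[of i]] insert.IH] insert by (simp add: algebra_simps)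
  qed
  then show ?thesis
    unfolding mon_val_def by simp
qed

lemma block_expos_sum_keys:
  assumes "\<sigma> \<in> block_expos n d"
  shows "(\<Sum>i\<in>Poly_Mapping.keys \<sigma>. int (Poly_Mapping.lookup \<sigma> i)) = d"
proof -
  have "(\<Sum>i\<in>Poly_Mapping.keys \<sigma>. int (Poly_Mapping.lookup \<sigma> i)) = (\<Sum>i\<le>n. int (Poly_Mapping.lookup \<sigma> i))"
    using assms by (intro sum.mono_neutral_left) (auto simp: block_expos_def in_keys_iff)
  then show ?thesis
    using assms by (simp add: block_expos_def)
qed

lemma change_coords_forms:
  fixes p :: "'a::comm_ring_1 tpoly"
  assumes "p \<in> forms nx ny nz (a, b, c)" "dim_col Ax = nx + 1" "dim_col Ay = ny + 1" "dim_col Az = nz + 1"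
  shows "change_coords (Ax, Ay, Az) p \<in> forms nx ny nz (a, b, c)"
proof -
  define X :: "nat \<Rightarrow> 'a tpoly" where "X i = (\<Sum>j<dim_col Ax. Poly_Mapping.single (Poly_Mapping.single j 1, 0, 0) (Ax $$ (i, j)))" for i
  define Y :: "nat \<Rightarrow> 'a tpoly" where "Y i = (\<Sum>j<dim_col Ay. Poly_Mapping.single (0, Poly_Mapping.single j 1, 0) (Ay $$ (i, j)))" for i
  define Z :: "nat \<Rightarrow> 'a tpoly" where "Z i = (\<Sum>j<dim_col Az. Poly_Mapping.single (0, 0, Poly_Mapping.single j 1) (Az $$ (i, j)))" for i
  have s: "Poly_Mapping.single j 1 \<in> block_expos n 1" if "j \<le> n" for j n
    using single_in_block_expos[OF that, of 1] by simp
  have X: "X i \<in> forms nx ny nz (1, 0, 0)" for i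
    unfolding X_def using assms(2) s[unfolded One_nat_def] by (intro forms_sum) (auto simp: forms_def block_expos_zero)
  have Y: "Y i \<in> forms nx ny nz (0, 1, 0)" for i
    unfolding Y_def using assms(3) s[unfolded One_nat_def] by (intro forms_sum) (auto simp: forms_def block_expos_zero)
  have Z: "Z i \<in> forms nx ny nz (0, 0, 1)" for i
    unfolding Z_def using assms(4) s[unfolded One_nat_def] by (intro forms_sum) (auto simp: forms_def block_expos_zero)
  have "Poly_Mapping.single 0 (Poly_Mapping.lookup p \<theta>) * mon_val3 (X, Y, Z) \<theta> \<in> forms nx ny nz (a, b, c)"
    if \<theta>: "\<theta> \<in> Poly_Mapping.keys p" for \<theta>
  proof -
    obtain u v w where uvw: "\<theta> = (u, v, w)" by (metis prod_cases3)
    have d: "u \<in> block_expos nx a" "v \<in> block_expos ny b" "w \<in> block_expos nz c"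
      using assms(1) \<theta> by (auto simp: forms_def uvw)
    have "mon_val X u \<in> forms nx ny nz (a, 0, 0)"
      using forms_mon_val[of u X nx ny nz 1 0 0] X block_expos_sum_keys[OF d(1)] by simp
    moreover have "mon_val Y v \<in> forms nx ny nz (0, b, 0)"
      using forms_mon_val[of v Y nx ny nz 0 1 0] Y block_expos_sum_keys[OF d(2)] by simp
    moreover have "mon_val Z w \<in> forms nx ny nz (0, 0, c)"
      using forms_mon_val[of w Z nx ny nz 0 0 1] Z block_expos_sum_keys[OF d(3)] by simp
    ultimately have "mon_val3 (X, Y, Z) \<theta> \<in> forms nx ny nz (a, b, c)"
      using forms_mult[OF forms_mult] by (fastforce simp: uvw)
    then show ?thesis
      using forms_mult[OF forms_const] by fastforce
  qed
  then show ?thesis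
    unfolding change_coords.simps eval_with_def X_def[symmetric] Y_def[symmetric] Z_def[symmetric]
    by (intro forms_sum)
qed

lemma mon_val_scale:
  "mon_val (\<lambda>i. c * x i) \<sigma> = c ^ (\<Sum>i\<in>Poly_Mapping.keys \<sigma>. Poly_Mapping.lookup \<sigma> i) * mon_val x \<sigma>"
  by (simp add: mon_val_def power_mult_distrib prod.distrib power_sum)

lemma teval_scale:
  assumes "p \<in> forms nx ny nz (a, b, c)"
  shows "teval (\<lambda>i. t * x i, \<lambda>i. u * y i, \<lambda>i. v * z i) p = t ^ nat a * u ^ nat b * v ^ nat c * teval (x, y, z) p"
proof -
  have "mon_val3 (\<lambda>i. t * x i, \<lambda>i. u * y i, \<lambda>i. v * z i) \<theta> = t ^ nat a * u ^ nat b * v ^ nat c * mon_val3 (x, y, z) \<theta>"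
    if \<theta>: "\<theta> \<in> Poly_Mapping.keys p" for \<theta>
  proof -
    obtain i j k where ijk: "\<theta> = (i, j, k)" by (metis prod_cases3)
    have d: "i \<in> block_expos nx a" "j \<in> block_expos ny b" "k \<in> block_expos nz c"
      using assms \<theta> by (auto simp: forms_def ijk)
    have n: "(\<Sum>l\<in>Poly_Mapping.keys \<sigma>. Poly_Mapping.lookup \<sigma> l) = nat e" if "\<sigma> \<in> block_expos n e" for \<sigma> n e
      using block_expos_sum_keys[OF that] by (metis nat_int of_nat_sum)
    show ?thesis
      by (simp add: ijk mon_val_scale n[OF d(1)] n[OF d(2)] n[OF d(3)] mult_ac)
  qed
  then show ?thesis
    unfolding teval_def eval_with_def sum_distrib_left by (intro sum.cong refl) (simp add: mult_ac)
qed

section \<open>Points and their coordinate vectors\<close>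

lemma proportional_class:
  assumes "a \<in> projective_space n" "x \<in> a"
  shows "x \<in> hom_coords n" "a = {x'. \<exists>c. c \<noteq> 0 \<and> x' = (\<lambda>i. c * x i)}"
proof -
  obtain v where v: "v \<in> hom_coords n" "a = proportional n `` {v}"
    using assms(1) by (auto simp: projective_space_def quotient_def)
  then obtain c where c: "x \<in> hom_coords n" "c \<noteq> 0" "x = (\<lambda>i. c * v i)"
    using assms(2) by (auto simp: proportional_def)
  show "x \<in> hom_coords n" by (rule c(1))
  have scale: "(\<lambda>i. d * v i) \<in> hom_coords n" if "d \<noteq> 0" for d
    using v(1) that by (auto simp: hom_coords_def)
  have "a = {x'. \<exists>d. d \<noteq> 0 \<and> x' = (\<lambda>i. d * v i)}"
    using v scale by (auto simp: proportional_def)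
  also have "\<dots> = {x'. \<exists>d. d \<noteq> 0 \<and> x' = (\<lambda>i. d * x i)}"
  proof (intro Collect_cong iffI)
    fix x' assume "\<exists>d. d \<noteq> 0 \<and> x' = (\<lambda>i. d * v i)"
    then obtain d where "d \<noteq> 0" "x' = (\<lambda>i. d * v i)" by blast
    then show "\<exists>d. d \<noteq> 0 \<and> x' = (\<lambda>i. d * x i)"
      using c by (intro exI[of _ "d / c"]) auto
  next
    fix x' assume "\<exists>d. d \<noteq> 0 \<and> x' = (\<lambda>i. d * x i)"
    then obtain d where "d \<noteq> 0" "x' = (\<lambda>i. d * x i)" by blast
    then show "\<exists>d. d \<noteq> 0 \<and> x' = (\<lambda>i. d * v i)"
      using c by (intro exI[of _ "d * c"]) (auto simp: mult_ac)
  qed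
  finally show "a = {x'. \<exists>c. c \<noteq> 0 \<and> x' = (\<lambda>i. c * x i)}" .
qed

lemma exists_class:
  assumes "x \<in> hom_coords n"
  obtains a where "a \<in> projective_space n" "x \<in> a"
proof
  show "proportional n `` {x} \<in> projective_space n"
    using assms by (auto simp: projective_space_def quotient_def)
  show "x \<in> proportional n `` {x}"
    using assms by (auto simp: proportional_def intro!: exI[of _ 1])
qed

lemma VP_class:
  assumes F: "\<And>p. p \<in> F \<Longrightarrow> \<exists>a b c. p \<in> forms nx ny nz (a, b, c)"
    and abc: "a \<in> projective_space nx" "b \<in> projective_space ny" "c \<in> projective_space nz" "x \<in> a" "y \<in> b" "z \<in> c"
    and zero: "\<And>p. p \<in> F \<Longrightarrow> teval (x, y, z) p = 0"
  shows "(a, b, c) \<in> VP nx ny nz F"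
proof -
  have "teval (x', y', z') p = 0" if h: "p \<in> F" "x' \<in> a" "y' \<in> b" "z' \<in> c" for p x' y' z'
  proof -
    obtain t u v where "x' = (\<lambda>i. t * x i)" "y' = (\<lambda>i. u * y i)" "z' = (\<lambda>i. v * z i)"
      using h proportional_class(2)[OF abc(1,4)] proportional_class(2)[OF abc(2,5)] proportional_class(2)[OF abc(3,6)]
      by blast
    moreover obtain d e g where "p \<in> forms nx ny nz (d, e, g)"
      using F[OF h(1)] by blast
    ultimately show ?thesis
      by (simp add: teval_scale zero[OF h(1)])
  qed
  then show ?thesis
    using abc by (auto simp: VP_def)
qed

lemma representatives_VP:
  assumes "\<And>p. p \<in> F \<Longrightarrow> \<exists>a b c. p \<in> forms nx ny nz (a, b, c)"
  shows "(x, y, z) \<in> representatives (VP nx ny nz F) \<longleftrightarrow>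
    x \<in> hom_coords nx \<and> y \<in> hom_coords ny \<and> z \<in> hom_coords nz \<and> (\<forall>p\<in>F. teval (x, y, z) p = 0)"
proof
  assume "(x, y, z) \<in> representatives (VP nx ny nz F)"
  then obtain a b c where abc: "(a, b, c) \<in> VP nx ny nz F" "x \<in> a" "y \<in> b" "z \<in> c"
    by (auto simp: representatives_def)
  then show "x \<in> hom_coords nx \<and> y \<in> hom_coords ny \<and> z \<in> hom_coords nz \<and> (\<forall>p\<in>F. teval (x, y, z) p = 0)"
    using proportional_class(1) unfolding VP_def by blast
next
  assume h: "x \<in> hom_coords nx \<and> y \<in> hom_coords ny \<and> z \<in> hom_coords nz \<and> (\<forall>p\<in>F. teval (x, y, z) p = 0)"
  obtain a where a: "a \<in> projective_space nx" "x \<in> a"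
    using exists_class h by blast
  obtain b where b: "b \<in> projective_space ny" "y \<in> b"
    using exists_class h by blast
  obtain c where c: "c \<in> projective_space nz" "z \<in> c"
    using exists_class h by blast
  have "(a, b, c) \<in> VP nx ny nz F"
    using h by (intro VP_class[OF assms a(1) b(1) c(1) a(2) b(2) c(2)]) auto
  then show "(x, y, z) \<in> representatives (VP nx ny nz F)"
    using a b c by (auto simp: representatives_def)
qed

text \<open>A point has infinitely many coordinate vectors, so one triple is chosen per point; every
  common zero can be scaled blockwise to a chosen triple.\<close>

lemma finite_representatives:
  assumes "finite (VP nx ny nz F)" "\<And>p. p \<in> F \<Longrightarrow> \<exists>a b c. p \<in> forms nx ny nz (a, b, c)"
  obtains P where "finite P" "P \<subseteq> hom_coords nx \<times> hom_coords ny \<times> hom_coords nz"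
    "\<And>x y z. x \<in> hom_coords nx \<Longrightarrow> y \<in> hom_coords ny \<Longrightarrow> z \<in> hom_coords nz \<Longrightarrow> (\<And>p. p \<in> F \<Longrightarrow> teval (x, y, z) p = 0) \<Longrightarrow>
      \<exists>t u v. (\<lambda>i. t * x i, \<lambda>i. u * y i, \<lambda>i. v * z i) \<in> P"
proof -
  define h where "h = (\<lambda>(a, b, c). (SOME x. x \<in> a, SOME y. y \<in> b, SOME z. z \<in> c) :: (nat \<Rightarrow> 'a) \<times> (nat \<Rightarrow> 'a) \<times> (nat \<Rightarrow> 'a))"
  have some: "(SOME x. x \<in> a) \<in> a" if a: "a \<in> projective_space n" for a :: "(nat \<Rightarrow> 'a) set" and n
  proof -
    obtain v where v: "v \<in> hom_coords n" "a = proportional n `` {v}"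
      using a by (auto simp: projective_space_def quotient_def)
    then have "v \<in> a"
      by (auto simp: proportional_def intro!: exI[of _ 1])
    then show ?thesis
      by (rule someI[of "\<lambda>x. x \<in> a"])
  qed
  have "h ` VP nx ny nz F \<subseteq> hom_coords nx \<times> hom_coords ny \<times> hom_coords nz"
  proof -
    have "h (a, b, c) \<in> hom_coords nx \<times> hom_coords ny \<times> hom_coords nz" if "(a, b, c) \<in> VP nx ny nz F" for a b c
      using that proportional_class(1)[OF _ some] by (auto simp: h_def VP_def)
    then show ?thesis
      by (metis image_subsetI prod_cases3)
  qed
  moreover have "\<exists>t u v. (\<lambda>i. t * x i, \<lambda>i. u * y i, \<lambda>i. v * z i) \<in> h ` VP nx ny nz F"
    if xyz: "x \<in> hom_coords nx" "y \<in> hom_coords ny" "z \<in> hom_coords nz" "\<And>p. p \<in> F \<Longrightarrow> teval (x, y, z) p = 0" for x y z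
  proof -
    obtain a where a: "a \<in> projective_space nx" "x \<in> a"
      using exists_class xyz(1) by blast
    obtain b where b: "b \<in> projective_space ny" "y \<in> b"
      using exists_class xyz(2) by blast
    obtain c where c: "c \<in> projective_space nz" "z \<in> c"
      using exists_class xyz(3) by blast
    have V: "(a, b, c) \<in> VP nx ny nz F"
      by (rule VP_class[OF assms(2) a(1) b(1) c(1) a(2) b(2) c(2) xyz(4)])
    obtain t where t: "(SOME x. x \<in> a) = (\<lambda>i. t * x i)"
      using some[OF a(1)] proportional_class(2)[OF a] by blast
    obtain u where u: "(SOME x. x \<in> b) = (\<lambda>i. u * y i)"
      using some[OF b(1)] proportional_class(2)[OF b] by blast
    obtain v where v: "(SOME x. x \<in> c) = (\<lambda>i. v * z i)"
      using some[OF c(1)] proportional_class(2)[OF c] by blast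
    have "h (a, b, c) = (\<lambda>i. t * x i, \<lambda>i. u * y i, \<lambda>i. v * z i)"
      by (simp add: h_def t u v)
    then show ?thesis
      using V by (metis imageI)
  qed
  ultimately show ?thesis
    using that[of "h ` VP nx ny nz F"] assms(1) by blast
qed

section \<open>Genericity\<close>

text \<open>Phrased for functions on the group, so that determinant conditions are recognized as
  polynomial by closure under sums and products.\<close>

definition entry_polynomial :: "nat \<Rightarrow> nat \<Rightarrow> nat \<Rightarrow> ('a::field coord_change \<Rightarrow> 'a) \<Rightarrow> bool" where
  "entry_polynomial nx ny nz \<phi> \<longleftrightarrow> (\<exists>q. poly_vars q \<subseteq> entry_indices nx ny nz \<and>
     (\<forall>A\<in>GL3 nx ny nz. eval_with id (mon_val (entry A)) q = \<phi> A))"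

lemma entry_polynomial_const: "entry_polynomial nx ny nz (\<lambda>A. c)"
  unfolding entry_polynomial_def
  by (rule exI[of _ "Poly_Mapping.single 0 c"]) (auto simp: poly_vars_def eval_with_single)

lemma entry_polynomial_entry:
  assumes "v \<in> entry_indices nx ny nz"
  shows "entry_polynomial nx ny nz (\<lambda>A. entry A v)"
  unfolding entry_polynomial_def using assms
  by (intro exI[of _ "Poly_Mapping.single (Poly_Mapping.single v 1) 1"]) (simp add: poly_vars_def eval_with_single)

lemma entry_polynomial_add:
  assumes "entry_polynomial nx ny nz \<phi>" "entry_polynomial nx ny nz \<psi>"
  shows "entry_polynomial nx ny nz (\<lambda>A. \<phi> A + \<psi> A)"
proof -
  obtain p q where "poly_vars p \<subseteq> entry_indices nx ny nz" "poly_vars q \<subseteq> entry_indices nx ny nz"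
    and "\<forall>A\<in>GL3 nx ny nz. eval_with id (mon_val (entry A)) p = \<phi> A"
    "\<forall>A\<in>GL3 nx ny nz. eval_with id (mon_val (entry A)) q = \<psi> A"
    using assms unfolding entry_polynomial_def by blast
  moreover have "poly_vars (p + q) \<subseteq> poly_vars p \<union> poly_vars q"
    using keys_add[of p q] unfolding poly_vars_def by blast
  ultimately show ?thesis
    unfolding entry_polynomial_def by (intro exI[of _ "p + q"]) (auto simp: eval_with_add)
qed

lemma entry_polynomial_mult:
  assumes "entry_polynomial nx ny nz \<phi>" "entry_polynomial nx ny nz \<psi>"
  shows "entry_polynomial nx ny nz (\<lambda>A. \<phi> A * \<psi> A)"
proof -
  obtain p q where "poly_vars p \<subseteq> entry_indices nx ny nz" "poly_vars q \<subseteq> entry_indices nx ny nz"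
    and "\<forall>A\<in>GL3 nx ny nz. eval_with id (mon_val (entry A)) p = \<phi> A"
    "\<forall>A\<in>GL3 nx ny nz. eval_with id (mon_val (entry A)) q = \<psi> A"
    using assms unfolding entry_polynomial_def by blast
  moreover have "poly_vars (p * q) \<subseteq> poly_vars p \<union> poly_vars q"
  proof
    fix v assume "v \<in> poly_vars (p * q)"
    then obtain m where m: "m \<in> Poly_Mapping.keys (p * q)" "v \<in> Poly_Mapping.keys m"
      unfolding poly_vars_def by blast
    then obtain a b where ab: "m = a + b" "a \<in> Poly_Mapping.keys p" "b \<in> Poly_Mapping.keys q"
      using keys_mult[of p q] by blast
    then show "v \<in> poly_vars p \<union> poly_vars q"
      using m(2) keys_add[of a b] unfolding poly_vars_def by blast
  qed
  ultimately show ?thesis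
    unfolding entry_polynomial_def by (intro exI[of _ "p * q"]) (auto simp: eval_with_mult mon_val_add)
qed

lemma entry_polynomial_sum:
  assumes "\<And>i. i \<in> S \<Longrightarrow> entry_polynomial nx ny nz (\<phi> i)"
  shows "entry_polynomial nx ny nz (\<lambda>A. \<Sum>i\<in>S. \<phi> i A)"
  using assms by (induction S rule: infinite_finite_induct)
    (auto intro: entry_polynomial_const entry_polynomial_add)

lemma entry_polynomial_prod:
  assumes "\<And>i. i \<in> S \<Longrightarrow> entry_polynomial nx ny nz (\<phi> i)"
  shows "entry_polynomial nx ny nz (\<lambda>A. \<Prod>i\<in>S. \<phi> i A)"
  using assms by (induction S rule: infinite_finite_induct)
    (auto intro: entry_polynomial_const entry_polynomial_mult)

lemma entry_polynomial_cong:
  assumes "entry_polynomial nx ny nz \<phi>" "\<And>A. A \<in> GL3 nx ny nz \<Longrightarrow> \<phi> A = \<psi> A"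
  shows "entry_polynomial nx ny nz \<psi>"
  using assms unfolding entry_polynomial_def by simp

lemma entry_polynomial_det_replace_col:
  fixes M :: "'a::field coord_change \<Rightarrow> 'a mat"
  assumes M: "\<And>A. A \<in> GL3 nx ny nz \<Longrightarrow> M A \<in> carrier_mat (n + 1) (n + 1)"
    and entries: "\<And>i j. i \<le> n \<Longrightarrow> j \<le> n \<Longrightarrow> entry_polynomial nx ny nz (\<lambda>A. M A $$ (i, j))"
  shows "entry_polynomial nx ny nz (\<lambda>A. det (replace_col (M A) (vec (n + 1) p) k))"
proof (rule entry_polynomial_cong)
  show "entry_polynomial nx ny nz (\<lambda>A. \<Sum>\<pi> | \<pi> permutes {0..<n + 1}.
      signof \<pi> * (\<Prod>i = 0..<n + 1. if \<pi> i = k then p i else M A $$ (i, \<pi> i)))"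
  proof (intro entry_polynomial_sum entry_polynomial_mult entry_polynomial_prod entry_polynomial_const)
    fix \<pi> i assume "\<pi> \<in> {\<pi>. \<pi> permutes {0..<n + 1}}" "i \<in> {0..<n + 1}"
    then have "i \<le> n" "\<pi> i \<le> n"
      using permutes_in_image[of \<pi> "{0..<n + 1}" i] by (simp_all add: less_Suc_eq_le)
    then show "entry_polynomial nx ny nz (\<lambda>A. if \<pi> i = k then p i else M A $$ (i, \<pi> i))"
      using entries entry_polynomial_const by (cases "\<pi> i = k") auto
  qed
next
  fix A :: "'a coord_change" assume A: "A \<in> GL3 nx ny nz"
  have R: "replace_col (M A) (vec (n + 1) p) k \<in> carrier_mat (n + 1) (n + 1)"
    using M[OF A] by (auto simp: replace_col_def)
  have entry: "replace_col (M A) (vec (n + 1) p) k $$ (i, \<pi> i) = (if \<pi> i = k then p i else M A $$ (i, \<pi> i))"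
    if "\<pi> permutes {0..<n + 1}" "i \<in> {0..<n + 1}" for \<pi> i
    using that M[OF A] permutes_in_image[OF that(1), of i] by (simp add: replace_col_def)
  show "(\<Sum>\<pi> | \<pi> permutes {0..<n + 1}.
      signof \<pi> * (\<Prod>i = 0..<n + 1. if \<pi> i = k then p i else M A $$ (i, \<pi> i))) =
      det (replace_col (M A) (vec (n + 1) p) k)"
    unfolding det_def'[OF R] by (intro sum.cong refl arg_cong2[of _ _ _ _ "(*)"] prod.cong) (simp only: entry mem_Collect_eq)
qed

section \<open>Cramer's rule and coordinate hyperplanes\<close>

lemma GL_det_nonzero:
  fixes A :: "'a::field mat"
  assumes "A \<in> GL n"
  obtains B where "B \<in> carrier_mat n n" "B * A = 1\<^sub>m n" "det A \<noteq> 0"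
proof -
  have A: "A \<in> carrier_mat n n"
    using assms by (simp add: GL_def)
  obtain B where B: "A * B = 1\<^sub>m n" "B * A = 1\<^sub>m (dim_row B)"
    using assms by (auto simp: GL_def invertible_mat_def inverts_mat_def)
  have "dim_col B = n" "dim_row B = n"
    using arg_cong[OF B(1), of dim_col] arg_cong[OF B(2), of dim_col] A by simp_all
  then have c: "B \<in> carrier_mat n n"
    by blast
  have "det A * det B = 1"
    using det_mult[OF A c] B(1) by simp
  then have "det A \<noteq> 0"
    by auto
  with c B(2) show ?thesis
    by (intro that[of B]) auto
qed

lemma mat_apply_vec:
  assumes "A \<in> carrier_mat n n"
  shows "vec n (mat_apply A x) = A *\<^sub>v vec n x"
  using assms by (intro eq_vecI) (auto simp: mat_apply_def scalar_prod_def lessThan_atLeast0)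

lemma mat_apply_hom_coords:
  fixes A :: "'a::field mat"
  assumes "A \<in> GL (n + 1)" "x \<in> hom_coords n"
  shows "mat_apply A x \<in> hom_coords n"
proof -
  obtain B where B: "B \<in> carrier_mat (n + 1) (n + 1)" "B * A = 1\<^sub>m (n + 1)"
    using assms(1) by (rule GL_det_nonzero)
  have A: "A \<in> carrier_mat (n + 1) (n + 1)"
    using assms by (simp add: GL_def)
  obtain i where i: "i \<le> n" "x i \<noteq> 0"
    using assms(2) by (auto simp: hom_coords_def)
  have "\<exists>i\<le>n. mat_apply A x i \<noteq> 0"
  proof (rule ccontr)
    assume "\<not> ?thesis"
    then have "A *\<^sub>v vec (n + 1) x = 0\<^sub>v (n + 1)"
      unfolding mat_apply_vec[OF A, symmetric] by (intro eq_vecI) auto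
    then have "B *\<^sub>v (A *\<^sub>v vec (n + 1) x) = 0\<^sub>v (n + 1)"
      using B(1) by (intro eq_vecI) (auto simp: scalar_prod_def)
    then have "vec (n + 1) x = 0\<^sub>v (n + 1)"
      using assoc_mult_mat_vec[OF B(1) A, of "vec (n + 1) x"] B(2) by simp
    then have "vec (n + 1) x $ i = 0\<^sub>v (n + 1) $ i"
      by (rule arg_cong)
    then show False
      using i by simp
  qed
  then show ?thesis
    using A by (auto simp: hom_coords_def mat_apply_def)
qed

text \<open>By Cramer's rule \<open>det (replace_col A p k)\<close> is \<open>det A\<close> times the \<open>k\<close>-th coordinate of the
  preimage of \<open>p\<close> under \<open>A\<close>, so its non-vanishing is a polynomial condition on \<open>A\<close> that keeps the
  preimage off a coordinate hyperplane.\<close>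

lemma coordinate_nonzero:
  fixes A :: "'a::field mat"
  assumes "A \<in> carrier_mat (n + 1) (n + 1)" "k \<le> n"
    and "det (replace_col A (vec (n + 1) (\<lambda>i. t * mat_apply A x i)) k) \<noteq> 0"
  shows "x k \<noteq> 0"
proof -
  have "vec (n + 1) (\<lambda>i. t * mat_apply A x i) = vec (n + 1) (mat_apply A (\<lambda>i. t * x i))"
    using assms(1) by (intro eq_vecI) (auto simp: mat_apply_def sum_distrib_left algebra_simps)
  also have "\<dots> = A *\<^sub>v vec (n + 1) (\<lambda>i. t * x i)"
    by (rule mat_apply_vec[OF assms(1)])
  finally show ?thesis
    using assms(3) cramer_lemma_mat[OF assms(1), of "vec (n + 1) (\<lambda>i. t * x i)" k] assms(2) by auto
qed

text \<open>The linear form with coefficients 1, t, ..., t^n is nonzero on all of \<open>P\<close>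
  for some \<open>t\<close>, since each vector gives a nonzero polynomial in \<open>t\<close>.
  \<open>B\<close> takes this form as the new \<open>k\<close>-th coordinate and keeps the others;
  \<open>A\<close> is its inverse.\<close>

lemma exists_coordinates_off_hyperplane:
  fixes P :: "(nat \<Rightarrow> 'a::{alg_closed_field, field_char_0}) set"
  assumes "finite P" "P \<subseteq> hom_coords n" "k \<le> n"
  obtains A where "A \<in> GL (n + 1)" "\<And>p. p \<in> P \<Longrightarrow> det (replace_col A (vec (n + 1) p) k) \<noteq> 0"
proof -
  define q where "q p = (\<Sum>j\<le>n. Polynomial.monom (p j) j)" for p :: "nat \<Rightarrow> 'a"
  have "q p \<noteq> 0" if "p \<in> P" for p
  proof -
    have "p \<in> hom_coords n"
      using assms(2) that by blast
    then obtain i where "i \<le> n" "p i \<noteq> 0"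
      by (auto simp: hom_coords_def)
    then have "coeff (q p) i \<noteq> 0"
      by (simp add: q_def coeff_sum)
    then show ?thesis
      by auto
  qed
  \<comment> \<open>The extra factor forces \<open>t\<close> to be nonzero, so that the entry
    \<open>t ^ k\<close> on the diagonal of \<open>B\<close> is nonzero and \<open>B\<close> is
    invertible.\<close>
  then have "Polynomial.monom 1 1 * (\<Prod>p\<in>P. q p) \<noteq> 0"
    using assms(1) by simp
  then obtain t where "poly (Polynomial.monom 1 1 * (\<Prod>p\<in>P. q p)) t \<noteq> 0"
    by (rule exists_nonroot)
  then have t: "t \<noteq> 0" "\<And>p. p \<in> P \<Longrightarrow> (\<Sum>j\<le>n. p j * t ^ j) \<noteq> 0"
    using assms(1) by (auto simp: poly_monom poly_prod q_def poly_sum)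
  define B where "B = mat (n + 1) (n + 1) (\<lambda>(i, j). if i = k then t ^ j else if i = j then 1 else 0)"
  have B: "B \<in> carrier_mat (n + 1) (n + 1)"
    by (simp add: B_def)
  have Bv: "(B *\<^sub>v vec (n + 1) v) $ i = (if i = k then \<Sum>j\<le>n. v j * t ^ j else v i)" if "i \<le> n" for v i
  proof -
    have "(B *\<^sub>v vec (n + 1) v) $ i =
        (\<Sum>j\<le>n. (if i = k then t ^ j else if i = j then 1 else 0) * v j)"
      using that by (simp add: B_def scalar_prod_def atLeast0LessThan lessThan_Suc_atMost del: sum.lessThan_Suc)
    moreover have "(\<Sum>j\<le>n. (if i = j then 1 else 0) * v j) = (\<Sum>j\<le>n. if j = i then v j else 0)"
      by (intro sum.cong) auto
    ultimately show ?thesis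
      using that by (simp add: mult.commute)
  qed
  have inj: "v = 0\<^sub>v (n + 1)" if v: "v \<in> carrier_vec (n + 1)" "B *\<^sub>v v = 0\<^sub>v (n + 1)" for v
  proof -
    have vv: "v = vec (n + 1) (\<lambda>i. v $ i)"
      using v(1) by auto
    have z: "(if i = k then \<Sum>j\<le>n. v $ j * t ^ j else v $ i) = 0" if "i \<le> n" for i
      using Bv[OF that, of "\<lambda>i. v $ i"] v(2) that unfolding vv[symmetric] by simp
    have o: "v $ i = 0" if "i \<le> n" "i \<noteq> k" for i
      using z[OF that(1)] that(2) by simp
    have "(\<Sum>j\<le>n. v $ j * t ^ j) = (\<Sum>j\<in>{k}. v $ j * t ^ j)"
      using o assms(3) by (intro sum.mono_neutral_right) auto
    then have "v $ k = 0"
      using z[OF assms(3)] t(1) by simp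
    then have "v $ i = 0" if "i \<le> n" for i
      using o that by blast
    then show ?thesis
      using v(1) by (intro eq_vecI) auto
  qed
  obtain A where A: "A \<in> carrier_mat (n + 1) (n + 1)" "B * A = 1\<^sub>m (n + 1)" "A * B = 1\<^sub>m (n + 1)"
    using injective_mat_inverse[OF B inj] by metis
  have "invertible_mat A"
    unfolding invertible_mat_def inverts_mat_def using A B by auto
  then have GL: "A \<in> GL (n + 1)"
    using A by (simp add: GL_def)
  have "det A \<noteq> 0"
    using GL by (rule GL_det_nonzero)
  show ?thesis
  proof (rule that[OF GL])
    fix p assume p: "p \<in> P"
    have "A *\<^sub>v (B *\<^sub>v vec (n + 1) p) = vec (n + 1) p"
      using assoc_mult_mat_vec[OF A(1) B, of "vec (n + 1) p"] A(3) by simp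
    moreover have "B *\<^sub>v vec (n + 1) p \<in> carrier_vec (n + 1)"
      using B by simp
    ultimately have "det (replace_col A (vec (n + 1) p) k) = (B *\<^sub>v vec (n + 1) p) $ k * det A"
      using cramer_lemma_mat[OF A(1), of "B *\<^sub>v vec (n + 1) p" k] assms(3) by simp
    then show "det (replace_col A (vec (n + 1) p) k) \<noteq> 0"
      using Bv[OF assms(3), of p] t(2)[OF p] \<open>det A \<noteq> 0\<close> by simp
  qed
qed

text \<open>\<open>A\<close> maps a zero of the transformed system to a zero of \<open>F\<close>,
  which scales to one of finitely many chosen vectors. A finite product of determinants thus keeps
  all zeros off the three hyperplanes at once, and it is nonzero somewhere because each block can be
  treated on its own.\<close>

lemma generic_coordinates:
  fixes F :: "'a::{alg_closed_field, field_char_0} tpoly set"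
  assumes fin: "finite (VP nx ny nz F)" and F: "\<And>p. p \<in> F \<Longrightarrow> \<exists>a b c. p \<in> forms nx ny nz (a, b, c)"
    and ijk: "i \<le> nx" "j \<le> ny" "k \<le> nz"
  obtains U where "zariski_open_GL3 nx ny nz U" "U \<noteq> {}" "U \<subseteq> GL3 nx ny nz"
    "\<And>A x y z. A \<in> U \<Longrightarrow> x \<in> hom_coords nx \<Longrightarrow> y \<in> hom_coords ny \<Longrightarrow> z \<in> hom_coords nz \<Longrightarrow>
      (\<And>p. p \<in> F \<Longrightarrow> teval (x, y, z) (change_coords A p) = 0) \<Longrightarrow> x i \<noteq> 0 \<and> y j \<noteq> 0 \<and> z k \<noteq> 0"
proof -
  obtain P where P: "finite P" "P \<subseteq> hom_coords nx \<times> hom_coords ny \<times> hom_coords nz"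
    "\<And>x y z. x \<in> hom_coords nx \<Longrightarrow> y \<in> hom_coords ny \<Longrightarrow> z \<in> hom_coords nz \<Longrightarrow> (\<And>p. p \<in> F \<Longrightarrow> teval (x, y, z) p = 0) \<Longrightarrow>
      \<exists>t u v. (\<lambda>i. t * x i, \<lambda>i. u * y i, \<lambda>i. v * z i) \<in> P"
    using finite_representatives[OF fin F] by metis
  define D where "D n M v l = det (replace_col M (vec (n + 1) v) l)" for n and M :: "'a mat" and v l
  define \<phi> where "\<phi> A = (\<Prod>w\<in>P. D nx (fst A) (fst w) i * D ny (fst (snd A)) (fst (snd w)) j *
    D nz (snd (snd A)) (snd (snd w)) k)" for A :: "'a coord_change"
  define U where "U = {A \<in> GL3 nx ny nz. \<phi> A \<noteq> 0}"
  have "entry_polynomial nx ny nz \<phi>"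
    unfolding \<phi>_def D_def
  proof (intro entry_polynomial_prod entry_polynomial_mult entry_polynomial_det_replace_col)
    fix a b assume ab: "a \<le> nx" "b \<le> nx"
    have "entry_polynomial nx ny nz (\<lambda>A. entry A (BlockX, a, b))"
      by (rule entry_polynomial_entry) (use ab in \<open>auto simp: entry_indices_def\<close>)
    then show "entry_polynomial nx ny nz (\<lambda>A. fst A $$ (a, b))"
      by (rule entry_polynomial_cong) auto
  next
    fix a b assume ab: "a \<le> ny" "b \<le> ny"
    have "entry_polynomial nx ny nz (\<lambda>A. entry A (BlockY, a, b))"
      by (rule entry_polynomial_entry) (use ab in \<open>auto simp: entry_indices_def\<close>)
    then show "entry_polynomial nx ny nz (\<lambda>A. fst (snd A) $$ (a, b))"
      by (rule entry_polynomial_cong) auto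
  next
    fix a b assume ab: "a \<le> nz" "b \<le> nz"
    have "entry_polynomial nx ny nz (\<lambda>A. entry A (BlockZ, a, b))"
      by (rule entry_polynomial_entry) (use ab in \<open>auto simp: entry_indices_def\<close>)
    then show "entry_polynomial nx ny nz (\<lambda>A. snd (snd A) $$ (a, b))"
      by (rule entry_polynomial_cong) auto
  qed (auto simp: GL3_def GL_def)
  then obtain q where q: "poly_vars q \<subseteq> entry_indices nx ny nz"
    "\<And>A. A \<in> GL3 nx ny nz \<Longrightarrow> eval_with id (mon_val (entry A)) q = \<phi> A"
    unfolding entry_polynomial_def by blast
  have "zariski_open_GL3 nx ny nz U"
    unfolding zariski_open_GL3_def
    by (rule exI[of _ "{q}"]) (use q in \<open>auto simp: U_def\<close>)
  moreover have "U \<noteq> {}"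
  proof -
    have fins: "finite (fst ` P)" "finite ((fst \<circ> snd) ` P)" "finite ((snd \<circ> snd) ` P)"
      and subs: "fst ` P \<subseteq> hom_coords nx" "(fst \<circ> snd) ` P \<subseteq> hom_coords ny" "(snd \<circ> snd) ` P \<subseteq> hom_coords nz"
      using P(1,2) by auto
    obtain Ax where Ax: "Ax \<in> GL (nx + 1)" "\<And>v. v \<in> fst ` P \<Longrightarrow> D nx Ax v i \<noteq> 0"
      using exists_coordinates_off_hyperplane[OF fins(1) subs(1) ijk(1)] unfolding D_def by metis
    obtain Ay where Ay: "Ay \<in> GL (ny + 1)" "\<And>v. v \<in> (fst \<circ> snd) ` P \<Longrightarrow> D ny Ay v j \<noteq> 0"
      using exists_coordinates_off_hyperplane[OF fins(2) subs(2) ijk(2)] unfolding D_def by metis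
    obtain Az where Az: "Az \<in> GL (nz + 1)" "\<And>v. v \<in> (snd \<circ> snd) ` P \<Longrightarrow> D nz Az v k \<noteq> 0"
      using exists_coordinates_off_hyperplane[OF fins(3) subs(3) ijk(3)] unfolding D_def by metis
    have "(Ax, Ay, Az) \<in> GL3 nx ny nz"
      using Ax(1) Ay(1) Az(1) by (simp add: GL3_def)
    moreover have "\<phi> (Ax, Ay, Az) \<noteq> 0"
      using P(1) Ax(2) Ay(2) Az(2) by (simp add: \<phi>_def)
    ultimately show ?thesis
      unfolding U_def by blast
  qed
  moreover have "x i \<noteq> 0 \<and> y j \<noteq> 0 \<and> z k \<noteq> 0"
    if h: "A \<in> U" "x \<in> hom_coords nx" "y \<in> hom_coords ny" "z \<in> hom_coords nz"
      "\<And>p. p \<in> F \<Longrightarrow> teval (x, y, z) (change_coords A p) = 0" for A x y z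
  proof -
    obtain Ax Ay Az where A: "A = (Ax, Ay, Az)" by (metis prod_cases3)
    have GL: "Ax \<in> GL (nx + 1)" "Ay \<in> GL (ny + 1)" "Az \<in> GL (nz + 1)"
      using h(1) by (auto simp: U_def GL3_def A)
    then have car: "Ax \<in> carrier_mat (nx + 1) (nx + 1)" "Ay \<in> carrier_mat (ny + 1) (ny + 1)"
      "Az \<in> carrier_mat (nz + 1) (nz + 1)"
      by (simp_all add: GL_def)
    have "teval (mat_apply Ax x, mat_apply Ay y, mat_apply Az z) p = 0" if p: "p \<in> F" for p
    proof -
      obtain a b c where "p \<in> forms nx ny nz (a, b, c)"
        using F[OF p] by blast
      from teval_change_coords[OF this, of Ax Ay Az x y z] show ?thesis
        using h(5)[OF p] car unfolding A by simp
    qed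
    then obtain t u v where w: "(\<lambda>i. t * mat_apply Ax x i, \<lambda>i. u * mat_apply Ay y i, \<lambda>i. v * mat_apply Az z i) \<in> P"
      using P(3)[OF mat_apply_hom_coords[OF GL(1) h(2)] mat_apply_hom_coords[OF GL(2) h(3)]
        mat_apply_hom_coords[OF GL(3) h(4)]] by blast
    have "\<phi> A \<noteq> 0"
      using h(1) by (simp add: U_def)
    then have "D nx Ax (\<lambda>i. t * mat_apply Ax x i) i \<noteq> 0" "D ny Ay (\<lambda>i. u * mat_apply Ay y i) j \<noteq> 0"
      "D nz Az (\<lambda>i. v * mat_apply Az z i) k \<noteq> 0"
      using w P(1) by (force simp: \<phi>_def A)+
    then show ?thesis
      using coordinate_nonzero[OF car(1) ijk(1)] coordinate_nonzero[OF car(2) ijk(2)]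
        coordinate_nonzero[OF car(3) ijk(3)] unfolding D_def by blast
  qed
  ultimately show ?thesis
    using that[of U] unfolding U_def by blast
qed

text \<open>Numerator and denominator have the same multidegree, so the quotient agrees on all
  coordinate vectors of a point and \<open>representatives\<close> may stand for points. The update
  at index 0 leaves \<open>f0\<close> untransformed. Invertibility of \<open>M11\<close> belongs to
  the conclusion because the Schur complement is formed with its inverse.\<close>

theorem theorem4p7:
  fixes nx ny nz r s :: nat
    and f :: "nat \<Rightarrow> 'a::{alg_closed_field, field_char_0} tpoly"
    and f0 :: "'a tpoly"
    and \<theta> :: expo
    and M11 M12 M21 M22 :: "'a upoly mat"
  assumes "square_two_bilinear nx ny nz r s f"
    and "finite (VP nx ny nz (f ` {1..nx+ny+nz}))"
    and "\<theta> \<in> expos nx ny nz (1, 1, 1)"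
    and "rearranged_delta1 nx ny nz r s \<theta> M11 M12 M21 M22"
    and "f0 \<in> forms nx ny nz (1, 1, 1)"
  shows "\<exists>U. zariski_open_GL3 nx ny nz U \<and> U \<noteq> {} \<and>
    (\<forall>A\<in>U.
      let fA = (\<lambda>i. change_coords A (f i));
          ev = map_mat (specialize (fA(0 := f0)));
          V = VP nx ny nz (fA ` {1..nx+ny+nz})
      in invertible_mat (ev M11) \<and>
         (\<forall>w\<in>representatives V. teval w (tmonom \<theta>) \<noteq> 0) \<and>
         {c. eigenvalue (schur_complement (ev M11) (ev M12) (ev M21) (ev M22)) c} =
         (\<lambda>w. teval w f0 / teval w (tmonom \<theta>)) ` representatives V)"
proof -
  have N: "nx + ny + nz = r + s"
    using assms(1) by (simp add: square_two_bilinear_def)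
  have forms: "\<exists>a b c. p \<in> forms nx ny nz (a, b, c)" if p: "p \<in> f ` {1..nx+ny+nz}" for p
  proof -
    obtain l where l: "p = f l" "l \<in> {1..r+s}"
      using p unfolding N by blast
    then show ?thesis
      using assms(1) unfolding square_two_bilinear_def
      by (cases "l \<le> r") (metis atLeastAtMost_iff, metis Suc_eq_plus1 atLeastAtMost_iff not_less_eq_eq)
  qed
  obtain a b e where abe: "\<theta> = (a, b, e)" by (metis prod_cases3)
  then have abe_expos: "a \<in> block_expos nx 1" "b \<in> block_expos ny 1" "e \<in> block_expos nz 1"
    using assms(3) by simp_all
  obtain i0 where i0: "i0 \<le> nx" "a = Poly_Mapping.single i0 1"
    using abe_expos(1) by (rule block_expos_1)
  obtain j0 where j0: "j0 \<le> ny" "b = Poly_Mapping.single j0 1"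
    using abe_expos(2) by (rule block_expos_1)
  obtain k0 where k0: "k0 \<le> nz" "e = Poly_Mapping.single k0 1"
    using abe_expos(3) by (rule block_expos_1)
  obtain U where U: "zariski_open_GL3 nx ny nz U" "U \<noteq> {}" "U \<subseteq> GL3 nx ny nz"
    and generic: "\<And>A x y z. A \<in> U \<Longrightarrow> x \<in> hom_coords nx \<Longrightarrow> y \<in> hom_coords ny \<Longrightarrow> z \<in> hom_coords nz \<Longrightarrow>
      (\<And>p. p \<in> f ` {1..nx+ny+nz} \<Longrightarrow> teval (x, y, z) (change_coords A p) = 0) \<Longrightarrow>
      x i0 \<noteq> 0 \<and> y j0 \<noteq> 0 \<and> z k0 \<noteq> 0"
    using generic_coordinates[OF assms(2) forms i0(1) j0(1) k0(1)] by metis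
  have "let fA = (\<lambda>i. change_coords A (f i));
          ev = map_mat (specialize (fA(0 := f0)));
          V = VP nx ny nz (fA ` {1..nx+ny+nz})
      in invertible_mat (ev M11) \<and>
         (\<forall>w\<in>representatives V. teval w (tmonom \<theta>) \<noteq> 0) \<and>
         {c. eigenvalue (schur_complement (ev M11) (ev M12) (ev M21) (ev M22)) c} =
         (\<lambda>w. teval w f0 / teval w (tmonom \<theta>)) ` representatives V" if A: "A \<in> U" for A
  proof -
    define fA where "fA = (\<lambda>i. change_coords A (f i))"
    define V where "V = VP nx ny nz (fA ` {1..nx+ny+nz})"
    obtain Ax Ay Az where Axyz: "A = (Ax, Ay, Az)" by (metis prod_cases3)
    have dim: "dim_col Ax = nx + 1" "dim_col Ay = ny + 1" "dim_col Az = nz + 1"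
      using A U(3) by (auto simp: Axyz GL3_def GL_def)
    have change: "change_coords A p \<in> forms nx ny nz (a, b, c)" if "p \<in> forms nx ny nz (a, b, c)" for p a b c
      unfolding Axyz by (rule change_coords_forms[OF that dim])
    have sys: "square_two_bilinear nx ny nz r s fA"
      using assms(1) change unfolding square_two_bilinear_def fA_def by blast
    have formsA: "\<exists>a b c. p \<in> forms nx ny nz (a, b, c)" if "p \<in> fA ` {1..nx+ny+nz}" for p
      using that forms change unfolding fA_def by blast
    have rep: "(x, y, z) \<in> representatives V \<longleftrightarrow> x \<in> hom_coords nx \<and> y \<in> hom_coords ny \<and> z \<in> hom_coords nz \<and>
        (\<forall>l\<in>{1..r+s}. teval (x, y, z) (fA l) = 0)" for x y z
      using representatives_VP[OF formsA, of "fA ` {1..nx+ny+nz}" x y z] unfolding V_def N by simp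
    have mon: "teval w (tmonom \<theta>) = mon_val3 w \<theta>" for w :: "(nat \<Rightarrow> 'a) \<times> (nat \<Rightarrow> 'a) \<times> (nat \<Rightarrow> 'a)"
      by (simp add: tmonom_def teval_single)
    have nonzero: "mon_val3 w \<theta> \<noteq> 0" if "w \<in> representatives V" for w
    proof -
      obtain x y z where w: "w = (x, y, z)" by (metis prod_cases3)
      have "x i0 \<noteq> 0 \<and> y j0 \<noteq> 0 \<and> z k0 \<noteq> 0"
        using that unfolding w rep by (intro generic[OF A]) (auto simp: fA_def N)
      then show ?thesis
        by (simp add: w abe i0 j0 k0)
    qed
    have gen: "mon_val3 (x, y, z) \<theta> \<noteq> 0" if "x \<in> hom_coords nx" "y \<in> hom_coords ny" "z \<in> hom_coords nz"
      "\<And>l. l \<in> {1..r+s} \<Longrightarrow> teval (x, y, z) (fA l) = 0" for x y z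
      using nonzero[of "(x, y, z)"] that rep by blast
    note main = schur_complement_eigenvalues[OF sys assms(3,4,5) gen]
    have "\<not> no_common_zero nx ny nz {0..r+s} (fA(0 := f0 - Poly_Mapping.single \<theta> c)) \<longleftrightarrow>
        c \<in> (\<lambda>w. teval w f0 / teval w (tmonom \<theta>)) ` representatives V" for c
    proof -
      have all: "(\<forall>l\<in>{0..r+s}. teval w ((fA(0 := p)) l) = 0) \<longleftrightarrow> teval w p = 0 \<and> (\<forall>l\<in>{1..r+s}. teval w (fA l) = 0)" for w p
      proof -
        have "{0..r+s} = insert 0 {1..r+s}"
          by auto
        then show ?thesis
          by auto
      qed
      have "\<not> no_common_zero nx ny nz {0..r+s} (fA(0 := f0 - Poly_Mapping.single \<theta> c)) \<longleftrightarrow>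
          (\<exists>x\<in>hom_coords nx. \<exists>y\<in>hom_coords ny. \<exists>z\<in>hom_coords nz.
            \<forall>l\<in>{0..r+s}. teval (x, y, z) ((fA(0 := f0 - Poly_Mapping.single \<theta> c)) l) = 0)"
        unfolding no_common_zero_def by blast
      also have "\<dots> \<longleftrightarrow> (\<exists>x y z. (x, y, z) \<in> representatives V \<and> teval (x, y, z) (f0 - Poly_Mapping.single \<theta> c) = 0)"
        unfolding all rep by blast
      also have "\<dots> \<longleftrightarrow> (\<exists>w\<in>representatives V. teval w (f0 - Poly_Mapping.single \<theta> c) = 0)"
        by (metis prod_cases3)
      also have "\<dots> \<longleftrightarrow> (\<exists>w\<in>representatives V. c = teval w f0 / teval w (tmonom \<theta>))"
        using nonzero by (intro bex_cong refl) (auto simp: mon teval_diff teval_single nonzero_eq_divide_eq)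
      finally show ?thesis
        by (simp add: image_iff)
    qed
    then have "{c. eigenvalue (schur_complement (map_mat (specialize (fA(0 := f0))) M11)
          (map_mat (specialize (fA(0 := f0))) M12) (map_mat (specialize (fA(0 := f0))) M21)
          (map_mat (specialize (fA(0 := f0))) M22)) c} =
        (\<lambda>w. teval w f0 / teval w (tmonom \<theta>)) ` representatives V"
      using main(2) by blast
    then show ?thesis
      using main(1) nonzero unfolding Let_def fA_def[symmetric] V_def[symmetric] mon by blast
  qed
  then show ?thesis
    using U(1,2) by blast
qed

end
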